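(* Fix $p\in[1,\infty]$ and let $q:(0,\pi/2)\to(0,\infty)$ be an integrable weight function. Let $\mathcal M=\{\Phi_{p,r}:r\in\mathcal R\}$, $\mathcal R\subseteq\mathbb R^m$, be a parametric model for the angular measure, and suppose that the null hypothesis holds: $\Phi_p=\Phi_{p,r_0}$ for some $r_0\in\mathcal R$ (so $\Lambda=\Lambda_{r_0}$). Assume: (1) $\Lambda$ is absolutely continuous with respect to Lebesgue measure with a density $\lambda$ that is continuous on $[0,\infty)^2\setminus\{(0,0)\}$, and $\Lambda(\{\infty\}\times[0,1])=\Lambda([0,1]\times\{\infty\})=0$. (2) $U$ has a density $c$, and there exist $\alpha_1,\alpha_2,\alpha_3>0$ such that, as $t\downarrow0$, $\mathcal D_{1/t}(t)=O(t^{\alpha_1})$, where $\mathcal D_T(t)=\iint_{\mathcal L_T}|t\,c(tu_1,tu_2)-\lambda(u_1,u_2)|\,du_1du_2$ and $\mathcal L_T=\{(u_1,u_2)\in[0,T]^2:u_1\wedge u_2\le1\}$, and, for every $s\in[1,\infty]$, $\Phi_s(t)=O(t^{\alpha_2})$ and $\Phi_s(\pi/2)-\Phi_s(\pi/2-t)=O(t^{\alpha_3})$ (the exponents not depending on $s$). Moreover $k=k(n)\to\infty$ and $k=o(n^{2\underline\alpha/(2\underline\alpha+1)})$ with $\underline\alpha=\min\{\alpha_1,\alpha_2,\alpha_3\}$. (3) The point $r_0$ lies in the interior of $\mathcal R$ and the map $\mathfrak R:r\in\mathcal R\mapsto Q_{p,r}\in\ell^\infty([0,\pi/2])$ is Hadamard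 differentiable at $r_0$. For every $\theta\in[0,\pi/2]$ the map $r\in\mathcal R\mapsto\varrho_{p,r}(\theta)$ is differentiable, and $\int_0^{\pi/2}|\nabla_r\varrho_{p,r_0}(\theta)|\,d\theta<\infty$. Differentiation with respect to $r$ and integration with respect to $\theta$ of $(r,\theta)\mapsto\varrho_{p,r}(\theta)$ can be exchanged, so that $(\mathfrak R'_r[h])(\theta)=\int_0^\theta\nabla_r\varrho_{p,r}(x)\,dx\cdot h$. (4) There exist a finite Borel measure $\sigma$ on $[0,1]^2$ and a function $g:[0,1]^2\to\mathbb R^m$ in $(L_2([0,1]^2,\sigma))^m$ such that, as $n\to\infty$, the parameter estimator $\widehat r_n$ used in the test statistic satisfies $$\sqrt k(\widehat r_n-r_0)=\int_{[0,1]^2}\sqrt k\big(\widehat\ell_n(x_1,x_2)-\ell(x_1,x_2)\big)g(x_1,x_2)\,d\sigma(x_1,x_2)+o_{\mathsf P}(1).$$ (5) With $\eta(\theta)=\min\{\tan\theta,\tan(\frac\pi2-\theta)\}$ for $\theta\in[0,\pi/2]$: $\sup_{\theta\in[0,\pi/2]}\{\eta(\theta)\varphi_{p,r_0}(\theta)\}<\infty$, and there exists $\nu\in(0,1)$ such that $$\lim_{n\to\infty}\sup_{\theta\in[0,\pi/2]}\eta(\theta)^\nu|\varphi_{p,r_n}(\theta)-\varphi_{p,r_0}(\theta)|=0\quad\text{and}\quad\lim_{n\to\infty}\sup_{\theta\in[0,\pi/2]}\eta(\theta)^\nu|\nabla_r\varphi_{p,r_n}(\theta)-\nabla_r\varphi_{p,r_0}(\theta)|=0$$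 for any sequence $(r_n)\subset\mathcal R$ with $r_n\to r_0$. For $r\in\mathcal R$ and $\alpha\in(0,1)$ let $\mathcal Q_r(\alpha)$ be the $\alpha$-quantile of the random variable $L_r$ defined in the context, where the function $g:[0,1]^2\to\mathbb R^m$ and the finite Borel measure $\sigma$ on $[0,1]^2$ entering $L_r$ through $I_{g,\sigma,r}$ are those for which the expansion $\sqrt k(\widehat r_n-r_0)=\int_{[0,1]^2}\sqrt k(\widehat\ell_n-\ell)\,g\,d\sigma+o_{\mathsf P}(1)$ of the parameter estimator $\widehat r_n$ is assumed. Then for any consistent estimator $\check r_n$ of $r_0$ (with values in $\mathcal R$, $\check r_n\to r_0$ in probability), $$\mathcal Q_{\check r_n}(1-\alpha)\xrightarrow{\mathsf P}\mathcal Q_{r_0}(1-\alpha),\qquad\alpha\in(0,1).$$ The convergence also holds locally uniformly: for any $[\alpha_0,\alpha_1]\subset(0,1)$, $$\sup_{\alpha\in[\alpha_0,\alpha_1]}\big|\mathcal Q_{\check r_n}(1-\alpha)-\mathcal Q_{r_0}(1-\alpha)\big|\xrightarrow{\mathsf P}0.$$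
   Context: **Regular variation.** $(X_{i1},X_{i2})$, $i=1,\dots,n$, is an i.i.d. sample from the law of $(X_1,X_2)$, which has continuous marginal distribution functions $F_1,F_2$. Put $U=(U_1,U_2)=(1-F_1(X_1),1-F_2(X_2))$. Let $\mathbb E=[0,\infty]^2\setminus\{(\infty,\infty)\}$. Standing assumption: there is a Radon measure $\Lambda$ on $\mathbb E$ such that $t^{-1}\mathsf P[U/t\in\cdot\,]\to\Lambda$ vaguely as $t\downarrow0$. Then $\Lambda([0,u]\times[0,\infty])=\Lambda([0,\infty]\times[0,u])=u$ for $0\le u<\infty$, and $\Lambda(cB)=c\Lambda(B)$ for $c>0$. The sequence $k=k(n)$ satisfies $k\to\infty$, $k/n\to0$. **Angular measure.** $\|\cdot\|_p$ is the $L_p$-norm on $\mathbb R^2$. For Borel $A\subset[0,\pi/2]$, $\Phi_p(A)=\Lambda(\{(x_1,x_2)\in(0,\infty]^2:\|(x_1^{-1},x_2^{-1})\|_p\ge1,\ \arctan(x_2/x_1)\in A\})$; write $\Phi_p(\theta)=\Phi_p([0,\theta])=\Lambda(C_{p,\theta})$, where $C_{p,0}=([0,\infty]\times\{0\})\cup(\{\infty\}\times[0,1])$; $C_{p,\theta}=\{(x,y):0\le x\le\infty,\ 0\le y\le\min(x\tan\theta,y_p(x))\}$ for $0<\theta<\pi/2$; $C_{p,\pi/2}=\{(x,y):0\le x\le\infty,\ 0\le y\le y_p(x)\}$. Here $y_p(x)=\infty$ for $x\in[0,1)$ and, for $x\in[1,\infty]$, $y_p(x)=(1+\frac1{x^p-1})^{1/p}$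 if $p<\infty$ and $y_p(x)=1$ if $p=\infty$; $y_p'$ is its derivative on $(1,\infty)$. Put $x_p(\theta)=\|(1,\cot\theta)\|_p$. **Model.** For $r\in\mathcal R$, $\Phi_{p,r}$ is an angular measure and $\Lambda_r$ is the corresponding measure on $\mathbb E$; each $\Lambda_r$ is understood to satisfy the smoothness condition (1) of the claim, with Lebesgue density $\lambda_r$, so that all objects below are defined. $\varphi_{p,r}$ is the derivative (density) of $\theta\mapsto\Phi_{p,r}(\theta)=\Phi_{p,r}([0,\theta])$. $Q_{p,r}=\Phi_{p,r}/\Phi_{p,r}([0,\pi/2])$ (identified with its distribution function), and $\varrho_{p,r}$ is the density of $Q_{p,r}$ on $[0,\pi/2]$. **Stable tail dependence function.** $\ell(x_1,x_2)=\lim_{t\downarrow0}t^{-1}\mathsf P[U_1\le tx_1\text{ or }U_2\le tx_2]$; $\ell_r$ is the version for $\Lambda_r$, i.e. $\ell_r(x_1,x_2)=\Lambda_r(A_{(x_1,x_2)})$ with $A_{(x_1,x_2)}=\{u\in[0,\infty)^2:u_1\le x_1\text{ or }u_2\le x_2\}$; $\dot\ell_{r,j}$ is its first-order partial derivative in $x_j$ (right-hand derivative at the boundary). Its estimator is $\widehat\ell_n(x_1,x_2)=\frac1k\sum_{i=1}^n\mathbb I\{R_{i1}>n+\frac12-kx_1\text{ or }R_{i2}>n+\frac12-kx_2\}$, where $R_{ij}$ is the rank of $X_{ij}$ among $X_{1j},\dots,X_{nj}$. **The random variables $L_r$.** For $r\in\mathcal R$, $W_{\Lambda_r}$ is a tight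 centered Gaussian (Wiener) process indexed by Borel sets of $\mathbb E$ with covariance $\mathsf E[W_{\Lambda_r}(C)W_{\Lambda_r}(C')]=\Lambda_r(C\cap C')$; $W_1(x)=W_{\Lambda_r}((0,x]\times(0,\infty])$, $W_2(y)=W_{\Lambda_r}((0,\infty]\times(0,y])$. Define $\alpha_{p,r}(\theta)=W_{\Lambda_r}(C_{p,\theta})+Z_{p,r}(\theta)$, where $Z_{p,r}(\theta)=\int_0^{x_p(\theta)}\lambda_r(x,x\tan\theta)[W_1(x)\tan\theta-W_2(x\tan\theta)]dx+B_{p,r}(\theta)$ with $B_{p,r}(\theta)=\int_{x_p(\theta)}^\infty\lambda_r(x,y_p(x))[W_1(x)y_p'(x)-W_2(y_p(x))]dx$ if $p<\infty$, and $B_{p,r}(\theta)=-W_1(1)\int_1^{1\vee\tan\theta}\lambda_r(1,y)dy-W_2(1)\int_{1\vee\cot\theta}^\infty\lambda_r(x,1)dx$ if $p=\infty$ (expressions at $\theta\in\{0,\pi/2\}$ are understood as limits). With $f(\theta)=(\sin\theta-\cos\theta)/\|(\sin\theta,\cos\theta)\|_p$ and derivative $f'$, $$\beta_{p,r}(\theta)=\frac{\alpha_{p,r}(\theta)\Phi_{p,r}(\frac\pi2)-\Phi_{p,r}(\theta)\alpha_{p,r}(\frac\pi2)}{\Phi_{p,r}(\frac\pi2)^2},\qquad \gamma_{p,r}(\theta)=\beta_{p,r}(\theta)+\frac{\int_0^{\pi/2}\beta_{p,r}(\psi)f'(\psi)d\psi}{\sigma^2_{Q_{p,r}}(f)}\int_0^\theta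 f(\psi)\,dQ_{p,r}(\psi),$$ where $\sigma^2_F(f)=\int_0^{\pi/2}(f-\mu_F(f))^2dF$, $\mu_F(f)=\int_0^{\pi/2}f\,dF$. Finally $$I_{g,\sigma,r}=\int_{[0,1]^2}\Big(W_{\Lambda_r}(A_{(x_1,x_2)})-\sum_{j=1}^2\dot\ell_{r,j}(x_1,x_2)W_j(x_j)\Big)g(x_1,x_2)\,d\sigma(x_1,x_2),$$ $$L_r=\int_0^{\pi/2}\Big|\gamma_{p,r}(\theta)-\int_0^\theta\nabla_r\varrho_{p,r}(x)\,dx\cdot I_{g,\sigma,r}\Big|\,q(\theta)\,d\theta .$$ ($L_{r_0}$ is the weak limit under the null hypothesis of a goodness-of-fit test statistic in which $r_0$ is estimated by $\widehat r_n$.) The dot $\cdot$ between vectors is the scalar product of $\mathbb R^m$, $|\cdot|$ is the Euclidean norm, and $\ell^\infty(S)$ is the space of bounded real functions on $S$ with the supremum norm. *)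

theory Defs
  imports "HOL-Probability.Probability" "HOL-Library.Landau_Symbols"
begin

text \<open>Outer probability is used because the random quantities to which it is applied (for instance
  \<open>r \<mapsto> quantile of L\<^sub>r\<close> evaluated at an estimator, or a supremum of such) need not be measurable.
  On measurable events it is the ordinary probability.\<close>

definition outer_prob :: "'w measure \<Rightarrow> 'w set \<Rightarrow> real" where
  "outer_prob M A = Inf {measure M B | B. B \<in> sets M \<and> A \<subseteq> B}"

definition conv_in_prob :: "'w measure \<Rightarrow> (nat \<Rightarrow> 'w \<Rightarrow> 'a::metric_space) \<Rightarrow> 'a \<Rightarrow> bool" where
  "conv_in_prob M Y y \<longleftrightarrow>
     (\<forall>\<epsilon>>0. (\<lambda>n. outer_prob M {\<omega> \<in> space M. dist (Y n \<omega>) y > \<epsilon>}) \<longlonglongrightarrow> 0)"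

text \<open>The completion makes the quantile insensitive to the behaviour of \<open>Y\<close> on null sets: a functional
  of a Gaussian process is measurable only up to the null set of irregular paths.\<close>

definition quantile :: "'b measure \<Rightarrow> ('b \<Rightarrow> real) \<Rightarrow> real \<Rightarrow> real" where
  "quantile N Y a = Inf {x. a \<le> measure (completion N) {\<omega> \<in> space N. Y \<omega> \<le> x}}"

text \<open>\<open>D\<close> is the Hadamard derivative at \<open>x\<close> of the map \<open>F : S \<rightarrow> \<ell>\<^sup>\<infinity>(T)\<close>; convergence in
  \<open>\<ell>\<^sup>\<infinity>(T)\<close> is uniform convergence on \<open>T\<close>.\<close>

definition hadamard_derivative ::
  "('a::real_normed_vector \<Rightarrow> 'b \<Rightarrow> real) \<Rightarrow> ('a \<Rightarrow> 'b \<Rightarrow> real) \<Rightarrow> 'a \<Rightarrow> 'a set \<Rightarrow> 'b set \<Rightarrow> bool" where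
  "hadamard_derivative F D x S T \<longleftrightarrow>
     (\<forall>\<theta>\<in>T. linear (\<lambda>h. D h \<theta>)) \<and>
     (\<exists>C. \<forall>h. \<forall>\<theta>\<in>T. \<bar>D h \<theta>\<bar> \<le> C * norm h) \<and>
     (\<forall>h hs t. (\<forall>n. t n \<noteq> 0) \<and> t \<longlonglongrightarrow> 0 \<and> hs \<longlonglongrightarrow> h \<and> (\<forall>n. x + t n *\<^sub>R hs n \<in> S) \<longrightarrow>
        uniform_limit T (\<lambda>n \<theta>. (F (x + t n *\<^sub>R hs n) \<theta> - F x \<theta>) / t n) (D h) sequentially)"

text \<open>\<open>P\<close> is the law of \<open>(X\<^sub>1, X\<^sub>2)\<close> on the plane. The vector \<open>U\<close> is a function on the probability space
  \<open>P\<close>.\<close>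

definition F1 :: "(real \<times> real) measure \<Rightarrow> real \<Rightarrow> real" where
  "F1 P = cdf (distr P borel fst)"

definition F2 :: "(real \<times> real) measure \<Rightarrow> real \<Rightarrow> real" where
  "F2 P = cdf (distr P borel snd)"

definition U_vec :: "(real \<times> real) measure \<Rightarrow> real \<times> real \<Rightarrow> real \<times> real" where
  "U_vec P z = (1 - F1 P (fst z), 1 - F2 P (snd z))"

definition iid_sample :: "'w measure \<Rightarrow> (nat \<Rightarrow> 'w \<Rightarrow> real \<times> real) \<Rightarrow> (real \<times> real) measure \<Rightarrow> bool" where
  "iid_sample M X P \<longleftrightarrow> prob_space M \<and> prob_space.indep_vars M (\<lambda>_. borel) X UNIV \<and>
     (\<forall>i. distr M borel (X i) = P)"

text \<open>An estimator based on the sample of size \<open>n\<close>, which is \<open>X 0, \<dots>, X (n - 1)\<close>.\<close>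

definition estimator ::
  "'w measure \<Rightarrow> (nat \<Rightarrow> 'w \<Rightarrow> real \<times> real) \<Rightarrow> nat \<Rightarrow> ('w \<Rightarrow> real ^ 'm::finite) \<Rightarrow> bool" where
  "estimator M X n T \<longleftrightarrow>
     T \<in> borel_measurable (vimage_algebra (space M) (\<lambda>\<omega>. \<lambda>i\<in>{..<n}. X i \<omega>) (PiM {..<n} (\<lambda>_. borel)))"

definition rank1 :: "(nat \<Rightarrow> real \<times> real) \<Rightarrow> nat \<Rightarrow> nat \<Rightarrow> nat" where
  "rank1 x n i = card {l \<in> {..<n}. fst (x l) \<le> fst (x i)}"

definition rank2 :: "(nat \<Rightarrow> real \<times> real) \<Rightarrow> nat \<Rightarrow> nat \<Rightarrow> nat" where
  "rank2 x n i = card {l \<in> {..<n}. snd (x l) \<le> snd (x i)}"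

definition ell_hat :: "real \<Rightarrow> (nat \<Rightarrow> real \<times> real) \<Rightarrow> nat \<Rightarrow> real \<times> real \<Rightarrow> real" where
  "ell_hat k x n v = (1 / k) * (\<Sum>i<n. of_bool
     (real (rank1 x n i) > real n + 1/2 - k * fst v \<or> real (rank2 x n i) > real n + 1/2 - k * snd v))"

definition ell :: "(real \<times> real) measure \<Rightarrow> real \<times> real \<Rightarrow> real" where
  "ell P v = Lim (at_right 0) (\<lambda>t.
     measure P {z \<in> space P. fst (U_vec P z) \<le> t * fst v \<or> snd (U_vec P z) \<le> t * snd v} / t)"

text \<open>\<open>[0,\<infinity>]\<close> is the type \<open>ennreal\<close>; measures on \<open>E_space\<close> live on its Borel sets.\<close>

type_synonym pt = "ennreal \<times> ennreal"

definition E_space :: "pt set" where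
  "E_space = UNIV - {(top, top)}"

definition emb :: "real \<times> real \<Rightarrow> pt" where
  "emb u = (ennreal (fst u), ennreal (snd u))"

definition radon_E :: "pt measure \<Rightarrow> bool" where
  "radon_E \<Lambda> \<longleftrightarrow> sets \<Lambda> = sets (restrict_space borel E_space) \<and>
     (\<forall>K. compact K \<and> K \<subseteq> E_space \<longrightarrow> emeasure \<Lambda> K < top)"

text \<open>Vague convergence on \<open>E_space\<close> of the measures \<open>t\<^sup>-\<^sup>1 P[U/t \<in> \<cdot>]\<close> as \<open>t \<down> 0\<close>.\<close>

definition regularly_varying :: "(real \<times> real) measure \<Rightarrow> pt measure \<Rightarrow> bool" where
  "regularly_varying P \<Lambda> \<longleftrightarrow>
     (\<forall>(f :: pt \<Rightarrow> real) K. continuous_on E_space f \<and> compact K \<and> K \<subseteq> E_space \<and> (\<forall>x\<in>E_space - K. f x = 0) \<longrightarrow>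
        ((\<lambda>t. (1 / t) * (\<integral>z. f (emb ((1 / t) *\<^sub>R U_vec P z)) \<partial>P)) \<longlongrightarrow> (\<integral>x. f x \<partial>\<Lambda>)) (at_right 0))"

text \<open>The properties that characterize the possible limits \<open>\<Lambda>\<close>; via its angular measure each such
  \<open>\<Lambda>\<close> corresponds to exactly one angular measure.\<close>

definition tail_measure :: "pt measure \<Rightarrow> bool" where
  "tail_measure \<Lambda> \<longleftrightarrow> radon_E \<Lambda> \<and>
     (\<forall>u\<ge>0. emeasure \<Lambda> ({..ennreal u} \<times> UNIV) = ennreal u \<and>
            emeasure \<Lambda> (UNIV \<times> {..ennreal u}) = ennreal u) \<and>
     (\<forall>c>0. \<forall>B\<in>sets \<Lambda>.
        emeasure \<Lambda> ((\<lambda>(x, y). (ennreal c * x, ennreal c * y)) ` B) = ennreal c * emeasure \<Lambda> B)"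

definition smooth_with_density :: "pt measure \<Rightarrow> (real \<times> real \<Rightarrow> real) \<Rightarrow> bool" where
  "smooth_with_density \<Lambda> l \<longleftrightarrow>
     continuous_on ({0..} \<times> {0..} - {(0, 0)}) l \<and>
     (\<forall>u \<in> {0..} \<times> {0..} - {(0, 0)}. 0 \<le> l u) \<and>
     (\<forall>B\<in>sets \<Lambda>. emeasure \<Lambda> (B \<inter> {..<top} \<times> {..<top}) =
        (\<integral>\<^sup>+u. ennreal (l u) * indicator {u \<in> {0..} \<times> {0..}. emb u \<in> B} u \<partial>lborel)) \<and>
     emeasure \<Lambda> ({top} \<times> {..1}) = 0 \<and> emeasure \<Lambda> ({..1} \<times> {top}) = 0"

definition L_region :: "real \<Rightarrow> (real \<times> real) set" where
  "L_region T = {u \<in> {0..T} \<times> {0..T}. min (fst u) (snd u) \<le> 1}"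

definition D_dist :: "(real \<times> real \<Rightarrow> real) \<Rightarrow> (real \<times> real \<Rightarrow> real) \<Rightarrow> real \<Rightarrow> real \<Rightarrow> real" where
  "D_dist c l T t = (LINT u:L_region T|lborel. \<bar>t * c (t *\<^sub>R u) - l u\<bar>)"

text \<open>The exponent \<open>p \<in> [1,\<infinity>]\<close> has type \<open>ennreal\<close>.\<close>

definition Lp_norm :: "ennreal \<Rightarrow> real \<times> real \<Rightarrow> real" where
  "Lp_norm p v = (if p = top then max \<bar>fst v\<bar> \<bar>snd v\<bar>
     else (\<bar>fst v\<bar> powr enn2real p + \<bar>snd v\<bar> powr enn2real p) powr (1 / enn2real p))"

definition arctan_ext :: "ennreal \<Rightarrow> real" where
  "arctan_ext z = (if z = top then pi / 2 else arctan (enn2real z))"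

text \<open>In \<open>ennreal\<close>, \<open>inverse \<infinity> = 0\<close>, \<open>y / \<infinity> = 0\<close>, and \<open>\<infinity> / x = \<infinity>\<close> for finite \<open>x > 0\<close>.\<close>

definition angular_region :: "ennreal \<Rightarrow> pt set" where
  "angular_region p = {(x1, x2). 0 < x1 \<and> 0 < x2 \<and>
     Lp_norm p (enn2real (inverse x1), enn2real (inverse x2)) \<ge> 1}"

definition angular_measure :: "ennreal \<Rightarrow> pt measure \<Rightarrow> real measure" where
  "angular_measure p \<Lambda> =
     distr (restrict_space \<Lambda> (angular_region p)) borel (\<lambda>(x1, x2). arctan_ext (x2 / x1))"

definition Phi :: "ennreal \<Rightarrow> pt measure \<Rightarrow> real \<Rightarrow> real" where
  "Phi p \<Lambda> \<theta> = measure (angular_measure p \<Lambda>) {0..\<theta>}"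

definition Q_measure :: "ennreal \<Rightarrow> pt measure \<Rightarrow> real measure" where
  "Q_measure p \<Lambda> =
     scale_measure (inverse (emeasure (angular_measure p \<Lambda>) {0..pi/2})) (angular_measure p \<Lambda>)"

definition Q_cdf :: "ennreal \<Rightarrow> pt measure \<Rightarrow> real \<Rightarrow> real" where
  "Q_cdf p \<Lambda> \<theta> = measure (Q_measure p \<Lambda>) {0..\<theta>}"

text \<open>The finite branch of \<open>y\<^sub>p\<close> for \<open>1 < x < \<infinity>\<close>, \<open>p < \<infinity>\<close>, and \<open>y\<^sub>p\<close> itself.\<close>

definition y_real :: "ennreal \<Rightarrow> real \<Rightarrow> real" where
  "y_real p x = (1 + 1 / (x powr enn2real p - 1)) powr (1 / enn2real p)"

definition y_ext :: "ennreal \<Rightarrow> ennreal \<Rightarrow> ennreal" where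
  "y_ext p x = (if x < 1 then top
     else if p = top then 1
     else if x = 1 then top
     else if x = top then 1
     else ennreal (y_real p (enn2real x)))"

definition x_p :: "ennreal \<Rightarrow> real \<Rightarrow> real" where
  "x_p p \<theta> = Lp_norm p (1, cot \<theta>)"

definition C_set :: "ennreal \<Rightarrow> real \<Rightarrow> pt set" where
  "C_set p \<theta> =
     (if \<theta> = 0 then UNIV \<times> {0} \<union> {top} \<times> {..1}
      else if \<theta> = pi / 2 then {(x, y). y \<le> y_ext p x}
      else {(x, y). y \<le> min (x * ennreal (tan \<theta>)) (y_ext p x)})"

definition A_set :: "real \<times> real \<Rightarrow> pt set" where
  "A_set v = {u \<in> {..<top} \<times> {..<top}. fst u \<le> ennreal (fst v) \<or> snd u \<le> ennreal (snd v)}"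

definition strip1 :: "real \<Rightarrow> pt set" where
  "strip1 x = {0<..ennreal x} \<times> {0<..}"

definition strip2 :: "real \<Rightarrow> pt set" where
  "strip2 y = {0<..} \<times> {0<..ennreal y}"

definition gaussian_rv :: "'b measure \<Rightarrow> ('b \<Rightarrow> real) \<Rightarrow> bool" where
  "gaussian_rv N Y \<longleftrightarrow> Y \<in> borel_measurable N \<and>
     ((\<exists>\<mu>. AE \<omega> in N. Y \<omega> = \<mu>) \<or> (\<exists>\<mu> s. 0 < s \<and> distributed N lborel Y (normal_density \<mu> s)))"

text \<open>Tightness of a process as a random element of \<open>\<ell>\<^sup>\<infinity>(\<C>)\<close>, which is
  \<open>funspace \<C> euclidean_metric\<close>.\<close>

definition tight_in_linf :: "'b measure \<Rightarrow> ('b \<Rightarrow> 'i \<Rightarrow> real) \<Rightarrow> 'i set \<Rightarrow> bool" where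
  "tight_in_linf N W \<C> \<longleftrightarrow>
     (\<forall>\<epsilon>>0. \<exists>K. compactin (mtopology_of (funspace \<C> euclidean_metric)) K \<and>
        (\<exists>G\<in>sets N. measure N G \<ge> 1 - \<epsilon> \<and> (\<forall>\<omega>\<in>G. restrict (W \<omega>) \<C> \<in> K)))"

text \<open>The sets at which the process is evaluated in the limit variable below. No process can be tight over
  all Borel sets, and the strips must be bounded for their measures to be bounded, whence the
  truncation at \<open>T\<close>.\<close>

definition index_sets :: "ennreal \<Rightarrow> real \<Rightarrow> pt set set" where
  "index_sets p T = C_set p ` {0..pi/2} \<union> A_set ` ({0..1} \<times> {0..1}) \<union> strip1 ` {0..T} \<union> strip2 ` {0..T}"

definition wiener_process ::
  "ennreal \<Rightarrow> pt measure \<Rightarrow> 'b measure \<Rightarrow> ('b \<Rightarrow> pt set \<Rightarrow> real) \<Rightarrow> bool" where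
  "wiener_process p \<Lambda> N W \<longleftrightarrow> prob_space N \<and>
     (let \<F> = {C \<in> sets \<Lambda>. emeasure \<Lambda> C < top} in
       (\<forall>S a. finite S \<and> S \<subseteq> \<F> \<longrightarrow> gaussian_rv N (\<lambda>\<omega>. \<Sum>C\<in>S. a C * W \<omega> C)) \<and>
       (\<forall>C\<in>\<F>. (\<integral>\<omega>. W \<omega> C \<partial>N) = 0) \<and>
       (\<forall>C\<in>\<F>. \<forall>C'\<in>\<F>. (\<integral>\<omega>. W \<omega> C * W \<omega> C' \<partial>N) = measure \<Lambda> (C \<inter> C'))) \<and>
     (\<forall>T>0. tight_in_linf N W (index_sets p T))"

text \<open>Here \<open>w\<close> is a path of the Wiener process, so that the following are functionals of the path.\<close>

definition W1 :: "(pt set \<Rightarrow> real) \<Rightarrow> real \<Rightarrow> real" where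
  "W1 w x = w (strip1 x)"

definition W2 :: "(pt set \<Rightarrow> real) \<Rightarrow> real \<Rightarrow> real" where
  "W2 w y = w (strip2 y)"

definition B_term :: "ennreal \<Rightarrow> (real \<times> real \<Rightarrow> real) \<Rightarrow> (pt set \<Rightarrow> real) \<Rightarrow> real \<Rightarrow> real" where
  "B_term p l w \<theta> =
     (if p = top then
        - W1 w 1 * (LINT y:{1..max 1 (tan \<theta>)}|lborel. l (1, y))
        - W2 w 1 * (LINT x:{max 1 (cot \<theta>)..}|lborel. l (x, 1))
      else
        (LINT x:{x_p p \<theta><..}|lborel.
           l (x, y_real p x) * (W1 w x * deriv (y_real p) x - W2 w (y_real p x))))"

definition Z_interior :: "ennreal \<Rightarrow> (real \<times> real \<Rightarrow> real) \<Rightarrow> (pt set \<Rightarrow> real) \<Rightarrow> real \<Rightarrow> real" where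
  "Z_interior p l w \<theta> =
     (LINT x:{0<..x_p p \<theta>}|lborel. l (x, x * tan \<theta>) * (W1 w x * tan \<theta> - W2 w (x * tan \<theta>)))
     + B_term p l w \<theta>"

definition Z_term :: "ennreal \<Rightarrow> (real \<times> real \<Rightarrow> real) \<Rightarrow> (pt set \<Rightarrow> real) \<Rightarrow> real \<Rightarrow> real" where
  "Z_term p l w \<theta> =
     (if \<theta> = 0 then Lim (at_right 0) (Z_interior p l w)
      else if \<theta> = pi / 2 then Lim (at_left (pi / 2)) (Z_interior p l w)
      else Z_interior p l w \<theta>)"

definition alpha_proc :: "ennreal \<Rightarrow> (real \<times> real \<Rightarrow> real) \<Rightarrow> (pt set \<Rightarrow> real) \<Rightarrow> real \<Rightarrow> real" where
  "alpha_proc p l w \<theta> = w (C_set p \<theta>) + Z_term p l w \<theta>"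

definition f_fun :: "ennreal \<Rightarrow> real \<Rightarrow> real" where
  "f_fun p \<theta> = (sin \<theta> - cos \<theta>) / Lp_norm p (sin \<theta>, cos \<theta>)"

definition mean_of :: "real measure \<Rightarrow> (real \<Rightarrow> real) \<Rightarrow> real" where
  "mean_of F h = (LINT \<theta>:{0..pi/2}|F. h \<theta>)"

definition variance_of :: "real measure \<Rightarrow> (real \<Rightarrow> real) \<Rightarrow> real" where
  "variance_of F h = (LINT \<theta>:{0..pi/2}|F. (h \<theta> - mean_of F h)\<^sup>2)"

definition beta_proc ::
  "ennreal \<Rightarrow> pt measure \<Rightarrow> (real \<times> real \<Rightarrow> real) \<Rightarrow> (pt set \<Rightarrow> real) \<Rightarrow> real \<Rightarrow> real" where
  "beta_proc p \<Lambda> l w \<theta> =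
     (alpha_proc p l w \<theta> * Phi p \<Lambda> (pi/2) - Phi p \<Lambda> \<theta> * alpha_proc p l w (pi/2)) / (Phi p \<Lambda> (pi/2))\<^sup>2"

definition gamma_proc ::
  "ennreal \<Rightarrow> pt measure \<Rightarrow> (real \<times> real \<Rightarrow> real) \<Rightarrow> (pt set \<Rightarrow> real) \<Rightarrow> real \<Rightarrow> real" where
  "gamma_proc p \<Lambda> l w \<theta> = beta_proc p \<Lambda> l w \<theta> +
     (LINT \<psi>:{0..pi/2}|lborel. beta_proc p \<Lambda> l w \<psi> * deriv (f_fun p) \<psi>)
       / variance_of (Q_measure p \<Lambda>) (f_fun p)
     * (LINT \<psi>:{0..\<theta>}|Q_measure p \<Lambda>. f_fun p \<psi>)"

definition ell_of :: "pt measure \<Rightarrow> real \<times> real \<Rightarrow> real" where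
  "ell_of \<Lambda> v = measure \<Lambda> (A_set v)"

text \<open>Differentiating within \<open>[0,\<infinity>)\<close> gives the ordinary partial derivative for positive arguments and the
  right-hand one at \<open>0\<close>.\<close>

definition ell_dot1 :: "pt measure \<Rightarrow> real \<times> real \<Rightarrow> real" where
  "ell_dot1 \<Lambda> v = vector_derivative (\<lambda>s. ell_of \<Lambda> (s, snd v)) (at (fst v) within {0..})"

definition ell_dot2 :: "pt measure \<Rightarrow> real \<times> real \<Rightarrow> real" where
  "ell_dot2 \<Lambda> v = vector_derivative (\<lambda>s. ell_of \<Lambda> (fst v, s)) (at (snd v) within {0..})"

definition I_term ::
  "pt measure \<Rightarrow> (real \<times> real \<Rightarrow> real ^ 'm::finite) \<Rightarrow> (real \<times> real) measure \<Rightarrow> (pt set \<Rightarrow> real) \<Rightarrow> real ^ 'm" where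
  "I_term \<Lambda> g \<sigma> w =
     (\<integral>v. (w (A_set v) - (ell_dot1 \<Lambda> v * W1 w (fst v) + ell_dot2 \<Lambda> v * W2 w (snd v))) *\<^sub>R g v \<partial>\<sigma>)"

text \<open>The argument \<open>d\<close> stands for \<open>\<theta> \<mapsto> \<nabla>\<^sub>r \<rho>\<^sub>p\<^sub>,\<^sub>r(\<theta>)\<close>.\<close>

definition L_var ::
  "ennreal \<Rightarrow> (real \<Rightarrow> real) \<Rightarrow> pt measure \<Rightarrow> (real \<times> real \<Rightarrow> real) \<Rightarrow> (real \<Rightarrow> real ^ 'm::finite) \<Rightarrow>
   (real \<times> real \<Rightarrow> real ^ 'm) \<Rightarrow> (real \<times> real) measure \<Rightarrow> (pt set \<Rightarrow> real) \<Rightarrow> real" where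
  "L_var p q \<Lambda> l d g \<sigma> w =
     (LINT \<theta>:{0<..<pi/2}|lborel.
        \<bar>gamma_proc p \<Lambda> l w \<theta> - (LINT x:{0..\<theta>}|lborel. d x) \<bullet> I_term \<Lambda> g \<sigma> w\<bar> * q \<theta>)"

text \<open>\<open>tan (pi / 2) = 0\<close> by totality, so this has the intended value \<open>0\<close> at both end points.\<close>

definition eta :: "real \<Rightarrow> real" where
  "eta \<theta> = min (tan \<theta>) (tan (pi / 2 - \<theta>))"

end

theory Submission
  imports Defs "HOL-Real_Asymp.Real_Asymp"
begin

text \<open>By (5), the law of \<open>L\<^sub>r\<close> converges to the law of the limit variable at \<open>r\<^sub>0\<close> as \<open>r \<rightarrow> r\<^sub>0\<close>. Where the latter
  distribution function lies strictly between 0 and 1 it is strictly increasing, so the quantiles converge, and they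
  do so uniformly over compact sets of levels. Consistency of the estimator gives both claims.

  Up to null sets \<open>L\<^sub>r\<close> is the \<open>L\<^sub>1\<close> norm of a Gaussian process whose values are Wiener integrals. In the
  coordinates \<open>(x, t) = (u\<^sub>1, u\<^sub>2 / u\<^sub>1)\<close> homogeneity turns the tail measure into one with density
  \<open>\<lambda>\<^sub>r(1, t)\<close>, so all integrands can be compared in a single \<open>L\<^sub>2\<close> space, where (5) makes them converge
  uniformly in the angle. This gives convergence of the finite-dimensional distributions. The moments of the
  \<open>L\<^sub>1\<close> norm are determined by these through \<open>\<bar>x\<bar> = \<integral>(1 - cos(t x)) d\<tau>(t)\<close>, and they are bounded by
  Gaussian moments, hence they determine the law. Strict monotonicity holds because rotating two independent
  copies of the process into each other moves its \<open>L\<^sub>1\<close> norm continuously and preserves the law.\<close>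

text \<open>The processes for different \<open>r\<close> live on unrelated probability spaces, so
  paths cannot be compared; only kernels can. This works because every functional in the limit
  variable is linear in the path: evaluated at the path \<open>%C. indicator C z\<close> of a point
  mass it returns its own Wiener kernel at \<open>z\<close>, so one definition serves the random
  variable and its integrand. The absolute value is the only nonlinearity, and the cosine formula
  confines it to characteristic functions. A process is given as a bare family of random variables,
  whereas integrating its paths requires joint measurability. Almost sure continuity is therefore
  extracted from tightness, and a version with regular paths replaces the given one. All sizes are
  controlled by the integrals of \<open>apos t\<close> and \<open>apos t/t\<close>, which equal 1
  for every \<open>r\<close> because the margins are normalised; hence the weight 1 + 1/t in most
  estimates. The limit at the angle pi/2 is taken path by path and needs the decay a(t) t -> 0,
  forced by the same normalisation. Convergence is shown along arbitrary sequences of parameters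
  with levels moving at the same time; compactness then yields uniformity in the level.\<close>

abbreviation (input) intb :: "('a::euclidean_space => 'b::{banach, second_countable_topology}) => bool" where
 "intb == integrable lborel"

abbreviation (input) pos :: "real => 'b::zero_neq_one" where
 "pos == indicator {0<..}"

notation pair_measure (infixr "|*|" 80)

notation LIMSEQ (infix "---->" 60) and tendsto (infixr "--->" 55)

abbreviation (input) meas :: "'a measure => ('a => 'b::topological_space) set" where
 "meas == borel_measurable"

lemmas lint_cong = Bochner_Integration.integral_cong
lemmas lint_bound = Bochner_Integration.integrable_bound
lemmas lint_sum = Bochner_Integration.integral_sum
lemmas lint_add = Bochner_Integration.integral_add
lemmas lintegrable_add = Bochner_Integration.integrable_add
lemmas lint_diff = Bochner_Integration.integral_diff
lemmas mcomp = measurable_compose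

section \<open>The L1 norm of a Gaussian process\<close>

lemma one_minus_cos_le: "1 - cos (x::real) <= x^2/2"
proof -
 have "1 - cos x = 2*(sin (x/2))^2" using cos_double_sin[of "x/2"] by simp
 also have "... <= 2*(x/2)^2"
 proof -
  have "abs (sin (x/2)) <= abs (x/2)" by (rule abs_sin_x_le_abs_x)
  then have "(sin (x/2))^2 <= (x/2)^2" by (simp only: abs_le_square_iff)
  then show ?thesis by simp
 qed
 finally show ?thesis by (simp add: power2_eq_square)
qed

text \<open>The bound is a function of \<open>t\<close> times a function of \<open>x\<close>: after
  taking expectations in \<open>x\<close>, the factor \<open>min 2 (t^2)\<close> remains as a
  dominating function, integrable against the measure of \<open>abs_eq_integral_cos\<close>.\<close>

lemma one_minus_cos_mult_le: "1 - cos (t*x) <= min 2 (t^2)*max 1 ((x::real)^2)"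
proof (cases "t^2 <= 2")
 case True
 have "1 - cos (t*x) <= t^2*x^2" using one_minus_cos_le[of "t*x"]
  by (simp add: power_mult_distrib) (smt (verit) zero_le_power2 mult_nonneg_nonneg field_sum_of_halves)
 also have "... <= t^2*max 1 (x^2)" by (intro mult_left_mono) auto
 finally show ?thesis using True by (simp add: min_absorb2)
next
 case False
 have "1 - cos (t*x) <= 2" by (smt (verit) cos_ge_minus_one)
 also have "... <= 2*max 1 (x^2)" by simp
 finally show ?thesis using False by (simp add: min_absorb1)
qed

lemma nn_integral_min_inverse_square:
 "(nn_integral lborel (%t. ennreal (min 2 (t^2)*(1/t^2)))) < \<infinity>"
proof -
 let ?f = "%t::real. ennreal (min 2 (t^2)*(1/t^2))"
 have *: "((%x::real. inverse x*2) ---> 0) at_top" by real_asymp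
 have h: "(nn_integral lborel (%t. ennreal (2/t^2)*indicator {1..} t)) = ennreal (0-(- 2/1))"
  by (rule nn_integral_FTC_atLeast[where F = "%t::real. - 2/t" and T = 0])
  (auto intro!: derivative_eq_intros simp: power2_eq_square, real_asymp)
 have le: "?f t <= indicator {-1..1} t+ennreal (2/t^2)*indicator {1..} t+ennreal (2/(-t)^2)*indicator {1..} (-t)" for t
 proof (cases "abs t <= 1")
  case True
  have "min 2 (t^2)*(1/t^2) <= 1" by (cases "t = 0") (auto simp: divide_simps min_def)
  then have "?f t <= ennreal 1" by (rule ennreal_leI)
  then show ?thesis using True by (auto simp: indicator_def intro: order_trans)
 next
  case False
  have "min 2 (t^2)*(1/t^2) <= 2/t^2" by (auto simp: divide_simps min_def)
  then show ?thesis using False by (auto simp: indicator_def intro!: ennreal_leI)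
 qed
 have m: "(nn_integral lborel (%t. ennreal (2/(-t)^2)*indicator {1..} (-t))) = (nn_integral lborel (%t. ennreal (2/t^2)*indicator {1..} t))"
  using nn_integral_real_affine[of "%t. ennreal (2/t^2)*indicator {1..} t" "-1" 0] by simp
 have [measurable]: "{1..} : sets (borel :: real measure)" by simp
 have "(nn_integral lborel (%t. ?f t)) <= (nn_integral lborel (%t. indicator {-1..1} t+ennreal (2/t^2)*indicator {1..} t+ennreal (2/(-t)^2)*indicator {1..} (-t)))"
  by (intro nn_integral_mono le)
 also have "... = (nn_integral lborel (%t. indicator {-1..1::real} t))+(nn_integral lborel (%t. ennreal (2/t^2)*indicator {1..} t))+(nn_integral lborel (%t. ennreal (2/(-t)^2)*indicator {1..} (-t)))"
  by (subst nn_integral_add, measurable, subst nn_integral_add, measurable)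
 also have "... < \<infinity>" unfolding m h by simp
 finally show ?thesis .
qed

text \<open>By the substitution t -> x t, the integral of (1 - cos (t x))/t^2 over the line is |x|
  times a constant \<open>c\<close>, so the density 1/(c t^2) works. Positivity of \<open>c\<close>
  is what matters, not its value.\<close>

lemma abs_eq_integral_cos:
 obtains ta :: "real measure" where "sigma_finite_measure ta" "sets ta = sets borel"
  "!!x. has_bochner_integral ta (%t. 1 - cos (t*x)) (abs x)" "integrable ta (%t. min 2 (t^2))"
proof -
 define f where "f t = (1 - cos t)/t^2" for t :: real
 have fm[measurable]: "f : meas borel" unfolding f_def by measurable
 have f0: "0 <= f t" for t unfolding f_def by simp
 have fi: "integrable lborel f"
 proof (rule integrableI_bounded)
  have "(nn_integral lborel (%t. ennreal (norm (f t)))) <= (nn_integral lborel (%t. ennreal (min 2 (t^2)*(1/t^2))))"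
  proof (intro nn_integral_mono ennreal_leI)
  fix t :: real
  have "1 - cos t <= min 2 (t^2)" using one_minus_cos_mult_le[of t 1] by simp
  then have "(1 - cos t)*(1/t^2) <= min 2 (t^2)*(1/t^2)" by (intro mult_right_mono) auto
  then show "norm (f t) <= min 2 (t^2)*(1/t^2)" using f0[of t] by (simp add: f_def)
  qed
  then show "(nn_integral lborel (%t. ennreal (norm (f t)))) < \<infinity>" using nn_integral_min_inverse_square by (rule le_less_trans)
 qed simp
 define c where "c = (LBINT t. f t)"
 \<comment> \<open>If the integral vanished, \<open>cos t = 1\<close> would hold almost everywhere
   off 0, but the cosine is at most 0 on [pi/2, pi], an interval of positive length.\<close>
 have "c ~= 0"
 proof
  assume "c = 0"
  then have "AE t in lborel. f t = 0" using integral_nonneg_eq_0_iff_AE[OF fi] f0 unfolding c_def by simp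
  moreover have "AE t in lborel. t ~: {pi/2..pi}"
  proof (rule AE_mp[OF \<open>AE t in lborel. f t = 0\<close>], rule AE_I2, intro impI notI)
  fix t :: real assume "f t = 0" "t : {pi/2..pi}"
  then have "t > 0" using pi_gt_zero by (auto intro: less_le_trans[of 0 "pi/2"])
  then have "cos t = 1" using \<open>f t = 0\<close> unfolding f_def by auto
  moreover have "cos t <= cos (pi/2)" using \<open>t : _\<close> by (intro cos_monotone_0_pi_le) auto
  ultimately show False by simp
  qed
  then have "emeasure lborel {pi/2..pi} = 0"

  by (subst AE_iff_measurable[symmetric, of _ _ "%t. t ~: {pi/2..pi}"]) auto
  then show False by simp
 qed
 then have cpos: "c > 0" unfolding c_def using f0 by (simp add: order_less_le integral_nonneg_AE)
 define ta where "ta = density lborel (%t. ennreal (1/(c*t^2)))"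
 have hi: "has_bochner_integral ta (%t. 1 - cos (t*x)) (abs x)" for x
 proof (cases "x = 0")
  case False
  have "has_bochner_integral lborel (%t. f (0+x*t)) (c /\<^sub>R (abs x))"
  using lborel_has_bochner_integral_real_affine_iff[of x f c 0] False fi
  by (simp add: has_bochner_integral_iff c_def)
  then have "has_bochner_integral lborel (%t. x^2 / c*f (0+x*t)) (x^2 / c*(c /\<^sub>R (abs x)))"
  by (rule has_bochner_integral_mult_right)
  moreover have "x^2 / c*(c /\<^sub>R (abs x)) = abs x" using cpos False by (simp add: power2_eq_square field_simps abs_mult_self_eq)
  moreover have "x^2 / c*f (0+x*t) = (1/(c*t^2)) *\<^sub>R (1 - cos (t*x))" for t
  proof (cases "t = 0")
  case False
  with \<open>x ~= 0\<close> cpos show ?thesis unfolding f_def by (simp add: power_mult_distrib divide_simps ac_simps)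
  qed (simp add: f_def)
  ultimately show ?thesis unfolding ta_def has_bochner_integral_iff
  using cpos by (subst integrable_density, simp, simp, simp, subst integral_density, simp, simp, simp) (simp)
 qed (simp add: has_bochner_integral_zero)
 show ?thesis
 proof
  show "sets ta = sets borel" by (simp add: ta_def)
  show "sigma_finite_measure ta" unfolding ta_def
  using sigma_finite_measure.sigma_finite_iff_density_finite[OF sigma_finite_lborel, of "%t. ennreal (1/(c*t^2))"] by simp
  show "has_bochner_integral ta (%t. 1 - cos (t*x)) (abs x)" for x by (rule hi)
  have "intb (%t::real. (1 / c)*(min 2 (t^2)*(1/t^2)))"
  by (intro integrable_mult_right integrableI_bounded) (use nn_integral_min_inverse_square in auto)
  then show "integrable ta (%t. min 2 (t^2))" unfolding ta_def using cpos
  by (subst integrable_density) (auto simp: field_simps)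
 qed
qed

section \<open>Moments of the L1 norm\<close>

text \<open>This isolates what the moment method uses of Gaussianity: joint measurability, and
  domination of all even moments by those of a centred normal variable of variance \<open>v\<close>;
  the quotient (2j)!/(2^j j!) is the double factorial (2j - 1)!!. One \<open>v\<close> has to serve
  all indices.\<close>

definition gproc :: "'a measure => 'b measure => ('a => 'b => real) => real => bool" where
 "gproc ka N G v \<longleftrightarrow> prob_space N & (%(th, om). G th om) : meas (ka |*| N) & 0 <= v &
  (ALL th:space ka. ALL j. integrable N (%om. G th om ^ (2*j)) &
  (LINT om|N. G th om ^ (2*j)) <= v ^ j*(fact (2*j)/(2^j*fact j)))"

definition even_moment_bound :: "real => nat => real" where
 "even_moment_bound v j = v ^ j*(fact (2*j)/(2^j*fact j))"

lemma even_moment_bound_nonneg: "0 <= v ==> 0 <= even_moment_bound v j"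
 by (simp add: even_moment_bound_def)

lemma nn_integral_even_moment:
 assumes "gproc ka N G v" "th : space ka"
 shows "(nn_integral N (%om. ennreal (G th om ^ (2*j)))) <= ennreal (even_moment_bound v j)"
 using assms unfolding gproc_def even_moment_bound_def
 by (subst nn_integral_eq_integral) (auto intro!: ennreal_leI simp: power_mult)

text \<open>The product is at most the k-th power of its largest factor; this replaces the Hoelder
  inequality for \<open>k\<close> functions.\<close>

lemma prod_le_sum_power:
 fixes x :: "nat => real"
 assumes "!!i. i < k ==> 0 <= x i" "0 < k"
 shows "(\<Prod>i<k. x i) <= (\<Sum>i<k. x i^k)"
proof -
 define m where "m = Max (x ` {..<k})"
 have "m : x ` {..<k}" unfolding m_def using assms by (intro Max_in) auto
 then obtain i where i: "i < k" "m = x i" by auto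
 have "x j <= m" if "j < k" for j unfolding m_def using that by (intro Max_ge) auto
 then have "(\<Prod>i<k. x i) <= (\<Prod>i<k. m)" using assms by (intro prod_mono) auto
 also have "... = x i^k" using i by simp
 also have "... <= (\<Sum>i<k. x i^k)" using i assms by (intro member_le_sum) auto
 finally show ?thesis .
qed

lemma prod_max_le:
 fixes x :: "nat => real"
 shows "(\<Prod>i<k. max 1 ((x i)^2)) <= 1+(\<Sum>i<k. 1+x i^(2 * k))"
proof (cases "k = 0")
 case False
 have "(\<Prod>i<k. max 1 ((x i)^2)) <= (\<Sum>i<k. (max 1 ((x i)^2))^k)" using False by (intro prod_le_sum_power) auto
 also have "... <= (\<Sum>i<k. 1+x i^(2 * k))" by (intro sum_mono) (auto simp: max_def power_mult)
 finally show ?thesis by simp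
qed simp

text \<open>The moments of the \<open>L\<^sub>1\<close> norm of a path are integrals of quantities that only involve the
 characteristic functions of the finite-dimensional distributions.\<close>

definition cos_coeff :: "real => complex" where
 "cos_coeff e = (if e = 0 then 1 else-1/2)"

definition char_prod :: "'b measure => ('a => 'b => real) => nat => (nat => 'a \<times> real) => real" where
 "char_prod N G k z = (LINT om|N. (\<Prod>i<k. 1 - cos (snd (z i)*G (fst (z i)) om)))"

lemma one_minus_cos_eq_sum:
 "complex_of_real (1 - cos y) = (\<Sum>e\<in>{-1, 0, 1}. cos_coeff e*iexp (e*y))"
proof -
 have "(\<Sum>e\<in>{-1, 0, 1}. cos_coeff e*iexp (e*y))
  = 1-(iexp y+exp (- (\<i> * complex_of_real y)))/2"
  by (simp add: cos_coeff_def field_simps)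
 also have "... = complex_of_real (1 - cos y)"
  by (simp add: cos_exp_eq flip: cos_of_real)
 finally show ?thesis by simp
qed

text \<open>Each factor has three exponential terms, so the expansion has 3^k terms indexed by
  frequencies in {-1, 0, 1}; every one is the characteristic function of a linear combination of the
  process.\<close>

lemma char_prod_eq_sum:
 assumes N: "prob_space N" and m: "!!i. i < k ==> G (fst (z i)) : meas N"
 shows "complex_of_real (char_prod N G k z) =
  (\<Sum>e\<in>PiE {..<k} (%_. {-1, 0, 1}). (\<Prod>i<k. cos_coeff (e i)) *
  (CLINT om|N. iexp (\<Sum>i<k. (e i * snd (z i))*G (fst (z i)) om)))"
proof -
 interpret prob_space N by fact
 have Sm: "(%om. \<Sum>i<k. (e i * snd (z i))*G (fst (z i)) om) : meas N" for e
  using m by (intro borel_measurable_sum borel_measurable_times) auto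
 have int: "integrable N (%om. iexp (\<Sum>i<k. (e i * snd (z i))*G (fst (z i)) om))" for e
  by (intro integrable_iexp mcomp[OF Sm borel_measurable_of_real]) auto
 have "complex_of_real (char_prod N G k z) = (CLINT om|N. complex_of_real (\<Prod>i<k. 1 - cos (snd (z i)*G (fst (z i)) om)))"
  unfolding char_prod_def by (rule integral_complex_of_real[symmetric])
 also have "... = (CLINT om|N. (\<Sum>e\<in>PiE {..<k} (%_. {-1, 0, 1}). (\<Prod>i<k. cos_coeff (e i)) *
  iexp (\<Sum>i<k. (e i * snd (z i))*G (fst (z i)) om)))"
 proof (intro lint_cong refl)
  fix om
  have "complex_of_real (\<Prod>i<k. 1 - cos (snd (z i)*G (fst (z i)) om)) =
  (\<Prod>i<k. \<Sum>e\<in>{-1, 0, 1}. cos_coeff e*iexp (e*(snd (z i)*G (fst (z i)) om)))"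
  unfolding of_real_prod one_minus_cos_eq_sum ..
  also have "... = (\<Sum>e\<in>PiE {..<k} (%_. {-1, 0, 1}). \<Prod>i<k. cos_coeff (e i)*iexp (e i*(snd (z i)*G (fst (z i)) om)))"
  by (rule prod_sum_PiE) auto
  also have "... = (\<Sum>e\<in>PiE {..<k} (%_. {-1, 0, 1}). (\<Prod>i<k. cos_coeff (e i)) *
  iexp (\<Sum>i<k. (e i * snd (z i))*G (fst (z i)) om))"
  by (simp add: prod.distrib exp_sum sum_distrib_left mult.assoc)
  finally show "complex_of_real (\<Prod>i<k. 1 - cos (snd (z i)*G (fst (z i)) om)) = ..." .
 qed
 also have "... = (\<Sum>e\<in>PiE {..<k} (%_. {-1, 0, 1}). (\<Prod>i<k. cos_coeff (e i)) *
  (CLINT om|N. iexp (\<Sum>i<k. (e i * snd (z i))*G (fst (z i)) om)))"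
  using int by (subst lint_sum) (auto intro!: integrable_mult_right)
 finally show ?thesis .
qed

text \<open>Separating the variables in every factor leaves a product of the terms
  \<open>min 2 ((snd (z i))^2)\<close>, integrable over the k-fold product space, with a constant
  depending on \<open>v\<close> and \<open>k\<close> alone: one dominating function for all
  processes under the same bound.\<close>

lemma char_prod_bound:
 assumes G: "gproc ka N G v" and z: "!!i. i < k ==> fst (z i) : space ka"
 shows "0 <= char_prod N G k z"
  "char_prod N G k z <= (1+real k*(1+even_moment_bound v k))*(\<Prod>i<k. min 2 ((snd (z i))^2))"
  "integrable N (%om. \<Prod>i<k. 1 - cos (snd (z i)*G (fst (z i)) om))"
proof -
 interpret prob_space N using G by (simp add: gproc_def)
 have m: "G th : meas N" if "th : space ka" for th
  using measurable_Pair2[OF _ that, of "%(th, om). G th om" N borel] G unfolding gproc_def by auto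
 have m': "(%om. \<Prod>i<k. 1 - cos (snd (z i)*G (fst (z i)) om)) : meas N"
  using m[OF z] by (intro borel_measurable_prod) auto
 show "0 <= char_prod N G k z" unfolding char_prod_def by (intro integral_nonneg_AE AE_I2 prod_nonneg) auto
 have norm2: "norm (\<Prod>i<k. 1 - cos (snd (z i)*G (fst (z i)) om)) <= 2^k" for om
 proof -
  have "(\<Prod>i<k. abs (1 - cos (snd (z i)*G (fst (z i)) om))) <= (\<Prod>i<k. 2)"
  by (intro prod_mono) (smt (verit) cos_ge_minus_one cos_le_one)
  then show ?thesis by (simp add: abs_prod)
 qed
 show int: "integrable N (%om. \<Prod>i<k. 1 - cos (snd (z i)*G (fst (z i)) om))"
  by (rule integrable_const_bound[where B = "2^k"]) (use norm2 m' in auto)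
 have mom: "integrable N (%om. G (fst (z i)) om ^ (2 * k))" "(LINT om|N. G (fst (z i)) om ^ (2 * k)) <= even_moment_bound v k" if "i < k" for i
  using G z[OF that] by (auto simp: gproc_def even_moment_bound_def)
 define P where "P = (\<Prod>i<k. min 2 ((snd (z i))^2))"
 have P: "0 <= P" unfolding P_def by (intro prod_nonneg) auto
 have "char_prod N G k z <= (LINT om|N. P*(1+(\<Sum>i<k. 1+G (fst (z i)) om ^ (2 * k))))"
  unfolding char_prod_def
 proof (rule integral_mono[OF int])
  show "integrable N (%om. P*(1+(\<Sum>i<k. 1+G (fst (z i)) om ^ (2 * k))))"
  using mom by (intro integrable_mult_right lintegrable_add Bochner_Integration.integrable_sum) auto
  fix om
  have "(\<Prod>i<k. 1 - cos (snd (z i)*G (fst (z i)) om)) <= (\<Prod>i<k. min 2 ((snd (z i))^2)*max 1 ((G (fst (z i)) om)^2))"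
  by (intro prod_mono) (auto intro!: one_minus_cos_mult_le)
  also have "... <= P*(1+(\<Sum>i<k. 1+G (fst (z i)) om ^ (2 * k)))"
  unfolding prod.distrib P_def[symmetric] using P by (intro mult_left_mono prod_max_le)
  finally show "(\<Prod>i<k. 1 - cos (snd (z i)*G (fst (z i)) om)) <= P*(1+(\<Sum>i<k. 1+G (fst (z i)) om ^ (2 * k)))" .
 qed
 also have "... = P*(1+(\<Sum>i<k. 1+(LINT om|N. G (fst (z i)) om ^ (2 * k))))"
 proof -
  have i1: "integrable N (%om. 1+G (fst (z i)) om ^ (2 * k))" if "i < k" for i
  using mom(1)[OF that] by simp
  have "(LINT om|N. (\<Sum>i<k. 1+G (fst (z i)) om ^ (2 * k))) = (\<Sum>i<k. (LINT om|N. 1+G (fst (z i)) om ^ (2 * k)))"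
  using i1 by (intro lint_sum) auto
  also have "... = (\<Sum>i<k. 1+(LINT om|N. G (fst (z i)) om ^ (2 * k)))"
  using mom(1) by (intro sum.cong) (auto simp: prob_space)
  moreover have "integrable N (%om. \<Sum>i<k. 1+G (fst (z i)) om ^ (2 * k))"
  using i1 by (intro Bochner_Integration.integrable_sum) auto
  ultimately show ?thesis by (simp add: prob_space)
 qed
 also have "... <= P*(1+(\<Sum>i<k. 1+even_moment_bound v k))"
  using mom P by (intro mult_left_mono add_left_mono sum_mono) auto
 finally show "char_prod N G k z <= (1+real k*(1+even_moment_bound v k))*(\<Prod>i<k. min 2 ((snd (z i))^2))"
  by (simp add: P_def mult.commute)
qed

text \<open>Tonelli, twice: the k-th power of an integral is an integral over the k-fold product,
  and then the expectation moves inside. A coordinate \<open>z i\<close> is a pair of a parameter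
  and a frequency. Extended nonnegative integrals postpone all questions of finiteness.\<close>

lemma nn_moment_eq:
 assumes G: "gproc ka N G v" and ka: "sigma_finite_measure ka"
  and ta: "sigma_finite_measure ta" "sets ta = sets borel"
  and abs: "!!x. has_bochner_integral ta (%t. 1 - cos (t*x)) (abs x)"
 shows "(nn_integral N (%om. (nn_integral ka (%th. ennreal (abs (G th om))))^k)) =
  (\<integral>\<^sup>+z. ennreal (char_prod N G k z) \<partial>PiM {..<k} (%_. ka |*| ta))"
  and "(%z. char_prod N G k z) : meas (PiM {..<k} (%_. ka |*| ta))"
proof -
 interpret prob_space N using G by (simp add: gproc_def)
 interpret ka: sigma_finite_measure ka by fact
 interpret ta: sigma_finite_measure ta by fact
 interpret p: pair_sigma_finite ka ta ..
 interpret P: product_sigma_finite "%_::nat. ka |*| ta" ..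
 interpret FP: finite_product_sigma_finite "%_::nat. ka |*| ta" "{..<k}" by standard auto
 interpret NP: pair_sigma_finite N "PiM {..<k} (%_. ka |*| ta)" ..
 have [measurable_cong]: "sets ta = sets borel" by fact
 have Gm[measurable]: "(%(th, om). G th om) : meas (ka |*| N)" using G by (simp add: gproc_def)
 have Gm2: "(%x. G (fst (snd x i)) (fst x)) : meas (N |*| PiM {..<k} (%_. ka |*| ta))" if "i < k" for i
 proof -
  have "(%x. (fst (snd x i), fst x)) : measurable (N |*| PiM {..<k} (%_. ka |*| ta)) (ka |*| N)"
  using that by (intro measurable_Pair measurable_fst
  mcomp[OF _ measurable_fst[of ka ta], where f = "%x. snd x i"]
  mcomp[OF measurable_snd measurable_component_singleton]) auto
  from mcomp[OF this Gm] show ?thesis by simp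
 qed
 have Gm1: "(%x. G (fst x) om) : meas (ka |*| ta)" if "om : space N" for om
 proof -
  have "(%x. (fst x, om)) : measurable (ka |*| ta) (ka |*| N)" using that by measurable
  from mcomp[OF this Gm] show ?thesis by simp
 qed
 have sndb: "snd : meas (ka |*| ta)" by measurable
 have snd_m: "(%x. snd (snd x i)) : meas (N |*| PiM {..<k} (%_. ka |*| ta))" if "i < k" for i
  using that by (intro mcomp[OF _ sndb, where f = "%x. snd x i"]
  mcomp[OF measurable_snd measurable_component_singleton]) auto
 have Fm: "(%x. \<Prod>i<k. 1 - cos (snd (snd x i)*G (fst (snd x i)) (fst x))) : meas (N |*| PiM {..<k} (%_. ka |*| ta))"
  using Gm2 snd_m by (intro borel_measurable_prod borel_measurable_diff borel_measurable_const borel_measurable_cos borel_measurable_times) auto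
 have one: "(nn_integral ka (%th. ennreal (abs (G th om)))) = (nn_integral (ka |*| ta) (%x. ennreal (1 - cos (snd x*G (fst x) om))))" if w: "om : space N" for om
 proof -
  note [measurable] = Gm1[OF w]
  have "(nn_integral (ka |*| ta) (%x. ennreal (1 - cos (snd x*G (fst x) om)))) = (nn_integral ka (%th. (nn_integral ta (%t. ennreal (1 - cos (t*G th om))))))"
  by (subst ta.nn_integral_fst[symmetric]) auto
  also have "... = (nn_integral ka (%th. ennreal (abs (G th om))))"
  using abs by (intro nn_integral_cong, subst nn_integral_eq_integral) (auto simp: has_bochner_integral_iff)
  finally show ?thesis ..
 qed
 have "(nn_integral N (%om. (nn_integral ka (%th. ennreal (abs (G th om))))^k)) = (\<integral>\<^sup>+om. (\<integral>\<^sup>+z. ennreal (\<Prod>i<k. 1 - cos (snd (z i)*G (fst (z i)) om)) \<partial>PiM {..<k} (%_. ka |*| ta)) \<partial>N)"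
 proof (rule nn_integral_cong)
  fix om assume w: "om : space N"
  note [measurable] = Gm1[OF w]
  have "(\<integral>\<^sup>+z. ennreal (\<Prod>i<k. 1 - cos (snd (z i)*G (fst (z i)) om)) \<partial>PiM {..<k} (%_. ka |*| ta))
  = (\<integral>\<^sup>+z. (\<Prod>i<k. ennreal (1 - cos (snd (z i)*G (fst (z i)) om))) \<partial>PiM {..<k} (%_. ka |*| ta))"
  by (intro nn_integral_cong prod_ennreal[symmetric]) auto
  also have "... = (\<Prod>i<k. (nn_integral (ka |*| ta) (%x. ennreal (1 - cos (snd x*G (fst x) om)))))"
  by (rule P.product_nn_integral_prod) auto
  finally show "(nn_integral ka (%th. ennreal (abs (G th om))))^k = (\<integral>\<^sup>+z. ennreal (\<Prod>i<k. 1 - cos (snd (z i)*G (fst (z i)) om)) \<partial>PiM {..<k} (%_. ka |*| ta))"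
  using one[OF w] by simp
 qed
 also have "... = (\<integral>\<^sup>+z. (nn_integral N (%om. ennreal (\<Prod>i<k. 1 - cos (snd (z i)*G (fst (z i)) om)))) \<partial>PiM {..<k} (%_. ka |*| ta))"
  using Fm by (intro NP.Fubini'[symmetric]) (auto simp: case_prod_beta')
 also have "... = (\<integral>\<^sup>+z. ennreal (char_prod N G k z) \<partial>PiM {..<k} (%_. ka |*| ta))"
 proof (rule nn_integral_cong)
  fix z assume "z : space (PiM {..<k} (%_. ka |*| ta))"
  then have "fst (z i) : space ka" if "i < k" for i using that by (auto simp: space_PiM space_pair_measure PiE_def Pi_def)
  from char_prod_bound(3)[OF G this, of k]
  show "(nn_integral N (%om. ennreal (\<Prod>i<k. 1 - cos (snd (z i)*G (fst (z i)) om)))) = ennreal (char_prod N G k z)"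
  unfolding char_prod_def by (intro nn_integral_eq_integral AE_I2 prod_nonneg) auto
 qed
 finally show "(nn_integral N (%om. (nn_integral ka (%th. ennreal (abs (G th om))))^k)) =
  (\<integral>\<^sup>+z. ennreal (char_prod N G k z) \<partial>PiM {..<k} (%_. ka |*| ta))" .
 have "(%(z, om). \<Prod>i<k. 1 - cos (snd (z i)*G (fst (z i)) om)) : meas (PiM {..<k} (%_. ka |*| ta) |*| N)"
  using mcomp[OF measurable_pair_swap' Fm] by (simp add: case_prod_beta')
 then show "(%z. char_prod N G k z) : meas (PiM {..<k} (%_. ka |*| ta))"
  unfolding char_prod_def by (intro borel_measurable_lebesgue_integral)
qed

text \<open>A bound through \<open>char_prod_bound\<close> would involve moments of order 2k and
  grow too fast in \<open>k\<close> for the exponential series to converge at every argument.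
  Working with the absolute values directly costs only moments of order \<open>k\<close>, hence the
  restriction to even \<open>k\<close>.\<close>

lemma nn_moment_bound:
 assumes G: "gproc ka N G v" and ka: "finite_measure ka" and k: "k = 2*j" "0 < k"
 shows "(nn_integral N (%om. (nn_integral ka (%th. ennreal (abs (G th om))))^k)) <= ennreal (measure ka (space ka)^k*(real k*even_moment_bound v j))"
proof -
 interpret prob_space N using G by (simp add: gproc_def)
 interpret ka: finite_measure ka by fact
 interpret P: product_sigma_finite "%_::nat. ka" ..
 interpret FP: finite_product_sigma_finite "%_::nat. ka" "{..<k}" by standard auto
 interpret NP: pair_sigma_finite N "PiM {..<k} (%_. ka)" ..
 have v: "0 <= v" using G by (simp add: gproc_def)
 have Gm: "(%(th, om). G th om) : meas (ka |*| N)" using G by (simp add: gproc_def)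
 have Gm2: "(%x. G (snd x i) (fst x)) : meas (N |*| PiM {..<k} (%_. ka))" if "i < k" for i
 proof -
  have "(%x. (snd x i, fst x)) : measurable (N |*| PiM {..<k} (%_. ka)) (ka |*| N)"
  using that by (intro measurable_Pair measurable_fst
  mcomp[OF measurable_snd measurable_component_singleton]) auto
  from mcomp[OF this Gm] show ?thesis by simp
 qed
 have Gm1: "(%th. G th om) : meas ka" if "om : space N" for om
  using measurable_Pair1[OF Gm that] by simp
 have Fm: "(%x. \<Prod>i<k. ennreal (abs (G (snd x i) (fst x)))) : meas (N |*| PiM {..<k} (%_. ka))"
  using Gm2 by (intro borel_measurable_prod_ennreal mcomp[OF _ measurable_ennreal] borel_measurable_abs) auto
 have "(nn_integral N (%om. (nn_integral ka (%th. ennreal (abs (G th om))))^k)) = (\<integral>\<^sup>+om. (\<integral>\<^sup>+z. (\<Prod>i<k. ennreal (abs (G (z i) om))) \<partial>PiM {..<k} (%_. ka)) \<partial>N)"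
 proof (rule nn_integral_cong)
  fix om assume w: "om : space N"
  note [measurable] = Gm1[OF w]
  show "(nn_integral ka (%th. ennreal (abs (G th om))))^k = (\<integral>\<^sup>+z. (\<Prod>i<k. ennreal (abs (G (z i) om))) \<partial>PiM {..<k} (%_. ka))"
  by (subst P.product_nn_integral_prod) auto
 qed
 also have "... = (\<integral>\<^sup>+z. (nn_integral N (%om. (\<Prod>i<k. ennreal (abs (G (z i) om))))) \<partial>PiM {..<k} (%_. ka))"
  using Fm by (intro NP.Fubini'[symmetric]) (auto simp: case_prod_beta')
 also have "... <= (\<integral>\<^sup>+z. (\<Prod>i<k. ennreal (1))*ennreal (real k*even_moment_bound v j) \<partial>PiM {..<k} (%_. ka))"
 proof (rule nn_integral_mono)
  fix z assume "z : space (PiM {..<k} (%_. ka))"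
  then have z: "z i : space ka" if "i < k" for i using that by (auto simp: space_PiM PiE_def Pi_def)
  have m: "G (z i) : meas N" if "i < k" for i
  using measurable_Pair2[OF Gm z[OF that]] by simp
  have "(nn_integral N (%om. (\<Prod>i<k. ennreal (abs (G (z i) om))))) <= (nn_integral N (%om. (\<Sum>i<k. ennreal (G (z i) om ^ (2*j)))))"
  proof (rule nn_integral_mono)
  fix om
  have "(\<Prod>i<k. abs (G (z i) om)) <= (\<Sum>i<k. abs (G (z i) om)^k)" using k by (intro prod_le_sum_power) auto
  also have "... = (\<Sum>i<k. G (z i) om ^ (2*j))" unfolding k(1) by (simp add: power_even_abs)
  finally show "(\<Prod>i<k. ennreal (abs (G (z i) om))) <= (\<Sum>i<k. ennreal (G (z i) om ^ (2*j)))"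
  by (simp add: prod_ennreal sum_ennreal power_mult ennreal_leI)
  qed
  also have "... = (\<Sum>i<k. (nn_integral N (%om. ennreal (G (z i) om ^ (2*j)))))"
  using m by (intro nn_integral_sum) auto
  also have "... <= (\<Sum>i<k. ennreal (even_moment_bound v j))"
  using nn_integral_even_moment[OF G z] by (intro sum_mono) auto
  also have "... = ennreal (real k*even_moment_bound v j)"
  by (subst sum_ennreal) (auto simp: even_moment_bound_nonneg[OF v])
  finally show "(nn_integral N (%om. (\<Prod>i<k. ennreal (abs (G (z i) om))))) <= (\<Prod>i<k. ennreal 1)*ennreal (real k*even_moment_bound v j)" by simp
 qed
 also have "... = (\<integral>\<^sup>+z. (\<Prod>i<k. ennreal 1) \<partial>PiM {..<k} (%_. ka))*ennreal (real k*even_moment_bound v j)"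
  by (rule nn_integral_multc) auto
 also have "(\<integral>\<^sup>+z. (\<Prod>i<k. ennreal 1) \<partial>PiM {..<k} (%_. ka)) = ennreal (measure ka (space ka)^k)"
  by (subst P.product_nn_integral_prod) (auto simp: ka.emeasure_eq_measure ennreal_power)
 finally show ?thesis using even_moment_bound_nonneg[OF v] by (simp add: ennreal_mult)
qed

text \<open>Convergence of moments: the characteristic functions determine \<open>char_prod\<close> pointwise, and
 \<open>char_prod_bound\<close> provides the dominating function.\<close>

lemma char_prod_tendsto:
 fixes N :: "nat => 'b measure" and N0 :: "'c measure"
 assumes G: "!!n. gproc ka (N n) (G n) v" "gproc ka N0 G0 v"
  and conv: "!!b th. (!!i. i < k ==> th i : space ka) ==>
  (%n. CLINT om|N n. iexp (\<Sum>i<k. b i*G n (th i) om))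
  ----> (CLINT om|N0. iexp (\<Sum>i<k. b i*G0 (th i) om))"
  and z: "!!i. i < k ==> fst (z i) : space ka"
 shows "(%n. char_prod (N n) (G n) k z) ----> char_prod N0 G0 k z"
proof -
 have m: "F th : meas M" if "gproc ka M F v" "th : space ka" for M :: "'b measure" and F th
  using measurable_Pair2[OF _ that(2), of "%(th, om). F th om" M borel] that(1) unfolding gproc_def by auto
 have m0: "F th : meas M" if "gproc ka M F v" "th : space ka" for M :: "'c measure" and F th
  using measurable_Pair2[OF _ that(2), of "%(th, om). F th om" M borel] that(1) unfolding gproc_def by auto
 have eqn: "complex_of_real (char_prod (N n) (G n) k z) = (\<Sum>e\<in>PiE {..<k} (%_. {-1, 0, 1}). (\<Prod>i<k. cos_coeff (e i)) *
  (CLINT om|N n. iexp (\<Sum>i<k. (e i * snd (z i))*G n (fst (z i)) om)))" for n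
  by (rule char_prod_eq_sum) (use G(1) m[OF G(1) z] in \<open>auto simp: gproc_def\<close>)
 have eq0: "complex_of_real (char_prod N0 G0 k z) = (\<Sum>e\<in>PiE {..<k} (%_. {-1, 0, 1}). (\<Prod>i<k. cos_coeff (e i)) *
  (CLINT om|N0. iexp (\<Sum>i<k. (e i * snd (z i))*G0 (fst (z i)) om)))"
  by (rule char_prod_eq_sum) (use G(2) m0[OF G(2) z] in \<open>auto simp: gproc_def\<close>)
 have "(%n. complex_of_real (char_prod (N n) (G n) k z)) ----> complex_of_real (char_prod N0 G0 k z)"
  unfolding eqn eq0 by (intro tendsto_sum tendsto_mult tendsto_const conv z)
 then show ?thesis by (simp add: tendsto_of_real_iff)
qed

lemma nn_moment_tendsto:
 fixes N :: "nat => 'b measure" and N0 :: "'c measure"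
 assumes G: "!!n. gproc ka (N n) (G n) v" "gproc ka N0 G0 v" and ka: "finite_measure ka"
  and conv: "!!b th. (!!i. i < k ==> th i : space ka) ==>
  (%n. CLINT om|N n. iexp (\<Sum>i<k. b i*G n (th i) om))
  ----> (CLINT om|N0. iexp (\<Sum>i<k. b i*G0 (th i) om))"
 shows "(%n. \<integral>\<^sup>+om. (nn_integral ka (%th. ennreal (abs (G n th om))))^k \<partial>N n) ---->
  (nn_integral N0 (%om. (nn_integral ka (%th. ennreal (abs (G0 th om))))^k))"
proof -
 obtain ta :: "real measure" where ta: "sigma_finite_measure ta" "sets ta = sets borel"
  and abs: "!!x. has_bochner_integral ta (%t. 1 - cos (t*x)) (abs x)" and dom: "integrable ta (%t. min 2 (t^2))"
  using abs_eq_integral_cos by metis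
 interpret ka: finite_measure ka by fact
 interpret ta: sigma_finite_measure ta by fact
 interpret p: pair_sigma_finite ka ta ..
 interpret P: product_sigma_finite "%_::nat. ka |*| ta" ..
 have sf: "sigma_finite_measure ka" ..
 let ?P = "PiM {..<k} (%_. ka |*| ta)"
 have v: "0 <= v" using G(2) by (simp add: gproc_def)
 define C where "C = 1+real k*(1+even_moment_bound v k)"
 have C: "0 <= C" unfolding C_def using even_moment_bound_nonneg[OF v] by (intro add_nonneg_nonneg mult_nonneg_nonneg) auto
 have zs: "fst (z i) : space ka" if "z : space ?P" "i < k" for z i
  using that by (auto simp: space_PiM space_pair_measure PiE_def Pi_def)
 have [measurable_cong]: "sets ta = sets borel" by fact
 have "integrable (ka |*| ta) (%x. min 2 ((snd x)^2))"
  by (rule p.Fubini_integrable) (use dom in \<open>auto simp: split_beta'\<close>)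
 then have "integrable ?P (%z. \<Prod>i<k. min 2 ((snd (z i))^2))"
  by (intro P.product_integrable_prod) auto
 then have w: "integrable ?P (%z. C*(\<Prod>i<k. min 2 ((snd (z i))^2)))" by simp
 have "(%n. \<integral>\<^sup>+z. ennreal (char_prod (N n) (G n) k z) \<partial>?P) ----> (\<integral>\<^sup>+z. ennreal (char_prod N0 G0 k z) \<partial>?P)"
 proof (rule nn_integral_dominated_convergence[where w = "%z. ennreal (C*(\<Prod>i<k. min 2 ((snd (z i))^2)))"])
  show "!!n. (%z. ennreal (char_prod (N n) (G n) k z)) : meas ?P"
  using nn_moment_eq(2)[OF G(1) sf ta abs] by measurable
  show "(%z. ennreal (char_prod N0 G0 k z)) : meas ?P"
  using nn_moment_eq(2)[OF G(2) sf ta abs] by measurable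
  show "(%z. ennreal (C*(\<Prod>i<k. min 2 ((snd (z i))^2)))) : meas ?P"
  using borel_measurable_integrable[OF w] by measurable
  show "(\<integral>\<^sup>+z. ennreal (C*(\<Prod>i<k. min 2 ((snd (z i))^2))) \<partial>?P) < \<infinity>"
  using w C by (subst nn_integral_eq_integral) (auto intro!: AE_I2 mult_nonneg_nonneg prod_nonneg)
  show "!!n. AE z in ?P. ennreal (char_prod (N n) (G n) k z) <= ennreal (C*(\<Prod>i<k. min 2 ((snd (z i))^2)))"
  unfolding C_def by (intro AE_I2 ennreal_leI char_prod_bound(2)[OF G(1)] zs)
  show "AE z in ?P. (%n. ennreal (char_prod (N n) (G n) k z)) ----> ennreal (char_prod N0 G0 k z)"
  by (intro AE_I2 tendsto_ennrealI char_prod_tendsto[OF G] conv zs)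
 qed
 then show ?thesis
  unfolding nn_moment_eq(1)[OF G(1) sf ta abs, symmetric] nn_moment_eq(1)[OF G(2) sf ta abs, symmetric] .
qed

definition L1_path :: "'a measure => ('a => 'b => real) => 'b => real" where
 "L1_path ka G om = (LINT th|ka. abs (G th om))"

lemma L1_path_measurable:
 assumes "gproc ka N G v" "finite_measure ka"
 shows "L1_path ka G : meas N"
proof -
 interpret finite_measure ka by fact
 have [measurable]: "(%(th, om). G th om) : meas (ka |*| N)" using assms by (simp add: gproc_def)
 have "(%(om, th). G th om) : meas (N |*| ka)" by measurable
 then have "(%(om, th). abs (G th om)) : meas (N |*| ka)" by measurable
 then show ?thesis unfolding L1_path_def[abs_def] by (rule borel_measurable_lebesgue_integral)
qed

text \<open>\<open>L1_path\<close> is a Bochner integral and would be 0 by default on a path that is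
  not integrable. A finite second moment of the extended integral excludes this almost surely, so
  both integrals agree up to a null set.\<close>

lemma L1_path_moments:
 assumes G: "gproc ka N G v" and ka: "finite_measure ka"
 defines "K \<equiv> measure ka (space ka)"
 shows "AE om in N. integrable ka (%th. G th om)"
  "integrable N (%om. L1_path ka G om ^ k)"
  "(nn_integral N (%om. (nn_integral ka (%th. ennreal (abs (G th om))))^k)) = ennreal (LINT om|N. L1_path ka G om ^ k)"
  "0 < j ==> (LINT om|N. abs (L1_path ka G om)^(2*j)) <= K^(2*j)*(real (2*j)*even_moment_bound v j)"
proof -
 interpret prob_space N using G by (simp add: gproc_def)
 interpret ka: finite_measure ka by fact
 let ?L = "%om. (nn_integral ka (%th. ennreal (abs (G th om))))"
 have v: "0 <= v" using G by (simp add: gproc_def)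
 have Gm[measurable]: "(%(th, om). G th om) : meas (ka |*| N)" using G by (simp add: gproc_def)
 have Gm1: "(%th. G th om) : meas ka" if "om : space N" for om
  using measurable_Pair1[OF Gm that] by simp
 have Lm[measurable]: "?L : meas N"
 proof -
  have "(%(om, th). ennreal (abs (G th om))) : meas (N |*| ka)" by measurable
  then show ?thesis by (rule ka.borel_measurable_nn_integral)
 qed
 have L0: "0 <= L1_path ka G om" for om unfolding L1_path_def by simp
 have "(nn_integral N (%om. ?L om ^ (2*1))) < \<infinity>" using nn_moment_bound[OF G ka, of "2*1" 1] by (simp add: le_less_trans)
 then have "AE om in N. ?L om ^ (2*1) ~= \<infinity>" by (intro nn_integral_noteq_infinite) (auto simp: less_top)
 then have fin: "AE om in N. ?L om < \<infinity>" by (rule AE_mp) (auto simp: less_top[symmetric] power2_eq_square ennreal_mult_eq_top_iff)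
 show ai: "AE om in N. integrable ka (%th. G th om)"
  using fin AE_space by eventually_elim (auto simp: integrable_iff_bounded Gm1)
 have eq: "AE om in N. ?L om ^ k = ennreal (L1_path ka G om ^ k)" for k
  using ai AE_space
 proof eventually_elim
  case (elim om)
  then have "?L om = ennreal (L1_path ka G om)" unfolding L1_path_def by (intro nn_integral_eq_integral) auto
  then show ?case by (simp add: ennreal_power L0)
 qed
 have M: "(nn_integral N (%om. ?L om ^ k)) = (nn_integral N (%om. ennreal (L1_path ka G om ^ k)))" for k
  by (rule nn_integral_cong_AE[OF eq])
 have [measurable]: "L1_path ka G : meas N" by (rule L1_path_measurable[OF G ka])
 have even: "(nn_integral N (%om. ennreal (L1_path ka G om ^ (2*j)))) <= ennreal (K^(2*j)*(real (2*j)*even_moment_bound v j))" if "0 < j" for j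
  using nn_moment_bound[OF G ka refl, of j] that unfolding M K_def by simp
 have int: "integrable N (%om. L1_path ka G om ^ k)" for k
 proof -
  \<comment> \<open>The exponent 2(k + 1) is a positive even number above \<open>k\<close>, so
    \<open>even\<close> applies whatever the parity of \<open>k\<close>, and also for
    \<open>k = 0\<close>.\<close>
  have "integrable N (%om. L1_path ka G om ^ (2*(k+1)))"
  using even[of "k+1"] by (intro integrableI_bounded) (auto simp: abs_of_nonneg L0 le_less_trans simp del: power_Suc)
  then have "integrable N (%om. 1+L1_path ka G om ^ (2*(k+1)))" by simp
  then show ?thesis
  proof (rule lint_bound)
  show "AE om in N. norm (L1_path ka G om ^ k) <= norm (1+L1_path ka G om ^ (2*(k+1)))"
  proof (rule AE_I2)
  fix om
  have "L1_path ka G om ^ k <= 1+L1_path ka G om ^ (2*(k+1))"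
  proof (cases "L1_path ka G om <= 1")
  case True then have "L1_path ka G om ^ k <= 1" by (intro power_le_one L0)
  moreover have "0 <= L1_path ka G om ^ (2*(k+1))" by (intro zero_le_power L0)
  ultimately show ?thesis by linarith
  next
  case False then have "L1_path ka G om ^ k <= L1_path ka G om ^ (2*(k+1))" by (intro power_increasing) auto
  then show ?thesis by linarith
  qed
  moreover have "0 <= L1_path ka G om ^ k" "0 <= L1_path ka G om ^ (2*(k+1))" by (intro zero_le_power L0)+
  ultimately show "norm (L1_path ka G om ^ k) <= norm (1+L1_path ka G om ^ (2*(k+1)))" by simp
  qed
  qed simp
 qed
 show "integrable N (%om. L1_path ka G om ^ k)" by (rule int)
 have eq2: "(nn_integral N (%om. ennreal (L1_path ka G om ^ k))) = ennreal (LINT om|N. L1_path ka G om ^ k)" for k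
  by (intro nn_integral_eq_integral int AE_I2 zero_le_power L0)
 show "(nn_integral N (%om. ?L om ^ k)) = ennreal (LINT om|N. L1_path ka G om ^ k)" unfolding M eq2 ..
 show "(LINT om|N. abs (L1_path ka G om)^(2*j)) <= K^(2*j)*(real (2*j)*even_moment_bound v j)" if "0 < j"
 proof -
  have "0 <= K^(2*j)*(real (2*j)*even_moment_bound v j)"
  using even_moment_bound_nonneg[OF v] by (intro mult_nonneg_nonneg zero_le_power) (auto simp: K_def)
  then show ?thesis using even[OF that] unfolding eq2 by (simp add: abs_of_nonneg[OF L0])
 qed
qed

text \<open>The remainder \<open>e j\<close> of the Taylor polynomial of degree 2j of the
  characteristic function does not depend on \<open>n\<close> and tends to 0, so convergence of all
  moments forces convergence of the characteristic functions. Sequence and limit may live on spaces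
  of different types: in the rotation argument one of them is a square.\<close>

theorem L1_path_weak_conv:
 fixes N :: "nat => 'b measure" and N0 :: "'c measure"
 assumes G: "!!n. gproc ka (N n) (G n) v" "gproc ka N0 G0 v" and ka: "finite_measure ka"
  and conv: "!!(k::nat) b th. (!!i. i < k ==> th i : space ka) ==>
  (%n. CLINT om|N n. iexp (\<Sum>i<k. b i*G n (th i) om))
  ----> (CLINT om|N0. iexp (\<Sum>i<k. b i*G0 (th i) om))"
 shows "weak_conv_m (%n. distr (N n) borel (L1_path ka (G n))) (distr N0 borel (L1_path ka G0))"
proof (rule levy_continuity)
 have rd0: "real_distribution (distr M borel (L1_path ka F))" if "gproc ka M F v" for M :: "'b measure" and F
 proof -
  interpret prob_space M using that by (simp add: gproc_def)
  show ?thesis by (rule real_distribution_distr) (rule L1_path_measurable[OF that ka])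
 qed
 show "real_distribution (distr (N n) borel (L1_path ka (G n)))" for n by (rule rd0[OF G(1)])
 show "real_distribution (distr N0 borel (L1_path ka G0))"
 proof -
  interpret prob_space N0 using G(2) by (simp add: gproc_def)
  show ?thesis by (rule real_distribution_distr) (rule L1_path_measurable[OF G(2) ka])
 qed
 fix t :: real
 define K where "K = measure ka (space ka)"
 \<comment> \<open>The remainder bound of \<open>char_approx1'\<close>, combined with the moment
   bound of order 2j.\<close>
 define e where "e j = (2*abs t^(2*j)/fact (2*j))*(K^(2*j)*(real (2*j)*even_moment_bound v j))" for j
 define mom where "mom n k = (\<integral>om. L1_path ka (G n) om ^ k \<partial>N n)" for n k
 define mom0 where "mom0 k = (LINT om|N0. L1_path ka G0 om ^ k)" for k
 have mom_conv: "(%n. mom n k) ----> mom0 k" for k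
 proof -
  have nn: "0 <= mom n k" "0 <= mom0 k" for n unfolding mom_def mom0_def L1_path_def by (auto intro!: integral_nonneg_AE)
  have "(%n. ennreal (mom n k)) ----> ennreal (mom0 k)"
  unfolding mom_def mom0_def L1_path_moments(3)[OF G(1) ka, symmetric] L1_path_moments(3)[OF G(2) ka, symmetric]
  by (rule nn_moment_tendsto[OF G ka]) (rule conv)
  then show ?thesis using nn by (subst (asm) tendsto_ennreal_iff) auto
 qed
 have approx0: "cmod (char (distr N0 borel (L1_path ka G0)) t-(\<Sum>k\<le>2*j. ((\<i> * t)^k/fact k)*mom0 k)) <= e j" if j: "0 < j" for j
 proof -
  interpret prob_space N0 using G(2) by (simp add: gproc_def)
  have "cmod (char (distr N0 borel (L1_path ka G0)) t-(\<Sum>k\<le>2*j. ((\<i> * t)^k/fact k)*mom0 k))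
  <= (2*abs t^(2*j)/fact (2*j))*(LINT om|N0. abs (L1_path ka G0 om)^(2*j))"
  unfolding mom0_def
  by (rule char_approx1') (auto intro: L1_path_moments(2)[OF G(2) ka] L1_path_measurable[OF G(2) ka])
  also have "... <= e j" unfolding e_def K_def
  by (intro mult_left_mono L1_path_moments(4)[OF G(2) ka j]) auto
  finally show ?thesis .
 qed
 have approxn: "cmod (char (distr (N n) borel (L1_path ka (G n))) t-(\<Sum>k\<le>2*j. ((\<i> * t)^k/fact k)*mom n k)) <= e j" if j: "0 < j" for j n
 proof -
  interpret prob_space "N n" using G(1) by (simp add: gproc_def)
  have "cmod (char (distr (N n) borel (L1_path ka (G n))) t-(\<Sum>k\<le>2*j. ((\<i> * t)^k/fact k)*mom n k))
  <= (2*abs t^(2*j)/fact (2*j))*(\<integral>om. abs (L1_path ka (G n) om)^(2*j) \<partial>N n)"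
  unfolding mom_def
  by (rule char_approx1') (auto intro: L1_path_moments(2)[OF G(1) ka] L1_path_measurable[OF G(1) ka])
  also have "... <= e j" unfolding e_def K_def
  by (intro mult_left_mono L1_path_moments(4)[OF G(1) ka j]) auto
  finally show ?thesis .
 qed
 have e0: "e ----> 0"
 proof -
  \<comment> \<open>The factors (2j)! cancel, which leaves 4 x^j/(j - 1)! with this
    \<open>x\<close>.\<close>
  define x where "x = t^2*K^2 * v / 2"
  have "e j = 4*x*(x^(j-1)/fact (j-1))" if "0 < j" for j
  proof -
  obtain i where i: "j = Suc i" using \<open>0 < j\<close> by (cases j) auto
  have p1: "K^(2*j) = (K^2)^j" and p2: "abs t^(2*j) = (t^2)^j" by (simp_all add: power_mult)
  have "e j = 4*real j*((t^2)^j*(K^2)^j * v ^ j/2^j)/fact j"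
  unfolding e_def even_moment_bound_def p1 p2 by (simp add: field_simps)
  also have "... = 4*real j*x^j/fact j" unfolding x_def by (simp add: power_mult_distrib power_divide)
  also have "... = 4*x*(x^(j-1)/fact (j-1))"
  proof -
  have "(fact j :: real) = real j*fact i" unfolding i by (rule fact_Suc)
  moreover have "x^j = x*x^i" "j-1 = i" unfolding i by simp_all
  moreover have "4*real j*(x*x^i)/(real j*fact i) = 4*x*(x^i/fact i)"
  using \<open>0 < j\<close> by (simp add: divide_simps)
  ultimately show ?thesis by (simp only:)
  qed
  finally show ?thesis .
  qed
  then have *: "\<forall>\<^sub>F j in sequentially. 4*x*(x^(j-1)/fact (j-1)) = e j"
  by (intro eventually_sequentiallyI[of 1]) auto
  have "(%j. x^j/fact j) ----> 0"
  using summable_LIMSEQ_zero[OF summable_exp[of x]] by (simp add: field_simps)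
  then have "(%j. x^(Suc j-1)/fact (Suc j-1)) ----> 0" by simp
  then have "(%j. x^(j-1)/fact (j-1)) ----> 0" by (rule LIMSEQ_imp_Suc)
  then have "(%j. 4*x*(x^(j-1)/fact (j-1))) ----> 4*x*0" by (intro tendsto_intros)
  with * show ?thesis by (simp add: tendsto_cong)
 qed
 show "(%n. char (distr (N n) borel (L1_path ka (G n))) t) ----> char (distr N0 borel (L1_path ka G0)) t"
 proof (rule metric_LIMSEQ_I)
  fix r :: real assume r: "0 < r"
  have "\<forall>\<^sub>F j in sequentially. e j < r/3 & 0 < j"
  using order_tendstoD(2)[OF e0, of "r/3"] r eventually_gt_at_top[of 0] by (auto intro: eventually_conj)
  then obtain j where j: "e j < r/3" "0 < j" using eventually_happens' sequentially_bot by blast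
  let ?s = "%m. (\<Sum>k\<le>2*j. ((\<i> * t)^k/fact k) * complex_of_real (m k))"
  have "(%n. ?s (mom n)) ----> ?s mom0" by (intro tendsto_intros mom_conv)
  then obtain n0 where n0: "!!n. n >= n0 ==> dist (?s (mom n)) (?s mom0) < r/3"
  using metric_LIMSEQ_D[of "%n. ?s (mom n)" "?s mom0" "r/3"] r by auto
  show "EX no. ALL n>=no. dist (char (distr (N n) borel (L1_path ka (G n))) t) (char (distr N0 borel (L1_path ka G0)) t) < r"
  proof (intro exI allI impI)
  fix n assume "n0 <= n"
  let ?a = "char (distr (N n) borel (L1_path ka (G n))) t" and ?b = "char (distr N0 borel (L1_path ka G0)) t"
  have "dist ?a ?b <= dist ?a (?s (mom n))+dist (?s (mom n)) (?s mom0)+dist (?s mom0) ?b"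
  using dist_triangle[of ?a ?b "?s (mom n)"] dist_triangle[of "?s (mom n)" ?b "?s mom0"] by linarith
  also have "... < r/3+r/3+r/3"
  using approxn[OF j(2), of n] approx0[OF j(2)] j(1) n0[OF \<open>n0 <= n\<close>]
  by (intro add_strict_mono) (auto simp: dist_norm norm_minus_commute)
  finally show "dist ?a ?b < r" by simp
  qed
 qed
qed

section \<open>Rotation of independent copies and absence of gaps\<close>

text \<open>\<open>V\<close> stands for the variance of a linear combination. Of its being a
  quadratic form the homogeneity is recorded, which lets the variances of two independent copies
  with weights cos and sin add up.\<close>

definition gauss_char :: "'a measure => 'b measure => ('a => 'b => real) => (nat => (nat => real) => (nat => 'a) => real) => bool" where
 "gauss_char ka N G V \<longleftrightarrow> (ALL k b th. (ALL i<k. th i : space ka) -->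
  (CLINT om|N. iexp (\<Sum>i<k. b i*G (th i) om)) = complex_of_real (exp (- V k b th / 2)) &
  (ALL c. V k (%i. c*b i) th = c^2*V k b th))"

text \<open>For constant sequences, a theorem on weak convergence becomes one on uniqueness of the
  law.\<close>

lemma weak_conv_m_const_eq:
 assumes "real_distribution M" "real_distribution M'" "weak_conv_m (%_. M) M'"
 shows "M = M'"
proof (rule Levy_uniqueness[OF assms(1,2)], rule ext)
 fix t show "char M t = char M' t"
  using levy_continuity1[of "%_. M" M' t] assms by (simp add: LIMSEQ_const_iff)
qed

context
 fixes ka :: "'a measure" and N :: "'b measure" and G :: "'a => 'b => real" and v V
 assumes gp: "gproc ka N G v" and gc: "gauss_char ka N G V" and ka: "finite_measure ka"
begin

interpretation prob_space N using gp by (simp add: gproc_def)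

interpretation NN: pair_prob_space N N ..

definition rot :: "real => 'a => 'b \<times> 'b => real" where
 "rot ph th x = cos ph * G th (fst x)+sin ph * G th (snd x)"

lemma G_measurable: "th : space ka ==> G th : meas N"
 using measurable_Pair2[of "%(th, om). G th om" ka N borel th] gp unfolding gproc_def by auto

lemma rot_measurable: "th : space ka ==> rot ph th : meas (N |*| N)"
 unfolding rot_def[abs_def] using G_measurable[of th] by measurable

text \<open>Independence factorizes the characteristic function, and the exponents add up to the
  original variance by cos^2 + sin^2 = 1.\<close>

lemma rot_char:
 fixes k :: nat
 assumes th: "!!i. i < k ==> th i : space ka"
 shows "(CLINT x|N |*| N. iexp (\<Sum>i<k. b i*rot ph (th i) x)) =
  (CLINT om|N. iexp (\<Sum>i<k. b i*G (th i) om))"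
proof -
 define S where "S c om = (\<Sum>i<k. (c*b i)*G (th i) om)" for c om
 have Sm[measurable]: "S c : meas N" for c
  unfolding S_def[abs_def] using G_measurable[OF th] by (intro borel_measurable_sum borel_measurable_times) auto
 have eq: "(\<Sum>i<k. b i*rot ph (th i) x) = S (cos ph) (fst x)+S (sin ph) (snd x)" for x
  unfolding S_def rot_def by (simp add: algebra_simps sum.distrib)
 have ch: "(CLINT om|N. iexp (S c om)) = complex_of_real (exp (- (c^2*V k b th)/2))" for c
 proof -
  have "(CLINT om|N. iexp (S c om)) = complex_of_real (exp (- V k (%i. c*b i) th / 2))"
  using gc[unfolded gauss_char_def, rule_format, of k th "%i. c*b i"] th unfolding S_def by auto
  moreover have "V k (%i. c*b i) th = c^2*V k b th"
  using gc[unfolded gauss_char_def, rule_format, of k th b] th by auto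
  ultimately show ?thesis by simp
 qed
 have int: "integrable (N |*| N) (%x. iexp (S (cos ph) (fst x))*iexp (S (sin ph) (snd x)))"
  by (rule NN.P.integrable_const_bound[where B = 1]) (auto simp: norm_mult)
 have "(CLINT x|N |*| N. iexp (\<Sum>i<k. b i*rot ph (th i) x)) =
  (CLINT x|N |*| N. iexp (S (cos ph) (fst x))*iexp (S (sin ph) (snd x)))"
  unfolding eq by (simp add: exp_add[symmetric] distrib_left)
 also have "... = (CLINT x|N. CLINT y|N. iexp (S (cos ph) x)*iexp (S (sin ph) y))"
  using NN.integral_fst'[OF int] by simp
 also have "... = complex_of_real (exp (- ((cos ph)^2*V k b th)/2)) * complex_of_real (exp (- ((sin ph)^2*V k b th)/2))"
  by (simp add: ch)
 also have "... = complex_of_real (exp (- ((cos ph)^2*V k b th)/2 + - ((sin ph)^2*V k b th)/2))"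
  by (simp only: exp_add of_real_mult)
 also have "- ((cos ph)^2*V k b th)/2 + - ((sin ph)^2*V k b th)/2 = - (((cos ph)^2+(sin ph)^2)*V k b th)/2"
 proof -
  have "- (a*w)/2 + - (b*w)/2 = - ((a+b)*w)/2" for a b w :: real by (simp add: field_simps)
  then show ?thesis .
 qed
 also have "... = - (1^2*V k b th)/2" by simp
 also have "complex_of_real (exp (- (1^2*V k b th)/2)) = (CLINT om|N. iexp (\<Sum>i<k. b i*G (th i) om))"
  unfolding ch[symmetric] by (simp add: S_def)
 finally show ?thesis .
qed

lemma rot_distr:
 assumes "th : space ka"
 shows "distr (N |*| N) borel (rot ph th) = distr N borel (G th)"
proof (rule Levy_uniqueness)
 show "real_distribution (distr (N |*| N) borel (rot ph th))"
  by (rule NN.P.real_distribution_distr) (rule rot_measurable[OF assms])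
 show "real_distribution (distr N borel (G th))" by (rule real_distribution_distr) (rule G_measurable[OF assms])
 show "char (distr (N |*| N) borel (rot ph th)) = char (distr N borel (G th))"
  using rot_char[of "Suc 0" "%_. th" "%_. t" ph for t] assms rot_measurable[OF assms] G_measurable[OF assms]
  by (auto simp: char_def integral_distr fun_eq_iff)
qed

lemma rot_gproc: "gproc ka (N |*| N) (rot ph) v"
 unfolding gproc_def
proof (intro conjI ballI allI)
 show "prob_space (N |*| N)" by (rule NN.P.prob_space_axioms)
 show "0 <= v" using gp by (simp add: gproc_def)
 have [measurable]: "(%(th, om). G th om) : meas (ka |*| N)" using gp by (simp add: gproc_def)
 show "(%(th, x). rot ph th x) : meas (ka |*| (N |*| N))" unfolding rot_def by measurable
 fix th j assume th: "th : space ka"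
 note m = rot_measurable[OF th, of ph] G_measurable[OF th]
 have g: "integrable N (%om. G th om ^ (2*j))" "(LINT om|N. G th om ^ (2*j)) <= v ^ j*(fact (2*j)/(2^j*fact j))"
  using gp th by (auto simp: gproc_def)
 have "integrable (distr N borel (G th)) (%x. x^(2*j))" using g m by (subst integrable_distr_eq) auto
 then show "integrable (N |*| N) (%x. rot ph th x^(2*j))"
  unfolding rot_distr[OF th, of ph, symmetric] using m by (subst (asm) integrable_distr_eq) auto
 have "(\<integral>x. x^(2*j) \<partial>distr N borel (G th)) <= v ^ j*(fact (2*j)/(2^j*fact j))"
  using g m by (subst integral_distr) auto
 then show "(LINT x|(N |*| N). rot ph th x^(2*j)) <= v ^ j*(fact (2*j)/(2^j*fact j))"
  unfolding rot_distr[OF th, of ph, symmetric] using m by (subst (asm) integral_distr) auto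
qed

text \<open>The rotated process has the same finite-dimensional characteristic functions, and these
  determine the law of the L1 norm by the convergence theorem for a constant sequence.\<close>

lemma rot_L1_distr: "distr (N |*| N) borel (L1_path ka (rot ph)) = distr N borel (L1_path ka G)"
proof (rule weak_conv_m_const_eq)
 show "real_distribution (distr (N |*| N) borel (L1_path ka (rot ph)))"
  by (rule NN.P.real_distribution_distr) (rule L1_path_measurable[OF rot_gproc ka])
 show "real_distribution (distr N borel (L1_path ka G))" by (rule real_distribution_distr) (rule L1_path_measurable[OF gp ka])
 show "weak_conv_m (%_. distr (N |*| N) borel (L1_path ka (rot ph))) (distr N borel (L1_path ka G))"
  by (rule L1_path_weak_conv[OF rot_gproc gp ka]) (simp only: rot_char tendsto_const)
qed

text \<open>If \<open>L\<close> is small on one copy and large on an independent one, the continuous path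
 \<open>ph \<mapsto> L (G cos ph + G' sin ph)\<close> passes through every intermediate value, although each
 of its points has the law of \<open>L\<close>.\<close>

theorem L1_path_no_gap:
 assumes x: "x1 < x2" and lo: "0 < cdf (distr N borel (L1_path ka G)) x1" and hi: "cdf (distr N borel (L1_path ka G)) x2 < 1"
 shows "cdf (distr N borel (L1_path ka G)) x1 < cdf (distr N borel (L1_path ka G)) x2"
proof (rule ccontr)
 let ?L = "L1_path ka G" and ?D = "distr N borel (L1_path ka G)"
 have Lm[measurable]: "?L : meas N" by (rule L1_path_measurable[OF gp ka])
 interpret D: real_distribution ?D by (rule real_distribution_distr) measurable
 assume "~ cdf ?D x1 < cdf ?D x2"
 then have eq: "cdf ?D x2 - cdf ?D x1 = 0" using D.cdf_nondecreasing[of x1 x2] x by simp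
 have gap: "measure ?D {x1<..x2} = 0" using D.cdf_diff_eq[OF x] eq by simp
 \<comment> \<open>The rotated norm has the law of the original one and avoids the same interval,
   outside an exceptional set that depends on the angle.\<close>
 have gapr: "AE w in N |*| N. L1_path ka (rot ph) w ~: {x1<..<x2}" for ph
 proof -
  have [measurable]: "L1_path ka (rot ph) : meas (N |*| N)" by (rule L1_path_measurable[OF rot_gproc ka])
  have "AE y in ?D. y ~: {x1<..x2}"
  using gap by (subst AE_iff_measurable[of "{x1<..x2}"]) (auto simp: D.emeasure_eq_measure)
  then have "AE y in distr (N |*| N) borel (L1_path ka (rot ph)). y ~: {x1<..x2}" by (simp only: rot_L1_distr)
  then have "AE w in N |*| N. L1_path ka (rot ph) w ~: {x1<..x2}" by (subst (asm) AE_distr_iff) auto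
  then show ?thesis by (rule AE_mp) auto
 qed
 have snd_eq: "distr (N |*| N) N snd = N"
 proof (rule measure_eqI)
  fix B assume "B : sets (distr (N |*| N) N snd)"
  then have B: "B : sets N" by simp
  have "snd -` B Int space (N |*| N) = space N \<times> B" using sets.sets_into_space[OF B] by (auto simp: space_pair_measure)
  then show "emeasure (distr (N |*| N) N snd) B = emeasure N B"
  using B by (simp add: emeasure_distr emeasure_pair_measure_Times emeasure_space_1)
 qed simp
 \<comment> \<open>Countably many angles share one exceptional set. Rational angles suffice: by
   continuity, the angles at which the norm falls into the gap form an open set.\<close>
 have "AE w in N |*| N. ALL r::rat. L1_path ka (rot (of_rat r)) w ~: {x1<..<x2}"
  unfolding AE_all_countable using gapr by auto
 moreover have "AE w in N |*| N. integrable ka (%th. G th (fst w))"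
  using L1_path_moments(1)[OF gp ka] by (intro AE_distrD[OF measurable_fst]) (simp only: distr_pair_fst)
 moreover have "AE w in N |*| N. integrable ka (%th. G th (snd w))"
  using L1_path_moments(1)[OF gp ka] by (intro AE_distrD[OF measurable_snd]) (simp only: snd_eq)
 ultimately have "AE w in N |*| N. ~ (?L (fst w) <= x1 & x2 < ?L (snd w))"
 proof eventually_elim
  case (elim w)
  show ?case
  proof
  assume *: "?L (fst w) <= x1 & x2 < ?L (snd w)"
  define g where "g ph = L1_path ka (rot ph) w" for ph
  have intr: "integrable ka (%th. rot ph th w)" for ph unfolding rot_def using elim by auto
  have lip: "abs (g a-g b) <= abs (cos a - cos b) * ?L (fst w)+abs (sin a-sin b) * ?L (snd w)" for a b
  proof -
  have "abs (g a-g b) = abs (\<integral>th. abs (rot a th w)-abs (rot b th w) \<partial>ka)"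
  unfolding g_def L1_path_def using intr by (subst lint_diff) auto
  also have "... <= (LINT th|ka. abs (abs (rot a th w)-abs (rot b th w)))" by (rule integral_abs_bound)
  also have "... <= (LINT th|ka. abs (cos a - cos b)*abs (G th (fst w))+abs (sin a-sin b)*abs (G th (snd w)))"
  proof (rule integral_mono)
  show "integrable ka (%th. abs (abs (rot a th w)-abs (rot b th w)))" using intr by auto
  show "integrable ka (%th. abs (cos a - cos b)*abs (G th (fst w))+abs (sin a-sin b)*abs (G th (snd w)))" using elim by auto
  fix th
  have "abs (abs (rot a th w)-abs (rot b th w)) <= abs (rot a th w-rot b th w)" by (rule abs_triangle_ineq3)
  also have "rot a th w-rot b th w = (cos a - cos b)*G th (fst w)+(sin a-sin b)*G th (snd w)"
  unfolding rot_def by (simp add: algebra_simps)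
  also have "abs ... <= abs ((cos a - cos b)*G th (fst w))+abs ((sin a-sin b)*G th (snd w))" by (rule abs_triangle_ineq)
  finally show "abs (abs (rot a th w)-abs (rot b th w)) <= abs (cos a - cos b)*abs (G th (fst w))+abs (sin a-sin b)*abs (G th (snd w))"
  by (simp add: abs_mult)
  qed
  also have "... = abs (cos a - cos b) * ?L (fst w)+abs (sin a-sin b) * ?L (snd w)"
  unfolding L1_path_def using elim by (subst lint_add) auto
  finally show ?thesis .
  qed
  have cont: "isCont g a" for a
  proof -
  have "((%b. abs (cos b - cos a) * ?L (fst w)+abs (sin b-sin a) * ?L (snd w)) ---> abs (cos a - cos a) * ?L (fst w)+abs (sin a-sin a) * ?L (snd w)) (at a)"
  by (intro tendsto_intros)
  then have "((%b. abs (cos b - cos a) * ?L (fst w)+abs (sin b-sin a) * ?L (snd w)) ---> 0) (at a)" by simp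
  then have "((%b. g b-g a) ---> 0) (at a)" by (rule Lim_null_comparison[rotated]) (use lip in auto)
  then show ?thesis by (simp add: isCont_def LIM_zero_iff)
  qed
  have g0: "g 0 = ?L (fst w)" "g (pi/2) = ?L (snd w)" by (auto simp: g_def L1_path_def rot_def)
  have "EX ph>=0. ph <= pi/2 & g ph = (x1+x2)/2"
  by (rule IVT) (use * g0 x cont in auto)
  then obtain ph where ph: "g ph = (x1+x2)/2" by auto
  have "open (g -` {x1<..<x2})" using cont by (intro open_vimage continuous_at_imp_continuous_on) auto
  moreover have "ph : g -` {x1<..<x2}" using ph x by auto
  ultimately obtain e where e: "0 < e" "ball ph e <= g -` {x1<..<x2}" by (meson open_contains_ball)
  obtain r where "ph < of_rat r" "of_rat r < ph + e" using of_rat_dense[of ph "ph + e"] e by auto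
  then have "of_rat r : ball ph e" by (auto simp: dist_real_def)
  then have "g (of_rat r) : {x1<..<x2}" using e by auto
  then show False using elim(1) by (auto simp: g_def)
  qed
 qed
 then have "NN.P.prob {w : space (N |*| N). ?L (fst w) <= x1 & x2 < ?L (snd w)} = 0"
  by (subst (asm) AE_iff_measurable[OF _ refl]) (auto simp: NN.P.emeasure_eq_measure)
 moreover have "{w : space (N |*| N). ?L (fst w) <= x1 & x2 < ?L (snd w)} =
  {w : space N. ?L w <= x1} \<times> {w : space N. x2 < ?L w}" by (auto simp: space_pair_measure)
 \<comment> \<open>The event is a rectangle, so its measure is a product, whose two factors are
   positive by \<open>lo\<close> and \<open>hi\<close>.\<close>
 ultimately have "prob {w : space N. ?L w <= x1}*prob {w : space N. x2 < ?L w} = 0"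
  by (simp add: measure_def emeasure_pair_measure_Times enn2real_mult)
 moreover have "prob {w : space N. ?L w <= x1} = cdf ?D x1"
  unfolding cdf_def by (subst measure_distr) (auto intro!: arg_cong[where f = prob])
 moreover have "prob {w : space N. x2 < ?L w} = 1 - cdf ?D x2"
 proof -
  have "prob {w : space N. ~ ?L w <= x2} = 1-prob {w : space N. ?L w <= x2}" by (rule prob_neg) measurable
  moreover have "prob {w : space N. ?L w <= x2} = cdf ?D x2"
  unfolding cdf_def by (subst measure_distr) (auto intro!: arg_cong[where f = prob])
  ultimately show ?thesis by (simp add: not_le)
 qed
 ultimately show False using lo hi by simp
qed

end

section \<open>Convergence of quantiles\<close>

lemma quantile_tendsto:
 fixes D :: "nat => real measure" and D0 :: "real measure"
 assumes D: "!!n. real_distribution (D n)" "real_distribution D0" and conv: "weak_conv_m D D0"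
  and nogap: "!!x1 x2. x1 < x2 ==> 0 < cdf D0 x1 ==> cdf D0 x2 < 1 ==> cdf D0 x1 < cdf D0 x2"
  and a: "a ----> a0" "0 < a0" "a0 < 1"
 shows "(%n. Inf {x. a n <= cdf (D n) x}) ----> Inf {x. a0 <= cdf D0 x}"
proof -
 interpret D0: real_distribution D0 by fact
 have Inf_lower: "Inf {x. b <= cdf E x} <= y" if "real_distribution E" "b <= cdf E y" "0 < b" for b y E
 proof (rule cInf_lower)
  interpret E: real_distribution E by fact
  have "\<forall>\<^sub>F x in at_bot. cdf E x < b" using order_tendstoD(2)[OF E.cdf_lim_at_bot \<open>0 < b\<close>] .
  then obtain x0 where "!!x. x <= x0 ==> cdf E x < b" by (auto simp: eventually_at_bot_linorder)
  then show "bdd_below {x. b <= cdf E x}" by (intro bdd_belowI[of _ x0]) (meson linorder_not_le mem_Collect_eq nle_le)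
 qed (use that in auto)
 have Inf_upper: "y <= Inf {x. b <= cdf E x}" if "real_distribution E" "cdf E y < b" "b < 1" for b y E
 proof (rule cInf_greatest)
  interpret E: real_distribution E by fact
  have "\<forall>\<^sub>F x in at_top. b < cdf E x" using order_tendstoD(1)[OF E.cdf_lim_at_top_prob \<open>b < 1\<close>] .
  then obtain x0 where "b < cdf E x0" by (auto simp: eventually_at_top_linorder)
  then show "{x. b <= cdf E x} ~= {}" by (auto intro: less_imp_le)
  fix x assume "x : {x. b <= cdf E x}"
  then show "y <= x" using that(2) E.cdf_nondecreasing[of x y] by (cases "y <= x") auto
 qed
 let ?q = "Inf {x. a0 <= cdf D0 x}"
 \<comment> \<open>For levels outside (0, 1) the set in the quantile may be unbounded below or
   empty, and its infimum would be meaningless.\<close>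
 have ev: "\<forall>\<^sub>F n in sequentially. 0 < a n & a n < 1"
  using order_tendstoD[OF a(1)] a(2,3) by (auto intro: eventually_conj)
 have cp: "EX y:{u<..<w}. isCont (cdf D0) y" if "u < w" for u w
 proof -
  have "countable {x. ~ isCont (cdf D0) x}" using D0.countable_atoms by (simp add: D0.isCont_cdf zero_less_measure_iff)
  then have "~ {u<..<w} <= {x. ~ isCont (cdf D0) x}"
  using uncountable_open_interval[of u w] that countable_subset by blast
  then show ?thesis by auto
 qed
 have cc: "(%n. cdf (D n) y) ----> cdf D0 y" if "isCont (cdf D0) y" for y
  using conv that unfolding weak_conv_m_def weak_conv_def by auto
 show ?thesis
 proof (rule order_tendstoI)
  fix u assume u: "u < ?q"
  obtain y where y: "u < y" "y < ?q" "isCont (cdf D0) y" using cp[OF u] by auto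
  have "cdf D0 y < a0" using Inf_lower[OF D(2), of a0 y] a y by (force simp: not_le[symmetric])
  then have "\<forall>\<^sub>F n in sequentially. cdf (D n) y < a n"
  proof -
  have "(%n. a n - cdf (D n) y) ----> a0 - cdf D0 y" by (intro tendsto_intros a cc y)
  from order_tendstoD(1)[OF this, of 0] \<open>cdf D0 y < a0\<close> show ?thesis by simp
  qed
  with ev show "\<forall>\<^sub>F n in sequentially. u < Inf {x. a n <= cdf (D n) x}"
  by eventually_elim (use Inf_upper[OF D(1)] y in \<open>blast intro: less_le_trans\<close>)
 next
  fix u assume u: "?q < u"
  obtain y where y: "?q < y" "y < u" "isCont (cdf D0) y" using cp[OF u] by auto
  obtain z where z: "?q < z" "z < y" using dense y by blast
  have az: "a0 <= cdf D0 z" using Inf_upper[OF D(2), of z a0] a z by force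
  have "a0 < cdf D0 y"
  proof (cases "cdf D0 y < 1")
  case True then have "cdf D0 z < cdf D0 y" using nogap[OF z(2)] az a by simp
  then show ?thesis using az by simp
  qed (use a in simp)
  then have "\<forall>\<^sub>F n in sequentially. a n < cdf (D n) y"
  proof -
  have "(%n. cdf (D n) y-a n) ----> cdf D0 y-a0" by (intro tendsto_intros a cc y)
  from order_tendstoD(1)[OF this, of 0] \<open>a0 < cdf D0 y\<close> show ?thesis by simp
  qed
  with ev show "\<forall>\<^sub>F n in sequentially. Inf {x. a n <= cdf (D n) x} < u"
  proof eventually_elim
  case (elim n)
  then have "Inf {x. a n <= cdf (D n) x} <= y" by (intro Inf_lower[OF D(1)]) auto
  then show ?case using y by simp
  qed
 qed
qed

section \<open>Wiener integrals\<close>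

text \<open>Norm bounds rather than norms: estimates compose by adding constants, and a function
  stays a function instead of a class, so pointwise constructions remain available.\<close>

definition l2_le :: "'a measure => ('a => real) => real => bool" where
 "l2_le M f c \<longleftrightarrow> f : meas M & 0 <= c & integrable M (%x. (f x)^2) & (LINT x|M. (f x)^2) <= c^2"

lemma l2_leD:
 assumes "l2_le M f c"
 shows "f : meas M" "0 <= c" "integrable M (%x. (f x)^2)" "(LINT x|M. (f x)^2) <= c^2"
  "(nn_integral M (%x. ennreal ((f x)^2))) <= ennreal (c^2)"
 using assms unfolding l2_le_def by (auto simp: nn_integral_eq_integral intro: ennreal_leI)

lemma l2_leI_nn:
 assumes "f : meas M" "0 <= c" "(nn_integral M (%x. ennreal ((f x)^2))) <= ennreal (c^2)"
 shows "l2_le M f c"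
proof -
 have i: "integrable M (%x. (f x)^2)"
  by (rule integrableI_bounded) (use assms in \<open>auto intro: le_less_trans\<close>)
 then show ?thesis using assms unfolding l2_le_def by (simp add: nn_integral_eq_integral)
qed

lemma l2_le_mono: "l2_le M f c ==> c <= d ==> l2_le M f d"
 unfolding l2_le_def by (auto intro: order_trans[OF _ power_mono])

lemma ennreal_le_of_square_le:
 assumes "(x :: ennreal)^2 <= (ennreal c)^2" "0 <= c"
 shows "x <= ennreal c"
proof (cases x)
 case (real r)
 then have "r^2 <= c^2" using assms by (simp add: ennreal_power)
 then have "r <= c" by (rule power2_le_imp_le) fact
 then show ?thesis using real by (simp add: ennreal_leI)
next
 case top
 then have "x^2 = top" by (simp add: power2_eq_square ennreal_mult_top)
 moreover have "(ennreal c)^2 < top" using assms(2) by (simp add: ennreal_power)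
 ultimately show ?thesis using assms(1) by simp
qed

lemma nn_integral_mult_le:
 assumes "l2_le M f a" "l2_le M g b"
 shows "(nn_integral M (%x. ennreal (abs (f x*g x)))) <= ennreal (a*b)"
proof (rule ennreal_le_of_square_le)
 note m = l2_leD(1)[OF assms(1)] l2_leD(1)[OF assms(2)]
 have sq: "(ennreal (abs y))^2 = ennreal (y^2)" for y by (simp add: ennreal_power)
 have "(nn_integral M (%x. ennreal (abs (f x*g x))))^2 = (nn_integral M (%x. ennreal (abs (f x))*ennreal (abs (g x))))^2"
  by (simp add: abs_mult ennreal_mult)
 also have "... <= (nn_integral M (%x. (ennreal (abs (f x)))^2))*(nn_integral M (%x. (ennreal (abs (g x)))^2))"
  using m by (intro Cauchy_Schwarz_nn_integral) auto
 also have "... <= ennreal (a^2)*ennreal (b^2)"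
  unfolding sq by (intro mult_mono l2_leD(5) assms) auto
 also have "... = (ennreal (a*b))^2" using l2_leD(2)[OF assms(1)] l2_leD(2)[OF assms(2)] by (simp add: ennreal_mult[symmetric] ennreal_power power_mult_distrib)
 finally show "(nn_integral M (%x. ennreal (abs (f x*g x))))^2 <= (ennreal (a*b))^2" .
 show "0 <= a*b" using l2_leD(2)[OF assms(1)] l2_leD(2)[OF assms(2)] by simp
qed

lemma l2_le_inner:
 assumes "l2_le M f a" "l2_le M g b"
 shows "integrable M (%x. f x*g x)" "abs (\<integral>x. f x*g x \<partial>M) <= a*b"
proof -
 note m = l2_leD(1)[OF assms(1)] l2_leD(1)[OF assms(2)]
 have ab: "0 <= a*b" using l2_leD(2)[OF assms(1)] l2_leD(2)[OF assms(2)] by simp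
 show i: "integrable M (%x. f x*g x)"
  by (rule integrableI_bounded) (use m nn_integral_mult_le[OF assms] in \<open>auto intro: le_less_trans\<close>)
 have "abs (\<integral>x. f x*g x \<partial>M) <= (LINT x|M. abs (f x*g x))" by (rule integral_abs_bound)
 also have "... <= a*b"
  using nn_integral_mult_le[OF assms] i ab by (subst (asm) nn_integral_eq_integral) auto
 finally show "abs (\<integral>x. f x*g x \<partial>M) <= a*b" .
qed

lemma l2_le_add:
 assumes "l2_le M f a" "l2_le M g b"
 shows "l2_le M (%x. f x+g x) (a+b)"
proof -
 note m = l2_leD(1)[OF assms(1)] l2_leD(1)[OF assms(2)]
 note i = l2_leD(3)[OF assms(1)] l2_leD(3)[OF assms(2)] l2_le_inner[OF assms]
 have eq: "(f x+g x)^2 = (f x)^2+(g x)^2+2*(f x*g x)" for x by (simp add: power2_sum)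
 have int: "integrable M (%x. (f x)^2+(g x)^2+2*(f x*g x))" using i by auto
 have "(LINT x|M. (f x)^2+(g x)^2+2*(f x*g x)) = (LINT x|M. (f x)^2)+(LINT x|M. (g x)^2)+2*(LINT x|M. f x*g x)"
  using i by simp
 also have "... <= a^2+b^2+2*(a*b)" using l2_leD(4)[OF assms(1)] l2_leD(4)[OF assms(2)] i(4) by linarith
 finally show ?thesis unfolding l2_le_def eq using int m l2_leD(2)[OF assms(1)] l2_leD(2)[OF assms(2)] by (simp add: power2_sum)
qed

lemma l2_le_mult:
 assumes "l2_le M f a"
 shows "l2_le M (%x. c*f x) (abs c*a)"
 using assms unfolding l2_le_def by (auto simp: power_mult_distrib intro: mult_left_mono)

lemma l2_le_diff:
 assumes "l2_le M f a" "l2_le M g b"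
 shows "l2_le M (%x. f x-g x) (a+b)"
 using l2_le_add[OF assms(1) l2_le_mult[OF assms(2), of "-1"]] by simp

lemma l2_le_zero: "l2_le M (%x. 0) 0"
 by (simp add: l2_le_def)

lemma l2_le_sum:
 assumes "finite I" "!!i. i : I ==> l2_le M (f i) (a i)"
 shows "l2_le M (%x. \<Sum>i\<in>I. f i x) (\<Sum>i\<in>I. a i)"
 using assms by (induction I rule: finite_induct) (auto intro: l2_le_zero l2_le_add)

text \<open>Minkowski's inequality for integrals: the square of the inner integral is a double
  integral over \<open>muv\<close>, and Cauchy-Schwarz applies to each pair of parameters. The
  result is finite, so the inner integral converges absolutely almost everywhere, and pairings with
  \<open>g\<close> may be computed by Fubini.\<close>

lemma l2_le_integral:
 fixes f :: "'s => 'a => real"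
 assumes muv: "sigma_finite_measure muv" and M: "sigma_finite_measure M"
  and f: "(%(s, x). f s x) : meas (muv |*| M)"
  and b: "!!s. s : space muv ==> l2_le M (f s) (b s)" "integrable muv b"
 shows "l2_le M (%x. (LINT s|muv. f s x)) (LINT s|muv. b s)"
  and "l2_le M g c ==> (LINT x|M. (LINT s|muv. f s x)*g x) = (LINT s|muv. (LINT x|M. f s x*g x))"
  and "AE x in M. integrable muv (%s. f s x)"
proof -
 interpret muv: sigma_finite_measure muv by fact
 interpret M: sigma_finite_measure M by fact
 interpret P: pair_sigma_finite muv M ..
 interpret Q: pair_sigma_finite M muv ..
 interpret PP: pair_sigma_finite muv muv ..
 interpret R: pair_sigma_finite "muv |*| muv" M ..
 note f[measurable]
 have f': "(%(x, s). f s x) : meas (M |*| muv)" by measurable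
 have fs: "(%s. f s x) : meas muv" if "x : space M" for x using measurable_Pair1[OF f that] by simp
 have b0: "0 <= b s" if "s : space muv" for s using l2_leD(2)[OF b(1)[OF that]] .
 define B where "B = (LINT s|muv. b s)"
 have B: "0 <= B" "(nn_integral muv (%s. ennreal (b s))) = ennreal B"
  unfolding B_def using b0 b(2) by (auto intro!: integral_nonneg_AE nn_integral_eq_integral)
 have bm[measurable]: "b : meas muv" using b(2) by auto
 let ?h = "%x. (nn_integral muv (%s. ennreal (abs (f s x))))"
 have hm[measurable]: "?h : meas M"
 proof -
  have "(%(x, s). ennreal (abs (f s x))) : meas (M |*| muv)" using f' by measurable
  then show ?thesis by (rule muv.borel_measurable_nn_integral)
 qed
 have "(nn_integral M (%x. (?h x)^2)) = (nn_integral M (%x. (nn_integral muv (%s. (nn_integral muv (%t. ennreal (abs (f s x*f t x))))))))"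
 proof (rule nn_integral_cong)
  fix x assume x: "x : space M"
  note [measurable] = fs[OF x]
  have "(?h x)^2 = (nn_integral muv (%s. ennreal (abs (f s x)) * ?h x))"
  by (subst nn_integral_multc) (auto simp: power2_eq_square)
  also have "... = (nn_integral muv (%s. (nn_integral muv (%t. ennreal (abs (f s x*f t x))))))"
  by (intro nn_integral_cong, subst nn_integral_cmult[symmetric]) (auto simp: abs_mult ennreal_mult)
  finally show "(?h x)^2 = (nn_integral muv (%s. (nn_integral muv (%t. ennreal (abs (f s x*f t x))))))" .
 qed
 also have "... = (nn_integral M (%x. (nn_integral (muv |*| muv) (%st. ennreal (abs (f (fst st) x*f (snd st) x))))))"
 proof (rule nn_integral_cong)
  fix x assume x: "x : space M"
  note [measurable] = fs[OF x]
  show "(nn_integral muv (%s. (nn_integral muv (%t. ennreal (abs (f s x*f t x)))))) = (nn_integral (muv |*| muv) (%st. ennreal (abs (f (fst st) x*f (snd st) x))))"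
  by (subst muv.nn_integral_fst[symmetric]) auto
 qed
 also have "... = (nn_integral (muv |*| muv) (%st. (nn_integral M (%x. ennreal (abs (f (fst st) x*f (snd st) x))))))"
 proof (rule R.Fubini')
  have 1: "(%z. f (fst (fst z)) (snd z)) : meas ((muv |*| muv) |*| M)"
  using mcomp[OF _ f, of "%z. (fst (fst z), snd z)" "(muv |*| muv) |*| M"] by simp
  have 2: "(%z. f (snd (fst z)) (snd z)) : meas ((muv |*| muv) |*| M)"
  using mcomp[OF _ f, of "%z. (snd (fst z), snd z)" "(muv |*| muv) |*| M"] by simp
  show "(%(st, x). ennreal (abs (f (fst st) x*f (snd st) x))) : meas ((muv |*| muv) |*| M)"
  using 1 2 by (simp add: split_beta')
 qed
 also have "... <= (nn_integral (muv |*| muv) (%st. ennreal (b (fst st))*ennreal (b (snd st))))"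
  by (intro nn_integral_mono) (auto simp: space_pair_measure b0 ennreal_mult[symmetric] intro!: nn_integral_mult_le b(1))
 also have "... = (nn_integral muv (%s. (nn_integral muv (%t. ennreal (b s)*ennreal (b t)))))"
  by (subst muv.nn_integral_fst[symmetric]) auto
 also have "... = ennreal (B^2)"
  by (simp add: nn_integral_cmult nn_integral_multc B power2_eq_square ennreal_mult)
 finally have main: "(nn_integral M (%x. (?h x)^2)) <= ennreal (B^2)" .
 then have "(nn_integral M (%x. (?h x)^2)) ~= \<infinity>" by (auto simp: top_unique)
 then have "AE x in M. (?h x)^2 ~= \<infinity>" by (intro nn_integral_noteq_infinite) auto
 then have hfin: "AE x in M. ?h x < \<infinity>"
  by (rule AE_mp) (auto simp: less_top[symmetric] power2_eq_square ennreal_mult_eq_top_iff)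
 show aei: "AE x in M. integrable muv (%s. f s x)"
  using hfin AE_space by eventually_elim (auto simp: integrable_iff_bounded fs)
 have Fm[measurable]: "(%x. (LINT s|muv. f s x)) : meas M"
  using f' by (rule muv.borel_measurable_lebesgue_integral)
 show "l2_le M (%x. (LINT s|muv. f s x)) (LINT s|muv. b s)"
 proof (rule l2_leI_nn)
  have "(nn_integral M (%x. ennreal ((LINT s|muv. f s x)^2))) <= (nn_integral M (%x. (?h x)^2))"
  proof (rule nn_integral_mono_AE, use aei AE_space in eventually_elim)
  fix x assume x: "integrable muv (%s. f s x)" "x : space M"
  have "ennreal (abs (\<integral>s. f s x \<partial>muv)) <= ennreal (LINT s|muv. abs (f s x))" by (intro ennreal_leI integral_abs_bound)
  also have "... = ?h x" using x by (subst nn_integral_eq_integral) auto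
  finally have "(ennreal (abs (\<integral>s. f s x \<partial>muv)))^2 <= (?h x)^2" by (intro power_mono) auto
  then show "ennreal ((LINT s|muv. f s x)^2) <= (?h x)^2" by (simp add: ennreal_power)
  qed
  then show "(nn_integral M (%x. ennreal ((LINT s|muv. f s x)^2))) <= ennreal ((LINT s|muv. b s)^2)"
  using main unfolding B_def by (rule order_trans)
 qed (use B in \<open>auto simp: B_def\<close>)
 assume g: "l2_le M g c"
 have gm[measurable]: "g : meas M" using l2_leD(1)[OF g] .
 have int: "integrable (muv |*| M) (%(s, x). f s x*g x)"
 proof (rule integrableI_bounded)
  have "(nn_integral (muv |*| M) (%z. ennreal (norm (case z of (s, x) => f s x*g x)))) = (nn_integral muv (%s. (nn_integral M (%x. ennreal (abs (f s x*g x))))))"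
  by (subst M.nn_integral_fst[symmetric]) auto
  also have "... <= (nn_integral muv (%s. ennreal (b s * c)))"
  by (intro nn_integral_mono nn_integral_mult_le b(1) g)
  also have "... < \<infinity>" using B(2) l2_leD(2)[OF g] b0
  by (subst nn_integral_cong[of _ _ "%s. ennreal (b s)*ennreal c"]) (auto simp: ennreal_mult nn_integral_multc ennreal_mult_less_top)
  finally show "(nn_integral (muv |*| M) (%z. ennreal (norm (case z of (s, x) => f s x*g x)))) < \<infinity>" .
 qed measurable
 have "(LINT x|M. (LINT s|muv. f s x)*g x) = (LINT x|M. (LINT s|muv. f s x*g x))" by simp
 also have "... = (LINT s|muv. (LINT x|M. f s x*g x))" by (rule P.Fubini_integral[OF int])
 finally show "(LINT x|M. (LINT s|muv. f s x)*g x) = (LINT s|muv. (LINT x|M. f s x*g x))" .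
qed

section \<open>Gaussian noise and Wiener integrals\<close>

text \<open>A degenerate Gaussian variable has no density, hence the case distinction; the other
  case reduces to the standard normal law by scaling.\<close>

lemma gaussian_rv_facts:
 assumes N: "prob_space N" and Y: "gaussian_rv N Y"
 shows "Y : meas N" "integrable N (%om. (Y om)^2)"
  "(LINT om|N. Y om) = 0 ==> (CLINT om|N. iexp (Y om)) = complex_of_real (exp (- (LINT om|N. (Y om)^2)/2))"
proof -
 interpret prob_space N by fact
 show m: "Y : meas N" using Y by (simp add: gaussian_rv_def)
 have *: "integrable N (%om. (Y om)^2) & ((LINT om|N. Y om) = 0 -->
  (CLINT om|N. iexp (Y om)) = complex_of_real (exp (- (LINT om|N. (Y om)^2)/2)))"
 proof (cases "EX c. AE om in N. Y om = c")
  case True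
  then obtain c where c: "AE om in N. Y om = c" by auto
  have "integrable N (%om. (Y om)^2) \<longleftrightarrow> integrable N (%om. c^2)"
  using m c by (intro integrable_cong_AE) auto
  moreover have "(LINT om|N. (Y om)^2) = (LINT om|N. c^2)" using m c by (intro integral_cong_AE) auto
  moreover have "(LINT om|N. Y om) = (LINT om|N. c)" using m c by (intro integral_cong_AE) auto
  moreover have "(CLINT om|N. iexp (Y om)) = (CLINT om|N. iexp c)"
  using m c by (intro integral_cong_AE) auto
  ultimately show ?thesis by (simp add: prob_space)
 next
  case False
  then obtain c s where s: "0 < s" and d: "distributed N lborel Y (normal_density c s)"
  using Y unfolding gaussian_rv_def by auto
  have e: "expectation Y = c" using normal_distributed_expectation[OF s d] .
  have v: "variance Y = s^2" using normal_distributed_variance[OF s d] .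
  have "intb (%x. normal_density c s x*(x - c)^2)" by (rule integrable_normal_moment[OF s])
  then have i1: "integrable N (%om. (Y om - c)^2)"
  by (subst (asm) distributed_integrable[OF d]) (auto simp: normal_density_nonneg)
  have "intb (%x. normal_density c s x*(x - c)^1)" by (rule integrable_normal_moment[OF s])
  then have i2: "integrable N (%om. (Y om - c))"
  by (subst (asm) distributed_integrable[OF d]) (auto simp: normal_density_nonneg)
  have "integrable N (%om. (Y om - c)^2+2 * c*(Y om - c) + c^2)" using i1 i2 by auto
  moreover have "(Y om - c)^2+2 * c*(Y om - c) + c^2 = (Y om)^2" for om by (simp add: power2_eq_square algebra_simps)
  ultimately have i: "integrable N (%om. (Y om)^2)" by simp
  have "(CLINT om|N. iexp (Y om)) = complex_of_real (exp (- (LINT om|N. (Y om)^2)/2))" if "(LINT om|N. Y om) = 0"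
  proof -
  have c0: "c = 0" using e that by simp
  have var: "(LINT om|N. (Y om)^2) = s^2" using v that by simp
  have "distributed N lborel (%x. (Y x - c)/s) std_normal_density"
  using normal_standard_normal_convert[OF s] d by auto
  then have dd: "distr N lborel (%x. Y x/s) = std_normal_distribution"
  by (simp add: c0 distributed_distr_eq_density)
  have "(CLINT om|N. iexp (Y om)) = (CLINT om|N. iexp (s*(Y om / s)))" using s by simp
  also have "... = (CLINT x|distr N lborel (%x. Y x/s). iexp (s*x))"
  using m by (subst integral_distr) auto
  also have "... = char std_normal_distribution s" unfolding dd char_def ..
  also have "... = complex_of_real (exp (- (LINT om|N. (Y om)^2)/2))" by (simp add: char_std_normal_distribution var)
  finally show ?thesis .
  qed
  then show ?thesis using i by simp
 qed
 show "integrable N (%om. (Y om)^2)" using * by simp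
 show "(LINT om|N. Y om) = 0 ==> (CLINT om|N. iexp (Y om)) = complex_of_real (exp (- (LINT om|N. (Y om)^2)/2))" using * by simp
qed

definition fin_sets :: "'x measure => 'x set set" where
 "fin_sets La = {C : sets La. emeasure La C < top}"

lemma l2_le_indicator:
 assumes "C : fin_sets La"
 shows "l2_le La (indicator C) (sqrt (measure La C))" "integrable La (indicator C :: _ => real)"
proof -
 have sq: "(indicator C x :: real)^2 = indicator C x" for x by (simp add: indicator_def)
 show "integrable La (indicator C :: _ => real)" using assms by (auto simp: fin_sets_def)
 then show "l2_le La (indicator C) (sqrt (measure La C))"
  using assms unfolding l2_le_def sq by (auto simp: fin_sets_def)
qed

text \<open>The approximating simple functions satisfy |F| <= 2|h|. This gives |h - F| <= 3|h|,
  hence the dominating function 9 h^2, and makes the level set of a nonzero value a set of finite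
  measure by Chebyshev.\<close>

lemma l2_simple_approx:
 assumes h: "l2_le La h c" and e: "0 < e"
 obtains S a where "finite S" "S <= fin_sets La" "(LINT x|La. (h x-(\<Sum>C\<in>S. a C*indicator C x))^2) < e"
proof -
 note hm = l2_leD(1)[OF h] and hi = l2_leD(3)[OF h]
 obtain F where F: "!!i. simple_function La (F i)" "!!x. x : space La ==> (%i. F i x) ----> h x"
  "!!i x. x : space La ==> dist (F i x) 0 <= 2*dist (h x) 0"
  using borel_measurable_implies_sequence_metric[OF hm, of 0] by blast
 have Fm: "F i : meas La" for i by (rule borel_measurable_simple_function[OF F(1)])
 have "(%i. (LINT x|La. (h x-F i x)^2)) ----> (LINT x|La. 0)"
 proof (rule integral_dominated_convergence[where w = "%x. 9*(h x)^2"])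
  show "integrable La (%x. 9*(h x)^2)" using hi by simp
  show "AE x in La. (%i. (h x-F i x)^2) ----> 0"
  proof (rule AE_I2)
  fix x assume "x : space La"
  then have "(%i. (h x-F i x)^2) ----> (h x-h x)^2" by (intro tendsto_intros F)
  then show "(%i. (h x-F i x)^2) ----> 0" by simp
  qed
  show "!!i. AE x in La. norm ((h x-F i x)^2) <= 9*(h x)^2"
  proof (rule AE_I2)
  fix i x assume "x : space La"
  then have "abs (h x-F i x) <= abs (3*h x)" using F(3)[of x i] by auto
  then have "(h x-F i x)^2 <= (3*h x)^2" by (simp only: abs_le_square_iff)
  then show "norm ((h x-F i x)^2) <= 9*(h x)^2" by (simp add: power_mult_distrib)
  qed
 qed (use hm Fm in auto)
 then have "\<forall>\<^sub>F i in sequentially. (LINT x|La. (h x-F i x)^2) < e" using e by (auto intro: order_tendstoD)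
 then obtain i where i: "(LINT x|La. (h x-F i x)^2) < e" using eventually_happens' sequentially_bot by blast
 define f where "f = F i"
 have fs: "simple_function La f" unfolding f_def by (rule F)
 \<comment> \<open>The value 0 is dropped because its level set may have infinite measure.\<close>
 define V where "V = f ` space La - {0}"
 define T where "T y = f -` {y} Int space La" for y
 have V: "finite V" unfolding V_def using simple_functionD(1)[OF fs] by auto
 \<comment> \<open>The noise is indexed by sets, so the sum has to run over level sets; as these are
   nonempty and disjoint, the coefficient is a function of the set.\<close>
 have inj: "inj_on T V" unfolding T_def V_def by (rule inj_onI) auto
 have Tm: "T y : sets La" for y unfolding T_def by (rule simple_functionD(2)[OF fs])
 have Tfin: "T y : fin_sets La" if "y : V" for y
 proof -
  have y: "y ~= 0" using that by (simp add: V_def)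
  have "emeasure La (T y) = (nn_integral La (%x. indicator (T y) x))" using Tm by simp
  also have "... <= (nn_integral La (%x. ennreal (4/y^2*(h x)^2)))"
  proof (rule nn_integral_mono)
  fix x assume x: "x : space La"
  show "indicator (T y) x <= ennreal (4/y^2*(h x)^2)"
  proof (cases "x : T y")
  case True
  then have "abs y <= abs (2*h x)" using F(3)[OF x, of i] by (auto simp: T_def f_def)
  then have "y^2 <= (2*h x)^2" by (simp only: abs_le_square_iff)
  then have "1 <= 4/y^2*(h x)^2" using y by (simp add: field_simps)
  then show ?thesis using True by (simp add: ennreal_leI flip: ennreal_1)
  qed simp
  qed
  also have "... < \<infinity>" using hi by (subst nn_integral_eq_integral) auto
  finally show ?thesis using Tm by (simp add: fin_sets_def)
 qed
 define a where "a C = the_inv_into V T C" for C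
 have eq: "f x = (\<Sum>C\<in>T ` V. a C*indicator C x)" if x: "x : space La" for x
 proof -
  have "(\<Sum>C\<in>T ` V. a C*indicator C x) = (\<Sum>y\<in>V. y*indicator (T y) x)"
  using inj by (subst sum.reindex[OF inj]) (auto intro!: sum.cong simp: a_def the_inv_into_f_f)
  also have "... = (\<Sum>y\<in>V. if y = f x then f x else 0)"
  using x by (intro sum.cong) (auto simp: T_def indicator_def)
  also have "... = f x" using V x by (auto simp: V_def)
  finally show ?thesis ..
 qed
 show ?thesis
 proof
  show "finite (T ` V)" using V by simp
  show "T ` V <= fin_sets La" using Tfin by auto
  have "(LINT x|La. (h x-(\<Sum>C\<in>T ` V. a C*indicator C x))^2) = (LINT x|La. (h x-F i x)^2)"
  by (intro lint_cong refl) (use eq in \<open>simp add: f_def\<close>)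
  then show "(LINT x|La. (h x-(\<Sum>C\<in>T ` V. a C*indicator C x))^2) < e" using i by simp
 qed
qed

text \<open>The second-order structure of \<open>wiener_process\<close>, with sigma-finiteness added
  for Fubini; tightness is kept apart until path regularity is at issue.\<close>

definition white_noise :: "'x measure => 'b measure => ('b => 'x set => real) => bool" where
 "white_noise La N W \<longleftrightarrow> prob_space N & sigma_finite_measure La &
  (ALL S a. finite S & S <= fin_sets La --> gaussian_rv N (%om. \<Sum>C\<in>S. a C*W om C)) &
  (ALL C:fin_sets La. (LINT om|N. W om C) = 0) &
  (ALL C:fin_sets La. ALL C':fin_sets La. (LINT om|N. W om C*W om C') = measure La (C Int C'))"

text \<open>No stochastic integral is constructed: that \<open>A\<close> is the Wiener integral of \<open>h\<close> is expressed by its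
 covariances with the process and by its variance.\<close>

definition wiener_int :: "'x measure => 'b measure => ('b => 'x set => real) => ('b => real) => ('x => real) => bool" where
 "wiener_int La N W A h \<longleftrightarrow>
  A : meas N & integrable N (%om. (A om)^2) &
  h : meas La & integrable La (%x. (h x)^2) &
  (ALL C:fin_sets La. (LINT om|N. A om * W om C) = (LINT x|La. h x*indicator C x)) &
  (LINT om|N. (A om)^2) = (LINT x|La. (h x)^2)"

context
 fixes La :: "'x measure" and N :: "'b measure" and W :: "'b => 'x set => real"
 assumes wn: "white_noise La N W"
begin

interpretation prob_space N using wn by (simp add: white_noise_def)

lemma wn_gauss: "finite S ==> S <= fin_sets La ==> gaussian_rv N (%om. \<Sum>C\<in>S. a C*W om C)"
 using wn by (simp add: white_noise_def)

lemma wn_l2: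
 assumes "C : fin_sets La"
 shows "l2_le N (%om. W om C) (sqrt (measure La C))"
proof -
 have g: "gaussian_rv N (%om. W om C)" using wn_gauss[of "{C}" "%_. 1"] assms by simp
 have "(LINT om|N. (W om C)^2) = measure La C"
  using wn assms unfolding white_noise_def power2_eq_square by (metis inf.idem)
 then show ?thesis using gaussian_rv_facts(1,2)[OF prob_space_axioms g] by (simp add: l2_le_def)
qed

lemma wiener_int_l2:
 assumes "wiener_int La N W A h"
 shows "l2_le N A (sqrt (LINT x|La. (h x)^2))" "l2_le La h (sqrt (LINT x|La. (h x)^2))"
  "l2_le La h c ==> l2_le N A c"
 using assms unfolding wiener_int_def l2_le_def by (auto simp: integral_nonneg_AE)

lemma wiener_int_sum:
 assumes S: "finite S" "S <= fin_sets La"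
 shows "wiener_int La N W (%om. \<Sum>C\<in>S. a C*W om C) (%x. \<Sum>C\<in>S. a C*indicator C x)"
proof -
 have c: "C : fin_sets La" if "C : S" for C using S that by auto
 have l1: "l2_le N (%om. \<Sum>C\<in>S. a C*W om C) (\<Sum>C\<in>S. abs (a C) * sqrt (measure La C))"
  by (intro l2_le_sum S l2_le_mult wn_l2 c)
 have l2: "l2_le La (%x. \<Sum>C\<in>S. a C*indicator C x) (\<Sum>C\<in>S. abs (a C) * sqrt (measure La C))"
  by (intro l2_le_sum S l2_le_mult l2_le_indicator c)
 have cov: "(LINT om|N. W om C*W om D) = (LINT x|La. indicator C x*indicator D x)" if "C : fin_sets La" "D : fin_sets La" for C D
 proof -
  have "(LINT x|La. indicator C x*(indicator D x :: real)) = (LINT x|La. indicator (C Int D) x)"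
  by (simp add: indicator_inter_arith)
  also have "... = measure La (C Int D)"
  proof -
  have "C Int D Int space La = C Int D" using that sets.sets_into_space[of C La] by (auto simp: fin_sets_def)
  then show ?thesis by simp
  qed
  finally show ?thesis using wn that unfolding white_noise_def by simp
 qed
 have pair: "(LINT om|N. (\<Sum>C\<in>S. a C*W om C)*W om D) = (LINT x|La. (\<Sum>C\<in>S. a C*indicator C x)*indicator D x)" if D: "D : fin_sets La" for D
 proof -
  have "(LINT om|N. (\<Sum>C\<in>S. a C*W om C)*W om D) = (LINT om|N. (\<Sum>C\<in>S. a C*(W om C*W om D)))" by (simp add: sum_distrib_right mult.assoc)
  also have "... = (\<Sum>C\<in>S. a C*(LINT om|N. W om C*W om D))"
  by (subst lint_sum) (auto intro!: l2_le_inner[OF wn_l2 wn_l2] c D)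
  also have "... = (\<Sum>C\<in>S. a C*(LINT x|La. indicator C x*indicator D x))"
  by (intro sum.cong refl) (simp add: cov c D)
  also have "... = (LINT x|La. (\<Sum>C\<in>S. a C*(indicator C x*indicator D x)))"
  by (subst lint_sum) (auto intro!: l2_le_inner[OF l2_le_indicator(1) l2_le_indicator(1)] c D)
  also have "... = (LINT x|La. (\<Sum>C\<in>S. a C*indicator C x)*indicator D x)" by (simp add: sum_distrib_right mult.assoc)
  finally show ?thesis .
 qed
 have "(LINT om|N. (\<Sum>C\<in>S. a C*W om C)^2) = (LINT om|N. (\<Sum>D\<in>S. a D*((\<Sum>C\<in>S. a C*W om C)*W om D)))"
  by (simp add: power2_eq_square sum_distrib_left ac_simps)
 also have "... = (\<Sum>D\<in>S. a D*(LINT om|N. (\<Sum>C\<in>S. a C*W om C)*W om D))"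
  by (subst lint_sum) (auto intro!: integrable_mult_right l2_le_inner[OF l1 wn_l2] c simp del: integrable_mult_right_iff)
 also have "... = (\<Sum>D\<in>S. a D*(LINT x|La. (\<Sum>C\<in>S. a C*indicator C x)*indicator D x))"
  by (intro sum.cong refl) (simp add: pair c)
 also have "... = (LINT x|La. (\<Sum>D\<in>S. a D*((\<Sum>C\<in>S. a C*indicator C x)*indicator D x)))"
  by (subst lint_sum) (auto intro!: integrable_mult_right l2_le_inner[OF l2 l2_le_indicator(1)] c simp del: integrable_mult_right_iff)
 also have "... = (LINT x|La. (\<Sum>C\<in>S. a C*indicator C x)^2)"
  by (simp add: power2_eq_square sum_distrib_left ac_simps)
 finally show ?thesis using l1 l2 pair unfolding wiener_int_def by (auto dest: l2_leD)
qed

lemma wiener_int_set: "C : fin_sets La ==> wiener_int La N W (%om. W om C) (indicator C)"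
 using wiener_int_sum[of "{C}" "%_. 1"] by simp

text \<open>Expanding the squares, the three terms of E(A - S)^2 agree with those of the integral of
  the squared difference of kernels: the cross term by the prescribed covariances, the other two by
  the variances. The same coefficients therefore approximate on both sides.\<close>

lemma wiener_int_approx:
 assumes A: "wiener_int La N W A h" and e: "0 < e"
 obtains S a where "finite S" "S <= fin_sets La"
  "l2_le N (%om. A om - (\<Sum>C\<in>S. a C*W om C)) e"
  "l2_le La (%x. h x-(\<Sum>C\<in>S. a C*indicator C x)) e"
proof -
 note l = wiener_int_l2(1,2)[OF A]
 obtain S a where S: "finite S" "S <= fin_sets La" and less: "(LINT x|La. (h x-(\<Sum>C\<in>S. a C*indicator C x))^2) < e^2"
  using l2_simple_approx[OF l(2), of "e^2"] e by auto
 have c: "C : fin_sets La" if "C : S" for C using S that by auto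
 let ?S = "%om. \<Sum>C\<in>S. a C*W om C" and ?h = "%x. \<Sum>C\<in>S. a C*indicator C x"
 note w = wiener_int_sum[OF S, of a]
 note k = wiener_int_l2(1,2)[OF w]
 have "(LINT om|N. A om * ?S om) = (LINT om|N. (\<Sum>C\<in>S. a C*(A om * W om C)))" by (simp add: sum_distrib_left ac_simps)
 also have "... = (\<Sum>C\<in>S. a C*(LINT om|N. A om * W om C))"
  by (subst lint_sum) (auto intro!: integrable_mult_right l2_le_inner[OF l(1) wn_l2] c simp del: integrable_mult_right_iff)
 also have "... = (\<Sum>C\<in>S. a C*(LINT x|La. h x*indicator C x))"
  using A by (intro sum.cong refl) (simp add: wiener_int_def c)
 also have "... = (LINT x|La. (\<Sum>C\<in>S. a C*(h x*indicator C x)))"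
  by (subst lint_sum) (auto intro!: integrable_mult_right l2_le_inner[OF l(2) l2_le_indicator(1)] c simp del: integrable_mult_right_iff)
 also have "... = (LINT x|La. h x * ?h x)" by (simp add: sum_distrib_left ac_simps)
 finally have cross: "(LINT om|N. A om * ?S om) = (LINT x|La. h x * ?h x)" .
 have sqe: "(x-y)^2 = x^2-2*(x*y)+y^2" for x y :: real by (simp add: power2_diff)
 have eqN: "(LINT om|N. (A om - ?S om)^2) = (LINT om|N. (A om)^2)-2*(LINT om|N. A om * ?S om)+(LINT om|N. (?S om)^2)"
  unfolding sqe using l2_leD(3)[OF l(1)] l2_leD(3)[OF k(1)] l2_le_inner(1)[OF l(1) k(1)]
  by (subst lint_add, simp_all add: lint_diff)
 have eqL: "(LINT x|La. (h x - ?h x)^2) = (LINT x|La. (h x)^2)-2*(LINT x|La. h x * ?h x)+(LINT x|La. (?h x)^2)"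
  unfolding sqe using l2_leD(3)[OF l(2)] l2_leD(3)[OF k(2)] l2_le_inner(1)[OF l(2) k(2)]
  by (subst lint_add, simp_all add: lint_diff)
 have "(LINT om|N. (A om - ?S om)^2) = (LINT x|La. (h x - ?h x)^2)"
  unfolding eqN eqL cross using A w by (simp add: wiener_int_def)
 then have "l2_le N (%om. A om - ?S om) e" "l2_le La (%x. h x - ?h x) e"
  using less e l2_le_diff[OF l(1) k(1)] l2_le_diff[OF l(2) k(2)] by (simp_all add: l2_le_def)
 with S show ?thesis by (rule that)
qed

text \<open>\<open>wiener_int\<close> prescribes covariances with the noise alone; approximating the
  second variable by finite combinations extends the isometry to all pairs.\<close>

lemma wiener_int_inner:
 assumes A: "wiener_int La N W A h" and B: "wiener_int La N W B k"
 shows "(LINT om|N. A om * B om) = (LINT x|La. h x * k x)"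
proof -
 note l = wiener_int_l2(1,2)[OF A] wiener_int_l2(1,2)[OF B]
 define c where "c = sqrt (LINT x|La. (h x)^2)"
 have c0: "0 <= c" unfolding c_def by (simp add: integral_nonneg_AE)
 have "abs ((LINT om|N. A om * B om)-(LINT x|La. h x * k x)) <= e" if e: "0 < e" for e
 proof -
  \<comment> \<open>Two error terms of size c d occur; adding 1 to \<open>c\<close> covers the case
    \<open>c = 0\<close>.\<close>
  define d where "d = e/(2*(c+1))"
  have d: "0 < d" "2*(c*d) <= e" using e c0 by (auto simp: d_def field_simps)
  obtain S a where S: "finite S" "S <= fin_sets La"
  and d1: "l2_le N (%om. B om - (\<Sum>C\<in>S. a C*W om C)) d"
  and d2: "l2_le La (%x. k x-(\<Sum>C\<in>S. a C*indicator C x)) d"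
  using wiener_int_approx[OF B d(1)] .
  let ?S = "%om. \<Sum>C\<in>S. a C*W om C" and ?h = "%x. \<Sum>C\<in>S. a C*indicator C x"
  have cc: "C : fin_sets La" if "C : S" for C using S that by auto
  note w = wiener_int_sum[OF S, of a]
  note sl = wiener_int_l2(1,2)[OF w]
  have "(LINT om|N. A om * ?S om) = (LINT om|N. (\<Sum>C\<in>S. a C*(A om * W om C)))" by (simp add: sum_distrib_left ac_simps)
  also have "... = (\<Sum>C\<in>S. a C*(LINT om|N. A om * W om C))"
  by (subst lint_sum) (auto intro!: integrable_mult_right l2_le_inner[OF l(1) wn_l2] cc simp del: integrable_mult_right_iff)
  also have "... = (\<Sum>C\<in>S. a C*(LINT x|La. h x*indicator C x))"
  using A by (intro sum.cong refl) (simp add: wiener_int_def cc)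
  also have "... = (LINT x|La. (\<Sum>C\<in>S. a C*(h x*indicator C x)))"
  by (subst lint_sum) (auto intro!: integrable_mult_right l2_le_inner[OF l(2) l2_le_indicator(1)] cc simp del: integrable_mult_right_iff)
  also have "... = (LINT x|La. h x * ?h x)" by (simp add: sum_distrib_left ac_simps)
  finally have cross: "(LINT om|N. A om * ?S om) = (LINT x|La. h x * ?h x)" .
  have 1: "abs (\<integral>om. A om * (B om - ?S om) \<partial>N) <= c*d" unfolding c_def by (rule l2_le_inner[OF l(1) d1])
  have 2: "abs (\<integral>x. h x*(k x - ?h x) \<partial>La) <= c*d" unfolding c_def by (rule l2_le_inner[OF l(2) d2])
  have 3: "(LINT om|N. A om * (B om - ?S om)) = (LINT om|N. A om * B om)-(LINT om|N. A om * ?S om)"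
  unfolding right_diff_distrib by (rule lint_diff[OF l2_le_inner(1)[OF l(1) l(3)] l2_le_inner(1)[OF l(1) sl(1)]])
  have 4: "(LINT x|La. h x*(k x - ?h x)) = (LINT x|La. h x * k x)-(LINT x|La. h x * ?h x)"
  unfolding right_diff_distrib by (rule lint_diff[OF l2_le_inner(1)[OF l(2) l(4)] l2_le_inner(1)[OF l(2) sl(2)]])
  show ?thesis using 1 2 3 4 cross d(2) by linarith
 qed
 then have "abs ((LINT om|N. A om * B om)-(LINT x|La. h x * k x)) <= 0" by (rule field_le_epsilon) simp
 then show ?thesis by simp
qed

lemma wiener_intI:
 assumes "l2_le N A c" "l2_le La h c'"
  and "!!C. C : fin_sets La ==> (LINT om|N. A om * W om C) = (LINT x|La. h x*indicator C x)"
  and "(LINT om|N. A om * A om) = (LINT x|La. h x*h x)"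
 shows "wiener_int La N W A h"
 using assms unfolding wiener_int_def l2_le_def by (auto simp: power2_eq_square)

lemma wiener_int_lin:
 assumes A: "wiener_int La N W A h" and B: "wiener_int La N W B k"
 shows "wiener_int La N W (%om. a*A om + b*B om) (%x. a*h x+b * k x)"
proof -
 note l = wiener_int_l2(1,2)[OF A] wiener_int_l2(1,2)[OF B]
 have lin: "(LINT om|N. (a*A om + b*B om)*D om) = (LINT x|La. (a*h x+b * k x)*d x)" if D: "wiener_int La N W D d" for D d
 proof -
  note ld = wiener_int_l2(1,2)[OF D]
  have "(LINT om|N. (a*A om + b*B om)*D om) = a*(LINT om|N. A om * D om)+b*(LINT om|N. B om * D om)"
  using l2_le_inner(1)[OF l(1) ld(1)] l2_le_inner(1)[OF l(3) ld(1)] by (simp add: distrib_right mult.assoc)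
  also have "... = (LINT x|La. (a*h x+b * k x)*d x)"
  unfolding wiener_int_inner[OF A D] wiener_int_inner[OF B D]
  using l2_le_inner(1)[OF l(2) ld(2)] l2_le_inner(1)[OF l(4) ld(2)] by (simp add: distrib_right mult.assoc)
  finally show ?thesis .
 qed
 have l1: "l2_le N (%om. a*A om + b*B om) (abs a * sqrt (LINT x|La. (h x)^2)+abs b * sqrt (LINT x|La. (k x)^2))"
  by (intro l2_le_add l2_le_mult l)
 have l2: "l2_le La (%x. a*h x+b * k x) (abs a * sqrt (LINT x|La. (h x)^2)+abs b * sqrt (LINT x|La. (k x)^2))"
  by (intro l2_le_add l2_le_mult l)
 have left: "(LINT om|N. D om * (a*A om + b*B om)) = (LINT x|La. d x*(a*h x+b * k x))" if "wiener_int La N W D d" for D d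
  using lin[OF that] by (simp add: mult.commute)
 show ?thesis
 proof (rule wiener_intI[OF l1 l2])
  show "(LINT om|N. (a*A om + b*B om)*W om C) = (LINT x|La. (a*h x+b * k x)*indicator C x)" if "C : fin_sets La" for C
  by (rule lin[OF wiener_int_set[OF that]])
  have "(LINT om|N. (a*A om + b*B om)*(a*A om + b*B om)) = a*(LINT om|N. A om * (a*A om + b*B om))+b*(LINT om|N. B om * (a*A om + b*B om))"
  using l2_le_inner(1)[OF l(1) l1] l2_le_inner(1)[OF l(3) l1]
  by (subst distrib_right, subst lint_add) (auto simp: mult.assoc)
  also have "... = (LINT x|La. (a*h x+b * k x)*(a*h x+b * k x))"
  proof -
  have "(LINT x|La. (a*h x+b * k x)*(a*h x+b * k x)) = a*(LINT x|La. h x*(a*h x+b * k x))+b*(LINT x|La. k x*(a*h x+b * k x))"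
  using l2_le_inner(1)[OF l(2) l2] l2_le_inner(1)[OF l(4) l2]
  by (subst distrib_right, subst lint_add) (auto simp: mult.assoc)
  then show ?thesis unfolding left[OF A] left[OF B] by (rule sym)
  qed
  finally show "(LINT om|N. (a*A om + b*B om)*(a*A om + b*B om)) = (LINT x|La. (a*h x+b * k x)*(a*h x+b * k x))" .
 qed
qed

lemma wiener_int_zero: "wiener_int La N W (%_. 0) (%_. 0)"
 by (simp add: wiener_int_def)

lemma wiener_int_finite_sum:
 assumes "finite I" "!!i. i : I ==> wiener_int La N W (A i) (h i)"
 shows "wiener_int La N W (%om. \<Sum>i\<in>I. b i*A i om) (%x. \<Sum>i\<in>I. b i*h i x)"
 using assms
proof (induction I rule: finite_induct)
 case (insert j I)
 then show ?case using wiener_int_lin[of "A j" "h j" "%om. \<Sum>i\<in>I. b i*A i om" "%x. \<Sum>i\<in>I. b i*h i x" "b j" 1] by simp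
qed (simp add: wiener_int_zero)

text \<open>A stochastic Fubini theorem. A Wiener integral is recognised by its covariances and its
  variance, so it suffices to exchange ordinary integrals in these.\<close>

lemma wiener_int_integral:
 assumes muv: "sigma_finite_measure muv"
  and A: "(%(s, om). A s om) : meas (muv |*| N)"
  and h: "(%(s, x). h s x) : meas (muv |*| La)"
  and Ah: "!!s. s : space muv ==> wiener_int La N W (A s) (h s)"
  and b: "!!s. s : space muv ==> l2_le La (h s) (b s)" "integrable muv b"
 shows "wiener_int La N W (%om. (LINT s|muv. A s om)) (%x. (LINT s|muv. h s x))"
  and "AE om in N. integrable muv (%s. A s om)"
proof -
 have sN: "sigma_finite_measure N" ..
 have sL: "sigma_finite_measure La" using wn by (simp add: white_noise_def)
 have bA: "l2_le N (A s) (b s)" if "s : space muv" for s using wiener_int_l2(3)[OF Ah b(1)] that by simp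
 note FA = l2_le_integral[OF muv sN A bA b(2)] and Fh = l2_le_integral[OF muv sL h b]
 have step: "(LINT om|N. (LINT s|muv. A s om)*D om) = (LINT x|La. (LINT s|muv. h s x)*d x)" if D: "wiener_int La N W D d" for D d
 proof -
  have "(LINT om|N. (LINT s|muv. A s om)*D om) = (LINT s|muv. (LINT om|N. A s om * D om))"
  by (rule FA(2)[OF _ wiener_int_l2(1)[OF D]])
  also have "... = (LINT s|muv. (LINT x|La. h s x*d x))"
  by (intro lint_cong refl wiener_int_inner Ah D)
  also have "... = (LINT x|La. (LINT s|muv. h s x)*d x)"
  by (rule Fh(2)[OF _ wiener_int_l2(2)[OF D], symmetric])
  finally show ?thesis .
 qed
 \<comment> \<open>The variance takes two passes: one of the two equal factors is opened as an
   integral while the other is kept as a fixed square integrable variable, and then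
   \<open>step\<close> is applied with \<open>A s\<close> as the fixed factor.\<close>
 have "(LINT om|N. (LINT s|muv. A s om)*(LINT s|muv. A s om)) = (LINT s|muv. (LINT om|N. A s om * (LINT s|muv. A s om)))"
  by (rule FA(2)[OF _ FA(1)])
 also have "... = (LINT s|muv. (LINT x|La. h s x*(LINT s|muv. h s x)))"
  by (intro lint_cong refl) (use step[OF Ah] in \<open>simp add: mult.commute\<close>)
 also have "... = (LINT x|La. (LINT s|muv. h s x)*(LINT s|muv. h s x))"
  by (rule Fh(2)[OF _ Fh(1), symmetric])
 finally show "wiener_int La N W (%om. (LINT s|muv. A s om)) (%x. (LINT s|muv. h s x))"
  by (intro wiener_intI[OF FA(1) Fh(1)] step[OF wiener_int_set]) auto
 show "AE om in N. integrable muv (%s. A s om)" by (rule FA(3))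
qed

text \<open>Gaussianity survives the L2 limit: exp (i A) is 1-Lipschitz in \<open>A\<close>, so the
  characteristic function and the standard deviation of an approximating finite combination are both
  within \<open>d\<close> of their limits.\<close>

lemma wiener_int_char:
 assumes A: "wiener_int La N W A h"
 shows "(CLINT om|N. exp (\<i> * complex_of_real (A om))) = complex_of_real (exp (- (\<integral>x. (h x)\<^sup>2 \<partial>La) / 2))"
proof -
 note l = wiener_int_l2(1,2)[OF A]
 have Am[measurable]: "A \<in> borel_measurable N" using A by (simp add: wiener_int_def)
 define c where "c = sqrt (\<integral>x. (h x)\<^sup>2 \<partial>La)"
 have c0: "0 \<le> c" and c2: "c\<^sup>2 = (\<integral>x. (h x)\<^sup>2 \<partial>La)" unfolding c_def by (auto simp: integral_nonneg_AE)
 let ?E = "CLINT om|N. exp (\<i> * complex_of_real (A om))"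
 have "cmod (?E - complex_of_real (exp (- c\<^sup>2 / 2))) \<le> e" if e: "0 < e" for e
 proof -
  \<comment> \<open>The total error is d + d(c + 1), which leaves one \<open>d\<close> of slack; d
    <= 1 is used to bound (s + c)/2 by c + 1.\<close>
  define d where "d = min 1 (e / (c + 3))"
  have "d \<le> e / (c + 3)" unfolding d_def by (rule min.cobounded2)
  then have "d * (c + 3) \<le> e" using c0 by (subst (asm) pos_le_divide_eq) auto
  moreover have "0 < d" "d \<le> 1" using e c0 by (auto simp: d_def)
  ultimately have d: "0 < d" "d \<le> 1" "d * (c + 3) \<le> e" by auto
  obtain S a where S: "finite S" "S \<subseteq> fin_sets La"
  and d1: "l2_le N (\<lambda>om. A om - (\<Sum>C\<in>S. a C * W om C)) d"
  and d2: "l2_le La (\<lambda>x. h x - (\<Sum>C\<in>S. a C * indicator C x)) d"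
  using wiener_int_approx[OF A d(1)] .
  let ?S = "\<lambda>om. \<Sum>C\<in>S. a C * W om C" and ?h = "\<lambda>x. \<Sum>C\<in>S. a C * indicator C x"
  note w = wiener_int_sum[OF S, of a]
  note sl = wiener_int_l2(1,2)[OF w]
  have [measurable]: "?S \<in> borel_measurable N" using l2_leD(1)[OF sl(1)] .
  have cc: "C \<in> fin_sets La" if "C \<in> S" for C using S that by auto
  have mean: "(\<integral>om. ?S om \<partial>N) = 0"
  proof -
  have "(\<integral>om. ?S om \<partial>N) = (\<Sum>C\<in>S. a C * (\<integral>om. W om C \<partial>N))"
  proof (subst lint_sum)
  have one: "l2_le N (\<lambda>_. 1) 1" by (simp add: l2_le_def prob_space)
  show "integrable N (\<lambda>om. a C * W om C)" if "C \<in> S" for C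
  using l2_le_inner(1)[OF wn_l2[OF cc[OF that]] one] by simp
  qed simp
  also have "\<dots> = 0" using wn cc by (simp add: white_noise_def)
  finally show ?thesis .
  qed
  define s where "s = sqrt (\<integral>x. (?h x)\<^sup>2 \<partial>La)"
  have s: "0 \<le> s" "s\<^sup>2 = (\<integral>x. (?h x)\<^sup>2 \<partial>La)" unfolding s_def by (auto simp: integral_nonneg_AE)
  have chS: "(CLINT om|N. exp (\<i> * complex_of_real (?S om))) = complex_of_real (exp (- s\<^sup>2 / 2))"
  using gaussian_rv_facts(3)[OF prob_space_axioms wn_gauss[OF S] mean] w s unfolding wiener_int_def by simp
  have sc: "\<bar>s - c\<bar> \<le> d"
  proof -
  have "l2_le La (\<lambda>x. ?h x + (h x - ?h x)) (s + d)" unfolding s_def by (rule l2_le_add[OF sl(2) d2])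
  then have "c\<^sup>2 \<le> (s + d)\<^sup>2" unfolding c2 using l2_leD(4) by fastforce
  then have 1: "c \<le> s + d" by (rule power2_le_imp_le) (use s d in auto)
  have "l2_le La (\<lambda>x. h x - (h x - ?h x)) (c + d)" unfolding c_def by (rule l2_le_diff[OF l(2) d2])
  then have "s\<^sup>2 \<le> (c + d)\<^sup>2" unfolding s(2) using l2_leD(4) by fastforce
  then have 2: "s \<le> c + d" by (rule power2_le_imp_le) (use c0 d in auto)
  show ?thesis using 1 2 by auto
  qed
  have i1: "integrable N (\<lambda>om. exp (\<i> * complex_of_real (A om)))" by (intro integrable_iexp) auto
  have i2: "integrable N (\<lambda>om. exp (\<i> * complex_of_real (?S om)))"
  by (intro integrable_iexp mcomp[OF _ borel_measurable_of_real]) auto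
  have one: "l2_le N (\<lambda>_. 1) 1" by (simp add: l2_le_def prob_space)
  have l2abs: "l2_le N (\<lambda>om. \<bar>A om - ?S om\<bar>) d" using d1 unfolding l2_le_def by auto
  have "cmod (?E - (CLINT om|N. exp (\<i> * complex_of_real (?S om)))) = cmod (CLINT om|N. exp (\<i> * complex_of_real (A om)) - exp (\<i> * complex_of_real (?S om)))"
  by (subst lint_diff[OF i1 i2]) simp
  also have "\<dots> \<le> (\<integral>om. cmod (exp (\<i> * complex_of_real (A om)) - exp (\<i> * complex_of_real (?S om))) \<partial>N)"
  by (rule integral_norm_bound)
  also have "\<dots> \<le> (\<integral>om. \<bar>A om - ?S om\<bar> * 1 \<partial>N)"
  proof (rule integral_mono)
  show "integrable N (\<lambda>om. cmod (exp (\<i> * complex_of_real (A om)) - exp (\<i> * complex_of_real (?S om))))"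
  using i1 i2 by (intro integrable_norm Bochner_Integration.integrable_diff)
  show "integrable N (\<lambda>om. \<bar>A om - ?S om\<bar> * 1)" by (rule l2_le_inner(1)[OF l2abs one])
  fix om
  have "exp (\<i> * complex_of_real (A om)) - exp (\<i> * complex_of_real (?S om)) = exp (\<i> * complex_of_real (?S om)) * (exp (\<i> * complex_of_real (A om - ?S om)) - 1)"
  by (simp add: right_diff_distrib exp_add[symmetric])
  also have "cmod \<dots> = cmod (exp (\<i> * complex_of_real (A om - ?S om)) - 1)" by (simp only: norm_mult norm_exp_i_times mult_1)
  also have "\<dots> \<le> \<bar>A om - ?S om\<bar>" using iexp_approx1[of "A om - ?S om" 0] by simp
  finally show "cmod (exp (\<i> * complex_of_real (A om)) - exp (\<i> * complex_of_real (?S om))) \<le> \<bar>A om - ?S om\<bar> * 1" by simp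
  qed
  also have "\<dots> \<le> d * 1" using l2_le_inner(2)[OF l2abs one] by linarith
  finally have b1: "cmod (?E - complex_of_real (exp (- s\<^sup>2 / 2))) \<le> d" unfolding chS by simp
  have b2: "\<bar>exp (- s\<^sup>2 / 2) - exp (- c\<^sup>2 / 2)\<bar> \<le> d * (c + 1)"
  proof -
  have ex: "\<bar>exp (- x) - exp (- y)\<bar> \<le> \<bar>x - y\<bar>" if "0 \<le> x" "0 \<le> y" for x y :: real
  proof -
  have *: "exp (- u) - exp (- v) \<le> v - u \<and> 0 \<le> exp (- u) - exp (- v)" if "u \<le> v" "0 \<le> u" for u v :: real
  proof -
  have "exp (- u) - exp (- v) = exp (- u) * (1 - exp (- (v - u)))" by (simp add: right_diff_distrib exp_add[symmetric])
  also have "\<dots> \<le> 1 * (v - u)"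
  proof (rule mult_mono)
  show "1 - exp (- (v - u)) \<le> v - u" using exp_ge_add_one_self[of "- (v - u)"] by linarith
  qed (use that in auto)
  finally show ?thesis using that by simp
  qed
  show ?thesis using *[of x y] *[of y x] that by linarith
  qed
  have "\<bar>exp (- (s\<^sup>2 / 2)) - exp (- (c\<^sup>2 / 2))\<bar> \<le> \<bar>s\<^sup>2 / 2 - c\<^sup>2 / 2\<bar>" by (rule ex) auto
  also have "s\<^sup>2 / 2 - c\<^sup>2 / 2 = (s - c) * ((s + c) / 2)" by (simp add: power2_eq_square field_simps)
  also have "\<bar>\<dots>\<bar> = \<bar>s - c\<bar> * ((s + c) / 2)" using s c0 by (simp add: abs_mult)
  also have "\<dots> \<le> d * (c + 1)" using sc s c0 d by (intro mult_mono) auto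
  finally show ?thesis by simp
  qed
  have "cmod (?E - complex_of_real (exp (- c\<^sup>2 / 2))) \<le> cmod (?E - complex_of_real (exp (- s\<^sup>2 / 2))) + cmod (complex_of_real (exp (- s\<^sup>2 / 2)) - complex_of_real (exp (- c\<^sup>2 / 2)))"
  using norm_triangle_ineq[of "?E - complex_of_real (exp (- s\<^sup>2 / 2))" "complex_of_real (exp (- s\<^sup>2 / 2)) - complex_of_real (exp (- c\<^sup>2 / 2))"]
  by (simp only: diff_add_cancel add_diff_eq)
  also have "\<dots> \<le> d + d * (c + 1)"
  using b1 b2 by (intro add_mono) (simp_all only: of_real_diff[symmetric] norm_of_real)
  also have "\<dots> \<le> d * (c + 3)" using d by (simp add: algebra_simps)
  also have "\<dots> \<le> e" by (rule d(3))
  finally show ?thesis .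
 qed
 then have "cmod (?E - complex_of_real (exp (- c\<^sup>2 / 2))) \<le> 0" by (rule field_le_epsilon) simp
 then show ?thesis by (simp add: c2)
qed

end

section \<open>Continuous paths from tightness\<close>

text \<open>Compact sets in the supremum metric are totally bounded, which is the form in which
  tightness enters.\<close>

lemma tight_net:
 assumes K: "compactin (mtopology_of (funspace \<C> euclidean_metric)) K" and d: "0 < d"
 obtains F :: "('i => real) set" where "finite F" "!!f. f : K ==> EX g:F. ALL c:\<C>. abs (f c-g c) <= d"
proof -
 let ?m = "funspace \<C> (euclidean_metric :: real metric)"
 interpret M: Metric_space "mspace ?m" "mdist ?m" by (rule Metric_space_mspace_mdist)
 have "compactin M.mtopology K" using K by (simp add: mtopology_of_def)
 then have tb: "M.mtotally_bounded K" by (rule M.compactin_imp_mtotally_bounded)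
 then obtain F where F: "finite F" "F <= K" "K <= (\<Union>x\<in>F. M.mball x d)"
  using tb[unfolded M.mtotally_bounded_def, rule_format, OF d] by auto
 show ?thesis
 proof
  show "finite F" by fact
  fix f assume "f : K"
  then obtain g where g: "g : F" "f : M.mball g d" using F by blast
  have fg: "g : mspace ?m" "f : mspace ?m" "mdist ?m g f <= d"
  using g(2)[unfolded M.in_mball] by (simp_all only: less_imp_le)
  have "ALL c:\<C>. abs (f c-g c) <= d"
  proof (cases "\<C> = {}")
  case False
  then have "ALL x:\<C>. mdist euclidean_metric (g x) (f x) <= d" using fg funspace_mdist_le[OF fg(1,2) False] by simp
  then show ?thesis by (simp add: dist_real_def abs_minus_commute)
  qed simp
  with g show "EX g:F. ALL c:\<C>. abs (f c-g c) <= d" by auto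
 qed
qed

text \<open>By tightness there are, up to \<open>d\<close>, finitely many path shapes; a shape that is attained with positive
 outer probability inherits the oscillation bound from an almost surely convergent subsequence.\<close>

lemma tight_continuous:
 fixes D :: "'s::metric_space => 'i"
 assumes N: "prob_space N" and tight: "tight_in_linf N W \<C>" and D: "!!s. s : S ==> D s : \<C>"
  and l2: "!!s. s : S ==> l2_le N (%om. W om (D s)) (c s)"
  and conv: "!!x s. (!!n. x n : S) ==> s : S ==> x ----> s ==>
  (%n. (LINT om|N. (W om (D (x n))-W om (D s))^2)) ----> 0"
 shows "AE om in N. continuous_on S (%s. W om (D s))"
proof -
 interpret prob_space N by fact
 \<comment> \<open>Continuity up to an error \<open>d\<close>, a property that passes, with a larger
   error, from a net function to all functions near it.\<close>
 define osc where "osc d f \<longleftrightarrow> (ALL s:S. EX r>0. ALL t:S. dist t s < r --> abs (f t-f s) <= d)" for d :: real and f :: "'s => real"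
 have one: "l2_le N (%_. 1) 1" by (simp add: l2_le_def prob_space)
 \<comment> \<open>Mean square convergence yields an almost surely convergent subsequence, for one
   sequence of parameters at a time.\<close>
 have sub: "EX r. strict_mono r & (AE om in N. (%n. W om (D (x (r n)))-W om (D s)) ----> 0)"
  if x: "!!n. x n : S" "s : S" "x ----> s" for x s
 proof (rule tendsto_L1_AE_subseq)
  have l: "l2_le N (%om. W om (D (x n))-W om (D s)) (c (x n) + c s)" for n by (intro l2_le_diff l2 x)
  have l': "l2_le N (%om. abs (W om (D (x n))-W om (D s))) (sqrt (LINT om|N. (W om (D (x n))-W om (D s))^2))" for n
  using l[of n] unfolding l2_le_def by (auto simp: integral_nonneg_AE)
  show "integrable N (%om. W om (D (x n))-W om (D s))" for n
  using l2_le_inner(1)[OF l one] by simp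
  have "(%n. sqrt (LINT om|N. (W om (D (x n))-W om (D s))^2)) ----> sqrt 0"
  by (intro tendsto_real_sqrt conv x)
  then have lim: "(%n. sqrt (LINT om|N. (W om (D (x n))-W om (D s))^2)) ----> 0" by simp
  have bnd: "norm (LINT om|N. norm (W om (D (x n))-W om (D s))) <= sqrt (LINT om|N. (W om (D (x n))-W om (D s))^2)" for n
  using l2_le_inner(2)[OF l'[of n] one] by simp
  show "(%n. (LINT om|N. norm (W om (D (x n))-W om (D s)))) ----> 0"
  by (rule Lim_null_comparison[OF _ lim]) (intro always_eventually allI bnd)
 qed
 \<comment> \<open>The 5d consists of 3d for the net function and \<open>d\<close> for each of the
   two evaluations of the path.\<close>
 have main: "EX G:sets N. prob G >= 1-e & (AE om in N. om : G --> osc (5*d) (%s. W om (D s)))" if e: "0 < e" and d: "0 < d" for e d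
 proof -
  obtain K G where K: "compactin (mtopology_of (funspace \<C> euclidean_metric)) K"
  and G: "G : sets N" "prob G >= 1-e" "!!om. om : G ==> restrict (W om) \<C> : K"
  using tight[unfolded tight_in_linf_def, rule_format, OF e] by auto
  obtain F where F: "finite F" "!!f. f : K ==> EX g:F. ALL c:\<C>. abs (f c-g c) <= d"
  by (rule tight_net[OF K d]) (rule that)
  \<comment> \<open>This set need not be measurable, as uncountably many parameters are involved;
    hence the distinction by whether it is avoided almost everywhere, instead of by its
    probability.\<close>
  define A where "A g = {om : G. ALL s:S. abs (W om (D s)-g (D s)) <= d}" for g
  have cover: "EX g:F. om : A g" if "om : G" for om
  using F(2)[OF G(3)[OF that]] that D unfolding A_def by fastforce
  have each: "AE om in N. om : A g --> osc (5*d) (%s. W om (D s))" for g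
  proof (cases "AE om in N. om ~: A g")
  case True then show ?thesis by (rule AE_mp) auto
  next
  case False
  \<comment> \<open>A jump of the net function beyond 3d along some sequence would force a jump
    beyond \<open>d\<close> on every path in \<open>A g\<close>, but some path of this set converges
    along the subsequence.\<close>
  have og: "osc (3*d) (%s. g (D s))"
  proof (rule ccontr)
  assume "~ osc (3*d) (%s. g (D s))"
  then obtain s where s: "s : S" "!!r. 0 < r ==> EX t:S. dist t s < r & 3*d < abs (g (D t)-g (D s))"
  unfolding osc_def by (auto simp: not_le)
  then have "ALL n. EX t:S. dist t s < 1/Suc n & 3*d < abs (g (D t)-g (D s))" by simp
  then obtain x where x: "!!n. x n : S" "!!n. dist (x n) s < 1/Suc n" "!!n. 3*d < abs (g (D (x n))-g (D s))"
  using choice[of "%n t. t : S & dist t s < 1/Suc n & 3*d < abs (g (D t)-g (D s))"] by blast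
  have "(%n. dist (x n) s) ----> 0"
  by (rule tendsto_sandwich[OF _ _ tendsto_const lim_1_over_n[THEN LIMSEQ_Suc]])
  (use x(2) in \<open>auto intro!: always_eventually less_imp_le\<close>)
  then have xs: "x ----> s" by (rule tendsto_dist_iff[THEN iffD2])
  obtain r where r: "strict_mono r" "AE om in N. (%n. W om (D (x (r n)))-W om (D s)) ----> 0"
  using sub[OF x(1) s(1) xs] by auto
  define P where "P om \<longleftrightarrow> (%n. W om (D (x (r n)))-W om (D s)) ----> 0" for om
  have "EX om. P om & om : A g"
  proof (rule ccontr)
  assume "\<nexists>om. P om & om : A g"
  then have imp: "P om ==> om ~: A g" for om by auto
  have "AE om in N. P om" using r(2) by (simp add: P_def)
  then have "AE om in N. om ~: A g" by eventually_elim (rule imp)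
  with False show False by contradiction
  qed
  then obtain om where w: "(%n. W om (D (x (r n)))-W om (D s)) ----> 0" "om : A g"
  unfolding P_def by auto
  have "\<forall>\<^sub>F n in sequentially. norm (W om (D (x (r n)))-W om (D s)) < d"
  using order_tendstoD(2)[OF tendsto_norm_zero[OF w(1)] d] .
  then obtain n where n: "abs (W om (D (x (r n)))-W om (D s)) < d" by (auto simp: eventually_sequentially)
  have "abs (W om (D (x (r n)))-g (D (x (r n)))) <= d" "abs (W om (D s)-g (D s)) <= d"
  using w(2) x(1) s(1) unfolding A_def by auto
  then show False using n x(3)[of "r n"] by linarith
  qed
  have "osc (5*d) (%s. W om (D s))" if "om : A g" for om
  unfolding osc_def
  proof
  fix s assume s: "s : S"
  then obtain r where r: "0 < r" "!!t. t : S ==> dist t s < r ==> abs (g (D t)-g (D s)) <= 3*d"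
  using og unfolding osc_def by blast
  have "abs (W om (D t)-W om (D s)) <= 5*d" if t: "t : S" "dist t s < r" for t
  proof -
  have "abs (W om (D t)-g (D t)) <= d" "abs (W om (D s)-g (D s)) <= d"
  using \<open>om : A g\<close> s t unfolding A_def by auto
  with r(2)[OF t] show ?thesis by linarith
  qed
  with r(1) show "EX r>0. ALL t:S. dist t s < r --> abs (W om (D t)-W om (D s)) <= 5*d" by auto
  qed
  then show ?thesis by auto
  qed
  have "AE om in N. ALL g:F. om : A g --> osc (5*d) (%s. W om (D s))"
  using each F(1) by (intro AE_finite_allI) auto
  then have "AE om in N. om : G --> osc (5*d) (%s. W om (D s))"
  by (rule AE_mp) (use cover in \<open>auto intro!: AE_I2\<close>)
  with G(1,2) show ?thesis by auto
 qed
 have osc_AE: "AE om in N. osc (5*d) (%s. W om (D s))" if d: "0 < d" for d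
 proof -
  have "ALL n. EX G:sets N. prob G >= 1-1/Suc n & (AE om in N. om : G --> osc (5*d) (%s. W om (D s)))"
  using main[OF _ d] by simp
  then obtain G where G: "!!n. G n : sets N" "!!n. prob (G n) >= 1-1/Suc n"
  "!!n. AE om in N. om : G n --> osc (5*d) (%s. W om (D s))"
  using choice[of "%n G. G : sets N & prob G >= 1-1/Suc n & (AE om in N. om : G --> osc (5*d) (%s. W om (D s)))"] by blast
  have "prob (\<Union>n. G n) = 1"
  proof (rule antisym)
  have "1-1/real (Suc n) <= prob (\<Union>n. G n)" for n
  using G(2)[of n] finite_measure_mono[of "G n" "\<Union>n. G n"] G(1) by (auto intro: order_trans)
  moreover have "(%n. 1-1/real (Suc n)) ----> 1-0" by (intro tendsto_intros lim_1_over_n[THEN LIMSEQ_Suc])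
  ultimately show "1 <= prob (\<Union>n. G n)" by (intro LIMSEQ_le_const2) auto
  qed simp
  then have "AE om in N. om : (\<Union>n. G n)" using G(1) by (subst (asm) prob_eq_1) auto
  moreover have "AE om in N. ALL n. om : G n --> osc (5*d) (%s. W om (D s))" unfolding AE_all_countable by (intro allI G(3))
  ultimately show ?thesis by eventually_elim auto
 qed
 have "AE om in N. ALL n. osc (5*(1/Suc n)) (%s. W om (D s))"
  unfolding AE_all_countable by (intro allI osc_AE) simp
 then show ?thesis
 proof eventually_elim
  case (elim om)
  show ?case unfolding continuous_on_iff
  proof (intro ballI allI impI)
  fix s and e :: real assume s: "s : S" and e: "0 < e"
  obtain n where n: "inverse (real (Suc n)) < e/5" using reals_Archimedean[of "e/5"] e by auto
  obtain r where "0 < r" "!!t. t : S ==> dist t s < r ==> abs (W om (D t)-W om (D s)) <= 5*(1/Suc n)"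
  using elim s unfolding osc_def by blast
  then show "EX d>0. ALL x':S. dist x' s < d --> dist (W om (D x')) (W om (D s)) < e"
  using n by (intro exI[of _ r]) (auto simp: dist_real_def inverse_eq_divide intro: le_less_trans)
  qed
 qed
qed

text \<open>Characteristic functions identify the law with that of \<open>sqrt v\<close> times a
  standard normal variable, which covers \<open>v = 0\<close> as well.\<close>

lemma wiener_int_moment:
 assumes wn: "white_noise La N W" and A: "wiener_int La N W A h"
 shows "integrable N (%om. A om ^ (2*j))"
  "(LINT om|N. A om ^ (2*j)) = (LINT x|La. (h x)^2)^j*(fact (2*j)/(2^j*fact j))"
proof -
 interpret prob_space N using wn by (simp add: white_noise_def)
 have Am[measurable]: "A : meas N" using A by (simp add: wiener_int_def)
 define v where "v = (LINT x|La. (h x)^2)"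
 have v: "0 <= v" unfolding v_def by (simp add: integral_nonneg_AE)
 let ?Z = "distr std_normal_distribution borel (%x. sqrt v * x)"
 interpret Z: prob_space std_normal_distribution by (simp add: prob_space_normal_density)
 have eq: "distr N borel A = ?Z"
 proof (rule Levy_uniqueness)
  show "real_distribution (distr N borel A)" by (rule real_distribution_distr) measurable
  show "real_distribution ?Z" by (rule Z.real_distribution_distr) measurable
  show "char (distr N borel A) = char ?Z"
  proof
  fix t
  have tA: "wiener_int La N W (%om. t*A om + 0*A om) (%x. t*h x+0*h x)" by (rule wiener_int_lin[OF wn A A])
  have "char (distr N borel A) t = (CLINT om|N. iexp (t*A om))"
  unfolding char_def by (subst integral_distr) auto
  also have "... = complex_of_real (exp (- (t^2 * v)/2))"
  using wiener_int_char[OF wn tA] by (simp add: power_mult_distrib v_def)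
  also have "... = char std_normal_distribution (t * sqrt v)"
  using v by (simp add: char_std_normal_distribution power_mult_distrib)
  also have "... = char ?Z t" unfolding char_def by (subst integral_distr) (auto simp: mult.assoc)
  finally show "char (distr N borel A) t = char ?Z t" .
  qed
 qed
 have "integrable ?Z (%x. x^(2*j))"
  using integrable_std_normal_distribution_moment[of "2*j"]
  by (subst integrable_distr_eq) (auto simp: power_mult_distrib intro!: integrable_mult_right)
 then show "integrable N (%om. A om ^ (2*j))"
  unfolding eq[symmetric] by (subst (asm) integrable_distr_eq) auto
 have "(LINT om|N. A om ^ (2*j)) = (\<integral>x. x^(2*j) \<partial>distr N borel A)" by (subst integral_distr) auto
 also have "... = (LINT x|std_normal_distribution. (sqrt v * x)^(2*j))" unfolding eq by (subst integral_distr) auto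
 also have "... = sqrt v ^ (2*j)*(fact (2*j)/(2^j*fact j))"
  by (simp add: power_mult_distrib std_normal_distribution_even_moments)
 also have "sqrt v ^ (2*j) = v ^ j" using v by (simp add: power_mult)
 finally show "(LINT om|N. A om ^ (2*j)) = (LINT x|La. (h x)^2)^j*(fact (2*j)/(2^j*fact j))" by (simp add: v_def)
qed

text \<open>Linear combinations are again Wiener integrals, so the variance functional is the
  squared L2 norm of the combined kernel, and one L2 bound on the kernels bounds all
  moments.\<close>

lemma wiener_int_gproc:
 assumes wn: "white_noise La N W" and m: "(%(th, om). G th om) : meas (ka |*| N)"
  and G: "!!th. th : space ka ==> wiener_int La N W (G th) (h th)"
  and b: "!!th. th : space ka ==> l2_le La (h th) c"
 shows "gproc ka N G (c^2)"
  "gauss_char ka N G (%k b th. (LINT x|La. (\<Sum>i<k. b i*h (th i) x)^2))"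
proof -
 show "gproc ka N G (c^2)"
  unfolding gproc_def
 proof (intro conjI ballI allI)
  show "prob_space N" using wn by (simp add: white_noise_def)
  fix th j assume th: "th : space ka"
  show "integrable N (%om. G th om ^ (2*j))" by (rule wiener_int_moment[OF wn G[OF th]])
  show "(LINT om|N. G th om ^ (2*j)) <= (c^2)^j*(fact (2*j)/(2^j*fact j))"
  unfolding wiener_int_moment[OF wn G[OF th]]
  by (intro mult_right_mono power_mono l2_leD(4) b th) (auto simp: integral_nonneg_AE)
 qed (use m in auto)
 show "gauss_char ka N G (%k b th. (LINT x|La. (\<Sum>i<k. b i*h (th i) x)^2))"
  unfolding gauss_char_def
 proof (intro allI impI conjI)
  fix k :: nat and b :: "nat => real" and th assume th: "ALL i<k. th i : space ka"
  have "wiener_int La N W (%om. \<Sum>i<k. b i*G (th i) om) (%x. \<Sum>i<k. b i*h (th i) x)"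
  using th by (intro wiener_int_finite_sum[OF wn] G) auto
  then show "(CLINT om|N. iexp (\<Sum>i<k. b i*G (th i) om)) =
  complex_of_real (exp (- (LINT x|La. (\<Sum>i<k. b i*h (th i) x)^2)/2))" by (rule wiener_int_char[OF wn])
  fix c
  have "(\<Sum>i<k. c*b i*h (th i) x)^2 = c^2*(\<Sum>i<k. b i*h (th i) x)^2" for x
  by (simp add: sum_distrib_left[symmetric] power_mult_distrib[symmetric] mult.assoc)
  then show "(LINT x|La. (\<Sum>i<k. c*b i*h (th i) x)^2) = c^2*(LINT x|La. (\<Sum>i<k. b i*h (th i) x)^2)" by simp
 qed
qed

section \<open>Tail measures with a continuous density\<close>

lemma ae_eq_continuous_imp_eq:
 fixes f g :: "'a::euclidean_space => real"
 assumes "AE x in lborel. x : U --> f x = g x" "open U" "continuous_on U f" "continuous_on U g" "x : U"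
 shows "f x = g x"
proof (rule ccontr)
 assume ne: "f x ~= g x"
 define V where "V = {x : U. f x-g x ~= 0}"
 have "open (U Int (%x. f x-g x) -` (- {0}))"
  using assms by (intro continuous_open_preimage continuous_intros) auto
 moreover have "U Int (%x. f x-g x) -` (- {0}) = V" unfolding V_def by auto
 ultimately have V: "open V" by simp
 have "x : V" using ne assms by (simp add: V_def)
 then have nn: "~ negligible V" using open_not_negligible[OF V] by auto
 have "AE x in lborel. x ~: V" using assms(1) by eventually_elim (auto simp: V_def)
 then have "V : null_sets lborel" using V by (subst (asm) AE_iff_null_sets[symmetric]) auto
 then have "V : null_sets lebesgue" using null_sets_completionI by blast
 then show False using nn by (simp add: negligible_iff_null_sets)
qed

lemma borel_pt: "(borel :: pt measure) = borel |*| borel"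
 by (simp add: borel_prod)

lemma E_space_borel: "E_space : sets borel"
 unfolding E_space_def by (intro sets.Diff borel_closed) auto

definition scale_E :: "real => pt => pt" where
 "scale_E c z = (ennreal c*fst z, ennreal c * snd z)"

definition quad :: "(real \<times> real) set" where
 "quad = {0<..} \<times> {0<..}"

lemma quad_open: "open quad"
 unfolding quad_def by (intro open_Times) auto

lemma quad_borel[measurable]: "quad : sets borel"
 using quad_open by auto

lemma emb_measurable[measurable]: "emb : meas borel"
 unfolding emb_def[abs_def]
proof (rule borel_measurable_Pair)
 have "(fst :: real \<times> real => real) : meas borel" "(snd :: real \<times> real => real) : meas borel"
  by (auto intro!: borel_measurable_continuous_onI continuous_intros)
 then show "(%u::real\<times>real. ennreal (fst u)) : meas borel" "(%u::real\<times>real. ennreal (snd u)) : meas borel"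
  by (auto intro: mcomp[OF _ measurable_ennreal])
qed

text \<open>The second coordinate is the slope u2/u1 and not an angle, which keeps the Jacobian
  elementary.\<close>

definition polar :: "real \<times> real => pt" where
 "polar z = emb (fst z, fst z * snd z)"

lemma polar_measurable[measurable]: "polar : meas borel"
proof -
 have "(%z::real\<times>real. (fst z, fst z * snd z)) : meas borel"
  by (intro borel_measurable_continuous_onI continuous_intros)
 from mcomp[OF this emb_measurable] show ?thesis by (simp add: polar_def[abs_def])
qed

section \<open>Homogeneity of the density and slope coordinates\<close>

locale smooth_tail =
 fixes La :: "pt measure" and l :: "real \<times> real => real"
 assumes tail: "tail_measure La" and smooth: "smooth_with_density La l"
begin

lemma sets_L: "sets La = sets (restrict_space borel E_space)"
 using tail by (simp add: tail_measure_def radon_E_def)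

lemma sets_L_iff: "B : sets La \<longleftrightarrow> B : sets borel & B <= E_space"
 unfolding sets_L using E_space_borel by (subst sets_restrict_space_iff) auto

lemma space_L: "space La = E_space"
 using sets_eq_imp_space_eq[OF sets_L] space_restrict_space[of borel E_space] by simp

lemma measurable_L: "f : measurable borel N ==> f : measurable La N"
 unfolding measurable_cong_sets[OF sets_L refl] by (rule measurable_restrict_space1)

lemma l_cont: "continuous_on ({0..} \<times> {0..}-{(0, 0)}) l"
 and l_nonneg: "!!u. u : {0..} \<times> {0..}-{(0, 0)} ==> 0 <= l u"
 and L_dens: "!!B. B : sets La ==> emeasure La (B Int {..<top} \<times> {..<top}) =
  (nn_integral lborel (%u. ennreal (l u)*indicator {u : {0..} \<times> {0..}. emb u : B} u))"
 and L_top: "emeasure La ({top} \<times> {..1}) = 0" "emeasure La ({..1} \<times> {top}) = 0"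
proof -
 note S = smooth[unfolded smooth_with_density_def]
 show "continuous_on ({0..} \<times> {0..}-{(0, 0)}) l" using S by (rule conjunct1)
 show "!!u. u : {0..} \<times> {0..}-{(0, 0)} ==> 0 <= l u" by (rule S[THEN conjunct2, THEN conjunct1, THEN bspec])
 show "!!B. B : sets La ==> emeasure La (B Int {..<top} \<times> {..<top}) =
  (nn_integral lborel (%u. ennreal (l u)*indicator {u : {0..} \<times> {0..}. emb u : B} u))"
  by (rule S[THEN conjunct2, THEN conjunct2, THEN conjunct1, THEN bspec])
 show "emeasure La ({top} \<times> {..1}) = 0" "emeasure La ({..1} \<times> {top}) = 0"
  using S[THEN conjunct2, THEN conjunct2, THEN conjunct2] by simp_all
qed

lemma l_cont_quad: "continuous_on quad l"
 by (rule continuous_on_subset[OF l_cont]) (auto simp: quad_def)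

lemma l_quad_nonneg: "0 < x ==> 0 < y ==> 0 <= l (x, y)"
 by (rule l_nonneg) auto

lemma L_margin: "0 <= u ==> emeasure La ({..ennreal u} \<times> UNIV) = ennreal u"
 "0 <= u ==> emeasure La (UNIV \<times> {..ennreal u}) = ennreal u"
 using tail[unfolded tail_measure_def, THEN conjunct2, THEN conjunct1, rule_format, of u] by blast+

lemma L_scale: "0 < c ==> B : sets La ==> emeasure La (scale_E c ` B) = ennreal c*emeasure La B"
proof -
 have "scale_E c = (%(x, y). (ennreal c*x, ennreal c*y))" by (auto simp: scale_E_def fun_eq_iff)
 then show "0 < c ==> B : sets La ==> emeasure La (scale_E c ` B) = ennreal c*emeasure La B"
  using tail[unfolded tail_measure_def, THEN conjunct2, THEN conjunct2, rule_format, of c B] by (simp only:)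
qed

lemma scale_E_inv: "0 < c ==> scale_E c (scale_E (1 / c) z) = z"
proof -
 assume c: "0 < c"
 have "ennreal c*(ennreal (1 / c)*x) = x" for x :: ennreal
  using c by (simp add: mult.assoc[symmetric] ennreal_mult[symmetric])
 then show ?thesis by (simp add: scale_E_def)
qed

lemma scale_E_image: "0 < c ==> scale_E c ` B = {z. scale_E (1 / c) z : B}"
proof (intro set_eqI iffI)
 fix z assume c: "0 < c"
 { assume "z : scale_E c ` B"
  then obtain b where b: "b : B" "z = scale_E c b" by auto
  then show "z : {z. scale_E (1 / c) z : B}" using scale_E_inv[of "1 / c" b] c by simp }
 { assume "z : {z. scale_E (1 / c) z : B}"
  then show "z : scale_E c ` B" using scale_E_inv[OF c, of z] by (intro image_eqI[of z _ "scale_E (1 / c) z"]) simp_all }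
qed

lemma ennreal_scale_le_iff: "0 < c ==> ennreal (1 / c)*y <= 1 \<longleftrightarrow> y <= ennreal c"
proof -
 assume c: "0 < c"
 show ?thesis
 proof (cases y)
  case (real r)
  then show ?thesis using c by (simp add: ennreal_mult[symmetric] divide_le_eq_1)
 qed (use c in \<open>simp add: ennreal_mult_top top_unique\<close>)
qed

lemma mult_top_iff: "0 < c ==> ennreal (1 / c)*y = top \<longleftrightarrow> y = top"
 by (auto simp: ennreal_mult_eq_top_iff)

text \<open>The smoothness condition speaks of the unit segments of the two lines at infinity;
  scaling these by integers exhausts both lines, since \<open>E_space\<close> omits the
  corner.\<close>

lemma at_infinity_null: "AE z in La. fst z < top & snd z < top"
proof -
 have a: "emeasure La ({top} \<times> {..ennreal (real (Suc n))}) = 0" for n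
 proof -
  have "{top} \<times> {..1} : sets La"
  unfolding sets_L_iff borel_pt by (auto simp: E_space_def top_unique)
  from L_scale[OF _ this, of "real (Suc n)"] have "emeasure La (scale_E (real (Suc n)) ` ({top} \<times> {..1})) = 0"
  by (simp only: L_top) simp
  moreover have "scale_E (real (Suc n)) ` ({top} \<times> {..1}) = {top} \<times> {..ennreal (real (Suc n))}"
  unfolding scale_E_image[of "real (Suc n)", OF of_nat_0_less_iff[THEN iffD2, OF zero_less_Suc]]
  using ennreal_scale_le_iff[of "real (Suc n)"] mult_top_iff[of "real (Suc n)"] by (auto simp: scale_E_def simp del: of_nat_Suc)
  ultimately show ?thesis by simp
 qed
 have b: "emeasure La ({..ennreal (real (Suc n))} \<times> {top}) = 0" for n
 proof -
  have "{..1} \<times> {top} : sets La"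
  unfolding sets_L_iff borel_pt by (auto simp: E_space_def top_unique)
  from L_scale[OF _ this, of "real (Suc n)"] have "emeasure La (scale_E (real (Suc n)) ` ({..1} \<times> {top})) = 0"
  by (simp only: L_top) simp
  moreover have "scale_E (real (Suc n)) ` ({..1} \<times> {top}) = {..ennreal (real (Suc n))} \<times> {top}"
  unfolding scale_E_image[of "real (Suc n)", OF of_nat_0_less_iff[THEN iffD2, OF zero_less_Suc]]
  using ennreal_scale_le_iff[of "real (Suc n)"] mult_top_iff[of "real (Suc n)"] by (auto simp: scale_E_def simp del: of_nat_Suc)
  ultimately show ?thesis by simp
 qed
 have m: "{top} \<times> {..ennreal (real (Suc n))} : sets La" "{..ennreal (real (Suc n))} \<times> {top} : sets La" for n
  unfolding sets_L_iff borel_pt by (auto simp: E_space_def top_unique)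
 have "AE z in La. ALL n. z ~: {top} \<times> {..ennreal (real (Suc n))} & z ~: {..ennreal (real (Suc n))} \<times> {top}"
  unfolding AE_all_countable using a b m by (auto intro!: AE_not_in null_setsI)
 moreover have "AE z in La. z : E_space" using AE_space[of La] by (simp add: space_L)
 ultimately show ?thesis
 proof eventually_elim
  case (elim z)
  have ex: "EX n. y <= ennreal (real (Suc n))" if "y ~= top" for y :: ennreal
  proof (cases y)
  case (real r)
  obtain n where "r <= real n" using real_arch_simple by auto
  then have "ennreal r <= ennreal (real (Suc n))" by (intro ennreal_leI) simp
  then show ?thesis using real by (auto simp del: of_nat_Suc)
  qed (use that in auto)
  show ?case using elim ex[of "fst z"] ex[of "snd z"] by (cases z) (auto simp: E_space_def less_top)
 qed
qed

text \<open>The axes are null, and the cut-off makes the density a nonnegative Borel function on the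
  whole plane.\<close>

definition dens :: "real \<times> real => real" where
 "dens u = (if u : quad then l u else 0)"

lemma dens_nonneg: "0 <= dens u"
 unfolding dens_def quad_def by (auto intro: l_nonneg)

lemma dens_measurable[measurable]: "dens : meas borel"
proof -
 have "(%u. indicator quad u *\<^sub>R l u) : meas borel"
  by (rule borel_measurable_continuous_on_indicator[OF _ l_cont_quad]) measurable
 moreover have "dens = (%u. indicator quad u *\<^sub>R l u)" by (auto simp: dens_def fun_eq_iff)
 ultimately show ?thesis by simp
qed

lemma AE_off_lines: "AE u in (lborel :: (real \<times> real) measure). fst u ~= c & snd u ~= d"
proof -
 have 1: "emeasure (lborel :: (real \<times> real) measure) ({c} \<times> UNIV) = 0" "emeasure (lborel :: (real \<times> real) measure) (UNIV \<times> {d}) = 0"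
  unfolding lborel_prod[symmetric] by (subst lborel.emeasure_pair_measure_Times; simp)+
 have "AE u in (lborel :: (real \<times> real) measure). u ~: {c} \<times> UNIV"
  using 1 by (intro AE_not_in null_setsI) (auto simp: borel_prod[symmetric])
 moreover have "AE u in (lborel :: (real \<times> real) measure). u ~: UNIV \<times> {d}"
  using 1 by (intro AE_not_in null_setsI) (auto simp: borel_prod[symmetric])
 ultimately show ?thesis by eventually_elim auto
qed

lemmas AE_off_axes = AE_off_lines[of 0 0]

lemma emeasure_L:
 assumes B: "B : sets La"
 shows "emeasure La B = (nn_integral lborel (%u. ennreal (dens u)*indicator B (emb u)))"
proof -
 have F: "{..<top} \<times> {..<top} : sets La"
  unfolding sets_L_iff borel_pt by (auto simp: E_space_def)
 have "emeasure La B = emeasure La (B Int {..<top} \<times> {..<top})"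
  using at_infinity_null B F by (intro emeasure_eq_AE) (auto elim: AE_mp)
 also have "... = (nn_integral lborel (%u. ennreal (l u)*indicator {u : {0..} \<times> {0..}. emb u : B} u))" by (rule L_dens[OF B])
 also have "... = (nn_integral lborel (%u. ennreal (dens u)*indicator B (emb u)))"
 proof (rule nn_integral_cong_AE)
  show "AE u in lborel. ennreal (l u)*indicator {u : {0..} \<times> {0..}. emb u : B} u = ennreal (dens u)*indicator B (emb u)"
  using AE_off_axes by eventually_elim (auto simp: dens_def quad_def indicator_def)
 qed
 finally show ?thesis .
qed

lemma L_eq_distr: "La = distr (density lborel (%u. ennreal (dens u))) La emb"
proof (rule measure_eqI)
 fix B assume B: "B : sets La"
 have em: "emb : measurable borel La"
 proof -
  have "emb : measurable borel (restrict_space borel E_space)"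
  by (rule measurable_restrict_space2) (auto simp: E_space_def emb_def)
  then show ?thesis by (simp add: measurable_cong_sets[OF refl sets_L])
 qed
 show "emeasure La B = emeasure (distr (density lborel (%u. ennreal (dens u))) La emb) B"
  using B em measurable_sets[OF em B]
  by (subst emeasure_distr, simp, simp, subst emeasure_density, simp, simp)
  (auto simp: emeasure_L[OF B] intro!: nn_integral_cong split: split_indicator)
qed simp

lemma nn_integral_L:
 assumes f: "f : meas La"
 shows "(nn_integral La (%z. f z)) = (nn_integral lborel (%u. ennreal (dens u)*f (emb u)))"
proof -
 have em: "emb : measurable borel La"
 proof -
  have "emb : measurable borel (restrict_space borel E_space)"
  by (rule measurable_restrict_space2) (auto simp: E_space_def emb_def)
  then show ?thesis by (simp add: measurable_cong_sets[OF refl sets_L])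
 qed
 have fm: "(%u. f (emb u)) : meas borel" using mcomp[OF em f] .
 have "(nn_integral La (%z. f z)) = (\<integral>\<^sup>+z. f z \<partial>distr (density lborel (%u. ennreal (dens u))) La emb)"
  using L_eq_distr by simp
 also have "... = (\<integral>\<^sup>+u. f (emb u) \<partial>density lborel (%u. ennreal (dens u)))"
  using em f by (intro nn_integral_distr) auto
 also have "... = (nn_integral lborel (%u. ennreal (dens u)*f (emb u)))"
  using fm by (intro nn_integral_density) auto
 finally show ?thesis .
qed

text \<open>Homogeneity of the measure gives the identity almost everywhere, by uniqueness of
  densities; both sides are continuous on the open quadrant, where equality almost everywhere is
  equality.\<close>

lemma l_homogeneous:
 assumes c: "0 < c" and u: "u : quad"
 shows "c*l (c *\<^sub>R u) = l u"
proof -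
 define inv where "inv z = (enn2real (fst z), enn2real (snd z))" for z :: pt
 have inv_m[measurable]: "inv : meas borel"
  unfolding inv_def[abs_def] borel_pt borel_prod[symmetric] by measurable
 \<comment> \<open>Scaling the plane contributes the Jacobian c^2, scaling the measure the factor
   \<open>c\<close>.\<close>
 define f where "f v = ennreal (c^2*dens (c *\<^sub>R v))" for v
 define g where "g v = ennreal (c*dens v)" for v
 have [measurable]: "f : meas borel" "g : meas borel" unfolding f_def[abs_def] g_def[abs_def] by measurable
 have cq: "c *\<^sub>R v : quad \<longleftrightarrow> v : quad" for v using c by (cases v) (auto simp: quad_def zero_less_mult_iff)
 have "density lborel f = density lborel g"
 proof (rule measure_eqI)
  fix A assume "A : sets (density lborel f)"
  then have A[measurable]: "A : sets borel" by simp
  define B where "B = {z. inv z : A Int quad}"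
  have Bq: "emb v : B \<longleftrightarrow> v : A Int quad" if "v : quad" for v
  using that by (cases v) (auto simp: B_def inv_def emb_def quad_def)
  have "B = inv -` (A Int quad) Int space borel" by (auto simp: B_def)
  then have "B : sets borel" using measurable_sets[OF inv_m, of "A Int quad"] by simp
  moreover have "B <= E_space" by (auto simp: B_def inv_def quad_def E_space_def)
  ultimately have B: "B : sets La" by (simp add: sets_L_iff)
  have cB: "scale_E c ` B : sets La"
  proof -
  have sm: "scale_E (1 / c) : meas borel"
  unfolding scale_E_def[abs_def] borel_pt by measurable
  have "scale_E (1 / c) -` B Int space borel : sets borel" by (rule measurable_sets[OF sm \<open>B : sets borel\<close>])
  moreover have "scale_E c ` B = scale_E (1 / c) -` B Int space borel" unfolding scale_E_image[OF c] by auto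
  moreover have "scale_E c ` B <= E_space" unfolding scale_E_image[OF c] using c \<open>B <= E_space\<close>
  by (auto simp: scale_E_def E_space_def ennreal_mult_top)
  ultimately show ?thesis by (simp add: sets_L_iff)
  qed
  have emc: "emb (c *\<^sub>R v) : scale_E c ` B \<longleftrightarrow> emb v : B" if "v : quad" for v
  proof -
  have "scale_E (1 / c) (emb (c *\<^sub>R v)) = emb v"
  using that c by (cases v) (auto simp: scale_E_def emb_def quad_def ennreal_mult[symmetric])
  then show ?thesis unfolding scale_E_image[OF c] by simp
  qed
  have "emeasure (density lborel f) A = (nn_integral lborel (%v. f v * indicator A v))" by (rule emeasure_density) auto
  also have "... = (nn_integral lborel (%v. ennreal (c^2)*(ennreal (dens (c *\<^sub>R v))*indicator (scale_E c ` B) (emb (c *\<^sub>R v)))))"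
  proof (rule nn_integral_cong)
  fix v
  have "f v = ennreal (c^2)*ennreal (dens (c *\<^sub>R v))" unfolding f_def by (rule ennreal_mult) (auto simp: dens_nonneg)
  moreover have "dens (c *\<^sub>R v) = 0" if "v ~: quad" using that by (simp add: dens_def cq)
  ultimately show "f v * indicator A v = ennreal (c^2)*(ennreal (dens (c *\<^sub>R v))*indicator (scale_E c ` B) (emb (c *\<^sub>R v)))"
  by (cases "v : quad") (auto simp: emc Bq mult.assoc split: split_indicator)
  qed
  also have "... = (nn_integral lborel (%v. ennreal (dens v)*indicator (scale_E c ` B) (emb v)))"
  proof -
  let ?h = "%v. ennreal (dens v)*indicator (scale_E c ` B) (emb v)"
  have hm[measurable]: "?h : meas borel"
  proof -
  have "(%v. indicator (scale_E c ` B) (emb v) :: ennreal) : meas borel"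
  using cB unfolding sets_L_iff by (intro mcomp[OF emb_measurable borel_measurable_indicator]) auto
  then show ?thesis by measurable
  qed
  have "(nn_integral lborel (%v. ?h v)) = (\<integral>\<^sup>+v. ?h v \<partial>density (distr lborel borel (%x. 0 + c *\<^sub>R x)) (%_. abs c^DIM(real \<times> real)))"
  by (subst lborel_affine[of c "0 :: real \<times> real"]) (use c in simp_all)
  also have "... = (nn_integral lborel (%v. ennreal (c^2) * ?h (c *\<^sub>R v)))"
  using c by (subst nn_integral_density, simp, simp, subst nn_integral_distr) (auto simp: numeral_2_eq_2)
  finally show ?thesis ..
  qed
  also have "... = emeasure La (scale_E c ` B)" by (rule emeasure_L[OF cB, symmetric])
  also have "... = ennreal c*emeasure La B" by (rule L_scale[OF c B])
  also have "... = (nn_integral lborel (%v. ennreal c*(ennreal (dens v)*indicator B (emb v))))"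
  unfolding emeasure_L[OF B]
  proof (rule nn_integral_cmult[symmetric])
  have "(%v. indicator B (emb v) :: ennreal) : meas borel"
  using B unfolding sets_L_iff by (intro mcomp[OF emb_measurable borel_measurable_indicator]) auto
  then show "(%v. ennreal (dens v)*indicator B (emb v)) : meas lborel" by measurable
  qed
  also have "... = (nn_integral lborel (%v. g v * indicator A v))"
  proof (rule nn_integral_cong)
  fix v
  have "g v = ennreal c*ennreal (dens v)" unfolding g_def using c by (intro ennreal_mult) (auto simp: dens_nonneg)
  moreover have "dens v = 0" if "v ~: quad" using that by (simp add: dens_def)
  ultimately show "ennreal c*(ennreal (dens v)*indicator B (emb v)) = g v * indicator A v"
  by (cases "v : quad") (auto simp: Bq mult.assoc split: split_indicator)
  qed
  also have "... = emeasure (density lborel g) A" by (rule emeasure_density[symmetric]) auto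
  finally show "emeasure (density lborel f) A = emeasure (density lborel g) A" .
 qed simp
 then have "AE v in lborel. f v = g v"
  by (subst (asm) sigma_finite_measure.density_unique_iff[OF sigma_finite_lborel]) auto
 then have ae: "AE v in lborel. v : quad --> c^2*l (c *\<^sub>R v) = c*l v"
 proof eventually_elim
  case (elim v)
  have "v : quad ==> 0 <= l v & 0 <= l (c *\<^sub>R v)" using dens_nonneg[of v] dens_nonneg[of "c *\<^sub>R v"] cq[of v] by (auto simp: dens_def)
  then show ?case using elim c cq[of v] by (auto simp: f_def g_def dens_def)
 qed
 have "continuous_on quad (%v. l (c *\<^sub>R v))"
 proof (rule continuous_on_compose2[OF l_cont_quad])
  show "(%v. c *\<^sub>R v) ` quad <= quad" using cq by blast
 qed (intro continuous_intros)
 then have "continuous_on quad (%v. c^2*l (c *\<^sub>R v))" "continuous_on quad (%v. c*l v)"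
  using l_cont_quad by (auto intro: continuous_on_mult_left)
 then have "c^2*l (c *\<^sub>R u) = c*l u"
  by (rule ae_eq_continuous_imp_eq[OF ae quad_open _ _ u])
 then show ?thesis using c by (simp add: power2_eq_square)
qed

definition a :: "real => real" where
 "a t = l (1, t)"

lemma a_nonneg: "0 < t ==> 0 <= a t"
 unfolding a_def by (rule l_quad_nonneg) auto

lemma l_ray: "0 < x ==> 0 < t ==> l (x, x*t) = a t/x"
 using l_homogeneous[of x "(1, t)"] by (simp add: a_def quad_def eq_divide_eq mult.commute)

lemma a_cont: "continuous_on {0..} a"
 unfolding a_def[abs_def] by (rule continuous_on_compose2[OF l_cont]) (auto intro!: continuous_intros)

definition apos :: "real => real" where
 "apos t = (if 0 < t then a t else 0)"

lemma apos_nonneg: "0 <= apos t"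
 by (simp add: apos_def a_nonneg)

lemma apos_measurable[measurable]: "apos : meas borel"
proof -
 have "(%t. pos t *\<^sub>R a t) : meas borel"
  by (rule borel_measurable_continuous_on_indicator) (auto intro: continuous_on_subset[OF a_cont])
 moreover have "apos = (%u. pos u *\<^sub>R a u)" by (auto simp: apos_def fun_eq_iff)
 ultimately show ?thesis by simp
qed

text \<open>The density in the coordinates \<open>(x, t) = (u\<^sub>1, u\<^sub>2 / u\<^sub>1)\<close>.\<close>

definition pdens :: "real \<times> real => real" where
 "pdens z = (if 0 < fst z then apos (snd z) else 0)"

lemma pdens_nonneg: "0 <= pdens z"
 by (simp add: pdens_def apos_nonneg)

lemma pdens_measurable[measurable]: "pdens : meas borel"
proof -
 have "pdens : meas (borel |*| borel)" unfolding pdens_def[abs_def] by measurable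
 then show ?thesis by (simp add: borel_prod)
qed

lemma polar_measurable_L: "polar : measurable borel La"
proof -
 have "polar : measurable borel (restrict_space borel E_space)"
  by (rule measurable_restrict_space2) (auto simp: E_space_def emb_def polar_def)
 then show ?thesis by (simp add: measurable_cong_sets[OF refl sets_L])
qed

text \<open>The Jacobian x of (x, t) -> (x, x t) cancels the factor 1/x from homogeneity, so for x >
  0 the new density depends on \<open>t\<close> alone.\<close>

lemma nn_integral_polar:
 assumes f: "f : meas La"
 shows "(nn_integral La (%z. f z)) = (nn_integral lborel (%z. ennreal (pdens z)*f (polar z)))"
proof -
 have em: "emb : measurable borel La"
 proof -
  have "emb : measurable borel (restrict_space borel E_space)"
  by (rule measurable_restrict_space2) (auto simp: E_space_def emb_def)
  then show ?thesis by (simp add: measurable_cong_sets[OF refl sets_L])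
 qed
 have fm: "(%u. f (emb u)) : meas borel" using mcomp[OF em f] .
 have fm'[measurable]: "(%u. f (emb u)) : meas (borel |*| borel)" using fm by (simp add: borel_prod)
 have fp: "(%u. f (polar u)) : meas borel" using mcomp[OF polar_measurable_L f] .
 have fp'[measurable]: "(%u. f (polar u)) : meas (borel |*| borel)" using fp by (simp add: borel_prod)
 have dm[measurable]: "dens : meas (borel |*| borel)" "pdens : meas (borel |*| borel)"
  using dens_measurable pdens_measurable by (simp_all add: borel_prod)
 have "(nn_integral La (%z. f z)) = (nn_integral lborel (%x. (nn_integral lborel (%y. ennreal (dens (x, y))*f (emb (x, y))))))"
  unfolding nn_integral_L[OF f] lborel_prod[symmetric] by (subst lborel.nn_integral_fst[symmetric]) auto
 also have "... = (nn_integral lborel (%x. (nn_integral lborel (%t. ennreal (pdens (x, t))*f (polar (x, t))))))"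
 proof (rule nn_integral_cong)
  fix x :: real
  show "(nn_integral lborel (%y. ennreal (dens (x, y))*f (emb (x, y)))) = (nn_integral lborel (%t. ennreal (pdens (x, t))*f (polar (x, t))))"
  proof (cases "0 < x")
  case True
  have m: "(%y. ennreal (dens (x, y))*f (emb (x, y))) : meas borel" by measurable
  have m2: "(%t. ennreal (dens (x, x*t))*f (emb (x, x*t))) : meas lborel"
  using mcomp[OF _ m, of "%t. x*t" borel] by simp
  have "(nn_integral lborel (%y. ennreal (dens (x, y))*f (emb (x, y)))) = ennreal x*(nn_integral lborel (%t. ennreal (dens (x, x*t))*f (emb (x, x*t))))"
  using nn_integral_real_affine[OF m, of x 0] True by simp
  also have "... = (nn_integral lborel (%t. ennreal x*(ennreal (dens (x, x*t))*f (emb (x, x*t)))))"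
  by (rule nn_integral_cmult[OF m2, symmetric])
  also have "... = (nn_integral lborel (%t. ennreal (pdens (x, t))*f (polar (x, t))))"
  proof (rule nn_integral_cong)
  fix t
  have "x*dens (x, x*t) = pdens (x, t)"
  using True l_ray[of x t] by (auto simp: dens_def pdens_def apos_def quad_def zero_less_mult_iff)
  then show "ennreal x*(ennreal (dens (x, x*t))*f (emb (x, x*t))) = ennreal (pdens (x, t))*f (polar (x, t))"
  using True by (simp add: polar_def mult.assoc[symmetric] ennreal_mult[symmetric] dens_nonneg)
  qed
  finally show ?thesis .
  qed (auto simp: dens_def pdens_def quad_def)
 qed
 also have "... = (nn_integral (lborel |*| lborel) (%z. ennreal (pdens z)*f (polar z)))"
  by (subst lborel.nn_integral_fst[symmetric]) auto
 finally show ?thesis by (simp add: lborel_prod)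
qed

lemma emeasure_polar:
 assumes "B : sets La"
 shows "emeasure La B = (nn_integral lborel (%t. ennreal (apos t)*(nn_integral lborel (%x. pos x*indicator B (polar (x, t))))))"
proof -
 have pm: "(%z. indicator B (polar z) :: ennreal) : meas borel"
  using mcomp[OF polar_measurable_L, of "indicator B" borel] assms by simp
 have pm'[measurable]: "(%z. indicator B (polar z) :: ennreal) : meas (borel |*| borel)" using pm by (simp add: borel_prod)
 have dm[measurable]: "pdens : meas (borel |*| borel)"
  using pdens_measurable by (simp add: borel_prod)
 have "emeasure La B = (nn_integral (lborel |*| lborel) (%z. ennreal (pdens z)*indicator B (polar z)))"
  using nn_integral_polar[of "indicator B"] assms by (simp add: lborel_prod)
 also have "... = (nn_integral lborel (%t. (nn_integral lborel (%x. ennreal (pdens (x, t))*indicator B (polar (x, t))))))"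
  by (subst lborel_pair.nn_integral_snd[symmetric]) auto
 also have "... = (nn_integral lborel (%t. ennreal (apos t)*(nn_integral lborel (%x. pos x*indicator B (polar (x, t))))))"
  by (intro nn_integral_cong, subst nn_integral_cmult[symmetric]) (auto intro!: nn_integral_cong simp: pdens_def)
 finally show ?thesis .
qed

end

text \<open>Simple functions converging to the parameter take finitely many values, so that
  measurability in the second variable suffices for them; continuity carries it to the
  limit.\<close>

lemma caratheodory_measurable:
 fixes f :: "'s::{metric_space, second_countable_topology} => 'w => real"
 assumes m: "!!s. f s : meas N" and c: "!!om. om : space N ==> continuous_on UNIV (%s. f s om)"
 shows "(%(s, om). f s om) : meas (borel |*| N)"
proof -
 have "(%x::'s. x) : meas borel" by simp
 from borel_measurable_implies_sequence_metric[OF this, of undefined] obtain F :: "nat => 's => 's" where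
  F: "!!i. simple_function borel (F i)" "!!x. (%i. F i x) ----> x" by auto
 have "(%x. f (F i (fst x)) (snd x)) : meas (borel |*| N)" for i
 proof (rule measurable_compose_countable'[where I = "F i ` space borel" and g = "%x. F i (fst x)"])
  show "(%x. f s (snd x)) : meas (borel |*| N)" for s
  by (rule mcomp[OF measurable_snd m])
  show "countable (F i ` space borel)" using simple_functionD(1)[OF F(1)] by (rule countable_finite)
  show "(%x. F i (fst x)) : measurable (borel |*| N) (count_space (F i ` space borel))"
  proof (rule mcomp[OF measurable_fst])
  show "F i : measurable borel (count_space (F i ` space borel))"
  using simple_functionD[OF F(1)] by (subst measurable_count_space_eq2) auto
  qed
 qed
 then have "(%x. f (fst x) (snd x)) : meas (borel |*| N)"
 proof (rule borel_measurable_LIMSEQ_metric)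
  fix x assume "x : space (borel |*| N :: ('s \<times> 'w) measure)"
  then have "snd x : space N" by (auto simp: space_pair_measure)
  from continuous_on_tendsto_compose[OF c[OF this] F(2)]
  show "(%i. f (F i (fst x)) (snd x)) ----> f (fst x) (snd x)" by simp
 qed
 then show ?thesis by (simp add: case_prod_beta')
qed

section \<open>Normalisation of the margins and transport to Lebesgue measure\<close>

context smooth_tail
begin

text \<open>The sets at which the process is evaluated lie in such unions, whose measure is at most
  2s by the margins; this gives finiteness and, later, uniform L2 bounds.\<close>

definition strips :: "real => pt set" where
 "strips s = {..ennreal s} \<times> UNIV Un UNIV \<times> {..ennreal s}"

lemma strips_sets: "strips s : sets La"
 unfolding sets_L_iff borel_pt strips_def by (auto simp: E_space_def top_unique)

lemma strips_fin: "0 <= s ==> strips s : fin_sets La"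
proof -
 assume s: "0 <= s"
 have m: "{..ennreal s} \<times> UNIV : sets La" "UNIV \<times> {..ennreal s} : sets La"
  unfolding sets_L_iff borel_pt by (auto simp: E_space_def top_unique)
 have "emeasure La (strips s) <= ennreal s+ennreal s"
  unfolding strips_def using emeasure_subadditive[OF m] L_margin[OF s] by simp
 also have "... < top" by simp
 finally show ?thesis using strips_sets by (simp add: fin_sets_def)
qed

lemma fin_sets_strips: "B : sets La ==> B <= strips s ==> B : fin_sets La"
proof -
 assume B: "B : sets La" "B <= strips s"
 have "strips s <= strips (max 0 s)" unfolding strips_def by (auto intro: order_trans[OF _ ennreal_leI])
 then have "emeasure La B <= emeasure La (strips (max 0 s))" using B by (intro emeasure_mono strips_sets) auto
 also have "... < top" using strips_fin[of "max 0 s"] by (simp add: fin_sets_def)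
 finally show ?thesis using B by (simp add: fin_sets_def)
qed

lemma sigma_finite_L: "sigma_finite_measure La"
proof
 have 1: "emeasure La (strips (real n)) ~= \<infinity>" for n using strips_fin[of "real n"] by (auto simp: fin_sets_def)
 have "z : (\<Union>n. strips (real n))" if z: "z : E_space" for z
 proof -
  have ex: "EX n. y <= ennreal (real n)" if "y ~= top" for y :: ennreal
  proof (cases y)
  case (real r)
  obtain n where "r <= real n" using real_arch_simple by auto
  then have "ennreal r <= ennreal (real n)" by (rule ennreal_leI)
  then show ?thesis using real by auto
  qed (use that in auto)
  show ?thesis using z ex[of "fst z"] ex[of "snd z"] by (cases z) (auto simp: E_space_def strips_def simp del: ennreal_of_nat_eq_real_of_nat)
 qed
 moreover have "strips (real n) <= E_space" for n using strips_sets[of "real n"] by (simp add: sets_L_iff)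
 ultimately have "(\<Union>n. strips (real n)) = space La" unfolding space_L by auto
 with 1 show "EX A. countable A & A <= sets La & \<Union> A = space La & (ALL a:A. emeasure La a ~= \<infinity>)"
  by (intro exI[of _ "range (%n. strips (real n))"]) (auto simp: strips_sets)
qed

lemma AE_L:
 assumes P: "{z : space La. ~ P z} : sets La" and ae: "AE u in lborel. u : quad --> P (emb u)"
 shows "AE z in La. P z"
proof -
 have "emeasure La {z : space La. ~ P z} = (nn_integral lborel (%u. ennreal (dens u)*indicator {z : space La. ~ P z} (emb u)))"
  by (rule emeasure_L[OF P])
 also have "... = (nn_integral lborel (%(u :: real \<times> real). 0))"
  by (rule nn_integral_cong_AE) (use ae in eventually_elim, auto simp: dens_def indicator_def)
 finally show ?thesis using P by (subst AE_iff_measurable[OF _ refl]) auto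
qed

lemma AE_polar:
 assumes P: "{z : space La. ~ P z} : sets La" and ae: "AE z in lborel. z : quad --> P (polar z)"
 shows "AE z in La. P z"
proof -
 have "emeasure La {z : space La. ~ P z} = (nn_integral La (%z. indicator {z : space La. ~ P z} z))" using P by simp
 also have "... = (nn_integral lborel (%u. ennreal (pdens u)*indicator {z : space La. ~ P z} (polar u)))"
  using P by (intro nn_integral_polar) auto
 also have "... = (nn_integral lborel (%(u :: real \<times> real). 0))"
  by (rule nn_integral_cong_AE) (use ae in eventually_elim, auto simp: pdens_def apos_def quad_def indicator_def mem_Times_iff)
 finally show ?thesis using P by (subst AE_iff_measurable[OF _ refl]) auto
qed

lemma polar_le_iff:
 assumes "0 < x" "0 < t" "0 <= s"
 shows "fst (polar (x, t)) <= ennreal s \<longleftrightarrow> x <= s" "snd (polar (x, t)) <= ennreal s \<longleftrightarrow> x <= s/t"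
 using assms by (auto simp: polar_def emb_def field_simps)

lemma nn_integral_interval: "(nn_integral lborel (%x. pos x*indicator {..s} x)) = ennreal s" if "0 <= s" for s :: real
proof -
 have "(nn_integral lborel (%x. pos x*indicator {..s} x)) = (nn_integral lborel (%x. indicator {0<..s} x))"
  by (intro nn_integral_cong) (auto simp: indicator_def)
 then show ?thesis using that by simp
qed

text \<open>On a ray of slope \<open>t\<close> the condition u1 <= 1 cuts out x <= 1, so the first
  margin gives integral 1 for \<open>apos\<close>; the second margin cuts out x <= 1/t and gives
  integral 1 for \<open>apos t/t\<close>. Both identities hold with the same constant for every tail
  measure.\<close>

lemma nn_integral_apos: "(nn_integral lborel (%t. ennreal (apos t))) = 1"
proof -
 have m: "{..ennreal 1} \<times> UNIV : sets La"
  unfolding sets_L_iff borel_pt by (auto simp: E_space_def top_unique)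
 have "1 = emeasure La ({..ennreal 1} \<times> UNIV)" using L_margin(1)[of 1] by simp
 also have "... = (nn_integral lborel (%t. ennreal (apos t)*(nn_integral lborel (%x. pos x*indicator ({..ennreal 1} \<times> UNIV) (polar (x, t))))))"
  by (rule emeasure_polar[OF m])
 also have "... = (nn_integral lborel (%t. ennreal (apos t)))"
 proof (rule nn_integral_cong)
  fix t :: real
  show "ennreal (apos t)*(nn_integral lborel (%x. pos x*indicator ({..ennreal 1} \<times> UNIV) (polar (x, t)))) = ennreal (apos t)"
  proof (cases "0 < t")
  case True
  have "(nn_integral lborel (%x. pos x*indicator ({..ennreal 1} \<times> UNIV) (polar (x, t)))) = (nn_integral lborel (%(x::real). pos x*indicator {..1} x))"
  using polar_le_iff(1)[OF _ True, of _ 1] by (intro nn_integral_cong) (auto simp: indicator_def mem_Times_iff simp del: ennreal_1)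
  then show ?thesis using nn_integral_interval[of 1] by simp
  qed (simp add: apos_def)
 qed
 finally show ?thesis ..
qed

lemma nn_integral_apos_div: "(nn_integral lborel (%t. ennreal (apos t/t))) = 1"
proof -
 have m: "UNIV \<times> {..ennreal 1} : sets La"
  unfolding sets_L_iff borel_pt by (auto simp: E_space_def top_unique)
 have "1 = emeasure La (UNIV \<times> {..ennreal 1})" using L_margin(2)[of 1] by simp
 also have "... = (nn_integral lborel (%t. ennreal (apos t)*(nn_integral lborel (%x. pos x*indicator (UNIV \<times> {..ennreal 1}) (polar (x, t))))))"
  by (rule emeasure_polar[OF m])
 also have "... = (nn_integral lborel (%t. ennreal (apos t/t)))"
 proof (rule nn_integral_cong)
  fix t :: real
  show "ennreal (apos t)*(nn_integral lborel (%x. pos x*indicator (UNIV \<times> {..ennreal 1}) (polar (x, t)))) = ennreal (apos t/t)"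
  proof (cases "0 < t")
  case True
  have "(nn_integral lborel (%x. pos x*indicator (UNIV \<times> {..ennreal 1}) (polar (x, t)))) = (nn_integral lborel (%x. pos x*indicator {..1/t} x))"
  using polar_le_iff(2)[OF _ True, of _ 1] by (intro nn_integral_cong) (auto simp: indicator_def mem_Times_iff simp del: ennreal_1)
  also have "... = ennreal (1/t)" using nn_integral_interval[of "1/t"] True by simp
  finally show ?thesis using True by (simp add: ennreal_mult[symmetric] apos_nonneg)
  qed (simp add: apos_def)
 qed
 finally show ?thesis ..
qed

lemma apos_integrable: "integrable lborel apos" "(LBINT t. apos t) = 1"
 "intb (%t. apos t/t)" "(LBINT t. apos t/t) = 1"
proof -
 have d0: "0 <= apos t/t" for t by (auto simp: apos_def a_nonneg)
 show i: "integrable lborel apos" by (rule integrableI_bounded) (use nn_integral_apos apos_nonneg in auto)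
 show j: "intb (%t. apos t/t)"
 proof (rule integrableI_bounded)
  have "(nn_integral lborel (%t. ennreal (norm (apos t/t)))) = (nn_integral lborel (%t. ennreal (apos t/t)))"
  using d0 by (intro nn_integral_cong) (simp only: real_norm_def abs_of_nonneg)
  then show "(nn_integral lborel (%t. ennreal (norm (apos t/t)))) < \<infinity>" using nn_integral_apos_div by simp
 qed simp
 show "(LBINT t. apos t) = 1" using nn_integral_apos apos_nonneg by (simp add: integral_eq_nn_integral)
 show "(LBINT t. apos t/t) = 1" using nn_integral_apos_div d0 by (simp add: integral_eq_nn_integral)
qed

text \<open>The square root of the density makes this an L2 isometry into Lebesgue measure on the
  plane of pairs (x, t).\<close>

definition kern :: "(pt => real) => real \<times> real => real" where
 "kern h z = h (polar z) * sqrt (pdens z)"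

lemma kern_measurable: "h : meas La ==> kern h : meas borel"
 unfolding kern_def[abs_def]
 by (intro borel_measurable_times mcomp[OF polar_measurable_L] mcomp[OF pdens_measurable borel_measurable_sqrt])

lemma nn_integral_kern:
 assumes h: "h : meas La"
 shows "(nn_integral La (%z. ennreal ((h z)^2))) = (nn_integral lborel (%z. ennreal ((kern h z)^2)))"
proof -
 have "(nn_integral La (%z. ennreal ((h z)^2))) = (nn_integral lborel (%z. ennreal (pdens z)*ennreal ((h (polar z))^2)))"
  using h by (intro nn_integral_polar) auto
 also have "... = (nn_integral lborel (%z. ennreal ((kern h z)^2)))"
  by (intro nn_integral_cong) (simp add: kern_def power_mult_distrib pdens_nonneg ennreal_mult mult.commute)
 finally show ?thesis .
qed

lemma integral_kern:
 assumes h: "h : meas La"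
 shows "(LINT z|La. (h z)^2) = (LBINT z. (kern h z)^2)"
 using nn_integral_kern[OF h] h kern_measurable[OF h] by (simp add: integral_eq_nn_integral)

lemma l2_le_kern: "l2_le La h c ==> l2_le lborel (kern h) c"
 using nn_integral_kern[OF l2_leD(1)] l2_leD[of La h c] kern_measurable[of h] by (intro l2_leI_nn) auto

lemma kern_integral: "kern (%z. (LINT s|muv. h s z)) z = (LINT s|muv. kern (h s) z)"
 by (simp add: kern_def)

end

section \<open>Substitutions and the boundary curve\<close>

lemma integrable_subst_pos:
 fixes g T T' :: "real => real"
 assumes A: "A : sets borel" and T: "bij_betw T A {0<..}"
  and der: "!!x. x : A ==> (T has_field_derivative T' x) (at x)"
  and m: "(%x. indicator A x*(abs (T' x)*g (T x))) : meas borel"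
  and g: "g : meas borel" "intb (%t. pos t*g t)"
 shows "intb (%x. indicator A x*(abs (T' x)*g (T x)))"
  "(LBINT x. indicator A x*(abs (T' x)*g (T x))) = (LBINT t. pos t*g t)"
proof -
 have Al: "A : sets lebesgue" using A by auto
 have gm: "(%t. pos t*g t) : meas lborel" using g(1) by measurable
 have mm: "(%x. indicator A x*(abs (T' x)*g (T x))) : meas lborel" using m by simp
 have gi: "g absolutely_integrable_on {0<..}"
  unfolding set_integrable_def using g(2) gm by (simp add: integrable_completion)
 have gv: "integral {0<..} g = (LBINT t. pos t*g t)"
  using set_lebesgue_integral_eq_integral(2)[OF gi] gm
  by (simp add: set_lebesgue_integral_def integral_completion)
 have inj: "inj_on T A" and im: "T ` A = {0<..}" using T by (auto simp: bij_betw_def)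
 have "(%x. abs (T' x)*g (T x)) absolutely_integrable_on A & integral A (%x. abs (T' x)*g (T x)) = integral {0<..} g"
  using has_absolute_integral_change_of_variables_1'[OF Al has_field_derivative_at_within[OF der] inj, of g "integral {0<..} g"] gi
  by (simp add: im)
 then have r: "(%x. abs (T' x)*g (T x)) absolutely_integrable_on A" "integral A (%x. abs (T' x)*g (T x)) = integral {0<..} g" by auto
 show "intb (%x. indicator A x*(abs (T' x)*g (T x)))"
  using r(1) mm unfolding set_integrable_def by (simp add: integrable_completion)
 show "(LBINT x. indicator A x*(abs (T' x)*g (T x))) = (LBINT t. pos t*g t)"
  using set_lebesgue_integral_eq_integral(2)[OF r(1)] r(2) gv mm
  by (simp add: set_lebesgue_integral_def integral_completion)
qed

text \<open>The measure dt/t is invariant under inversion.\<close>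

lemma integrable_inverse_subst:
 fixes F :: "real => real"
 assumes F: "F : meas borel" "intb (%t. pos t*(F t/t))"
 shows "intb (%x. pos x*(F (1/x)/x))"
  "(LBINT x. pos x*(F (1/x)/x)) = (LBINT t. pos t*(F t/t))"
proof -
 have bij: "bij_betw (%x::real. 1/x) {0<..} {0<..}"
  by (rule bij_betwI[where g = "%x. 1/x"]) auto
 have der: "((%x::real. 1/x) has_field_derivative-(1/x^2)) (at x)" if "x : {0<..}" for x :: real
  using that by (auto intro!: derivative_eq_intros simp: power2_eq_square)
 have eq: "pos x*(abs (- (1/x^2))*(F (1/x)/(1/x))) = pos x*(F (1/x)/x)" for x :: real
  by (cases "x = 0") (auto simp: power2_eq_square)
 have m: "(%x. pos x*(abs (- (1/x^2))*(F (1/x)/(1/x)))) : meas borel"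
  using F(1) by measurable
 show "intb (%x. pos x*(F (1/x)/x))"
  using integrable_subst_pos(1)[of "{0<..}" "%x. 1/x" "%x. - (1/x^2)" "%t. F t/t", OF _ bij der m _ F(2)] F(1) unfolding eq by simp
 show "(LBINT x. pos x*(F (1/x)/x)) = (LBINT t. pos t*(F t/t))"
  using integrable_subst_pos(2)[of "{0<..}" "%x. 1/x" "%x. - (1/x^2)" "%t. F t/t", OF _ bij der m _ F(2)] F(1) unfolding eq by simp
qed

lemma powr_add_le:
 assumes "0 <= x" "0 <= y" "1 <= (P::real)"
 shows "x powr P+y powr P <= (x+y) powr P"
proof (cases "x+y = 0")
 case False
 define s where "s = x+y"
 have s: "0 < s" using assms False by (simp add: s_def)
 have le: "(z/s) powr P <= z/s" if "0 <= z" "z <= s" for z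
  using that s assms(3) powr_mono'[of 1 P "z/s"] by (cases "z = 0") auto
 have "(x/s) powr P+(y/s) powr P <= x/s+y/s" using assms by (intro add_mono le) (auto simp: s_def)
 also have "... = 1" using s by (simp add: s_def add_divide_distrib[symmetric])
 finally have "(x powr P+y powr P)/s powr P <= 1" using assms s by (simp add: powr_divide add_divide_distrib)
 then show ?thesis using s by (simp add: s_def divide_le_eq_1)
next
 case True
 then have "x = 0" "y = 0" using assms by auto
 then show ?thesis using assms by simp
qed

lemma enn2real_ge_1: "1 <= p ==> p ~= top ==> 1 <= enn2real p"
 using enn2real_mono[of 1 p] by (simp add: less_top)

lemma Lp_norm_bounds:
 assumes p: "1 <= p" and "0 <= x" "0 <= y"
 shows "max x y <= Lp_norm p (x, y)" "Lp_norm p (x, y) <= x+y"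
proof -
 have "max x y <= Lp_norm p (x, y) & Lp_norm p (x, y) <= x+y"
 proof (cases "p = top")
  case True then show ?thesis using assms by (auto simp: Lp_norm_def)
 next
  case False
  define P where "P = enn2real p"
  have P: "1 <= P" unfolding P_def by (rule enn2real_ge_1[OF p False])
  have eq: "Lp_norm p (x, y) = (x powr P+y powr P) powr (1/P)" using assms False by (simp add: Lp_norm_def P_def)
  have root: "(z powr P) powr (1/P) = z" if "0 <= z" for z using that P by (simp add: powr_powr)
  have "(x powr P+y powr P) powr (1/P) <= ((x+y) powr P) powr (1/P)"
  using powr_add_le[of x y P] assms P by (intro powr_mono2) auto
  then have 1: "Lp_norm p (x, y) <= x+y" using eq root[of "x+y"] assms by simp
  have "(x powr P) powr (1/P) <= (x powr P+y powr P) powr (1/P)" "(y powr P) powr (1/P) <= (x powr P+y powr P) powr (1/P)"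
  using P by (auto intro!: powr_mono2)
  then show ?thesis using 1 eq root assms by simp
 qed
 then show "max x y <= Lp_norm p (x, y)" "Lp_norm p (x, y) <= x+y" by auto
qed

lemma Lp_norm_scale:
 assumes "1 <= p" "0 < c" "0 <= x" "0 <= y"
 shows "Lp_norm p (c*x, c*y) = c*Lp_norm p (x, y)"
proof (cases "p = top")
 case True then show ?thesis using assms by (auto simp: Lp_norm_def abs_mult max_mult_distrib_left)
next
 case False
 have P: "1 <= enn2real p" by (rule enn2real_ge_1) fact+
 have "(c powr enn2real p*(x powr enn2real p+y powr enn2real p)) powr (1/enn2real p)
  = c*(x powr enn2real p+y powr enn2real p) powr (1/enn2real p)"
  using assms P by (subst powr_mult) (auto simp: powr_powr)
 then show ?thesis using assms False by (simp add: Lp_norm_def powr_mult distrib_left)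
qed

lemma Lp_norm_measurable[measurable]: "(%z. Lp_norm p z) : meas (borel |*| borel)"
 unfolding Lp_norm_def[abs_def] by (cases "p = top"; simp; measurable)

text \<open>The abscissa \<open>x_p\<close> as a function of the slope instead of the angle: the ray
  of slope \<open>t\<close> leaves the angular region at this x.\<close>

definition Xp :: "ennreal => real => real" where
 "Xp p t = Lp_norm p (1, 1/t)"

lemma Xp_bounds: "1 <= p ==> 0 < t ==> 1 <= Xp p t" "1 <= p ==> 0 < t ==> Xp p t <= 1+1/t"
 "1 <= p ==> 0 < t ==> 1/t <= Xp p t"
 using Lp_norm_bounds[of p 1 "1/t"] by (auto simp: Xp_def)

lemma Xp_measurable[measurable]: "Xp p : meas borel"
 unfolding Xp_def[abs_def] by measurable

lemma x_p_eq: "0 < th ==> th < pi/2 ==> x_p p th = Xp p (tan th)"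
 by (simp add: x_p_def Xp_def cot_altdef inverse_eq_divide)

text \<open>The curve \<open>y = y\<^sub>p(x)\<close> in the slope coordinate \<open>t = y / x\<close>.\<close>

definition slope :: "real => real => real" where
 "slope P x = (x powr P-1) powr (- 1/P)"

lemma powr_gt_one: "1 < x ==> 1 <= P ==> 1 < x powr P" for x P :: real
 using powr_less_mono[of 0 P x] by simp

lemma y_real_slope:
 assumes "1 <= p" "p ~= top" "1 < x"
 shows "y_real p x = x * slope (enn2real p) x"
proof -
 define P where "P = enn2real p"
 have P: "1 <= P" unfolding P_def by (rule enn2real_ge_1) fact+
 define w where "w = x powr P-1"
 have w: "0 < w" using powr_gt_one[OF assms(3) P] by (simp add: w_def)
 have "1+1/w = x powr P/w" using w by (simp add: w_def field_simps)
 then have "y_real p x = (x powr P/w) powr (1/P)" by (simp add: y_real_def w_def P_def)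
 also have "... = x/w powr (1/P)" using w assms P by (simp add: powr_divide powr_powr)
 also have "... = x * slope P x" by (simp add: slope_def w_def powr_minus_divide)
 finally show ?thesis by (simp add: P_def)
qed

lemma slope_pos: "1 < x ==> 1 <= P ==> 0 < slope P x"
 using powr_gt_one[of x P] by (simp add: slope_def)

lemma slope_deriv:
 assumes "1 <= P" "1 < x"
 shows "(slope P has_field_derivative-(x powr (P-1)*(x powr P-1) powr (- 1/P-1))) (at x)"
 unfolding slope_def[abs_def] using powr_gt_one[OF assms(2,1)] assms
 by (auto intro!: derivative_eq_intros simp: field_simps)

lemma y_real_deriv:
 assumes "1 <= p" "p ~= top" "1 < x"
 shows "deriv (y_real p) x = - ((x powr enn2real p-1) powr (- 1/enn2real p-1))"
proof -
 define P where "P = enn2real p"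
 have P: "1 <= P" unfolding P_def by (rule enn2real_ge_1) fact+
 define w where "w = x powr P-1"
 have w: "0 < w" using powr_gt_one[OF assms(3) P] by (simp add: w_def)
 have xp: "x*x powr (P-1) = w+1" using assms(3) by (simp add: w_def powr_diff)
 have "((%x. x * slope P x) has_field_derivative 1 * slope P x + - (x powr (P-1)*w powr (- 1/P-1))*x) (at x)"
  unfolding w_def by (rule DERIV_mult'[OF DERIV_ident slope_deriv[OF P assms(3)], THEN DERIV_cong]) simp
 moreover have "1 * slope P x + - (x powr (P-1)*w powr (- 1/P-1))*x = - (w powr (- 1/P-1))"
 proof -
  have "slope P x = w*w powr (- 1/P-1)" using w by (simp add: slope_def w_def[symmetric] powr_diff)
  moreover have "x powr (P-1)*w powr (- 1/P-1)*x = (w+1)*w powr (- 1/P-1)" using xp by (simp add: ac_simps)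
  ultimately show ?thesis by (simp add: algebra_simps)
 qed
 ultimately have "((%x. x * slope P x) has_field_derivative-(w powr (- 1/P-1))) (at x)" by simp
 then have "(y_real p has_field_derivative-(w powr (- 1/P-1))) (at x)"
  by (rule has_field_derivative_transform_within_open[of _ _ _ "{1<..}"]) (use assms in \<open>auto simp: y_real_slope P_def\<close>)
 then show ?thesis by (simp add: DERIV_imp_deriv w_def P_def)
qed

text \<open>Each ray meets the curve exactly once, so slopes parametrize it; the inverse solves x^P
  = 1 + t^(-P).\<close>

lemma slope_bij: "1 <= P ==> bij_betw (slope P) {1<..} {0<..}"
proof (rule bij_betwI[where g = "%t. (1+t powr (- P)) powr (1/P)"])
 assume P: "1 <= P"
 show "slope P : {1<..} \<rightarrow> {0<..}" using slope_pos[OF _ P] by auto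
 show "(%t. (1+t powr (- P)) powr (1/P)) : {0<..} \<rightarrow> {1<..}"
  using P by (auto intro!: gr_one_powr)
 show "(1+slope P x powr (- P)) powr (1/P) = x" if "x : {1<..}" for x
 proof -
  have "1 < x powr P" using that by (intro powr_gt_one P) auto
  then have "abs (x powr P-1) = x powr P-1" by simp
  then show ?thesis using that P by (simp add: slope_def powr_powr)
 qed
 show "slope P ((1+t powr (- P)) powr (1/P)) = t" if "t : {0<..}" for t
  using that P by (simp add: slope_def powr_powr)
qed

lemma y_real_ge_1: "1 <= p ==> p ~= top ==> 1 < x ==> 1 <= y_real p x"
 unfolding y_real_def using enn2real_ge_1[of p] powr_gt_one[of x "enn2real p"]
 by (intro ge_one_powr_ge_zero) (auto intro: less_imp_le)

lemma y_real_measurable[measurable]: "y_real p : meas borel"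
 unfolding y_real_def[abs_def] by measurable

text \<open>The left side is, up to sqrt 2, the L2 size of W1(x) y'(x) - W2(y(x)) divided by x, the
  factor of homogeneity. On the right stands the Jacobian of the slope times 1 + 1/t, so integrals
  over the curve become integrals over slopes.\<close>

lemma curve_weight_le:
 assumes p: "1 <= p" "p ~= top" and x: "1 < x"
 defines "P \<equiv> enn2real p"
 shows "(sqrt x*abs (deriv (y_real p) x)+sqrt (y_real p x))/x
  <= 2*(abs (- (x powr (P-1)*(x powr P-1) powr (- 1/P-1)))*(1+1/slope P x))"
proof -
 have P: "1 <= P" unfolding P_def by (rule enn2real_ge_1) fact+
 define w where "w = x powr P-1"
 have w: "0 < w" using powr_gt_one[OF x P] by (simp add: w_def)
 define d where "d = w powr (- 1/P-1)"
 have d: "0 < d" using w by (simp add: d_def)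
 define T where "T = slope P x"
 have T: "0 < T" unfolding T_def by (rule slope_pos[OF x P])
 \<comment> \<open>In terms of w = x^P - 1 the slope is w^(-1/P) and |y'| is w^(-1/P - 1).\<close>
 have Td: "T = w*d" using w by (simp add: T_def slope_def w_def[symmetric] d_def powr_diff)
 have dy: "abs (deriv (y_real p) x) = d" using y_real_deriv[OF p x] d by (simp add: P_def w_def d_def)
 have xp1: "1 <= x powr (P-1)" using x P by (intro ge_one_powr_ge_zero) auto
 have xp: "x*x powr (P-1) = w+1" using x by (simp add: w_def powr_diff)
 have R: "abs (- (x powr (P-1)*(x powr P-1) powr (- 1/P-1))) = x powr (P-1)*d"
  unfolding w_def[symmetric] d_def[symmetric] using d by (simp add: abs_mult)
 have t1: "sqrt x*d/x <= x powr (P-1)*d*(1+1/T)"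
 proof -
  have "sqrt x/x <= 1" using x real_sqrt_le_mono[of x "x^2"] by (simp add: power2_eq_square)
  then have "sqrt x/x*d <= 1*d" using d by (intro mult_right_mono) auto
  also have "... <= x powr (P-1)*d" using xp1 d by (intro mult_right_mono) auto
  also have "... <= x powr (P-1)*d*(1+1/T)"
  proof -
  have "x powr (P-1)*d*1 <= x powr (P-1)*d*(1+1/T)" using d xp1 T by (intro mult_left_mono) auto
  then show ?thesis by simp
  qed
  finally show ?thesis by simp
 qed
 have y1: "1 <= y_real p x" by (rule y_real_ge_1[OF p x])
 have "y_real p x <= 1+1/w"
 proof -
  have "(1+1/w) powr (1/P) <= (1+1/w) powr 1" using w P by (intro powr_mono) auto
  then show ?thesis using w by (simp add: y_real_def w_def P_def)
 qed
 moreover have "sqrt (y_real p x) <= y_real p x" using y1 real_sqrt_le_mono[of "y_real p x" "(y_real p x)^2"] by (simp add: power2_eq_square)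
 ultimately have "sqrt (y_real p x) <= 1+1/w" by linarith
 then have "sqrt (y_real p x)/x <= (1+1/w)/x" using x by (intro divide_right_mono) auto
 also have "... = x powr (P-1)*d*(1/T)"
 proof -
  have "x powr (P-1) = (w+1)/x" using xp x by (simp add: field_simps)
  then show ?thesis using w d x unfolding Td by (simp add: field_simps)
 qed
 also have "... <= x powr (P-1)*d*(1+1/T)" using d xp1 by (intro mult_left_mono) auto
 finally have t2: "sqrt (y_real p x)/x <= x powr (P-1)*d*(1+1/T)" .
 show ?thesis unfolding R dy T_def[symmetric] using t1 t2 by (simp add: add_divide_distrib)
qed

text \<open>The right-hand side is the weighted integral by which two tail measures are compared.
  Taking \<open>F\<close> as a sum of densities or as their absolute difference, one estimate serves
  for the size of the boundary term and for its modulus of continuity.\<close>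

lemma curve_integral_le:
 assumes p: "1 <= p" "p ~= top" and F: "F : meas borel" "!!t. 0 < t ==> 0 <= F t"
  "intb (%t. pos t*(F t*(1+1/t)))"
 defines "J \<equiv> %x. indicator {1<..} x*(F (y_real p x/x)/x*(sqrt x*abs (deriv (y_real p) x)+sqrt (y_real p x)))"
 shows "integrable lborel J" "(LBINT x. J x) <= 2*(LBINT t. pos t*(F t*(1+1/t)))"
proof -
 define P where "P = enn2real p"
 have P: "1 <= P" unfolding P_def by (rule enn2real_ge_1) fact+
 define T' where "T' x = - (x powr (P-1)*(x powr P-1) powr (- 1/P-1))" for x
 let ?G = "%x. indicator {1<..} x*(abs (T' x)*(F (slope P x)*(1+1/slope P x)))"
 have sm[measurable]: "slope P : meas borel" unfolding slope_def[abs_def] by measurable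
 have Tm[measurable]: "T' : meas borel" unfolding T'_def[abs_def] by measurable
 note F(1)[measurable]
 have Gm: "?G : meas borel" by measurable
 have gm: "(%t. F t*(1+1/t)) : meas borel" by measurable
 have Gi: "integrable lborel ?G" and Gv: "(LBINT x. ?G x) = (LBINT t. pos t*(F t*(1+1/t)))"
  using integrable_subst_pos[OF _ slope_bij[OF P] _ Gm gm F(3)] slope_deriv[OF P] by (auto simp: T'_def)
 have Jeq: "J x = indicator {1<..} x*(F (slope P x)*((sqrt x*abs ((x powr P-1) powr (- 1/P-1))+sqrt (y_real p x))/x))" for x
  using y_real_slope[OF p, of x] y_real_deriv[OF p, of x] by (auto simp: J_def P_def indicator_def)
 have Jm: "J : meas borel" unfolding Jeq[abs_def] by measurable
 have le: "0 <= J x" "J x <= 2 * ?G x" for x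
 proof -
  have "0 <= J x & J x <= 2 * ?G x"
  proof (cases "1 < x")
  case True
  have F0: "0 <= F (slope P x)" by (rule F(2)[OF slope_pos[OF True P]])
  have eq: "J x = F (slope P x)*((sqrt x*abs (deriv (y_real p) x)+sqrt (y_real p x))/x)"
  using y_real_slope[OF p True] True by (simp add: J_def P_def)
  have "0 <= J x" unfolding eq using F0 True y_real_ge_1[OF p True] by (intro mult_nonneg_nonneg divide_nonneg_pos add_nonneg_nonneg) auto
  moreover have "J x <= F (slope P x)*(2*(abs (T' x)*(1+1/slope P x)))"
  unfolding eq T'_def P_def by (intro mult_left_mono curve_weight_le p True F0[unfolded P_def])
  moreover have "... = 2 * ?G x" using True by simp
  ultimately show ?thesis by simp
  qed (auto simp: J_def)
  then show "0 <= J x" "J x <= 2 * ?G x" by auto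
 qed
 show Ji: "integrable lborel J"
  by (rule lint_bound[OF integrable_mult_right[OF Gi, of 2]])
  (use Jm le in \<open>auto intro!: AE_I2 order_trans[OF _ abs_ge_self]\<close>)
 have "(LBINT x. J x) <= (LBINT x. 2 * ?G x)"
  using Ji Gi le by (intro integral_mono) auto
 also have "... = 2*(LBINT x. ?G x)" by (rule integral_mult_right_zero)
 finally show "(LBINT x. J x) <= 2*(LBINT t. pos t*(F t*(1+1/t)))" unfolding Gv .
qed

text \<open>Each hinge is convex with left slope \<open>of_bool (k t < s)\<close>. Hence the
  difference quotient between \<open>s\<close> and \<open>u\<close> lies between D(s) and D(u), and
  \<open>D\<close> is continuous at \<open>s\<close> because the level k = s carries no
  mass.\<close>

lemma hinge_deriv:
 fixes a k :: "real => real"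
 assumes a: "integrable lborel a" "!!t. 0 <= a t" and k: "k : meas borel" "!!t. 0 <= k t" and s: "0 < s"
  and ne: "AE t in lborel. a t ~= 0 --> k t ~= s"
 shows "((%s. (LBINT t. a t*max 0 (s-k t))) has_real_derivative (LBINT t. a t * of_bool (k t < s))) (at s)"
proof -
 define f where "f s = (LBINT t. a t*max 0 (s-k t))" for s
 define D where "D s = (LBINT t. a t * of_bool (k t < s))" for s
 note k(1)[measurable]
 have am[measurable]: "a : meas borel" using a(1) by auto
 have fi: "intb (%t. a t*max 0 (s-k t))" for s
  by (rule lint_bound[OF integrable_mult_left[OF a(1), of "abs s"]])
  (auto simp: abs_mult intro!: AE_I2 mult_left_mono, smt (verit) k(2))
 have Di: "intb (%t. a t * of_bool (k t < s))" for s
  by (rule lint_bound[OF a(1)]) (auto intro!: AE_I2)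
 have diff: "(u-s)*D s <= f u-f s" for s u
 proof -
  have "(u-s)*D s = (LBINT t. (u-s)*(a t * of_bool (k t < s)))" unfolding D_def by simp
  also have "... <= (LBINT t. a t*max 0 (u-k t)-a t*max 0 (s-k t))"
  proof (rule integral_mono)
  fix t
  have "(u-s) * of_bool (k t < s) <= max 0 (u-k t) - max 0 (s-k t)" by (auto simp: max_def)
  then have "a t*((u-s) * of_bool (k t < s)) <= a t*(max 0 (u-k t) - max 0 (s-k t))" by (rule mult_left_mono) (rule a(2))
  then show "(u-s)*(a t * of_bool (k t < s)) <= a t*max 0 (u-k t)-a t*max 0 (s-k t)" by (simp add: algebra_simps)
  qed (use fi Di in auto)
  also have "... = f u-f s" unfolding f_def by (rule lint_diff[OF fi fi])
  finally show ?thesis .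
 qed
 have Dlim: "(D ---> D s) (at s)"
  unfolding tendsto_at_iff_sequentially comp_def
 proof (intro allI impI)
  fix x assume x: "x ----> s"
  show "(%n. D (x n)) ----> D s"
  unfolding D_def
  proof (rule integral_dominated_convergence[where w = a])
  show "AE t in lborel. (%n. a t * of_bool (k t < x n)) ----> a t * of_bool (k t < s)"
  using ne
  proof eventually_elim
  case (elim t)
  show ?case
  proof (cases "a t = 0")
  case False
  then have "k t < s | s < k t" using elim by auto
  then have "\<forall>\<^sub>F n in sequentially. (k t < x n) = (k t < s)"
  proof
  assume "k t < s" then show ?thesis using order_tendstoD(1)[OF x] by (auto elim: eventually_mono)
  next
  assume "s < k t" then show ?thesis by (intro eventually_mono[OF order_tendstoD(2)[OF x \<open>s < k t\<close>]]) auto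
  qed
  then have "\<forall>\<^sub>F n in sequentially. a t * of_bool (k t < x n) = a t * of_bool (k t < s)" by eventually_elim simp
  then show ?thesis by (rule tendsto_eventually)
  qed simp
  qed
  show "AE t in lborel. norm (a t * of_bool (k t < x n)) <= a t" for n using a(2) by (auto intro!: AE_I2)
  qed (use a in auto)
 qed
 have lim: "((%u. abs (D u-D s)) ---> 0) (at s)" using tendsto_rabs[OF LIM_zero[OF Dlim]] by simp
 have "((%u. (f u-f s)/(u-s)-D s) ---> 0) (at s)"
 proof (rule Lim_null_comparison[OF _ lim])
  have "norm ((f u-f s)/(u-s)-D s) <= abs (D u-D s)" if "u ~= s" for u
  proof -
  have 1: "(u-s)*D s <= f u-f s" "f u-f s <= (u-s)*D u" using diff[of u s] diff[of s u] by (auto simp: algebra_simps)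
  have eq: "(f u-f s)/(u-s)-D s = (f u-f s-(u-s)*D s)/(u-s)" using that by (simp add: field_simps)
  have "abs (f u-f s-(u-s)*D s) <= abs ((u-s)*(D u-D s))" using 1 by (simp add: algebra_simps)
  then show ?thesis unfolding eq using that by (simp add: abs_mult divide_le_eq mult.commute)
  qed
  then show "\<forall>\<^sub>F u in at s. norm ((f u-f s)/(u-s)-D s) <= abs (D u-D s)" by (auto simp: eventually_at_filter)
 qed
 then have "((%u. (f u-f s)/(u-s)) ---> D s) (at s)" by (rule LIM_zero_cancel)
 then show ?thesis unfolding has_field_derivative_iff f_def D_def .
qed

lemma arctan_ext_ennreal: "0 <= t ==> arctan_ext (ennreal t) = arctan t"
 by (simp add: arctan_ext_def)

section \<open>Decay of the density and the stable tail dependence function\<close>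

context smooth_tail
begin

lemma l_x1: "0 < x ==> l (x, 1) = apos (1/x)/x"
 using l_ray[of x "1/x"] by (simp add: apos_def)

text \<open>Continuity bounds \<open>l\<close> on the segments {1} x [0, 1] and [0, 1] x {1}; by
  homogeneity the second one describes \<open>a\<close> at infinity, where it yields decay of order
  1/t.\<close>

lemma apos_bound: "EX C>=0. ALL t. apos t <= C/(1+abs t)"
proof -
 have c1: "continuous_on {0..1} a" by (rule continuous_on_subset[OF a_cont]) auto
 obtain C1 where "ALL y:a ` {0..1}. norm y <= C1"
  using compact_imp_bounded[OF compact_continuous_image[OF c1 compact_Icc]] unfolding bounded_iff by blast
 then have C1: "!!t. t : {0..1} ==> norm (a t) <= C1" by auto
 have c2: "continuous_on {0..1} (%x. l (x, 1))"
  by (rule continuous_on_compose2[OF l_cont]) (auto intro!: continuous_intros)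
 obtain C2 where "ALL y:(%x. l (x, 1)) ` {0..1}. norm y <= C2"
  using compact_imp_bounded[OF compact_continuous_image[OF c2 compact_Icc]] unfolding bounded_iff by blast
 then have C2: "!!t. t : {0..1} ==> norm (l (t, 1)) <= C2" by auto
 define C where "C = 2*(abs C1+abs C2)"
 have "apos t <= C/(1+abs t)" for t
 proof -
  consider "t <= 0" | "0 < t" "t <= 1" | "1 < t" by linarith
  then show ?thesis
  proof cases
  case 1 then show ?thesis by (simp add: apos_def C_def)
  next
  case 2
  have "a t*(1+t) <= abs C1*2" using C1[of t] 2 by (intro mult_mono) auto
  also have "... <= C" by (simp add: C_def)
  finally show ?thesis using 2 by (simp add: apos_def field_simps)
  next
  case 3
  have "l (1/t, 1) = a t*t" using l_x1[of "1/t"] 3 by (simp add: apos_def)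
  then have "a t*t <= abs C2" using C2[of "1/t"] 3 by auto
  moreover have "a t*1 <= a t*t" using a_nonneg[of t] 3 by (intro mult_left_mono) auto
  ultimately have "a t*(1+t) <= C" unfolding C_def by (simp add: algebra_simps)
  then show ?thesis using 3 by (simp add: apos_def field_simps)
  qed
 qed
 moreover have "0 <= C" by (simp add: C_def)
 ultimately show ?thesis by auto
qed

text \<open>The product a(t) t converges to l(0, 1) by continuity at the axis. A positive limit
  would make \<open>a\<close> decay no faster than 1/t, against its integral 1; so the density
  vanishes at (0, 1).\<close>

lemma apos_mult_tendsto: "((%t. apos t*t) ---> 0) at_top"
proof -
 have c2: "continuous_on {0..} (%x. l (x, 1))"
  by (rule continuous_on_compose2[OF l_cont]) (auto intro!: continuous_intros)
 define L where "L = l (0, 1)"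
 have L0: "0 <= L" unfolding L_def by (rule l_nonneg) auto
 have inv: "filterlim (%t::real. 1/t) (at 0 within {0..}) at_top"
  unfolding filterlim_at
  by (intro conjI eventually_at_top_linorderI[of 1]) (auto, real_asymp)
 have "((%x. l (x, 1)) ---> L) (at 0 within {0..})" using c2 unfolding L_def continuous_on_def by auto
 from filterlim_compose[OF this inv] have lim: "((%t. l (1/t, 1)) ---> L) at_top" .
 have ev: "\<forall>\<^sub>F t in at_top. l (1/t, 1) = apos t*t"
  by (rule eventually_at_top_linorderI[of 1]) (use l_x1 in auto)
 have lim2: "((%t. apos t*t) ---> L) at_top" using lim ev by (simp add: tendsto_cong)
 have "L = 0"
 proof (rule ccontr)
  assume "L ~= 0" then have L: "0 < L" using L0 by simp
  have "\<forall>\<^sub>F t in at_top. L/2 < apos t*t" using order_tendstoD(1)[OF lim2, of "L/2"] L by simp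
  then obtain t0 where t0: "!!t. t >= t0 ==> L/2 < apos t*t" by (auto simp: eventually_at_top_linorder)
  define u where "u = max 1 t0"
  have "u >= 1" "!!t. t >= u ==> L/2 < apos t*t" using t0 by (auto simp: u_def)
  \<comment> \<open>The mass of the slopes in [u, y] is at least (L/2) log (y/u), which is unbounded
    in y.\<close>
  have bnd: "L/2*ln y <= 1+L/2*ln u" if y: "u <= y" for y
  proof -
  have "ennreal (L/2*ln y-L/2*ln u) = (nn_integral lborel (%t. ennreal (L/2/t)*indicator {u..y} t))"
  using y \<open>u >= 1\<close> L
  by (intro nn_integral_FTC_Icc[where F = "%t. L/2*ln t", symmetric]) (auto intro!: derivative_eq_intros)
  also have "... <= (nn_integral lborel (%t. ennreal (apos t)))"
  proof (intro nn_integral_mono)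
  fix t
  show "ennreal (L/2/t)*indicator {u..y} t <= ennreal (apos t)"
  proof (cases "t : {u..y}")
  case True
  then have "L/2 < apos t*t" "0 < t" using \<open>!!t. t >= u ==> L / 2 < apos t * t\<close> \<open>u >= 1\<close> by auto
  then have "L/2/t <= apos t" by (simp add: field_simps)
  then show ?thesis using True by (simp add: ennreal_leI)
  qed simp
  qed
  also have "... = ennreal 1" using nn_integral_apos by simp
  finally show ?thesis by (subst (asm) ennreal_le_iff) auto
  qed
  have "filterlim (%y::real. L/2*ln y) at_top at_top"
  using L by (intro filterlim_tendsto_pos_mult_at_top[OF tendsto_const _ ln_at_top]) auto
  then have "\<forall>\<^sub>F y in at_top. 1+L/2*ln u < L/2*ln y" by (rule filterlim_at_top_dense[THEN iffD1, rule_format])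
  moreover have "\<forall>\<^sub>F y in at_top. u <= y" by (rule eventually_ge_at_top)
  ultimately have "\<forall>\<^sub>F y::real in at_top. False" by eventually_elim (use bnd in fastforce)
  then show False by simp
 qed
 with lim2 show ?thesis by simp
qed

lemma A_set_sets: "A_set v : sets La"
proof -
 have "A_set v = ({..<top} \<times> {..<top}) Int ({..ennreal (fst v)} \<times> UNIV Un UNIV \<times> {..ennreal (snd v)})"
  by (auto simp: A_set_def)
 then show ?thesis unfolding sets_L_iff borel_pt by (auto simp: E_space_def)
qed

lemma apos_max_integrable: "intb (%t. apos t*max x (y/t))"
proof (rule lint_bound)
 show "intb (%t. abs x*apos t+abs y*(apos t/t))"
  by (intro lintegrable_add integrable_mult_right apos_integrable)
 show "AE t in lborel. norm (apos t*max x (y/t)) <= norm (abs x*apos t+abs y*(apos t/t))"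
 proof (rule AE_I2)
  fix t
  show "norm (apos t*max x (y/t)) <= norm (abs x*apos t+abs y*(apos t/t))"
  proof (cases "0 < t")
  case True
  have "abs (max x (y/t)) <= abs x+abs y/t" using True by (auto simp: max_def)
  then have "apos t*abs (max x (y/t)) <= apos t*(abs x+abs y/t)" by (rule mult_left_mono) (rule apos_nonneg)
  moreover have "0 <= apos t*(abs x+abs y/t)" using True apos_nonneg by (intro mult_nonneg_nonneg) auto
  ultimately show ?thesis by (simp add: abs_mult apos_nonneg algebra_simps)
  qed (simp add: apos_def)
 qed
qed simp

text \<open>The points of a ray of slope \<open>t\<close> inside \<open>A_set v\<close> are those
  with x up to the larger of v1 and v2/t.\<close>

lemma ell_of_eq:
 assumes "0 <= fst v" "0 <= snd v"
 shows "ell_of La v = (LBINT t. apos t*max (fst v) (snd v / t))"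
proof -
 have "emeasure La (A_set v) = (nn_integral lborel (%t. ennreal (apos t)*(nn_integral lborel (%x. pos x*indicator (A_set v) (polar (x, t))))))"
  by (rule emeasure_polar[OF A_set_sets])
 also have "... = (nn_integral lborel (%t. ennreal (apos t*max (fst v) (snd v / t))))"
 proof (rule nn_integral_cong)
  fix t :: real
  show "ennreal (apos t)*(nn_integral lborel (%x. pos x*indicator (A_set v) (polar (x, t)))) = ennreal (apos t*max (fst v) (snd v / t))"
  proof (cases "0 < t")
  case True
  have "(nn_integral lborel (%x. pos x*indicator (A_set v) (polar (x, t)))) = (nn_integral lborel (%(x::real). pos x*indicator {..max (fst v) (snd v / t)} x))"
  proof (rule nn_integral_cong)
  fix x :: real
  show "pos x*indicator (A_set v) (polar (x, t)) = (pos x*indicator {..max (fst v) (snd v / t)} x :: ennreal)"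
  proof (cases "0 < x")
  case x: True
  have "fst (polar (x, t)) < top" "snd (polar (x, t)) < top" by (auto simp: polar_def emb_def)
  then have "polar (x, t) : A_set v \<longleftrightarrow> x <= fst v | x <= snd v / t"
  using polar_le_iff[OF x True] assms by (auto simp: A_set_def mem_Times_iff)
  then show ?thesis by (auto simp: indicator_def le_max_iff_disj)
  qed simp
  qed
  also have "... = ennreal (max (fst v) (snd v / t))" using nn_integral_interval[of "max (fst v) (snd v / t)"] assms True by (simp add: le_max_iff_disj)
  finally show ?thesis using assms by (simp add: ennreal_mult[symmetric] apos_nonneg le_max_iff_disj)
  qed (simp add: apos_def)
 qed
 finally have "emeasure La (A_set v) = (nn_integral lborel (%t. ennreal (apos t*max (fst v) (snd v / t))))" .
 moreover have "0 <= apos t*max (fst v) (snd v / t)" for t using assms by (cases "0 < t") (auto simp: apos_def a_nonneg le_max_iff_disj)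
 ultimately show ?thesis unfolding ell_of_def measure_def by (subst integral_eq_nn_integral) auto
qed

lemma AE_ne_point: "AE t in lborel. t ~= (c::real)"
 using AE_lborel_singleton[of c] .

text \<open>From max s (c/t) = c/t + max 0 (s - c/t) the function is a constant plus an integrated
  hinge; ties occur for at most one positive slope and are null.\<close>

lemma ell_dot1_eq:
 assumes v: "0 < fst v" "0 <= snd v"
 shows "ell_dot1 La v = (LBINT t. apos t * of_bool (snd v < fst v * t))"
proof -
 define c where "c = snd v"
 define k where "k t = (if 0 < t then c/t else 0)" for t :: real
 have km: "k : meas borel" unfolding k_def[abs_def] by measurable
 have k0: "0 <= k t" for t using v by (auto simp: k_def c_def)
 have ne: "AE t in lborel. apos t ~= 0 --> k t ~= fst v"
  using AE_ne_point[of "c/fst v"] by eventually_elim (use v in \<open>auto simp: apos_def k_def field_simps\<close>)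
 have hd: "((%s. (LBINT t. apos t*max 0 (s-k t))) has_real_derivative (LBINT t. apos t * of_bool (k t < fst v))) (at (fst v))"
  by (rule hinge_deriv[OF apos_integrable(1) apos_nonneg km k0 v(1) ne])
 have "ell_of La (s, c) = c+(LBINT t. apos t*max 0 (s-k t))" if "0 < s" for s
 proof -
  have eq: "apos t*max s (c/t) = c*(apos t/t)+apos t*max 0 (s-k t)" for t
  by (auto simp: apos_def k_def max_def field_simps)
  have i: "intb (%t. apos t*max 0 (s-k t))"
  proof -
  have "intb (%t. apos t*max s (c/t) - c*(apos t/t))"
  by (intro Bochner_Integration.integrable_diff integrable_mult_right apos_max_integrable apos_integrable)
  then show ?thesis unfolding eq by simp
  qed
  have "ell_of La (s, c) = (LBINT t. c*(apos t/t)+apos t*max 0 (s-k t))"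
  using ell_of_eq[of "(s, c)"] that v by (simp add: c_def[symmetric] eq)
  also have "... = (LBINT t. c*(apos t/t))+(LBINT t. apos t*max 0 (s-k t))"
  by (intro lint_add integrable_mult_right apos_integrable i)
  also have "(LBINT t. c*(apos t/t)) = c" unfolding integral_mult_right_zero apos_integrable(4) by simp
  finally show ?thesis .
 qed
 then have "((%s. ell_of La (s, c)) has_real_derivative (LBINT t. apos t * of_bool (k t < fst v))) (at (fst v))"
 proof -
  assume eqs: "!!s. 0 < s ==> ell_of La (s, c) = c+(LBINT t. apos t*max 0 (s-k t))"
  have "((%s. c+(LBINT t. apos t*max 0 (s-k t))) has_real_derivative (LBINT t. apos t * of_bool (k t < fst v))) (at (fst v))"
  using DERIV_add[OF DERIV_const[of c] hd] by simp
  then show ?thesis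
  by (rule has_field_derivative_transform_within_open[of _ _ _ "{0<..}"]) (use v(1) in \<open>simp_all only: open_greaterThan greaterThan_iff eqs\<close>)
 qed
 then have "vector_derivative (%s. ell_of La (s, c)) (at (fst v)) = (LBINT t. apos t * of_bool (k t < fst v))"
  by (intro vector_derivative_at) (simp add: has_real_derivative_iff_has_vector_derivative)
 moreover have "apos t * of_bool (k t < fst v) = apos t * of_bool (snd v < fst v * t)" for t
  by (auto simp: apos_def k_def c_def field_simps)
 moreover have "at (fst v) within {0..} = at (fst v)"
  by (rule at_within_interior, rule interiorI[of "{0<..}"]) (use v(1) in auto)
 ultimately show ?thesis unfolding ell_dot1_def c_def[symmetric] by simp
qed

lemma ell_dot2_eq:
 assumes v: "0 <= fst v" "0 < snd v"
 shows "ell_dot2 La v = (LBINT t. apos t/t * of_bool (fst v * t < snd v))"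
proof -
 define c where "c = fst v"
 define k where "k t = (if 0 < t then c*t else 0)" for t :: real
 have km: "k : meas borel" unfolding k_def[abs_def] by measurable
 have k0: "0 <= k t" for t using v by (auto simp: k_def c_def)
 have d0: "0 <= apos t/t" for t by (auto simp: apos_def a_nonneg)
 have ne: "AE t in lborel. apos t/t ~= 0 --> k t ~= snd v"
  using AE_ne_point[of "snd v / c"] by eventually_elim (use v in \<open>cases "fst v = 0"; auto simp: apos_def k_def c_def field_simps\<close>)
 have hd: "((%s. (LBINT t. apos t/t*max 0 (s-k t))) has_real_derivative (LBINT t. apos t/t * of_bool (k t < snd v))) (at (snd v))"
  by (rule hinge_deriv[OF apos_integrable(3) d0 km k0 v(2) ne])
 have "ell_of La (c, s) = c+(LBINT t. apos t/t*max 0 (s-k t))" if "0 < s" for s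
 proof -
  have eq: "apos t*max c (s/t) = c*apos t+apos t/t*max 0 (s-k t)" for t
  by (auto simp: apos_def k_def max_def field_simps)
  have i: "intb (%t. apos t/t*max 0 (s-k t))"
  proof -
  have "intb (%t. apos t*max c (s/t) - c*apos t)"
  using apos_max_integrable[of c s] apos_integrable by auto
  then show ?thesis unfolding eq by simp
  qed
  have "ell_of La (c, s) = (LBINT t. c*apos t+apos t/t*max 0 (s-k t))"
  using ell_of_eq[of "(c, s)"] that v by (simp add: c_def[symmetric] eq)
  also have "... = (LBINT t. c*apos t)+(LBINT t. apos t/t*max 0 (s-k t))"
  by (intro lint_add integrable_mult_right apos_integrable i)
  also have "(LBINT t. c*apos t) = c" using apos_integrable(2) by simp
  finally show ?thesis .
 qed
 then have "((%s. ell_of La (c, s)) has_real_derivative (LBINT t. apos t/t * of_bool (k t < snd v))) (at (snd v))"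
 proof -
  assume eqs: "!!s. 0 < s ==> ell_of La (c, s) = c+(LBINT t. apos t/t*max 0 (s-k t))"
  have "((%s. c+(LBINT t. apos t/t*max 0 (s-k t))) has_real_derivative (LBINT t. apos t/t * of_bool (k t < snd v))) (at (snd v))"
  using DERIV_add[OF DERIV_const[of c] hd] by simp
  then show ?thesis
  by (rule has_field_derivative_transform_within_open[of _ _ _ "{0<..}"]) (use v(2) in \<open>simp_all only: open_greaterThan greaterThan_iff eqs\<close>)
 qed
 then have "vector_derivative (%s. ell_of La (c, s)) (at (snd v)) = (LBINT t. apos t/t * of_bool (k t < snd v))"
  by (intro vector_derivative_at) (simp add: has_real_derivative_iff_has_vector_derivative)
 moreover have "apos t/t * of_bool (k t < snd v) = apos t/t * of_bool (fst v * t < snd v)" for t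
  by (auto simp: apos_def k_def c_def field_simps)
 moreover have "at (snd v) within {0..} = at (snd v)"
  by (rule at_within_interior, rule interiorI[of "{0<..}"]) (use v(2) in auto)
 ultimately show ?thesis unfolding ell_dot2_def c_def[symmetric] by (simp only:)
qed

section \<open>The angular measure in slope coordinates\<close>

lemma angular_region_sets: "angular_region p : sets La"
proof -
 have "(%z::pt. Lp_norm p (enn2real (inverse (fst z)), enn2real (inverse (snd z)))) : meas (borel |*| borel)" by measurable
 then have "{z : space (borel |*| borel). 0 < fst z & 0 < snd z & 1 <= Lp_norm p (enn2real (inverse (fst z)), enn2real (inverse (snd z)))} : sets (borel |*| borel :: pt measure)"
  by measurable
 moreover have "{z : space (borel |*| borel). 0 < fst z & 0 < snd z & 1 <= Lp_norm p (enn2real (inverse (fst z)), enn2real (inverse (snd z)))} = angular_region p"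
  by (auto simp: angular_region_def space_pair_measure)
 ultimately have "angular_region p : sets borel" by (simp only: borel_pt)
 moreover have "angular_region p <= E_space"
  by (auto simp: angular_region_def E_space_def Lp_norm_def)
 ultimately show ?thesis by (simp add: sets_L_iff)
qed

lemma angle_measurable: "(%(x1, x2). arctan_ext (x2/x1)) : meas La"
proof -
 have "(%z::pt. arctan_ext (snd z/fst z)) : meas (borel |*| borel)"
  unfolding arctan_ext_def by measurable
 then have "(%(x1, x2). arctan_ext (x2/x1)) : meas (borel :: pt measure)"
  by (simp only: borel_pt case_prod_beta')
 then show ?thesis by (rule measurable_L)
qed

definition adens :: "ennreal => real => real" where
 "adens p t = apos t*Xp p t"

lemma adens_measurable[measurable]: "adens p : meas borel"
 unfolding adens_def[abs_def] by measurable

text \<open>By homogeneity of the norm the ray of slope \<open>t\<close> stays in the region exactly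
  up to x = \<open>Xp p t\<close>, so it carries the mass a(t) Xp(t).\<close>

lemma angular_measure_eq:
 assumes p: "1 <= p"
 shows "angular_measure p La = distr (density lborel (%t. ennreal (adens p t))) borel arctan"
proof (rule measure_eqI)
 fix B assume "B : sets (angular_measure p La)"
 then have B[measurable]: "B : sets borel" by (simp add: angular_measure_def)
 let ?f = "%(x1, x2). arctan_ext (x2/x1) :: real"
 have fm: "?f : meas (restrict_space La (angular_region p))"
  by (rule measurable_restrict_space1[OF angle_measurable])
 define S where "S = {z : angular_region p. ?f z : B}"
 have "?f -` B Int space La : sets La" by (rule measurable_sets[OF angle_measurable B])
 then have "?f -` B Int space La Int angular_region p : sets La" using angular_region_sets by auto
 moreover have "?f -` B Int space La Int angular_region p = S"
  unfolding S_def using sets.sets_into_space[OF angular_region_sets[of p]] by blast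
 ultimately have S: "S : sets La" by simp
 have sub: "space La Int angular_region p = angular_region p" using sets.sets_into_space[OF angular_region_sets] by auto
 have "emeasure (angular_measure p La) B = emeasure (restrict_space La (angular_region p)) (?f -` B Int space (restrict_space La (angular_region p)))"
  unfolding angular_measure_def using fm by (subst emeasure_distr) auto
 also have "?f -` B Int space (restrict_space La (angular_region p)) = S"
  unfolding space_restrict_space S_def using sub by blast
 also have "emeasure (restrict_space La (angular_region p)) S = emeasure La S"
  using angular_region_sets by (intro emeasure_restrict_space) (auto simp: S_def)
 also have "... = (nn_integral lborel (%t. ennreal (apos t)*(nn_integral lborel (%x. pos x*indicator S (polar (x, t))))))"
  by (rule emeasure_polar[OF S])
 also have "... = (nn_integral lborel (%t. ennreal (adens p t)*indicator B (arctan t)))"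
 proof (rule nn_integral_cong)
  fix t :: real
  show "ennreal (apos t)*(nn_integral lborel (%x. pos x*indicator S (polar (x, t)))) = ennreal (adens p t)*indicator B (arctan t)"
  proof (cases "0 < t")
  case True
  have "(nn_integral lborel (%x. pos x*indicator S (polar (x, t)))) = (nn_integral lborel (%(x::real). (pos x*indicator {..Xp p t} x)*indicator B (arctan t)))"
  proof (rule nn_integral_cong)
  fix x :: real
  show "pos x*indicator S (polar (x, t)) = ((pos x*indicator {..Xp p t} x)*indicator B (arctan t) :: ennreal)"
  proof (cases "0 < x")
  case x: True
  have pol: "polar (x, t) = (ennreal x, ennreal (x*t))" by (simp add: polar_def emb_def)
  have inv: "enn2real (inverse (ennreal x)) = 1/x*1" "enn2real (inverse (ennreal (x*t))) = 1/x*(1/t)"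
  using x True by (simp_all add: inverse_ennreal inverse_eq_divide)
  have "Lp_norm p (1/x*1, 1/x*(1/t)) = 1/x*Xp p t"
  unfolding Xp_def using x True by (intro Lp_norm_scale[OF p]) auto
  then have r: "polar (x, t) : angular_region p \<longleftrightarrow> x <= Xp p t"
  unfolding pol angular_region_def using x True inv by (simp add: le_divide_eq_1)
  have "ennreal (x*t)/ennreal x = ennreal t" using x True by (simp add: divide_ennreal)
  then have "?f (polar (x, t)) = arctan t" using True by (simp add: pol arctan_ext_ennreal)
  then have "polar (x, t) : S \<longleftrightarrow> x <= Xp p t & arctan t : B" using r by (simp add: S_def)
  then show ?thesis by (auto simp: indicator_def)
  qed simp
  qed
  also have "... = ennreal (Xp p t)*indicator B (arctan t)"
  using nn_integral_interval[of "Xp p t"] Xp_bounds(1)[OF p True] by (subst nn_integral_multc) auto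
  finally show ?thesis using Xp_bounds(1)[OF p True] by (simp add: adens_def ennreal_mult apos_nonneg mult.assoc)
  qed (simp add: apos_def adens_def)
 qed
 also have "... = emeasure (distr (density lborel (%t. ennreal (adens p t))) borel arctan) B"
 proof -
  have am: "arctan : meas borel" by measurable
  have v: "arctan -` B : sets borel" using measurable_sets[OF am B] by simp
  show ?thesis using v
  by (subst emeasure_distr, simp, simp, subst emeasure_density, simp, simp) (auto intro!: nn_integral_cong split: split_indicator)
 qed
 finally show "emeasure (angular_measure p La) B = emeasure (distr (density lborel (%t. ennreal (adens p t))) borel arctan) B" .
qed (simp add: angular_measure_def)

lemma adens_bounds:
 assumes "1 <= p"
 shows "0 <= adens p t" "apos t <= adens p t" "adens p t <= apos t+apos t/t"
proof -
 have "0 <= adens p t & apos t <= adens p t & adens p t <= apos t+apos t/t"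
 proof (cases "0 < t")
  case True
  have x: "1 <= Xp p t" "Xp p t <= 1+1/t" using Xp_bounds[OF assms True] by auto
  have "apos t*1 <= apos t*Xp p t" using x apos_nonneg by (intro mult_left_mono) auto
  moreover have "apos t*Xp p t <= apos t*(1+1/t)" using x apos_nonneg by (intro mult_left_mono) auto
  ultimately show ?thesis using apos_nonneg[of t] by (simp add: adens_def algebra_simps)
 qed (simp add: apos_def adens_def)
 then show "0 <= adens p t" "apos t <= adens p t" "adens p t <= apos t+apos t/t" by auto
qed

lemma adens_integrable: "1 <= p ==> intb (adens p)"
 by (rule lint_bound[OF lintegrable_add[OF apos_integrable(1,3)]])
  (use adens_bounds in \<open>auto intro!: AE_I2 order_trans[OF _ abs_ge_self]\<close>)

definition PhiT :: "ennreal => real" where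
 "PhiT p = (LBINT t. adens p t)"

text \<open>Combine 1 <= Xp <= 1 + 1/t with the two marginal integrals; the bounds are the same for
  all tail measures.\<close>

lemma PhiT_bounds: "1 <= p ==> 1 <= PhiT p" "1 <= p ==> PhiT p <= 2"
proof -
 assume p: "1 <= p"
 have "(LBINT t. apos t) <= PhiT p" unfolding PhiT_def
  by (intro integral_mono apos_integrable adens_integrable p adens_bounds)
 then show "1 <= PhiT p" using apos_integrable by simp
 have "PhiT p <= (LBINT t. apos t+apos t/t)" unfolding PhiT_def
  using apos_integrable by (intro integral_mono adens_integrable p adens_bounds) auto
 then show "PhiT p <= 2" using apos_integrable by simp
qed

lemma emeasure_angular:
 assumes p: "1 <= p" and B: "B : sets borel"
 shows "emeasure (angular_measure p La) B = ennreal (LBINT t. adens p t*indicator B (arctan t))"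
proof -
 have am: "arctan : meas borel" by measurable
 have v: "arctan -` B : sets borel" using measurable_sets[OF am B] by simp
 have ind: "indicator B (arctan t) = (indicator (arctan -` B) t :: real)" for t by (simp add: indicator_def)
 have i: "intb (%t. adens p t*indicator B (arctan t))"
  unfolding ind using v by (intro integrable_real_mult_indicator adens_integrable p) auto
 have "emeasure (angular_measure p La) B = (nn_integral lborel (%t. ennreal (adens p t)*indicator (arctan -` B) t))"
  unfolding angular_measure_eq[OF p] using v B
  by (subst emeasure_distr, simp, simp, subst emeasure_density, simp, simp) simp
 also have "... = (nn_integral lborel (%t. ennreal (adens p t*indicator B (arctan t))))"
  by (intro nn_integral_cong) (auto split: split_indicator)
 also have "... = ennreal (LBINT t. adens p t*indicator B (arctan t))"
  using i adens_bounds[OF p] by (intro nn_integral_eq_integral) auto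
 finally show ?thesis .
qed

lemma Phi_eq:
 assumes p: "1 <= p"
 shows "Phi p La th = (LBINT t. adens p t * of_bool (arctan t <= th))"
proof -
 have eq: "adens p t*indicator {0..th} (arctan t) = adens p t * of_bool (arctan t <= th)" for t
  by (cases "0 < t") (auto simp: adens_def apos_def indicator_def)
 have "0 <= (LBINT t. adens p t*indicator {0..th} (arctan t))" using adens_bounds[OF p] by (intro integral_nonneg_AE) auto
 then show ?thesis unfolding Phi_def measure_def using emeasure_angular[OF p, of "{0..th}"] by (simp add: eq)
qed

lemma Phi_total: "1 <= p ==> Phi p La (pi/2) = PhiT p"
 unfolding Phi_eq PhiT_def using arctan_ubound by (intro lint_cong) (auto simp: less_imp_le)

text \<open>The mass of slopes up to a variable bound is differentiated by the fundamental theorem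
  on a compact interval around tan th, where the density is continuous; the chain rule returns to
  the angle.\<close>

lemma Phi_deriv:
 assumes p: "1 <= p" and th: "0 < th" "th < pi/2"
 shows "(Phi p La has_real_derivative adens p (tan th)*(1+(tan th)^2)) (at th)"
proof -
 define u where "u = tan th"
 have u: "0 < u" unfolding u_def using th by (rule tan_gt_zero)
 have c: "continuous_on {u/2..2*u} (adens p)"
 proof -
  have 1: "continuous_on {u/2..2*u} a" by (rule continuous_on_subset[OF a_cont]) (use u in auto)
  have 2: "continuous_on {u/2..2*u} (Xp p)"
  unfolding Xp_def[abs_def] Lp_norm_def using u
  by (cases "p = top"; simp; intro continuous_intros; auto simp: add_nonneg_eq_0_iff)
  have "continuous_on {u/2..2*u} (%t. a t*Xp p t)" by (intro continuous_on_mult 1 2)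
  then show ?thesis by (rule continuous_on_eq) (use u in \<open>auto simp: adens_def apos_def\<close>)
 qed
 define g where "g x = (LBINT t. adens p t * of_bool (t <= x))" for x
 have gi: "intb (%t. adens p t * of_bool (t <= x))" for x
  by (rule lint_bound[OF adens_integrable[OF p]]) (auto intro!: AE_I2)
 have geq: "g x = g (u/2)+integral {u/2..x} (adens p)" if x: "x : {u/2..2*u}" for x
 proof -
  have s: "set_integrable lborel {u/2..x} (adens p)"
  by (rule borel_integrable_atLeastAtMost') (rule continuous_on_subset[OF c], use x in auto)
  have s': "set_integrable lborel {u/2<..x} (adens p)" by (rule set_integrable_subset[OF s]) auto
  have "(LINT t:{u/2<..x}|lborel. adens p t) = (LINT t:{u/2..x}|lborel. adens p t)"
  unfolding set_lebesgue_integral_def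
  by (rule integral_cong_AE) (use AE_ne_point[of "u/2"] in \<open>auto elim!: eventually_mono simp: indicator_def\<close>)
  moreover have "(LINT t:{u/2..x}|lborel. adens p t) = integral {u/2..x} (adens p)"
  using set_borel_integral_eq_integral[OF s] by simp
  moreover have "g x = (LBINT t. adens p t * of_bool (t <= u/2)+indicator {u/2<..x} t *\<^sub>R adens p t)"
  unfolding g_def by (intro lint_cong refl) (use x in \<open>auto simp: indicator_def\<close>)
  moreover have "... = g (u/2)+(LINT t:{u/2<..x}|lborel. adens p t)"
  unfolding g_def set_lebesgue_integral_def using gi s'[unfolded set_integrable_def] by (rule lint_add)
  ultimately show ?thesis by simp
 qed
 have "((%x. integral {u/2..x} (adens p)) has_real_derivative adens p u) (at u within {u/2..2*u})"
  by (rule integral_has_real_derivative[OF c]) (use u in auto)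
 then have "((%x. g (u/2)+integral {u/2..x} (adens p)) has_real_derivative adens p u) (at u within {u/2..2*u})"
  using DERIV_add[OF DERIV_const, of _ _ u "{u/2..2*u}" "g (u/2)"] by simp
 then have "(g has_real_derivative adens p u) (at u within {u/2..2*u})"
  by (rule has_field_derivative_transform_within[where d = 1]) (use u geq[symmetric] in simp_all)
 then have gd: "(g has_real_derivative adens p u) (at u)"
  using u by (subst (asm) at_within_interior) auto
 have "cos th ~= 0" using cos_gt_zero[of th] th by simp
 then have td: "(tan has_real_derivative 1+(tan th)^2) (at th)"
  by (auto intro!: derivative_eq_intros simp: tan_sec inverse_eq_divide power_divide)
 have "((%x. g (tan x)) has_real_derivative adens p u*(1+(tan th)^2)) (at th)"
  by (rule DERIV_chain2[OF _ td]) (use gd in \<open>simp add: u_def\<close>)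
 then show ?thesis unfolding u_def
 proof (rule has_field_derivative_transform_within_open[of _ _ _ "{0<..<pi/2}"])
  fix x assume x: "x : {0<..<pi/2}"
  have "arctan t <= x \<longleftrightarrow> t <= tan x" for t
  using x arctan_tan[of x] arctan_le_iff[of t "tan x"] by auto
  then show "g (tan x) = Phi p La x" unfolding g_def Phi_eq[OF p] by simp
 qed (use th in auto)
qed

lemma Q_measure_eq:
 assumes p: "1 <= p"
 shows "Q_measure p La = distr (density lborel (%t. ennreal (adens p t/PhiT p))) borel arctan"
proof (rule measure_eqI)
 fix B assume "B : sets (Q_measure p La)"
 then have B: "B : sets borel" by (simp add: Q_measure_def angular_measure_def)
 have am: "arctan : meas borel" by measurable
 have v: "arctan -` B : sets borel" using measurable_sets[OF am B] by simp
 have P: "1 <= PhiT p" by (rule PhiT_bounds[OF p])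
 have "(LBINT t. adens p t*indicator {0..pi/2} (arctan t)) = PhiT p"
  unfolding PhiT_def
 proof (intro lint_cong refl)
  fix t show "adens p t*indicator {0..pi/2} (arctan t) = adens p t"
  using arctan_ubound[of t] by (cases "0 < t") (auto simp: adens_def apos_def indicator_def)
 qed
 then have tot: "inverse (emeasure (angular_measure p La) {0..pi/2}) = ennreal (1/PhiT p)"
  using emeasure_angular[OF p, of "{0..pi/2}"] P by (simp add: inverse_ennreal inverse_eq_divide)
 have "emeasure (Q_measure p La) B = ennreal (1/PhiT p)*(nn_integral lborel (%t. ennreal (adens p t)*indicator (arctan -` B) t))"
  unfolding Q_measure_def tot emeasure_scale_measure unfolding angular_measure_eq[OF p] using v B
  by (subst emeasure_distr, simp, simp, subst emeasure_density, simp, simp) simp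
 also have "... = (nn_integral lborel (%t. ennreal (1/PhiT p)*(ennreal (adens p t)*indicator (arctan -` B) t)))"
  using v by (intro nn_integral_cmult[symmetric]) auto
 also have "... = (nn_integral lborel (%t. ennreal (adens p t/PhiT p)*indicator (arctan -` B) t))"
  using P adens_bounds(1)[OF p] by (intro nn_integral_cong) (auto simp: ennreal_mult[symmetric] split: split_indicator)
 also have "... = emeasure (distr (density lborel (%t. ennreal (adens p t/PhiT p))) borel arctan) B"
  using v B by (subst emeasure_distr, simp, simp, subst emeasure_density, simp, simp) simp
 finally show "emeasure (Q_measure p La) B = emeasure (distr (density lborel (%t. ennreal (adens p t/PhiT p))) borel arctan) B" .
qed (simp add: Q_measure_def angular_measure_def)

lemma integral_Q:
 assumes p: "1 <= p" and f: "f : meas borel" "0 <= th"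
 shows "(LINT ps:{0..th}|Q_measure p La. f ps) = (LBINT t. adens p t/PhiT p*(of_bool (arctan t <= th)*f (arctan t)))"
proof -
 note f(1)[measurable]
 have P: "1 <= PhiT p" by (rule PhiT_bounds[OF p])
 have "(LINT ps:{0..th}|Q_measure p La. f ps) = (\<integral>t. indicator {0..th} (arctan t) *\<^sub>R f (arctan t) \<partial>density lborel (%t. ennreal (adens p t/PhiT p)))"
  unfolding set_lebesgue_integral_def Q_measure_eq[OF p] by (subst integral_distr) auto
 also have "... = (LBINT t. (adens p t/PhiT p) *\<^sub>R (indicator {0..th} (arctan t) *\<^sub>R f (arctan t)))"
  using P adens_bounds(1)[OF p] by (intro integral_density) (auto intro!: AE_I2 divide_nonneg_pos)
 also have "... = (LBINT t. adens p t/PhiT p*(of_bool (arctan t <= th)*f (arctan t)))"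
 proof (intro lint_cong refl)
  fix t show "(adens p t/PhiT p) *\<^sub>R (indicator {0..th} (arctan t) *\<^sub>R f (arctan t)) = adens p t/PhiT p*(of_bool (arctan t <= th)*f (arctan t))"
  by (cases "0 < t") (auto simp: adens_def apos_def indicator_def)
 qed
 finally show ?thesis .
qed

end

section \<open>Functionals of the Wiener process\<close>

definition clampT :: "real => real" where
 "clampT s = max 0 (min (pi/2) s)"

definition clampI :: "real \<times> real => real \<times> real" where
 "clampI v = (max 0 (min 1 (fst v)), max 0 (min 1 (snd v)))"

lemma clampT_id: "0 <= s ==> s <= pi/2 ==> clampT s = s" "clampT s : {0..pi/2}"
 by (auto simp: clampT_def max_def min_def)

lemma clampI_id: "v : {0..1} \<times> {0..1} ==> clampI v = v" "clampI v : {0..1} \<times> {0..1}"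
 by (auto simp: clampI_def)

lemma y_ext_measurable[measurable]: "y_ext p : meas borel"
 unfolding y_ext_def[abs_def] by (cases "p = top"; simp; measurable)

text \<open>For x > 2 the curve lies at height at most 2, as x^P - 1 >= 1 when P >= 1; this is why
  every \<open>C_set\<close> lies in \<open>strips 2\<close>.\<close>

lemma y_ext_strip:
 assumes p: "1 <= p" and y: "y <= y_ext p x"
 shows "x <= 2 | y <= 2"
proof (rule ccontr)
 assume "~ (x <= 2 | y <= 2)"
 then have x: "2 < x" and y2: "2 < y" by auto
 have "(1::ennreal) < 2" by simp
 then have x1: "~ x < 1" "x ~= 1" using x by (auto dest: order.strict_trans)
 have "y_ext p x <= 2"
 proof (cases "p = top | x = top")
  case True then show ?thesis using x1 by (auto simp: y_ext_def)
 next
  case False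
  then obtain r where r: "x = ennreal r" "0 <= r" by (cases x) auto
  have "ennreal 2 < ennreal r" using x r by simp
  then have r2: "2 < r" by (simp add: ennreal_less_iff)
  define P where "P = enn2real p"
  have P: "1 <= P" unfolding P_def using False by (intro enn2real_ge_1 p) auto
  have "2 powr 1 <= r powr P" using r2 P powr_mono[of 1 P r] powr_mono2[of 1 2 r] by simp
  then have w: "1 <= r powr P-1" by simp
  have "(1+1/(r powr P-1)) powr (1/P) <= (1+1/(r powr P-1)) powr 1" using w P by (intro powr_mono) auto
  also have "... <= 2" using w by simp
  finally have "y_real p r <= 2" by (simp add: y_real_def P_def)
  then have "ennreal (y_real p r) <= ennreal 2" by (rule ennreal_leI)
  then show ?thesis using False x1 r by (simp add: y_ext_def)
 qed
 with y y2 show False by simp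
qed

lemma C_set_indicator_measurable:
 "(%(s, z). indicator (C_set p s) z :: real) : meas (borel |*| (borel :: pt measure))"
proof -
 have "(%x::real \<times> pt. if fst x = 0 then of_bool (snd (snd x) = 0 | (fst (snd x) = top & snd (snd x) <= 1))
  else if fst x = pi/2 then of_bool (snd (snd x) <= y_ext p (fst (snd x)))
  else of_bool (snd (snd x) <= min (fst (snd x)*ennreal (tan (fst x))) (y_ext p (fst (snd x)))) :: real)
  : meas (borel |*| (borel |*| borel))"
  unfolding tan_def by measurable
 moreover have "(%(s, z). indicator (C_set p s) z :: real) = (%x::real \<times> pt. if fst x = 0 then of_bool (snd (snd x) = 0 | (fst (snd x) = top & snd (snd x) <= 1))
  else if fst x = pi/2 then of_bool (snd (snd x) <= y_ext p (fst (snd x)))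
  else of_bool (snd (snd x) <= min (fst (snd x)*ennreal (tan (fst x))) (y_ext p (fst (snd x)))))"
  by (auto simp: fun_eq_iff C_set_def indicator_def)
 ultimately show ?thesis by (simp only: borel_pt)
qed

lemma A_set_indicator_measurable:
 "(%(v, z). indicator (A_set v) z :: real) : meas ((borel :: (real \<times> real) measure) |*| (borel :: pt measure))"
proof -
 have "(%x::(real \<times> real) \<times> pt. of_bool (fst (snd x) < top & snd (snd x) < top & (fst (snd x) <= ennreal (fst (fst x)) | snd (snd x) <= ennreal (snd (fst x)))) :: real)
  : meas ((borel |*| borel) |*| (borel |*| borel))" by measurable
 moreover have "(%(v, z). indicator (A_set v) z :: real) = (%x::(real \<times> real) \<times> pt. of_bool (fst (snd x) < top & snd (snd x) < top & (fst (snd x) <= ennreal (fst (fst x)) | snd (snd x) <= ennreal (snd (fst x)))))"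
  by (auto simp: fun_eq_iff A_set_def indicator_def)
 ultimately show ?thesis by (simp only: borel_prod)
qed

lemma strip_indicator_measurable:
 "(%(s, z). indicator (strip1 s) z :: real) : meas (borel |*| (borel :: pt measure))"
 "(%(s, z). indicator (strip2 s) z :: real) : meas (borel |*| (borel :: pt measure))"
proof -
 have "(%x::real \<times> pt. of_bool (0 < fst (snd x) & fst (snd x) <= ennreal (fst x) & 0 < snd (snd x)) :: real) : meas (borel |*| (borel |*| borel))"
  "(%x::real \<times> pt. of_bool (0 < fst (snd x) & snd (snd x) <= ennreal (fst x) & 0 < snd (snd x)) :: real) : meas (borel |*| (borel |*| borel))"
  by measurable
 moreover have "(%(s, z). indicator (strip1 s) z :: real) = (%x::real \<times> pt. of_bool (0 < fst (snd x) & fst (snd x) <= ennreal (fst x) & 0 < snd (snd x)))"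
  "(%(s, z). indicator (strip2 s) z :: real) = (%x::real \<times> pt. of_bool (0 < fst (snd x) & snd (snd x) <= ennreal (fst x) & 0 < snd (snd x)))"
  by (auto simp: fun_eq_iff strip1_def strip2_def indicator_def)
 ultimately show "(%(s, z). indicator (strip1 s) z :: real) : meas (borel |*| (borel :: pt measure))"
  "(%(s, z). indicator (strip2 s) z :: real) : meas (borel |*| (borel :: pt measure))"
  by (simp_all only: borel_pt)
qed

text \<open>The clamping only serves to have Borel parameter spaces.\<close>

definition meas_paths :: "ennreal => 'y measure => ('y => pt set => real) => bool" where
 "meas_paths p Y w \<longleftrightarrow>
  (%(s, y). w y (C_set p (clampT s))) : meas (borel |*| Y) &
  (%(v, y). w y (A_set (clampI v))) : meas (borel |*| Y) &
  (%(x, y). w y (strip1 x)) : meas (borel |*| Y) &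
  (%(x, y). w y (strip2 x)) : meas (borel |*| Y)"

text \<open>Closed form of \<open>deriv (y_real p)\<close> on x > 1, total and visibly
  Borel.\<close>

definition ydv :: "ennreal => real => real" where
 "ydv p x = - ((x powr enn2real p-1) powr (- 1/enn2real p-1))"

lemma ydv_measurable[measurable]: "ydv p : meas borel"
 unfolding ydv_def[abs_def] by measurable

context smooth_tail
begin

lemma C_set_strips: "1 <= p ==> C_set p th <= strips 2"
proof
 fix z assume p: "1 <= p" and z: "z : C_set p th"
 have two: "ennreal 2 = 2" by simp
 have "fst z <= 2 | snd z <= 2"
 proof (cases "th = 0")
  case True
  have "(0::ennreal) <= 2" "(1::ennreal) <= 2" by simp_all
  then show ?thesis using z True unfolding C_set_def by (auto intro: order_trans)
 next
  case False
  then have "snd z <= y_ext p (fst z)" using z unfolding C_set_def by (auto split: if_splits)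
  then show ?thesis by (rule y_ext_strip[OF p])
 qed
 then show "z : strips 2" unfolding strips_def two by (cases z) auto
qed

lemma C_set_sets: "1 <= p ==> C_set p th : sets La"
proof -
 assume p: "1 <= p"
 have "(%z. indicator (C_set p th) z :: real) : meas borel"
  using measurable_Pair2[OF C_set_indicator_measurable[of p], of th] by simp
 then have "C_set p th : sets borel" by (simp add: borel_measurable_indicator_iff)
 moreover have "C_set p th <= E_space"
  using C_set_strips[OF p, of th] strips_sets[of 2] unfolding sets_L_iff by auto
 ultimately show ?thesis by (simp add: sets_L_iff)
qed

lemma strip_sets: "strip1 x : sets La" "strip2 x : sets La"
 unfolding sets_L_iff borel_pt strip1_def strip2_def by (auto simp: E_space_def top_unique)

lemma strip_strips: "strip1 x <= strips x" "strip2 x <= strips x"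
 by (auto simp: strip1_def strip2_def strips_def)

lemma A_set_strips: "v : {0..1} \<times> {0..1} ==> A_set v <= strips 1"
 by (auto simp: A_set_def strips_def intro: order_trans ennreal_leI)

text \<open>The point masses form a family of paths indexed by \<open>La\<close>; hence a
  measurability result for a functional of paths covers its kernel as well.\<close>

lemma meas_paths_indicator: "meas_paths p La (%z C. indicator C z)"
proof -
 have id: "(%x. x) : measurable La borel" by (rule measurable_L) simp
 have 1: "(%(s, z). (clampT s, z)) : measurable (borel |*| La) (borel |*| (borel :: pt measure))"
  unfolding clampT_def case_prod_beta' by (intro measurable_Pair mcomp[OF measurable_snd id]) measurable
 have 2: "(%(s, z). (clampI s, z)) : measurable (borel |*| La) ((borel :: (real \<times> real) measure) |*| (borel :: pt measure))"
 proof -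
  have "clampI : meas borel" unfolding clampI_def[abs_def]
  by (intro borel_measurable_continuous_onI continuous_intros)
  from mcomp[OF measurable_fst this] show ?thesis
  unfolding case_prod_beta' by (intro measurable_Pair mcomp[OF measurable_snd id])
 qed
 have 3: "(%(s, z). (s, z)) : measurable (borel |*| La) ((borel :: real measure) |*| (borel :: pt measure))"
  unfolding case_prod_beta' by (intro measurable_Pair mcomp[OF measurable_snd id] measurable_fst)
 show ?thesis unfolding meas_paths_def
  using mcomp[OF 1 C_set_indicator_measurable[of p]] mcomp[OF 2 A_set_indicator_measurable]
  mcomp[OF 3 strip_indicator_measurable(1)] mcomp[OF 3 strip_indicator_measurable(2)]
  by (simp add: case_prod_beta')
qed

lemma polar_C_set_iff:
 assumes "0 < x" "0 < t" "0 <= th" "th <= pi/2"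
 shows "polar (x, t) : C_set p th \<longleftrightarrow> arctan t <= th & ennreal (x*t) <= y_ext p (ennreal x)"
proof -
 have pol: "polar (x, t) = (ennreal x, ennreal (x*t))" by (simp add: polar_def emb_def)
 have at: "0 < arctan t" "arctan t < pi/2" using assms arctan_ubound by auto
 consider "th = 0" | "th = pi/2" | "0 < th" "th < pi/2" using assms by linarith
 then show ?thesis
 proof cases
  case 1 then show ?thesis unfolding pol using assms at by (auto simp: C_set_def)
 next
  case 2 then show ?thesis unfolding pol using assms at by (auto simp: C_set_def)
 next
  case 3
  have "tan th > 0" using 3 by (rule tan_gt_zero)
  have "ennreal (x*t) <= ennreal x*ennreal (tan th) \<longleftrightarrow> t <= tan th"
  using assms \<open>tan th > 0\<close> by (simp add: ennreal_mult[symmetric] ennreal_le_iff)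
  also have "... \<longleftrightarrow> arctan t <= th" using arctan_tan[of th] 3 arctan_le_iff[of t "tan th"] by simp
  finally show ?thesis unfolding pol using 3 by (simp add: C_set_def)
 qed
qed

text \<open>From here on the functionals are written in the slope t = tan th and with the cut-off
  density, which makes them total and jointly measurable.\<close>

definition Z_ray :: "ennreal => real => (pt set => real) => real" where
 "Z_ray p t w = (LBINT x. indicator {0<..Xp p t} x*(dens (x, x*t)*(W1 w x*t-W2 w (x*t))))"

definition B_curve :: "ennreal => real => (pt set => real) => real" where
 "B_curve p s w = (LBINT x. indicator {s<..} x*(dens (x, y_real p x)*(W1 w x*ydv p x-W2 w (y_real p x))))"

definition B_can :: "ennreal => real => (pt set => real) => real" where
 "B_can p t w = (if p = top then
  - (LBINT y. indicator {1..max 1 t} y*apos y)*W1 w 1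
  + - (LBINT x. indicator {max 1 (1/t)..} x*(apos (1/x)/x))*W2 w 1
  else B_curve p (Xp p t) w)"

text \<open>The limit of \<open>B_can\<close> as the slope tends to infinity, that is at the angle
  pi/2, where \<open>Xp\<close> tends to 1.\<close>

definition B_lim :: "ennreal => (pt set => real) => real" where
 "B_lim p w = (if p = top then
  - (LBINT y. indicator {1..} y*apos y)*W1 w 1
  + - (LBINT x. indicator {1..} x*(apos (1/x)/x))*W2 w 1
  else B_curve p 1 w)"

definition alpha_can :: "ennreal => real => (pt set => real) => real" where
 "alpha_can p th w = w (C_set p (clampT th))+(Z_ray p (tan th) w+B_can p (tan th) w)"

text \<open>At the angle pi/2 the ray integral disappears in the limit, so only the boundary term
  accompanies the value of the path.\<close>

definition alpha_lim :: "ennreal => (pt set => real) => real" where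
 "alpha_lim p w = w (C_set p (clampT (pi/2)))+B_lim p w"

text \<open>\<open>e1\<close> and \<open>e2\<close> are the partial derivatives of the stable tail
  dependence function, in integral form so as to be defined and Borel on the whole plane.\<close>

definition e1 :: "real \<times> real => real" where
 "e1 v = (LBINT t. apos t * of_bool (snd v < fst v * t))"

definition e2 :: "real \<times> real => real" where
 "e2 v = (LBINT t. apos t/t * of_bool (fst v * t < snd v))"

definition I_kernel :: "real \<times> real => (pt set => real) => real" where
 "I_kernel v w = w (A_set (clampI v))+(- e1 v * W1 w (fst v) + - e2 v * W2 w (snd v))"

lemma e_measurable[measurable]: "e1 : meas borel" "e2 : meas borel"
proof -
 have "(%(v::real\<times>real, t). apos t * of_bool (snd v < fst v * t)) : meas ((borel |*| borel) |*| lborel)"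
  "(%(v::real\<times>real, t). apos t/t * of_bool (fst v * t < snd v)) : meas ((borel |*| borel) |*| lborel)"
  by measurable
 from lborel.borel_measurable_lebesgue_integral[OF this(1)] lborel.borel_measurable_lebesgue_integral[OF this(2)]
 show "e1 : meas borel" "e2 : meas borel" unfolding e1_def[abs_def] e2_def[abs_def] by (simp_all add: borel_prod)
qed

lemma dens_measurable2[measurable]: "dens : meas (borel |*| borel)"
 using dens_measurable by (simp add: borel_prod)

context
 fixes p :: ennreal and Y :: "'y measure" and w :: "'y => pt set => real"
 assumes mp: "meas_paths p Y w"
begin

lemma W_path_measurable:
 assumes f: "f : meas M" and g: "g : measurable M Y"
 shows "(%x. W1 (w (g x)) (f x)) : meas M" "(%x. W2 (w (g x)) (f x)) : meas M"
proof -
 have 1: "(%(x, y). w y (strip1 x)) : meas (borel |*| Y)" and 2: "(%(x, y). w y (strip2 x)) : meas (borel |*| Y)"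
  using mp unfolding meas_paths_def by blast+
 show "(%x. W1 (w (g x)) (f x)) : meas M" "(%x. W2 (w (g x)) (f x)) : meas M"
  unfolding W1_def W2_def using mcomp[OF measurable_Pair[OF f g] 1] mcomp[OF measurable_Pair[OF f g] 2] by simp_all
qed

lemma C_path_measurable:
 assumes f: "f : meas M" and g: "g : measurable M Y"
 shows "(%x. w (g x) (C_set p (clampT (f x)))) : meas M"
proof -
 have 1: "(%(s, y). w y (C_set p (clampT s))) : meas (borel |*| Y)"
  using mp unfolding meas_paths_def by blast
 show ?thesis using mcomp[OF measurable_Pair[OF f g] 1] by simp
qed

lemma A_path_measurable:
 assumes f: "f : meas M" and g: "g : measurable M Y"
 shows "(%x. w (g x) (A_set (clampI (f x)))) : meas M"
proof -
 have 1: "(%(s, y). w y (A_set (clampI s))) : meas (borel |*| Y)"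
  using mp unfolding meas_paths_def by blast
 show ?thesis using mcomp[OF measurable_Pair[OF f g] 1] by simp
qed

lemma Z_integrand_measurable:
 "(%((t, y), x). indicator {0<..Xp p t} x*(dens (x, x*t)*(W1 (w y) x*t-W2 (w y) (x*t)))) : meas ((borel |*| Y) |*| lborel)"
proof -
 have 1: "(%z::(real \<times> 'y) \<times> real. W1 (w (snd (fst z))) (snd z)) : meas ((borel |*| Y) |*| lborel)"
  by (rule W_path_measurable(1)) measurable
 have 2: "(%z::(real \<times> 'y) \<times> real. W2 (w (snd (fst z))) (snd z*fst (fst z))) : meas ((borel |*| Y) |*| lborel)"
  by (rule W_path_measurable(2)) measurable
 have 3: "(%z::(real \<times> 'y) \<times> real. indicator {0<..Xp p (fst (fst z))} (snd z) :: real) : meas ((borel |*| Y) |*| lborel)"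
 proof -
  have "(%z::(real \<times> 'y) \<times> real. of_bool (0 < snd z & snd z <= Xp p (fst (fst z))) :: real) : meas ((borel |*| Y) |*| lborel)" by measurable
  moreover have "(%z::(real \<times> 'y) \<times> real. indicator {0<..Xp p (fst (fst z))} (snd z) :: real) = (%z::(real \<times> 'y) \<times> real. of_bool (0 < snd z & snd z <= Xp p (fst (fst z))))"
  by (auto simp: indicator_def fun_eq_iff)
  ultimately show ?thesis by simp
 qed
 show ?thesis unfolding case_prod_beta' using 1 2 3 by measurable
qed

lemma B_integrand_measurable:
 "(%((s, y), x). indicator {s<..} x*(dens (x, y_real p x)*(W1 (w y) x*ydv p x-W2 (w y) (y_real p x)))) : meas ((borel |*| Y) |*| lborel)"
proof -
 have 1: "(%z::(real \<times> 'y) \<times> real. W1 (w (snd (fst z))) (snd z)) : meas ((borel |*| Y) |*| lborel)"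
  by (rule W_path_measurable(1)) measurable
 have 2: "(%z::(real \<times> 'y) \<times> real. W2 (w (snd (fst z))) (y_real p (snd z))) : meas ((borel |*| Y) |*| lborel)"
  by (rule W_path_measurable(2)) measurable
 have 3: "(%z::(real \<times> 'y) \<times> real. indicator {fst (fst z)<..} (snd z) :: real) : meas ((borel |*| Y) |*| lborel)"
 proof -
  have "(%z::(real \<times> 'y) \<times> real. of_bool (fst (fst z) < snd z) :: real) : meas ((borel |*| Y) |*| lborel)" by measurable
  moreover have "(%z::(real \<times> 'y) \<times> real. indicator {fst (fst z)<..} (snd z) :: real) = (%z::(real \<times> 'y) \<times> real. of_bool (fst (fst z) < snd z))"
  by (auto simp: indicator_def fun_eq_iff)
  ultimately show ?thesis by simp
 qed
 show ?thesis unfolding case_prod_beta' using 1 2 3 by measurable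
qed

lemma alpha_can_measurable: "(%(th, y). alpha_can p th (w y)) : meas (borel |*| Y)"
proof -
 have tm: "(%z::real \<times> 'y. (tan (fst z), snd z)) : measurable (borel |*| Y) (borel |*| Y)"
  unfolding tan_def by measurable
 have Z: "(%(t, y). Z_ray p t (w y)) : meas (borel |*| Y)"
  using lborel.borel_measurable_lebesgue_integral[OF Z_integrand_measurable] unfolding Z_ray_def by (simp add: case_prod_beta')
 have Bc: "(%(s, y). B_curve p s (w y)) : meas (borel |*| Y)"
  using lborel.borel_measurable_lebesgue_integral[OF B_integrand_measurable] unfolding B_curve_def by (simp add: case_prod_beta')
 have B: "(%(t, y). B_can p t (w y)) : meas (borel |*| Y)"
 proof (cases "p = top")
  case True
  have "(%(t::real, y). indicator {1..max 1 t} y*apos y) : meas (borel |*| lborel)"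
  proof -
  have "(%(t::real, y). of_bool (1 <= y & y <= max 1 t)*apos y) : meas (borel |*| lborel)" by measurable
  moreover have "(%(t::real, y). indicator {1..max 1 t} y*apos y) = (%(t::real, y). of_bool (1 <= y & y <= max 1 t)*apos y)"
  by (auto simp: fun_eq_iff indicator_def)
  ultimately show ?thesis by simp
  qed
  from lborel.borel_measurable_lebesgue_integral[OF this]
  have c1[measurable]: "(%t. (LBINT y. indicator {1..max 1 t} y*apos y)) : meas borel" .
  have "(%(t::real, x). indicator {max 1 (1/t)..} x*(apos (1/x)/x)) : meas (borel |*| lborel)"
  proof -
  have "(%(t::real, x). of_bool (max 1 (1/t) <= x)*(apos (1/x)/x)) : meas (borel |*| lborel)" by measurable
  moreover have "(%(t::real, x). indicator {max 1 (1/t)..} x*(apos (1/x)/x)) = (%(t::real, x). of_bool (max 1 (1/t) <= x)*(apos (1/x)/x))"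
  by (auto simp: fun_eq_iff indicator_def)
  ultimately show ?thesis by simp
  qed
  from lborel.borel_measurable_lebesgue_integral[OF this]
  have c2[measurable]: "(%t. (LBINT x. indicator {max 1 (1/t)..} x*(apos (1/x)/x))) : meas borel" .
  have 1: "(%z. W1 (w (snd z)) 1) : meas (borel |*| Y)" "(%z. W2 (w (snd z)) 1) : meas (borel |*| Y)"
  by (auto intro!: W_path_measurable)
  show ?thesis unfolding B_can_def case_prod_beta' if_P[OF True]
  by (intro borel_measurable_add borel_measurable_times borel_measurable_uminus 1 mcomp[OF measurable_fst c1] mcomp[OF measurable_fst c2])
 next
  case False
  have "(%z. (Xp p (fst z), snd z)) : measurable (borel |*| Y) (borel |*| Y)" by measurable
  from mcomp[OF this Bc] show ?thesis unfolding B_can_def case_prod_beta' using False by simp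
 qed
 have C: "(%z::real \<times> 'y. w (snd z) (C_set p (clampT (fst z)))) : meas (borel |*| Y)"
  by (rule C_path_measurable) measurable
 show ?thesis unfolding alpha_can_def case_prod_beta'
  using C mcomp[OF tm Z] mcomp[OF tm B] by simp
qed

lemma alpha_lim_measurable: "(%y. alpha_lim p (w y)) : meas Y"
proof -
 have Bc: "(%(s, y). B_curve p s (w y)) : meas (borel |*| Y)"
  using lborel.borel_measurable_lebesgue_integral[OF B_integrand_measurable] unfolding B_curve_def by (simp add: case_prod_beta')
 have B1: "(%y. B_curve p 1 (w y)) : meas Y" using measurable_Pair2[OF Bc, of 1] by simp
 have 1: "(%y. W1 (w y) 1) : meas Y" "(%y. W2 (w y) 1) : meas Y"
  "(%y. w y (C_set p (clampT (pi/2)))) : meas Y"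
  by (auto intro!: W_path_measurable C_path_measurable)
 show ?thesis unfolding alpha_lim_def B_lim_def using 1 B1 by (cases "p = top") auto
qed

lemma I_kernel_measurable: "(%(v, y). I_kernel v (w y)) : meas (borel |*| Y)"
proof -
 have f: "(%z. fst (fst z)) : meas ((borel :: (real \<times> real) measure) |*| Y)" "(%z. snd (fst z)) : meas ((borel :: (real \<times> real) measure) |*| Y)"
  by (auto intro!: mcomp[OF measurable_fst] borel_measurable_continuous_onI continuous_intros)
 have "(%z. w (snd z) (A_set (clampI (fst z)))) : meas ((borel :: (real \<times> real) measure) |*| Y)"
  "(%z. W1 (w (snd z)) (fst (fst z))) : meas ((borel :: (real \<times> real) measure) |*| Y)"
  "(%z. W2 (w (snd z)) (snd (fst z))) : meas ((borel :: (real \<times> real) measure) |*| Y)"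
  using f by (auto intro!: A_path_measurable W_path_measurable)
 then show ?thesis unfolding I_kernel_def case_prod_beta' by measurable
qed

end

end

section \<open>Functionals as Wiener integrals\<close>

locale noise = smooth_tail La l for La l +
 fixes p :: ennreal and N :: "'b measure" and w :: "'b => pt set => real"
 assumes p: "1 <= p" and wn: "white_noise La N w" and mp: "meas_paths p N w"
begin

lemma mpi: "meas_paths p La (%z C. indicator C z)" by (rule meas_paths_indicator)

text \<open>The functional is applied to the random path and to the path of a point mass; for a
  functional linear in the path the latter is the kernel of the former.\<close>

definition represents :: "((pt set => real) => real) => real => bool" where
 "represents F K \<longleftrightarrow> wiener_int La N w (%om. F (w om)) (%z. F (%C. indicator C z)) &
  l2_le La (%z. F (%C. indicator C z)) K"

definition sym_kern :: "((pt set => real) => real) => real \<times> real => real" where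
 "sym_kern F = kern (%z. F (%C. indicator C z))"

definition jointly :: "'s measure => ('s => (pt set => real) => real) => bool" where
 "jointly muv F \<longleftrightarrow> (%(s, om). F s (w om)) : meas (muv |*| N) &
  (%(s, z). F s (%C. indicator C z)) : meas (muv |*| La)"

lemma represents_set:
 assumes "C : sets La" "C <= strips s" "0 <= s"
 shows "represents (%w. w C) (sqrt (2 * s))"
proof -
 have C: "C : fin_sets La" by (rule fin_sets_strips[OF assms(1,2)])
 have "emeasure La C <= emeasure La (strips s)" by (intro emeasure_mono assms strips_sets)
 also have "... <= emeasure La ({..ennreal s} \<times> UNIV)+emeasure La (UNIV \<times> {..ennreal s})"
  unfolding strips_def
  by (intro emeasure_subadditive; simp add: sets_L_iff borel_pt E_space_def; auto simp: top_unique)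
 also have "... = ennreal (2 * s)" using assms by (simp add: L_margin flip: ennreal_plus)
 finally have "measure La C <= 2 * s" using assms unfolding measure_def by (intro enn2real_leI) auto
 then show ?thesis unfolding represents_def
  using wiener_int_set[OF wn C] l2_le_indicator(1)[OF C] by (auto intro: l2_le_mono)
qed

lemma represents_mono: "represents F K ==> K <= K' ==> represents F K'"
 unfolding represents_def by (auto intro: l2_le_mono)

lemma represents_nonneg: "represents F K ==> 0 <= K"
 unfolding represents_def l2_le_def by auto

lemma represents_lin:
 assumes "represents F K" "represents G L"
 shows "represents (%w. b*F w + c*G w) (abs b*K+abs c*L)"
 using assms unfolding represents_def by (auto intro!: wiener_int_lin[OF wn] l2_le_add l2_le_mult)

lemma represents_integral:
 assumes "sigma_finite_measure muv" "jointly muv F" "!!s. s : space muv ==> represents (F s) (b s)" "integrable muv b"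
 shows "represents (%w. (LINT s|muv. F s w)) (LINT s|muv. b s)" "AE om in N. integrable muv (%s. F s (w om))"
proof -
 note J = assms(2)[unfolded jointly_def]
 show "represents (%w. (LINT s|muv. F s w)) (LINT s|muv. b s)" unfolding represents_def
  using wiener_int_integral(1)[OF wn assms(1) conjunct1[OF J] conjunct2[OF J] _ _ assms(4)]
  l2_le_integral(1)[OF assms(1) sigma_finite_L conjunct2[OF J] _ assms(4)] assms(3)[unfolded represents_def] by auto
 show "AE om in N. integrable muv (%s. F s (w om))"
  using wiener_int_integral(2)[OF wn assms(1) conjunct1[OF J] conjunct2[OF J] _ _ assms(4)] assms(3)[unfolded represents_def] by auto
qed

lemma sym_kern_measurable:
 "represents F K ==> sym_kern F : meas borel"
 unfolding sym_kern_def represents_def by (intro kern_measurable) (auto dest: l2_leD(1))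

lemma sym_kern_joint:
 assumes "jointly muv F"
 shows "(%(s, z). sym_kern (F s) z) : meas (muv |*| lborel)"
proof -
 have "(%x. (fst x, polar (snd x))) : measurable (muv |*| (lborel :: (real \<times> real) measure)) (muv |*| La)"
  using mcomp[OF measurable_snd, of polar "lborel :: (real \<times> real) measure" La muv] polar_measurable_L
  by (intro measurable_Pair measurable_fst) simp_all
 from mcomp[OF this conjunct2[OF assms[unfolded jointly_def]]]
 have 1: "(%x. F (fst x) (%C. indicator C (polar (snd x)))) : meas (muv |*| (lborel :: (real \<times> real) measure))" by simp
 have 2: "(%x. sqrt (pdens (snd x))) : meas (muv |*| (lborel :: (real \<times> real) measure))" by measurable
 show ?thesis unfolding sym_kern_def kern_def case_prod_beta' using 1 2 by measurable
qed

end

section \<open>Comparison of two tail measures\<close>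

text \<open>The isometry \<open>kern\<close> maps the \<open>L\<^sub>2\<close> spaces of different tail measures into the same space, which
 makes the integrands of functionals of different Wiener processes comparable.\<close>

locale noise_pair = S1: noise La1 l1 p N1 w1 + S0: noise La0 l0 p N0 w0 for La1 l1 p N1 w1 La0 l0 N0 w0 +
 fixes e :: real
 assumes e: "0 <= e" "intb (%t. pos t*(abs (S1.apos t-S0.apos t)*(1+1/t)))"
  "(LBINT t. pos t*(abs (S1.apos t-S0.apos t)*(1+1/t))) <= e"
begin

text \<open>\<open>K\<close> bounds both kernels in their own L2 spaces, \<open>c\<close> bounds
  their distance after transport to Lebesgue measure.\<close>

definition close :: "((pt set => real) => real) => ((pt set => real) => real) => real => real => bool" where
 "close Fa Fb K c \<longleftrightarrow> S1.represents Fa K & S0.represents Fb K &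
  l2_le lborel (%z. S1.sym_kern Fa z-S0.sym_kern Fb z) c"

lemma close_nonneg: "close Fa Fb K c ==> 0 <= K" "close Fa Fb K c ==> 0 <= c"
 unfolding close_def by (auto dest: S1.represents_nonneg l2_leD)

lemma close_mono: "close Fa Fb K c ==> K <= K' ==> c <= c' ==> close Fa Fb K' c'"
 unfolding close_def by (auto intro: S1.represents_mono S0.represents_mono l2_le_mono)

lemma close_add:
 assumes "close Fa Fb K c" "close G1 G0 L d"
 shows "close (%w. Fa w+G1 w) (%w. Fb w+G0 w) (K+L) (c+d)"
proof -
 have "S1.sym_kern (%w. Fa w+G1 w) z-S0.sym_kern (%w. Fb w+G0 w) z =
  (S1.sym_kern Fa z-S0.sym_kern Fb z)+(S1.sym_kern G1 z-S0.sym_kern G0 z)" for z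
  by (simp add: S1.sym_kern_def S0.sym_kern_def S1.kern_def S0.kern_def algebra_simps)
 then show ?thesis using assms S1.represents_lin[of Fa K G1 L 1 1] S0.represents_lin[of Fb K G0 L 1 1] unfolding close_def
  by (auto intro!: l2_le_add simp del: add_diff_add)
qed

lemma close_scale:
 assumes F: "close Fa Fb K c" and b: "abs b1 <= B" "abs b0 <= B" "abs (b1-b0) <= de"
 shows "close (%w. b1*Fa w) (%w. b0*Fb w) (B*K) (de * K+B * c)"
proof -
 note F' = F[unfolded close_def]
 have eq: "S1.sym_kern (%w. b1*Fa w) z-S0.sym_kern (%w. b0*Fb w) z =
  (b1-b0)*S1.sym_kern Fa z+b0*(S1.sym_kern Fa z-S0.sym_kern Fb z)" for z
  by (simp add: S1.sym_kern_def S0.sym_kern_def S1.kern_def S0.kern_def algebra_simps)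
 have k: "l2_le lborel (S1.sym_kern Fa) K"
  using F' unfolding S1.represents_def S1.sym_kern_def by (auto intro: S1.l2_le_kern)
 have "l2_le lborel (%z. (b1-b0)*S1.sym_kern Fa z+b0*(S1.sym_kern Fa z-S0.sym_kern Fb z)) (abs (b1-b0)*K+abs b0 * c)"
  using F' k by (intro l2_le_add l2_le_mult) auto
 then have "l2_le lborel (%z. S1.sym_kern (%w. b1*Fa w) z-S0.sym_kern (%w. b0*Fb w) z) (de * K+B * c)"
  unfolding eq using b close_nonneg[OF F] by (elim l2_le_mono) (intro add_mono mult_right_mono; simp)
 moreover have "S1.represents (%w. b1*Fa w) (B*K)"
  using S1.represents_lin[of Fa K Fa K b1 0] F' b close_nonneg[OF F]
  by (auto intro: mult_right_mono elim!: S1.represents_mono)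
 moreover have "S0.represents (%w. b0*Fb w) (B*K)"
  using S0.represents_lin[of Fb K Fb K b0 0] F' b close_nonneg[OF F]
  by (auto intro: mult_right_mono elim!: S0.represents_mono)
 ultimately show ?thesis unfolding close_def by blast
qed

lemma close_scale_const: "close Fa Fb K c ==> close (%w. b*Fa w) (%w. b*Fb w) (abs b*K) (abs b * c)"
 using close_scale[of Fa Fb K c b "abs b" b 0] by simp

lemma close_sum:
 assumes "finite I" "!!i. i : I ==> close (Fa i) (Fb i) (K i) (c i)"
 shows "close (%w. \<Sum>i\<in>I. Fa i w) (%w. \<Sum>i\<in>I. Fb i w) (\<Sum>i\<in>I. K i) (\<Sum>i\<in>I. c i)"
 using assms
proof (induction I)
 case empty
 then show ?case unfolding close_def S1.represents_def S0.represents_def S1.sym_kern_def S0.sym_kern_def S1.kern_def S0.kern_def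
  by (auto intro: wiener_int_zero[OF S1.wn] wiener_int_zero[OF S0.wn] l2_le_zero)
qed (auto intro!: close_add)

lemma close_integral:
 assumes muv: "sigma_finite_measure muv" and J: "S1.jointly muv Fa" "S0.jointly muv Fb"
  and F: "!!s. s : space muv ==> close (Fa s) (Fb s) (K s) (c s)" and i: "integrable muv K" "integrable muv c"
 shows "close (%w. (LINT s|muv. Fa s w)) (%w. (LINT s|muv. Fb s w)) (LINT s|muv. K s) (LINT s|muv. c s)"
proof -
 note F' = F[unfolded close_def]
 have r: "S1.represents (%w. (LINT s|muv. Fa s w)) (LINT s|muv. K s)" "S0.represents (%w. (LINT s|muv. Fb s w)) (LINT s|muv. K s)"
  using F' by (auto intro: S1.represents_integral(1)[OF muv J(1) _ i(1)] S0.represents_integral(1)[OF muv J(2) _ i(1)])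
 have m1: "(%(s, z). S1.sym_kern (Fa s) z) : meas (muv |*| lborel)" by (rule S1.sym_kern_joint[OF J(1)])
 have m0: "(%(s, z). S0.sym_kern (Fb s) z) : meas (muv |*| lborel)" by (rule S0.sym_kern_joint[OF J(2)])
 have k1: "l2_le lborel (S1.sym_kern (Fa s)) (K s)" if "s : space muv" for s
  using F'[OF that] unfolding S1.represents_def S1.sym_kern_def by (auto intro: S1.l2_le_kern)
 have k0: "l2_le lborel (S0.sym_kern (Fb s)) (K s)" if "s : space muv" for s
  using F'[OF that] unfolding S0.represents_def S0.sym_kern_def by (auto intro: S0.l2_le_kern)
 have sfl: "sigma_finite_measure (lborel :: (real \<times> real) measure)" by (rule sigma_finite_lborel)
 have "(%(s, z). S1.sym_kern (Fa s) z-S0.sym_kern (Fb s) z) : meas (muv |*| lborel)"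
  using borel_measurable_diff[OF m1 m0] by (simp add: case_prod_beta')
 from l2_le_integral(1)[OF muv sfl this _ i(2)] F'
 have "l2_le lborel (%z. (LINT s|muv. S1.sym_kern (Fa s) z-S0.sym_kern (Fb s) z)) (LINT s|muv. c s)" by auto
 \<comment> \<open>Transport acts pointwise and commutes with the parameter integral, but a
   difference of integrals is the integral of the difference where both converge, hence almost
   everywhere.\<close>
 moreover have "AE z in lborel. (LINT s|muv. S1.sym_kern (Fa s) z-S0.sym_kern (Fb s) z) =
  S1.sym_kern (%w. (LINT s|muv. Fa s w)) z-S0.sym_kern (%w. (LINT s|muv. Fb s w)) z"
 proof -
  have "AE z in lborel. integrable muv (%s. S1.sym_kern (Fa s) z)" by (rule l2_le_integral(3)[OF muv sfl m1 _ i(1)]) (rule k1)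
  moreover have "AE z in lborel. integrable muv (%s. S0.sym_kern (Fb s) z)" by (rule l2_le_integral(3)[OF muv sfl m0 _ i(1)]) (rule k0)
  ultimately show ?thesis
 proof eventually_elim
  case (elim z)
  then show ?case by (simp add: S1.sym_kern_def S0.sym_kern_def S1.kern_integral S0.kern_integral)
 qed
 qed
 ultimately have "l2_le lborel (%z. S1.sym_kern (%w. (LINT s|muv. Fa s w)) z-S0.sym_kern (%w. (LINT s|muv. Fb s w)) z) (LINT s|muv. c s)"
  using S1.sym_kern_measurable[OF r(1)] S0.sym_kern_measurable[OF r(2)]
  by (intro l2_leI_nn) (auto dest: l2_leD(2,5) elim!: order_trans[OF eq_refl, rotated] intro!: nn_integral_cong_AE)
 with r show ?thesis unfolding close_def by blast
qed

lemma sets_eq: "sets La1 = sets La0" by (simp add: S1.sets_L S0.sets_L)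

text \<open>The inequality (sqrt x - sqrt y)^2 <= |x - y| turns the L2 distance of the transported
  indicators into an L1 distance of densities. A set inside \<open>strips s\<close> meets the ray of
  slope \<open>t\<close> only for x <= s(1 + 1/t), which is the origin of the weight 1 +
  1/t.\<close>

lemma close_set:
 assumes C: "C : sets La0" "C <= S0.strips s" and s: "0 <= s"
 shows "close (%w. w C) (%w. w C) (sqrt (2 * s)) (sqrt (2 * s) * sqrt e)"
proof -
 define D where "D t = abs (S1.apos t-S0.apos t)" for t
 have strips: "S1.strips s = S0.strips s" by (simp add: S1.strips_def S0.strips_def)
 have r: "S1.represents (%w. w C) (sqrt (2 * s))" "S0.represents (%w. w C) (sqrt (2 * s))"
  using C s sets_eq strips by (auto intro: S1.represents_set S0.represents_set)
 have sq: "(sqrt x-sqrt y)^2 <= abs (x-y)" if "0 <= x" "0 <= y" for x y :: real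
 proof -
  have "abs (sqrt x-sqrt y)*abs (sqrt x-sqrt y) <= abs (sqrt x-sqrt y)*(sqrt x+sqrt y)"
  using that by (intro mult_left_mono) (auto simp: abs_if)
  also have "... = abs ((sqrt x-sqrt y)*(sqrt x+sqrt y))" using that by (simp add: abs_mult)
  also have "(sqrt x-sqrt y)*(sqrt x+sqrt y) = x-y" using that by (simp add: algebra_simps)
  finally show ?thesis by (simp add: power2_eq_square)
 qed
 define g where "g z = indicator quad z*indicator {..s*(1+1/snd z)} (fst z)*D (snd z)" for z :: "real \<times> real"
 have pt: "(S1.sym_kern (%w. w C) z-S0.sym_kern (%w. w C) z)^2 <= g z" for z
 proof (cases "polar z : C & z : quad")
  case False
  then show ?thesis unfolding S1.sym_kern_def S0.sym_kern_def S1.kern_def S0.kern_def g_def D_def S1.pdens_def S0.pdens_def S1.apos_def S0.apos_def quad_def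
  by (auto simp: indicator_def mem_Times_iff)
 next
  case True
  obtain x t where z: "z = (x, t)" by (cases z)
  have xt: "0 < x" "0 < t" using True by (auto simp: z quad_def)
  have "polar (x, t) : S0.strips s" using True C z by auto
  then have "x <= s | x <= s/t" using S0.polar_le_iff[OF xt s] by (auto simp: S0.strips_def mem_Times_iff)
  moreover have "0 <= s/t" using s xt by simp
  ultimately have "x <= s*(1+1/t)" using s by (auto simp: distrib_left)
  then show ?thesis using True xt sq[OF S1.apos_nonneg[of t] S0.apos_nonneg[of t]] z
  unfolding S1.sym_kern_def S0.sym_kern_def S1.kern_def S0.kern_def g_def D_def S1.pdens_def S0.pdens_def by simp
 qed
 have Dm[measurable]: "D : meas borel" unfolding D_def[abs_def] by measurable
 have "(nn_integral lborel (%z. ennreal ((S1.sym_kern (%w. w C) z-S0.sym_kern (%w. w C) z)^2))) <= (nn_integral lborel (%z. ennreal (g z)))"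
  using pt by (intro nn_integral_mono ennreal_leI)
 also have "... = (nn_integral lborel (%t. (nn_integral lborel (%x. ennreal (g (x, t))))))"
 proof -
  have "g = (%z. of_bool (0 < fst z & 0 < snd z & fst z <= s*(1+1/snd z))*D (snd z))"
  by (auto simp: g_def fun_eq_iff quad_def indicator_def mem_Times_iff)
  moreover have "... : meas (lborel |*| lborel)" by measurable
  ultimately have "(%z. ennreal (g z)) : meas (lborel |*| lborel)" by simp
  from lborel_pair.nn_integral_snd[OF this] show ?thesis by (simp add: lborel_prod)
 qed
 also have "... = (nn_integral lborel (%t. ennreal (s*(pos t*(D t*(1+1/t))))))"
 proof (intro nn_integral_cong)
  fix t :: real
  have "(nn_integral lborel (%x. ennreal (g (x, t)))) = (nn_integral lborel (%x. ennreal (pos t*D t)*(pos x*indicator {..s*(1+1/t)} x)))"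
  by (intro nn_integral_cong) (auto simp: g_def quad_def indicator_def)
  also have "... = ennreal (pos t*D t)*(nn_integral lborel (%x. pos x*indicator {..s*(1+1/t)} x))"
  by (rule nn_integral_cmult) measurable
  also have "... = ennreal (s*(pos t*(D t*(1+1/t))))"
  proof (cases "0 < t")
  case True
  then show ?thesis using s S0.nn_integral_interval[of "s*(1+1/t)"] by (simp add: D_def ac_simps flip: ennreal_mult)
  qed simp
  finally show "(nn_integral lborel (%x. ennreal (g (x, t)))) = ennreal (s*(pos t*(D t*(1+1/t))))" .
 qed
 also have "... = ennreal (s*(LBINT t. pos t*(D t*(1+1/t))))"
  using e(2) s unfolding D_def[symmetric]
  by (subst nn_integral_eq_integral) (auto simp: D_def indicator_def)
 also have "... <= ennreal ((sqrt (2 * s) * sqrt e)^2)"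
 proof (intro ennreal_leI)
  have "s*(LBINT t. pos t*(D t*(1+1/t))) <= s*e"
  using mult_left_mono[OF e(3) s] unfolding D_def .
  also have "... <= 2 * s*e" using mult_nonneg_nonneg[OF s e(1)] by linarith
  finally show "s*(LBINT t. pos t*(D t*(1+1/t))) <= (sqrt (2 * s) * sqrt e)^2"
  using e s by (simp add: power_mult_distrib)
 qed
 finally show ?thesis using r e s S1.sym_kern_measurable[OF r(1)] S0.sym_kern_measurable[OF r(2)]
  unfolding close_def by (auto intro!: l2_leI_nn)
qed

end

lemma integral_inverse_sqrt:
 assumes "0 <= (c::real)"
 shows "intb (%x. indicator {0<..c} x/sqrt x)" "(LBINT x. indicator {0<..c} x/sqrt x) = 2 * sqrt c"
proof -
 have "((%x. x powr (- 1/2)) has_integral (c powr (- 1/2+1)/(- 1/2+1))) {0..c}"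
  by (rule has_integral_powr_from_0) (use assms in auto)
 then have "((%x. if x : {0..c} then x powr (- 1/2) else 0) has_integral (c powr (- 1/2+1)/(- 1/2+1))) UNIV"
  by (rule has_integral_restrict_UNIV[THEN iffD2])
 also have "(%x. if x : {0..c} then x powr (- 1/2) else 0) = (%x. indicator {0..c} x*x powr (- 1/2))"
  by (auto simp: indicator_def)
 finally have "((%x. indicator {0..c} x*x powr (- 1/2)) has_integral (c powr (- 1/2+1)/(- 1/2+1))) UNIV" .
 then have "(nn_integral lborel (%x. ennreal (indicator {0..c} x*x powr (- 1/2)))) = ennreal (c powr (- 1/2+1)/(- 1/2+1))"
  by (intro nn_integral_has_integral_lborel) auto
 also have "c powr (- 1/2+1)/(- 1/2+1) = 2 * sqrt c" using assms by (simp add: powr_half_sqrt)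
 also have "(%x. indicator {0..c} x*x powr (- 1/2)) = (%x. indicator {0<..c} x/sqrt x :: real)"
  by (auto simp: fun_eq_iff indicator_def powr_minus powr_half_sqrt field_simps)
 finally have n: "(nn_integral lborel (%x. ennreal (indicator {0<..c} x/sqrt x))) = ennreal (2 * sqrt c)" .
 have nn: "0 <= indicator {0<..c} x/sqrt x" for x by (auto simp: indicator_def)
 then show i: "intb (%x. indicator {0<..c} x/sqrt x)" by (intro integrableI_nonneg) (auto simp: n)
 show "(LBINT x. indicator {0<..c} x/sqrt x) = 2 * sqrt c"
  using nn_integral_eq_integral[OF i] nn n assms by (simp add: integral_nonneg_AE)
qed

context noise
begin

lemma jointly_Z: "jointly lborel (%x w. indicator {0<..Xp p t} x*(dens (x, x*t)*(W1 w x*t-W2 w (x*t))))"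
proof -
 have "(%z. ((t, snd z), fst z)) : measurable (lborel |*| Y) ((borel |*| Y) |*| lborel)" for Y :: "'y measure" by measurable
 from mcomp[OF this Z_integrand_measurable[OF mp]]
 have 1: "(%(x, om). indicator {0<..Xp p t} x*(dens (x, x*t)*(W1 (w om) x*t-W2 (w om) (x*t)))) : meas (lborel |*| N)" by (simp add: case_prod_beta')
 have "(%z. ((t, snd z), fst z)) : measurable (lborel |*| La) ((borel |*| La) |*| lborel)" by measurable
 from 1 mcomp[OF this Z_integrand_measurable[OF mpi]] show ?thesis unfolding jointly_def by (simp add: case_prod_beta')
qed

lemma jointly_B: "jointly lborel (%x w. indicator {s<..} x*(dens (x, y_real p x)*(W1 w x*ydv p x-W2 w (y_real p x))))"
proof -
 have "(%z. ((s, snd z), fst z)) : measurable (lborel |*| N) ((borel |*| N) |*| lborel)" by measurable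
 from mcomp[OF this B_integrand_measurable[OF mp]]
 have 1: "(%(x, om). indicator {s<..} x*(dens (x, y_real p x)*(W1 (w om) x*ydv p x-W2 (w om) (y_real p x)))) : meas (lborel |*| N)" by (simp add: case_prod_beta')
 have "(%z. ((s, snd z), fst z)) : measurable (lborel |*| La) ((borel |*| La) |*| lborel)" by measurable
 from 1 mcomp[OF this B_integrand_measurable[OF mpi]] show ?thesis unfolding jointly_def by (simp add: case_prod_beta')
qed

definition beta_can :: "real => (pt set => real) => real" where
 "beta_can th u = 1/PhiT p*alpha_can p th u + - (Phi p La th / (PhiT p)^2)*alpha_lim p u"

lemma Phi_measurable[measurable]: "Phi p La : meas borel"
proof -
 have "(%(th::real, t). adens p t * of_bool (arctan t <= th)) : meas (borel |*| lborel)" by measurable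
 from lborel.borel_measurable_lebesgue_integral[OF this] show ?thesis unfolding Phi_eq[OF p, abs_def] .
qed

lemma beta_can_measurable:
 assumes "meas_paths p Y y"
 shows "(%(th, x). beta_can th (y x)) : meas (borel |*| Y)"
proof -
 have [measurable]: "(%z. alpha_can p (fst z) (y (snd z))) : meas (borel |*| Y)"
  using alpha_can_measurable[OF assms] by (simp add: case_prod_beta')
 have [measurable]: "(%x. alpha_lim p (y x)) : meas Y" by (rule alpha_lim_measurable[OF assms])
 show ?thesis unfolding beta_can_def case_prod_beta' by measurable
qed

lemma jointly_beta: "c : meas borel ==> jointly lborel (%ps w. c ps * beta_can ps w)"
 using beta_can_measurable[OF mp] beta_can_measurable[OF mpi] unfolding jointly_def case_prod_beta'
 by (auto intro!: borel_measurable_times simp: measurable_fst cong: measurable_cong_sets)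

lemma jointly_I:
 fixes si :: "(real \<times> real) measure"
 assumes si: "sets si = sets (restrict_space borel ({0..1} \<times> {0..1}))" and g: "g : meas si"
 shows "jointly si (%v w. g v * I_kernel v w)"
proof -
 have id: "(%v. v) : measurable si borel" unfolding measurable_cong_sets[OF si refl] by (rule measurable_restrict_space1) simp
 have "(%z. I_kernel (fst z) (w (snd z))) : meas (si |*| N)"
  using mcomp[OF measurable_Pair[OF mcomp[OF measurable_fst id] measurable_snd] I_kernel_measurable[OF mp]]
  by simp
 moreover have "(%z. I_kernel (fst z) (%C. indicator C (snd z))) : meas (si |*| La)"
  using mcomp[OF measurable_Pair[OF mcomp[OF measurable_fst id] measurable_snd] I_kernel_measurable[OF mpi]]
  by simp
 ultimately show ?thesis unfolding jointly_def case_prod_beta'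
  by (auto intro!: borel_measurable_times mcomp[OF measurable_fst g])
qed

definition M_can :: "(real => real) => (pt set => real) => real" where
 "M_can f u = (LBINT ps. indicator {0<..<pi/2} ps * f ps * beta_can ps u)"

definition I_can :: "(real \<times> real) measure => (real \<times> real => real) => (pt set => real) => real" where
 "I_can si g u = (LINT v|si. g v * I_kernel v u)"

definition G_can :: "(real => real) => (real \<times> real) measure => (real \<times> real => real ^ 'm::finite) => (real => real) => (real => real ^ 'm) => real => (pt set => real) => real" where
 "G_can f si g m D th u = beta_can th u+(m th * M_can f u + - 1*(\<Sum>j\<in>UNIV. D th $ j*I_can si (%v. g v $ j) u))"

end

context noise_pair
begin

lemma close_W1: "close (%w. W1 w x) (%w. W1 w x) (sqrt (2*abs x)) (sqrt (2*abs x) * sqrt e)"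
 and close_W2: "close (%w. W2 w x) (%w. W2 w x) (sqrt (2*abs x)) (sqrt (2*abs x) * sqrt e)"
proof -
 have "ennreal x <= ennreal (abs x)" by (intro ennreal_leI) simp
 then have "S0.strips x <= S0.strips (abs x)" unfolding S0.strips_def by (auto intro: order_trans)
 then show "close (%w. W1 w x) (%w. W1 w x) (sqrt (2*abs x)) (sqrt (2*abs x) * sqrt e)"
  "close (%w. W2 w x) (%w. W2 w x) (sqrt (2*abs x)) (sqrt (2*abs x) * sqrt e)"
  unfolding W1_def W2_def using S0.strip_strips[of x] S0.strip_sets[of x] by (auto intro!: close_set)
qed

text \<open>The combination of the two marginal processes that is integrated over a curve with tangent \<open>(1, t)\<close>.\<close>

lemma close_tangent:
 "close (%w. W1 w x*t-W2 w y) (%w. W1 w x*t-W2 w y)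
  (abs t * sqrt (2*abs x)+sqrt (2*abs y)) ((abs t * sqrt (2*abs x)+sqrt (2*abs y)) * sqrt e)"
 using close_add[OF close_scale_const[OF close_W1[of x], of t] close_scale_const[OF close_W2[of y], of "- 1"]]
 by (simp add: algebra_simps)

lemma close_zero: "close (%w. 0) (%w. 0) 0 0"
 using close_sum[of "{} :: nat set"] by simp

text \<open>Along the ray the integrand has L2 size of order a(t)/x times t sqrt x + sqrt (x t).
  Integrating 1/sqrt x up to Xp <= 1 + 1/t and using the decay C/(1 + t) of \<open>a\<close> leaves
  a bound that is uniform in the slope.\<close>

lemma close_Z:
 assumes C: "0 <= C" "S1.apos t <= C/(1+t)" "S0.apos t <= C/(1+t)" "abs (S1.apos t-S0.apos t) <= e/(1+t)" and t: "0 < t"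
 shows "close (S1.Z_ray p t) (S0.Z_ray p t) (4*C) (4*(e+C * sqrt e))"
proof -
 define X where "X = Xp p t"
 have X: "1 <= X" "X <= 1+1/t" unfolding X_def using t by (auto intro!: Xp_bounds S1.p)
 \<comment> \<open>Chosen such that \<open>C * k x\<close> bounds the integrand in L2, with
   \<open>ka\<close> collecting the dependence on the slope apart from the upper limit
   \<open>X\<close>.\<close>
 define ka where "ka = sqrt 2*(t+sqrt t)/(1+t)"
 define k where "k x = ka * (indicator {0<..X} x/sqrt x)" for x :: real
 have kint: "integrable lborel k" "(LBINT x. k x) = ka * (2 * sqrt X)"
  unfolding k_def[abs_def] integral_mult_right_zero using integral_inverse_sqrt[of X] X
  by (auto intro!: integrable_mult_right simp del: times_divide_eq_right)
 have "ka * (2 * sqrt X) <= 4"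
 proof -
  have "ka * (2 * sqrt X) <= ka * (2 * sqrt ((1+t)/t))"
  using X t unfolding ka_def by (intro mult_left_mono) (auto simp: field_simps)
  also have "... = 2 * sqrt 2*(sqrt t+1)/sqrt (1+t)"
  proof -
  have "t = sqrt t * sqrt t" "1+t = sqrt (1+t) * sqrt (1+t)" using t by simp_all
  define u v where "u = sqrt t" and "v = sqrt (1+t)"
  have uv: "0 < u" "0 < v" "t = u*u" "1+t = v * v" using t by (simp_all add: u_def v_def)
  have "ka * (2*(v / u)) = 2 * sqrt 2*(u+1)/v" unfolding ka_def u_def[symmetric] uv(4) using uv(1,2) by (simp add: uv(3) field_simps)
  then show ?thesis by (simp add: real_sqrt_divide u_def v_def)
  qed
  also have "... <= 4"
  proof -
  have "2 * sqrt t <= 1+t" using sum_squares_bound[of 1 "sqrt t"] t by simp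
  then have "(sqrt t+1)^2 <= 2*(1+t)" using t by (simp add: power2_sum)
  then have "sqrt t+1 <= sqrt 2 * sqrt (1+t)" unfolding real_sqrt_mult[symmetric] by (rule real_le_rsqrt)
  then have "sqrt 2*(sqrt t+1) <= sqrt 2*(sqrt 2 * sqrt (1+t))" by (intro mult_left_mono) auto
  then have "sqrt 2*(sqrt t+1) <= 2 * sqrt (1+t)" by (simp add: mult.assoc[symmetric])
  then have "2 * sqrt 2*(sqrt t+1) <= 4 * sqrt (1+t)" by (simp only: mult.assoc)
  then show ?thesis using t by (simp add: divide_le_eq)
  qed
  finally show ?thesis .
 qed
 have pt: "close (%w. indicator {0<..Xp p t} x*(S1.dens (x, x*t)*(W1 w x*t-W2 w (x*t))))
  (%w. indicator {0<..Xp p t} x*(S0.dens (x, x*t)*(W1 w x*t-W2 w (x*t)))) (C * k x) ((e+C * sqrt e) * k x)" for x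
 proof (cases "0 < x & x <= X")
  case False
  then show ?thesis using close_zero by (auto simp: X_def k_def)
 next
  case True
  have d: "S1.dens (x, x*t) = S1.apos t/x" "S0.dens (x, x*t) = S0.apos t/x"
  using True t by (simp_all add: S1.dens_def S0.dens_def quad_def S1.l_ray S0.l_ray S1.apos_def S0.apos_def)
  have kx: "k x = (t * sqrt (2*x)+sqrt (2*(x*t)))/(1+t)/x"
  proof -
  have "x = sqrt x * sqrt x" using True by simp
  then have "sqrt x/x = 1/sqrt x" using True by (metis nonzero_divide_mult_cancel_left real_sqrt_eq_zero_cancel_iff less_irrefl)
  moreover have "(t * sqrt (2*x)+sqrt (2*(x*t)))/(1+t)/x = ka * (sqrt x/x)"
  by (simp add: ka_def real_sqrt_mult field_simps)
  ultimately show ?thesis using True by (simp add: k_def)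
  qed
  have bnd: "abs (S1.apos t/x) <= C/(1+t)/x" "abs (S0.apos t/x) <= C/(1+t)/x" "abs (S1.apos t/x-S0.apos t/x) <= e/(1+t)/x"
  using True C S1.apos_nonneg[of t] S0.apos_nonneg[of t]
  by (auto simp: abs_div_pos[symmetric] diff_divide_distrib[symmetric] simp del: divide_divide_eq_left intro!: divide_right_mono)
  have K: "C/(1+t)/x*(abs t * sqrt (2*abs x)+sqrt (2*abs (x*t))) = C * k x"
  "e/(1+t)/x*(abs t * sqrt (2*abs x)+sqrt (2*abs (x*t))) = e * k x"
  using True t by (simp_all add: kx abs_mult)
  have c: "e/(1+t)/x*(abs t * sqrt (2*abs x)+sqrt (2*abs (x*t)))+C/(1+t)/x*((abs t * sqrt (2*abs x)+sqrt (2*abs (x*t))) * sqrt e) = (e+C * sqrt e) * k x"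
  unfolding mult.assoc[symmetric] K by (simp add: algebra_simps)
  show ?thesis using close_scale[OF close_tangent[of x t "x*t"] bnd, unfolded K(1) c] True by (simp add: d X_def)
 qed
 have "close (%w. (LBINT x. indicator {0<..Xp p t} x*(S1.dens (x, x*t)*(W1 w x*t-W2 w (x*t)))))
  (%w. (LBINT x. indicator {0<..Xp p t} x*(S0.dens (x, x*t)*(W1 w x*t-W2 w (x*t))))) (LBINT x. C * k x) (LBINT x. (e+C * sqrt e) * k x)"
  by (rule close_integral[OF sigma_finite_lborel S1.jointly_Z S0.jointly_Z pt]) (use kint in auto)
 moreover have "(LBINT x. C * k x) <= 4*C" "(LBINT x. (e+C * sqrt e) * k x) <= 4*(e+C * sqrt e)"
  using kint C(1) e(1) mult_left_mono[OF \<open>ka * (2 * sqrt X) <= 4\<close> C(1)] mult_left_mono[OF \<open>ka * (2 * sqrt X) <= 4\<close>, of "e+C * sqrt e"] by auto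
 ultimately show ?thesis unfolding S1.Z_ray_def[abs_def] S0.Z_ray_def[abs_def] by (rule close_mono)
qed

end

text \<open>The scalar coefficients of the functionals are integrals of \<open>apos\<close> against
  a weight between 0 and 1 + 1/t, so the two marginal identities bound them by 2;
  \<open>coef_diff\<close> compares them within the same class.\<close>

lemma (in smooth_tail) coef_bounds:
 assumes "ph : meas borel" "!!t. 0 < t ==> 0 <= ph t & ph t <= 1+1/t"
 shows "intb (%t. apos t * ph t)" "0 <= (LBINT t. apos t * ph t)" "(LBINT t. apos t * ph t) <= 2"
proof -
 have le: "0 <= apos t * ph t & apos t * ph t <= apos t+apos t/t" for t
 proof (cases "0 < t")
  case True
  have "apos t * ph t <= apos t*(1+1/t)" using assms(2)[OF True] apos_nonneg by (intro mult_left_mono) auto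
  then show ?thesis using assms(2)[OF True] apos_nonneg[of t] by (simp add: algebra_simps)
 qed (simp add: apos_def)
 show i: "intb (%t. apos t * ph t)"
  by (rule lint_bound[OF lintegrable_add[OF apos_integrable(1,3)]])
  (use assms(1) le in \<open>auto intro!: AE_I2 order_trans[OF _ abs_ge_self]\<close>)
 show "0 <= (LBINT t. apos t * ph t)" using le by (intro integral_nonneg_AE) auto
 have "(LBINT t. apos t * ph t) <= (LBINT t. apos t+apos t/t)"
  using i le apos_integrable by (intro integral_mono) auto
 also have "... = 2" by (simp add: apos_integrable)
 finally show "(LBINT t. apos t * ph t) <= 2" .
qed

context noise_pair
begin

lemma coef_diff:
 assumes "ph : meas borel" "!!t. 0 < t ==> 0 <= ph t & ph t <= 1+1/t"
 shows "abs ((LBINT t. S1.apos t * ph t)-(LBINT t. S0.apos t * ph t)) <= e"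
proof -
 note i = S1.coef_bounds(1)[OF assms] S0.coef_bounds(1)[OF assms]
 have "abs ((LBINT t. S1.apos t * ph t)-(LBINT t. S0.apos t * ph t)) = abs (\<integral>t. S1.apos t * ph t-S0.apos t * ph t \<partial>lborel)"
  using i by simp
 also have "... <= (LBINT t. abs (S1.apos t * ph t-S0.apos t * ph t))" by (rule integral_abs_bound)
 also have "... <= (LBINT t. pos t*(abs (S1.apos t-S0.apos t)*(1+1/t)))"
 proof (rule integral_mono)
  show "intb (%t. abs (S1.apos t * ph t-S0.apos t * ph t))"
  by (intro integrable_abs Bochner_Integration.integrable_diff i)
  show "abs (S1.apos t * ph t-S0.apos t * ph t) <= pos t*(abs (S1.apos t-S0.apos t)*(1+1/t))" for t
  using assms(2)[of t] by (cases "0 < t") (auto simp: left_diff_distrib[symmetric] abs_mult S1.apos_def S0.apos_def intro!: mult_left_mono)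
 qed (rule e)
 finally show ?thesis using e by linarith
qed

text \<open>The sum of the two densities majorizes both and has weighted integral 4, their absolute
  difference controls the distance, and both go through \<open>curve_integral_le\<close>. The second
  claim records that the path integral converges almost surely, which a Bochner integral with its
  default value would conceal.\<close>

lemma close_B_curve:
 assumes pt: "p ~= top" and s: "1 <= s"
 shows "close (S1.B_curve p s) (S0.B_curve p s) 16 (4*e+16 * sqrt e)"
  "AE om in N1. intb (%x. indicator {s<..} x*(S1.dens (x, y_real p x)*(W1 (w1 om) x*ydv p x-W2 (w1 om) (y_real p x))))"
proof -
 define F D where "F t = S1.apos t+S0.apos t" and "D t = abs (S1.apos t-S0.apos t)" for t
 define J where "J F x = indicator {1<..} x*(F (y_real p x/x)/x*(sqrt x*abs (deriv (y_real p) x)+sqrt (y_real p x)))"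
  for F :: "real => real" and x
 have "(%t. pos t*(F t*(1+1/t))) = (%t. (S1.apos t+S1.apos t/t)+(S0.apos t+S0.apos t/t))"
  by (auto simp: F_def fun_eq_iff indicator_def S1.apos_def S0.apos_def algebra_simps)
 then have Fi: "intb (%t. pos t*(F t*(1+1/t)))" "(LBINT t. pos t*(F t*(1+1/t))) = 4"
  using S1.apos_integrable S0.apos_integrable by simp_all
 have m: "F : meas borel" "D : meas borel" unfolding F_def[abs_def] D_def[abs_def] by measurable
 have JF: "intb (J F)" "(LBINT x. J F x) <= 2*4"
  using curve_integral_le[OF S1.p pt m(1) _ Fi(1)] S1.apos_nonneg S0.apos_nonneg Fi(2) unfolding J_def[abs_def] by (auto simp: F_def)
 have JD: "intb (J D)" "(LBINT x. J D x) <= 2*e"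
  using curve_integral_le[OF S1.p pt m(2) _ e(2)[folded D_def]] e(3) unfolding J_def[abs_def] by (auto simp: D_def)
 have pw: "close (%w. indicator {s<..} x*(S1.dens (x, y_real p x)*(W1 w x*ydv p x-W2 w (y_real p x))))
  (%w. indicator {s<..} x*(S0.dens (x, y_real p x)*(W1 w x*ydv p x-W2 w (y_real p x))))
  (sqrt 2*J F x) (sqrt 2*(J D x+J F x * sqrt e))" for x
 proof (cases "s < x")
  case False
  have "0 <= J F x" "0 <= J D x" using S1.apos_nonneg S0.apos_nonneg by (auto simp: J_def indicator_def F_def D_def y_real_def intro!: mult_nonneg_nonneg divide_nonneg_nonneg add_nonneg_nonneg)
  then show ?thesis using False e by (auto intro!: close_mono[OF close_zero])
 next
  case True
  define y where "y = y_real p x"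
  have x: "1 < x" using True s by simp
  have y: "1 <= y" unfolding y_def by (rule y_real_ge_1[OF S1.p pt x])
  define k where "k = abs (ydv p x) * sqrt (2*abs x)+sqrt (2*abs y)"
  have d: "S1.dens (x, y) = S1.apos (y/x)/x" "S0.dens (x, y) = S0.apos (y/x)/x"
  using x y S1.l_ray[of x "y/x"] S0.l_ray[of x "y/x"] by (simp_all add: S1.dens_def S0.dens_def quad_def S1.apos_def S0.apos_def)
  have bnd: "abs (S1.apos (y/x)/x) <= F (y/x)/x" "abs (S0.apos (y/x)/x) <= F (y/x)/x" "abs (S1.apos (y/x)/x-S0.apos (y/x)/x) <= D (y/x)/x"
  using x S1.apos_nonneg[of "y/x"] S0.apos_nonneg[of "y/x"]
  by (auto simp: F_def D_def diff_divide_distrib[symmetric] intro!: divide_right_mono)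
  have k: "k = sqrt 2*(sqrt x*abs (deriv (y_real p) x)+sqrt y)"
  using x y by (simp add: k_def real_sqrt_mult y_real_deriv[OF S1.p pt x] ydv_def algebra_simps)
  have K: "F (y/x)/x * k = sqrt 2*J F x" "D (y/x)/x * k = sqrt 2*J D x"
  using x by (simp_all add: k J_def y_def)
  have c: "D (y/x)/x * k+F (y/x)/x*(k * sqrt e) = sqrt 2*(J D x+J F x * sqrt e)"
  unfolding mult.assoc[symmetric] K by (simp add: algebra_simps)
  show ?thesis using close_scale[OF close_tangent[of x "ydv p x" y] bnd, folded k_def, unfolded K(1) c] True
  by (simp add: d[unfolded y_def] y_def)
 qed
 have "close (%w. (LBINT x. indicator {s<..} x*(S1.dens (x, y_real p x)*(W1 w x*ydv p x-W2 w (y_real p x)))))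
  (%w. (LBINT x. indicator {s<..} x*(S0.dens (x, y_real p x)*(W1 w x*ydv p x-W2 w (y_real p x)))))
  (LBINT x. sqrt 2*J F x) (LBINT x. sqrt 2*(J D x+J F x * sqrt e))"
  by (rule close_integral[OF sigma_finite_lborel S1.jointly_B S0.jointly_B pw]) (use JF JD in auto)
 moreover have s2: "sqrt 2 <= 2" by (rule real_le_lsqrt) auto
 have nn: "0 <= (LBINT x. J F x)" "0 <= (LBINT x. J D x)"
  using S1.apos_nonneg S0.apos_nonneg by (auto simp: J_def indicator_def F_def D_def y_real_def intro!: integral_nonneg_AE mult_nonneg_nonneg divide_nonneg_nonneg add_nonneg_nonneg)
 have "(LBINT x. sqrt 2*J F x) <= 16"
  using mult_mono[OF s2 JF(2)] nn by simp
 moreover have "(LBINT x. sqrt 2*(J D x+J F x * sqrt e)) <= 4*e+16 * sqrt e"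
 proof -
  have "(LBINT x. J F x) * sqrt e <= 8 * sqrt e" using JF e by (intro mult_right_mono) auto
  then have "(LBINT x. J D x)+(LBINT x. J F x) * sqrt e <= 2*e+8 * sqrt e" using JD by simp
  from mult_mono[OF s2 this] show ?thesis using nn e JF JD by simp
 qed
 ultimately show "close (S1.B_curve p s) (S0.B_curve p s) 16 (4*e+16 * sqrt e)"
  unfolding S1.B_curve_def[abs_def] S0.B_curve_def[abs_def] by (elim close_mono) auto
 show "AE om in N1. intb (%x. indicator {s<..} x*(S1.dens (x, y_real p x)*(W1 (w1 om) x*ydv p x-W2 (w1 om) (y_real p x))))"
  by (rule S1.represents_integral(2)[OF sigma_finite_lborel S1.jointly_B pw[unfolded close_def, THEN conjunct1]]) (use JF in auto)
qed

lemma close_margins: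
 assumes "ph : meas borel" "!!t. 0 < t ==> 0 <= ph t & ph t <= 1+1/t"
  and "ps : meas borel" "!!t. 0 < t ==> 0 <= ps t & ps t <= 1+1/t" and x: "abs x <= 1" "abs y <= 1"
 shows "close (%w. - (LBINT t. S1.apos t * ph t)*W1 w x + - (LBINT t. S1.apos t * ps t)*W2 w y)
  (%w. - (LBINT t. S0.apos t * ph t)*W1 w x + - (LBINT t. S0.apos t * ps t)*W2 w y) 6 (3*e+6 * sqrt e)"
proof -
 \<comment> \<open>3/2 is a bound for sqrt 2; with coefficients at most 2 the two terms add up to
   6.\<close>
 have "sqrt (2*abs z) <= 3/2" if "abs z <= 1" for z :: real
  by (rule real_le_lsqrt) (use that in \<open>auto simp: power2_eq_square\<close>)
 from this[OF x(1)] this[OF x(2)] have s: "sqrt (2*abs x) <= 3/2" "sqrt (2*abs y) <= 3/2" .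
 have W: "close (%w. W1 w x) (%w. W1 w x) (3/2) (3/2 * sqrt e)" "close (%w. W2 w y) (%w. W2 w y) (3/2) (3/2 * sqrt e)"
  using mult_right_mono[OF s(1), of "sqrt e"] mult_right_mono[OF s(2), of "sqrt e"] s e
  by (auto intro!: close_mono[OF close_W1] close_mono[OF close_W2] simp del: mult_le_cancel_right)
 have b: "abs (- (LBINT t. S1.apos t * ph t)) <= 2" "abs (- (LBINT t. S0.apos t * ph t)) <= 2"
  "abs (- (LBINT t. S1.apos t * ph t) - - (LBINT t. S0.apos t * ph t)) <= e"
  using S1.coef_bounds[OF assms(1,2)] S0.coef_bounds[OF assms(1,2)] coef_diff[OF assms(1,2)] by auto
 have c: "abs (- (LBINT t. S1.apos t * ps t)) <= 2" "abs (- (LBINT t. S0.apos t * ps t)) <= 2"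
  "abs (- (LBINT t. S1.apos t * ps t) - - (LBINT t. S0.apos t * ps t)) <= e"
  using S1.coef_bounds[OF assms(3,4)] S0.coef_bounds[OF assms(3,4)] coef_diff[OF assms(3,4)] by auto
 show ?thesis using close_add[OF close_scale[OF W(1) b] close_scale[OF W(2) c]] by (simp add: algebra_simps)
qed

end

text \<open>The substitution x = 1/t brings the coefficient into the form treated by
  \<open>coef_bounds\<close>.\<close>

lemma (in smooth_tail) tail_coef:
 assumes m: "1 <= m"
 shows "(LBINT x. indicator {m..} x*(apos (1/x)/x)) = (LBINT t. apos t*(of_bool (m <= 1/t)/t))"
proof -
 define F where "F t = of_bool (m <= 1/t)*apos t" for t :: real
 have Fm: "F : meas borel" unfolding F_def[abs_def] by measurable
 have i: "intb (%t. pos t*(F t/t))"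
 proof (rule lint_bound[OF apos_integrable(3)])
  show "(%t. pos t*(F t/t)) : meas lborel" using Fm by simp
 qed (auto simp: F_def indicator_def apos_def)
 have "(LBINT x. indicator {m..} x*(apos (1/x)/x)) = (LBINT x. pos x*(F (1/x)/x))"
  using m by (intro lint_cong) (auto simp: F_def indicator_def)
 also have "... = (LBINT t. pos t*(F t/t))" by (rule integrable_inverse_subst(2)[OF Fm i])
 also have "... = (LBINT t. apos t*(of_bool (m <= 1/t)/t))"
  by (intro lint_cong) (auto simp: F_def indicator_def apos_def)
 finally show ?thesis .
qed

context noise_pair
begin

lemma close_top:
 fixes A :: "real set" and m :: real
 assumes A: "A : sets borel" and m: "1 <= m"
 shows "close (%w. - (LBINT y. indicator A y*S1.apos y)*W1 w 1 + - (LBINT x. indicator {m..} x*(S1.apos (1/x)/x))*W2 w 1)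
  (%w. - (LBINT y. indicator A y*S0.apos y)*W1 w 1 + - (LBINT x. indicator {m..} x*(S0.apos (1/x)/x))*W2 w 1)
  16 (4*e+16 * sqrt e)"
 unfolding S1.tail_coef[OF m] S0.tail_coef[OF m] mult.commute[of "indicator A _"]
 by (rule close_mono[OF close_margins]) (use A e in \<open>auto simp: indicator_def\<close>)

lemma close_B_can: "0 < t ==> close (S1.B_can p t) (S0.B_can p t) 16 (4*e+16 * sqrt e)"
 using close_B_curve(1) Xp_bounds(1)[OF S1.p, of t] close_top[of "{1..max 1 t}" "max 1 (1/t)"]
 unfolding S1.B_can_def[abs_def] S0.B_can_def[abs_def] by (cases "p = top") auto

lemma close_B_lim: "close (S1.B_lim p) (S0.B_lim p) 16 (4*e+16 * sqrt e)"
 using close_B_curve(1) close_top[of "{1..}" 1]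
 unfolding S1.B_lim_def[abs_def] S0.B_lim_def[abs_def] by (cases "p = top") auto

lemma close_I_kernel:
 assumes v: "v : {0..1} \<times> {0..1}"
 shows "close (S1.I_kernel v) (S0.I_kernel v) 8 (8*(e+sqrt e))"
proof -
 have 1: "close (%w. w (A_set (clampI v))) (%w. w (A_set (clampI v))) (sqrt (2*1)) (sqrt (2*1) * sqrt e)"
  using S0.A_set_strips[OF clampI_id(2)[of v]] S0.A_set_sets by (intro close_set) auto
 have 2: "close (%w. - S1.e1 v * W1 w (fst v) + - S1.e2 v * W2 w (snd v)) (%w. - S0.e1 v * W1 w (fst v) + - S0.e2 v * W2 w (snd v)) 6 (3*e+6 * sqrt e)"
  unfolding S1.e1_def S0.e1_def S1.e2_def S0.e2_def times_divide_eq_left[symmetric] times_divide_eq_right[symmetric]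
  using close_margins[of "%t. of_bool (snd v < fst v * t)" "%t. of_bool (fst v * t < snd v)/t" "fst v" "snd v"] v
  by (auto simp: field_simps)
 have "sqrt 2 <= 2" by (rule real_le_lsqrt) auto
 then have "sqrt 2 * sqrt e <= 2 * sqrt e" using e by (intro mult_right_mono) auto
 then show ?thesis unfolding S1.I_kernel_def[abs_def] S0.I_kernel_def[abs_def]
  using e \<open>sqrt 2 <= 2\<close> by (intro close_mono[OF close_add[OF 1 2]]) auto
qed

text \<open>18 = 2 + 16: sqrt 4 from the indicator of \<open>C_set\<close> inside
  \<open>strips 2\<close>, and 16 from the boundary term; 4C comes from the ray integral. None of
  the constants depends on the angle.\<close>

lemma close_alpha:
 assumes C: "0 <= C" "!!t. 0 < t ==> S1.apos t <= C/(1+t)" "!!t. 0 < t ==> S0.apos t <= C/(1+t)"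
  "!!t. 0 < t ==> abs (S1.apos t-S0.apos t) <= e/(1+t)"
 shows "0 < th ==> th < pi/2 ==> close (S1.alpha_can p th) (S0.alpha_can p th) (18+4*C) ((18+4*C)*(e+sqrt e))"
  "close (S1.alpha_lim p) (S0.alpha_lim p) (18+4*C) ((18+4*C)*(e+sqrt e))"
proof -
 have Ce: "0 <= C*e" "0 <= C * sqrt e" "0 <= sqrt e" using C e by auto
 have 1: "close (%w. w (C_set p (clampT th))) (%w. w (C_set p (clampT th))) (sqrt (2*2)) (sqrt (2*2) * sqrt e)" for th
  using S0.C_set_strips[OF S0.p, of "clampT th"] S0.C_set_sets[OF S0.p] by (intro close_set) auto
 show "close (S1.alpha_lim p) (S0.alpha_lim p) (18+4*C) ((18+4*C)*(e+sqrt e))"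
  unfolding S1.alpha_lim_def[abs_def] S0.alpha_lim_def[abs_def]
  using C e Ce by (intro close_mono[OF close_add[OF 1 close_B_lim]]) (auto simp: algebra_simps)
 show "close (S1.alpha_can p th) (S0.alpha_can p th) (18+4*C) ((18+4*C)*(e+sqrt e))" if "0 < th" "th < pi/2"
 proof -
  have t: "0 < tan th" using that by (rule tan_gt_zero)
  show ?thesis unfolding S1.alpha_can_def[abs_def] S0.alpha_can_def[abs_def]
  using C e Ce by (intro close_mono[OF close_add[OF 1 close_add[OF close_Z[OF C(1) C(2-4)[OF t] t] close_B_can[OF t]]]]) (auto simp: algebra_simps)
 qed
qed

lemma total_close: "abs (S1.PhiT p-S0.PhiT p) <= e"
 and Phi_close: "abs (Phi p La1 th - Phi p La0 th) <= e"
proof -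
 have X: "0 < t ==> 0 <= Xp p t & Xp p t <= 1+1/t" for t using Xp_bounds[OF S1.p, of t] by auto
 have Y: "0 < t ==> 0 <= Xp p t * of_bool (arctan t <= th) & Xp p t * of_bool (arctan t <= th) <= 1+1/t" for t
  using X[of t] by auto
 show "abs (S1.PhiT p-S0.PhiT p) <= e" unfolding S1.PhiT_def S0.PhiT_def S1.adens_def S0.adens_def
  by (rule coef_diff[OF _ X]) auto
 show "abs (Phi p La1 th - Phi p La0 th) <= e" unfolding S1.Phi_eq[OF S1.p] S0.Phi_eq[OF S1.p] S1.adens_def S0.adens_def mult.assoc
  by (rule coef_diff[OF _ Y]) auto
qed

text \<open>Total masses are at least 1, so division is harmless: 1/T and P/T^2 are Lipschitz
  functions of (P, T) on 1 <= T, 0 <= P <= T.\<close>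

lemma ratio_close:
 "abs (1/S1.PhiT p) <= 1" "abs (1/S0.PhiT p) <= 1" "abs (1/S1.PhiT p-1/S0.PhiT p) <= e"
 "abs (- (Phi p La1 th / (S1.PhiT p)^2)) <= 1" "abs (- (Phi p La0 th / (S0.PhiT p)^2)) <= 1"
 "abs (- (Phi p La1 th / (S1.PhiT p)^2) - - (Phi p La0 th / (S0.PhiT p)^2)) <= 3*e"
proof -
 define T1 T0 P1 P0 where "T1 = S1.PhiT p" and "T0 = S0.PhiT p" and "P1 = Phi p La1 th" and "P0 = Phi p La0 th"
 have T: "1 <= T1" "1 <= T0" "abs (T1-T0) <= e" "abs (P1-P0) <= e"
  unfolding T1_def T0_def P1_def P0_def using S1.PhiT_bounds[OF S1.p] S0.PhiT_bounds[OF S0.p] total_close Phi_close by auto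
 have P: "0 <= P1" "P1 <= T1" "0 <= P0" "P0 <= T0"
 proof -
  have "Phi p La1 th <= S1.PhiT p" unfolding S1.Phi_eq[OF S1.p] S1.PhiT_def
  using S1.adens_bounds[OF S1.p] S1.adens_integrable[OF S1.p]
  by (intro integral_mono lint_bound[OF S1.adens_integrable[OF S1.p]]) auto
  moreover have "Phi p La0 th <= S0.PhiT p" unfolding S0.Phi_eq[OF S0.p] S0.PhiT_def
  using S0.adens_bounds[OF S0.p] S0.adens_integrable[OF S0.p]
  by (intro integral_mono lint_bound[OF S0.adens_integrable[OF S0.p]]) auto
  ultimately show "0 <= P1" "P1 <= T1" "0 <= P0" "P0 <= T0" unfolding P1_def P0_def T1_def T0_def by (auto simp: Phi_def)
 qed
 have inv: "abs (1/T1) <= 1" "abs (1/T0) <= 1" "abs (1/T1-1/T0) <= e"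
 proof -
  have TT: "1 <= T1*T0" using mult_mono[OF T(1,2)] T by simp
  have "abs (1/T1-1/T0) = abs (T1-T0)/(T1*T0)" using T by (simp add: divide_simps abs_mult abs_minus_commute)
  also have "... <= abs (T1-T0)/1" using TT by (intro divide_left_mono) auto
  finally show "abs (1/T1-1/T0) <= e" using T by simp
 qed (use T in auto)
 have PT: "0 <= P1/T1" "P1/T1 <= 1" "0 <= P0/T0" "P0/T0 <= 1" using T P by (auto simp: divide_le_eq)
 have prod: "abs (a1*b1-a0*b0) <= abs (a1-a0)+abs (b1-b0)" if "abs a1 <= 1" "abs b0 <= 1" for a1 b1 a0 b0 :: real
 proof -
  have "abs (a1*b1-a0*b0) = abs (a1*(b1-b0)+(a1-a0)*b0)" by (simp add: algebra_simps)
  also have "... <= abs a1*abs (b1-b0)+abs (a1-a0)*abs b0" by (metis abs_mult abs_triangle_ineq)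
  also have "... <= 1*abs (b1-b0)+abs (a1-a0)*1" using that by (intro add_mono mult_mono) auto
  finally show ?thesis by simp
 qed
 have q1: "abs (P1/T1-P0/T0) <= 2*e"
 proof -
  have "P1/T1-P0/T0 = (P1-P0)/T1+(P0/T0)*((T0-T1)/T1)" using T by (simp add: field_simps)
  also have "abs ... <= abs (P1-P0)*abs (1/T1)+abs (P0/T0)*(abs (T0-T1)*abs (1/T1))"
  by (rule order_trans[OF abs_triangle_ineq]) (simp add: abs_mult)
  also have "... <= e*1+1*(e*1)"
  proof -
  have "abs (P0/T0) <= 1" "abs (T0-T1) <= e" using PT T(3) by (simp_all only: abs_of_nonneg abs_minus_commute)
  then show ?thesis using T(4) inv(1) e(1) by (intro add_mono mult_mono mult_nonneg_nonneg) auto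
  qed
  finally show ?thesis by simp
 qed
 have r: "P1/T1^2 = P1/T1*(1/T1)" "P0/T0^2 = P0/T0*(1/T0)" by (simp_all add: power2_eq_square)
 have b: "abs (- (P1/T1^2)) <= 1" "abs (- (P0/T0^2)) <= 1" "abs (- (P1/T1^2) - - (P0/T0^2)) <= 3*e"
 proof -
  show "abs (- (P1/T1^2)) <= 1" "abs (- (P0/T0^2)) <= 1"
  unfolding abs_minus_cancel r abs_mult using mult_mono[of "abs (P1/T1)" 1 "abs (1/T1)" 1] mult_mono[of "abs (P0/T0)" 1 "abs (1/T0)" 1] PT inv by auto
  show "abs (- (P1/T1^2) - - (P0/T0^2)) <= 3*e"
  proof -
  have "abs (P1/T1) <= 1" using PT by (simp only: abs_of_nonneg)
  from q1 inv(3) prod[OF this inv(2), of "1/T1" "P0/T0"] show ?thesis unfolding r minus_diff_minus abs_minus_cancel by simp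
  qed
 qed
 show "abs (1/S1.PhiT p) <= 1" "abs (1/S0.PhiT p) <= 1" "abs (1/S1.PhiT p-1/S0.PhiT p) <= e"
  "abs (- (Phi p La1 th / (S1.PhiT p)^2)) <= 1" "abs (- (Phi p La0 th / (S0.PhiT p)^2)) <= 1"
  "abs (- (Phi p La1 th / (S1.PhiT p)^2) - - (Phi p La0 th / (S0.PhiT p)^2)) <= 3*e"
  using inv b unfolding T1_def T0_def P1_def P0_def .
qed

lemma close_beta:
 assumes a: "close (S1.alpha_can p th) (S0.alpha_can p th) K (K*(e+sqrt e))" "close (S1.alpha_lim p) (S0.alpha_lim p) K (K*(e+sqrt e))"
 shows "close (S1.beta_can th) (S0.beta_can th) (2*K) (6*K*(e+sqrt e))"
proof -
 have K: "0 <= K" "0 <= K * sqrt e" using close_nonneg[OF a(1)] e by auto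
 show ?thesis unfolding S1.beta_can_def[abs_def] S0.beta_can_def[abs_def] using K
  by (intro close_mono[OF close_add[OF close_scale[OF a(1) ratio_close(1-3)] close_scale[OF a(2) ratio_close(4-6)]]])
  (auto simp: algebra_simps)
qed

lemma close_M:
 assumes b: "!!th. 0 < th ==> th < pi/2 ==> close (S1.beta_can th) (S0.beta_can th) K c"
  and f: "f : meas borel" "!!th. 0 < th ==> th < pi/2 ==> abs (f th) <= B"
 shows "close (S1.M_can f) (S0.M_can f) (B*K*(pi/2)) (B * c*(pi/2))"
proof -
 let ?I = "indicator {0<..<pi/2} :: real => real"
 have "close (%w. ?I ps * f ps * S1.beta_can ps w) (%w. ?I ps * f ps * S0.beta_can ps w) (?I ps * (B*K)) (?I ps * (B * c))" for ps
  using close_scale[OF b, of ps "f ps" B "f ps" 0] f(2)[of ps] close_zero by (auto simp: indicator_def)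
 from close_integral[OF sigma_finite_lborel S1.jointly_beta S0.jointly_beta this] f(1)
 show ?thesis unfolding S1.M_can_def[abs_def] S0.M_can_def[abs_def] by (simp add: mult.commute)
qed

lemma close_I:
 fixes g :: "real \<times> real => real"
 assumes si: "sets si = sets (restrict_space borel ({0..1} \<times> {0..1}))" "finite_measure si" and g: "integrable si g"
 shows "close (S1.I_can si g) (S0.I_can si g) ((LINT v|si. abs (g v))*8) ((LINT v|si. abs (g v))*(8*(e+sqrt e)))"
proof -
 have sp: "space si = {0..1} \<times> {0..1}" using sets_eq_imp_space_eq[OF si(1)] by (simp add: space_restrict_space)
 have sf: "sigma_finite_measure si" using si(2) by (rule finite_measure.axioms)
 have gm: "g : meas si" using g by auto
 have "close (%w. g v * S1.I_kernel v w) (%w. g v * S0.I_kernel v w) (abs (g v)*8) (abs (g v)*(8*(e+sqrt e)))" if "v : space si" for v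
  using that unfolding sp by (intro close_scale_const close_I_kernel) auto
 from close_integral[OF sf S1.jointly_I[OF si(1) gm] S0.jointly_I[OF si(1) gm] this] g
 show ?thesis unfolding S1.I_can_def[abs_def] S0.I_can_def[abs_def] by simp
qed

lemma close_G:
 fixes g :: "real \<times> real => real ^ 'm::finite"
 assumes b: "close (S1.beta_can th) (S0.beta_can th) Kb cb" and M: "close (S1.M_can f) (S0.M_can f) KM cM"
  and I: "!!j. close (S1.I_can si (%v. g v $ j)) (S0.I_can si (%v. g v $ j)) KI cI"
  and m: "abs (m1 th) <= B" "abs (m0 th) <= B" "abs (m1 th - m0 th) <= de"
  and D: "norm (D1 th) <= B" "norm (D0 th) <= B" "norm (D1 th - D0 th) <= de"
 shows "close (S1.G_can f si g m1 D1 th) (S0.G_can f si g m0 D0 th)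
  (Kb+(B*KM+real CARD('m)*(B*KI))) (cb+((de * KM+B * cM)+real CARD('m)*(de * KI+B * cI)))"
proof -
 have Dj: "abs (D1 th $ j) <= B" "abs (D0 th $ j) <= B" "abs (D1 th $ j-D0 th $ j) <= de" for j
  using D Finite_Cartesian_Product.norm_nth_le[of "D1 th" j] Finite_Cartesian_Product.norm_nth_le[of "D0 th" j] Finite_Cartesian_Product.norm_nth_le[of "D1 th - D0 th" j] by auto
 have S: "close (%w. \<Sum>j\<in>UNIV. D1 th $ j*S1.I_can si (%v. g v $ j) w) (%w. \<Sum>j\<in>UNIV. D0 th $ j*S0.I_can si (%v. g v $ j) w)
  (\<Sum>j\<in>(UNIV :: 'm set). B*KI) (\<Sum>j\<in>(UNIV :: 'm set). de * KI+B * cI)"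
  by (rule close_sum) (auto intro!: close_scale[OF I] Dj)
 show ?thesis unfolding S1.G_can_def[abs_def] S0.G_can_def[abs_def]
  using close_add[OF b close_add[OF close_scale[OF M m] close_scale_const[OF S, of "- 1"]]] by simp
qed

end

section \<open>Regular versions of the process\<close>

lemma clamp_continuous: "continuous_on UNIV clampT" "continuous_on UNIV clampI"
 unfolding clampT_def[abs_def] clampI_def[abs_def] by (intro continuous_intros)+

context smooth_tail
begin

text \<open>The mean square of an increment is the measure of a symmetric difference, which tends to
  0 by dominated convergence inside \<open>strips B\<close>.\<close>

lemma noise_L2_continuous:
 assumes wn: "white_noise La N W" and C: "!!n. C n : sets La" "!!n. C n <= strips B" and D: "D : sets La" "D <= strips B" and B: "0 <= B"
  and ae: "AE z in La. EX m. ALL n>=m. z : C n \<longleftrightarrow> z : D"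
 shows "(%n. (LINT om|N. (W om (C n)-W om D)^2)) ----> 0"
proof -
 have fin: "C n : fin_sets La" "D : fin_sets La" for n using C D by (auto intro: fin_sets_strips)
 have eq: "(LINT om|N. (W om (C n)-W om D)^2) = (LINT z|La. (indicator (C n) z-indicator D z)^2)" for n
  using wiener_int_lin[OF wn wiener_int_set[OF wn fin(1)] wiener_int_set[OF wn fin(2)], of 1 n "- 1"]
  unfolding wiener_int_def by simp
 have "(%n. (LINT z|La. (indicator (C n) z-indicator D z)^2)) ----> (LINT z|La. (0::real))"
 proof (rule integral_dominated_convergence[where w = "indicator (strips B)"])
  show "integrable La (indicator (strips B) :: pt => real)" by (rule l2_le_indicator(2)[OF strips_fin[OF B]])
  show "AE z in La. (%n. (indicator (C n) z-indicator D z :: real)^2) ----> 0"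
  using ae
  proof eventually_elim
  case (elim z)
  then obtain m where "ALL n>=m. z : C n \<longleftrightarrow> z : D" by blast
  then have "\<forall>\<^sub>F n in sequentially. (indicator (C n) z-indicator D z :: real)^2 = 0"
  unfolding eventually_sequentially by (intro exI[of _ m]) (auto simp: indicator_def)
  then show ?case by (rule tendsto_eventually)
  qed
 qed (use C D in \<open>auto simp: indicator_def\<close>)
 then show ?thesis by (simp add: eq)
qed

lemma eventually_sets:
 fixes C :: "nat => pt set"
 assumes "!!n. C n : sets La" "D : sets La"
 shows "{z : space La. ~ (EX m. ALL n>=m. z : C n \<longleftrightarrow> z : D)} : sets La"
proof -
 have "{z : space La. ~ (EX m. ALL n>=m. z : C n \<longleftrightarrow> z : D)} = (\<Inter>m. \<Union>n\<in>{m..}. (C n-D) Un (D-C n))"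
  using sets.sets_into_space[OF assms(1)] sets.sets_into_space[OF assms(2)] by (fastforce simp: not_le)
 also have "... : sets La"
 proof -
  have "(\<Union>n\<in>{m..}. (C n-D) Un (D-C n)) : sets La" for m using assms by (intro sets.countable_UN') auto
  then show ?thesis by (intro sets.countable_INT) auto
 qed
 finally show ?thesis .
qed

lemma eventually_order:
 fixes x :: "nat => real"
 assumes "x ----> b" "u ~= b"
 shows "EX m. ALL n>=m. (u <= x n \<longleftrightarrow> u <= b)"
proof (cases "u < b")
 case True
 then show ?thesis using order_tendstoD(1)[OF assms(1) True] unfolding eventually_sequentially by (meson less_imp_le)
next
 case False
 then have "b < u" using assms by simp
 then show ?thesis using order_tendstoD(2)[OF assms(1)] unfolding eventually_sequentially by (meson leD less_imp_le)
qed

text \<open>On a ray, membership depends on the angle only through arctan t <= th; this can fail to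
  stabilize on the single slope tan th, which is a null set.\<close>

lemma C_set_eventually:
 assumes p: "1 <= p" and x: "!!n. x n : {0..pi/2}" "th : {0..pi/2}" "x ----> th"
 shows "AE z in La. EX m. ALL n>=m. z : C_set p (x n) \<longleftrightarrow> z : C_set p th"
proof (rule AE_polar)
 show "AE z in lborel. z : quad --> (EX m. ALL n>=m. polar z : C_set p (x n) \<longleftrightarrow> polar z : C_set p th)"
  using AE_off_lines[of 0 "tan th"]
 proof eventually_elim
  case (elim z)
  show ?case
  proof
  assume z: "z : quad"
  obtain r t where rt: "z = (r, t)" "0 < r" "0 < t" using z by (cases z) (auto simp: quad_def)
  have "arctan t ~= th" using elim rt tan_arctan[of t] by auto
  from eventually_order[OF x(3) this] obtain m where m: "ALL n>=m. arctan t <= x n \<longleftrightarrow> arctan t <= th" by blast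
  have "polar (r, t) : C_set p (x n) \<longleftrightarrow> polar (r, t) : C_set p th" if "n >= m" for n
  using polar_C_set_iff[OF rt(2,3), of "x n" p] polar_C_set_iff[OF rt(2,3), of th p] x(1)[of n] x(2) m that by auto
  then show "EX m. ALL n>=m. polar z : C_set p (x n) \<longleftrightarrow> polar z : C_set p th" unfolding rt(1) by blast
  qed
 qed
qed (intro eventually_sets C_set_sets p)

lemma emb_coord:
 assumes "u : quad"
 shows "emb u : A_set v \<longleftrightarrow> fst u <= max 0 (fst v) | snd u <= max 0 (snd v)"
  "emb u : strip1 x \<longleftrightarrow> fst u <= max 0 x" "emb u : strip2 x \<longleftrightarrow> snd u <= max 0 x"
proof -
 have le: "ennreal c <= ennreal b \<longleftrightarrow> c <= max 0 b" if "0 < c" for c b :: real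
  using that by (cases "0 <= b") (auto simp: ennreal_le_iff ennreal_neg)
 have "0 < fst u" "0 < snd u" using assms by (auto simp: quad_def mem_Times_iff)
 then show "emb u : A_set v \<longleftrightarrow> fst u <= max 0 (fst v) | snd u <= max 0 (snd v)"
  "emb u : strip1 x \<longleftrightarrow> fst u <= max 0 x" "emb u : strip2 x \<longleftrightarrow> snd u <= max 0 x"
  by (auto simp: emb_def A_set_def strip1_def strip2_def le)
qed

lemma A_set_eventually:
 assumes x: "x ----> v" and v: "v : {0..1} \<times> {0..1}"
 shows "AE z in La. EX m. ALL n>=m. z : A_set (x n) \<longleftrightarrow> z : A_set v"
proof (rule AE_L)
 show "AE u in lborel. u : quad --> (EX m. ALL n>=m. emb u : A_set (x n) \<longleftrightarrow> emb u : A_set v)"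
  using AE_off_lines[of "max 0 (fst v)" "max 0 (snd v)"]
 proof eventually_elim
  case (elim u)
  have "(%n. max 0 (fst (x n))) ----> max 0 (fst v)" "(%n. max 0 (snd (x n))) ----> max 0 (snd v)"
  by (intro tendsto_intros x)+
  from eventually_order[OF this(1), of "fst u"] eventually_order[OF this(2), of "snd u"] elim
  obtain m m' where m: "ALL n>=m. fst u <= max 0 (fst (x n)) \<longleftrightarrow> fst u <= max 0 (fst v)"
  "ALL n>=m'. snd u <= max 0 (snd (x n)) \<longleftrightarrow> snd u <= max 0 (snd v)" by blast
  show ?case
  proof
  assume u: "u : quad"
  show "EX m. ALL n>=m. emb u : A_set (x n) \<longleftrightarrow> emb u : A_set v"
  by (intro exI[of _ "max m m'"]) (use m in \<open>simp add: emb_coord(1)[OF u]\<close>)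
  qed
 qed
qed (intro eventually_sets A_set_sets)

lemma strip_eventually:
 fixes x :: "nat => real"
 assumes x: "x ----> s"
 shows "AE z in La. EX m. ALL n>=m. z : strip1 (x n) \<longleftrightarrow> z : strip1 s" "AE z in La. EX m. ALL n>=m. z : strip2 (x n) \<longleftrightarrow> z : strip2 s"
proof -
 have l: "(%n. max 0 (x n)) ----> max 0 s" by (intro tendsto_intros x)
 show "AE z in La. EX m. ALL n>=m. z : strip1 (x n) \<longleftrightarrow> z : strip1 s"
 proof (rule AE_L)
  show "AE u in lborel. u : quad --> (EX m. ALL n>=m. emb u : strip1 (x n) \<longleftrightarrow> emb u : strip1 s)"
  using AE_off_lines[of "max 0 s" 0]
  by eventually_elim (use eventually_order[OF l] in \<open>auto simp: emb_coord(2)\<close>)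
 qed (intro eventually_sets strip_sets)
 show "AE z in La. EX m. ALL n>=m. z : strip2 (x n) \<longleftrightarrow> z : strip2 s"
 proof (rule AE_L)
  show "AE u in lborel. u : quad --> (EX m. ALL n>=m. emb u : strip2 (x n) \<longleftrightarrow> emb u : strip2 s)"
  using AE_off_lines[of 0 "max 0 s"]
  by eventually_elim (use eventually_order[OF l] in \<open>auto simp: emb_coord(3)\<close>)
 qed (intro eventually_sets strip_sets)
qed

lemma strips_mono: "s <= B ==> strips s <= strips B"
 using ennreal_leI[of s B] unfolding strips_def by (auto intro: order_trans)

lemma strip_strips_le: "x <= B ==> strip1 x <= strips B" "x <= B ==> strip2 x <= strips B"
 by (rule order_trans[OF strip_strips(1) strips_mono], assumption, rule order_trans[OF strip_strips(2) strips_mono])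

lemma noise_continuous:
 fixes D :: "'s::metric_space => pt set"
 assumes wn: "white_noise La N W" and tight: "tight_in_linf N W \<C>" and D: "!!s. s : S ==> D s : \<C> & D s : sets La & D s <= strips B" and B: "0 <= B"
  and ae: "!!x s. (!!n. x n : S) ==> s : S ==> x ----> s ==> AE z in La. EX m. ALL n>=m. z : D (x n) \<longleftrightarrow> z : D s"
 shows "AE om in N. continuous_on S (%s. W om (D s))"
proof (rule tight_continuous[OF _ tight])
 show "prob_space N" using wn by (simp add: white_noise_def)
 show "l2_le N (%om. W om (D s)) (sqrt (measure La (D s)))" if "s : S" for s
  using D[OF that] by (intro wn_l2[OF wn] fin_sets_strips) auto
 show "(%n. (LINT om|N. (W om (D (x n))-W om (D s))^2)) ----> 0" if "!!n. x n : S" "s : S" "x ----> s" for x s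
  using D[OF that(1)] D[OF that(2)] by (intro noise_L2_continuous[OF wn _ _ _ _ B ae[OF that]]) auto
qed (use D in auto)

lemma wiener_process_white_noise:
 assumes "wiener_process p La N W"
 shows "white_noise La N W" "T > 0 ==> tight_in_linf N W (index_sets p T)"
 using assms sigma_finite_L unfolding wiener_process_def white_noise_def Let_def fin_sets_def by blast+

text \<open>Paths are replaced by 0 on a null set so that all of them are continuous in the
  parameters; with measurability at each parameter this gives joint measurability. The value at the
  empty set is recorded because \<open>strip1 0\<close> and \<open>strip2 0\<close> are empty, so
  that both marginal processes start at 0.\<close>

lemma regular_version:
 assumes p: "1 <= p" and W: "wiener_process p La N W"
 obtains w where "noise La l p N w" "AE om in N. w om = W om & w om {} = 0"
proof -
 note wn = wiener_process_white_noise(1)[OF W] and tight = wiener_process_white_noise(2)[OF W]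
 interpret N: prob_space N using wn by (simp add: white_noise_def)
 have c1: "AE om in N. continuous_on {0..pi/2} (%s. W om (C_set p s))"
  by (rule noise_continuous[OF wn tight[of 1], where B = 2])
  (use p C_set_strips C_set_sets in \<open>auto simp: index_sets_def intro: C_set_eventually\<close>)
 have c2: "AE om in N. continuous_on ({0..1} \<times> {0..1}) (%v. W om (A_set v))"
  by (rule noise_continuous[OF wn tight[of 1], where B = 1])
  (use A_set_strips A_set_sets in \<open>auto simp: index_sets_def intro: A_set_eventually\<close>)
 have c3: "AE om in N. ALL n. continuous_on {0..real (Suc n)} (%x. W om (strip1 x))"
  unfolding AE_all_countable
 proof
  fix n
  show "AE om in N. continuous_on {0..real (Suc n)} (%x. W om (strip1 x))"
  by (rule noise_continuous[OF wn tight[of "real (Suc n)"], where B = "real (Suc n)"])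
  (use strip_sets(1) in \<open>auto simp: index_sets_def intro!: strip_eventually(1) subsetD[OF strip_strips_le(1)]\<close>)
 qed
 have c4: "AE om in N. ALL n. continuous_on {0..real (Suc n)} (%x. W om (strip2 x))"
  unfolding AE_all_countable
 proof
  fix n
  show "AE om in N. continuous_on {0..real (Suc n)} (%x. W om (strip2 x))"
  by (rule noise_continuous[OF wn tight[of "real (Suc n)"], where B = "real (Suc n)"])
  (use strip_sets(2) in \<open>auto simp: index_sets_def intro!: strip_eventually(2) subsetD[OF strip_strips_le(2)]\<close>)
 qed
 have c5: "AE om in N. W om {} = 0"
 proof -
  have "{} : fin_sets La" by (simp add: fin_sets_def)
  from wn_l2[OF wn this] have l: "l2_le N (%om. W om {}) 0" by simp
  have "(LINT om|N. (W om {})^2) = 0" using l2_leD(4)[OF l] by (simp add: order_antisym)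
  then show ?thesis using integral_nonneg_eq_0_iff_AE[OF l2_leD(3)[OF l]] by simp
 qed
 define good where "good om \<longleftrightarrow> continuous_on {0..pi/2} (%s. W om (C_set p s)) & continuous_on ({0..1} \<times> {0..1}) (%v. W om (A_set v)) &
  (ALL n. continuous_on {0..real (Suc n)} (%x. W om (strip1 x))) & (ALL n. continuous_on {0..real (Suc n)} (%x. W om (strip2 x))) & W om {} = 0" for om
 have "AE om in N. good om" using c1 c2 c3 c4 c5 by eventually_elim (simp add: good_def)
 then obtain Z where Z: "{om : space N. ~ good om} <= Z" "emeasure N Z = 0" "Z : sets N" by (rule AE_E)
 define w where "w om C = (if om : Z then 0 else W om C)" for om C
 have aeZ: "AE om in N. om ~: Z" using Z by (intro AE_not_in null_setsI)
 have Wm: "(%om. W om C) : meas N" if "C : fin_sets La" for C by (rule l2_leD(1)[OF wn_l2[OF wn that]])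
 have wm: "(%om. w om C) : meas N" if "C : fin_sets La" for C
  unfolding w_def using Wm[OF that] Z(3) by (intro measurable_If_set) (auto simp: sets.Int_space_eq2)
 have ae: "AE om in N. w om = W om" using aeZ by eventually_elim (auto simp: w_def fun_eq_iff)
 have gauss: "gaussian_rv N (%om. \<Sum>C\<in>S. b C*w om C)" if S: "finite S" "S <= fin_sets La" for S and b :: "pt set => real"
 proof -
  have m: "(%om. \<Sum>C\<in>S. b C*w om C) : meas N" using wm S by (intro borel_measurable_sum borel_measurable_times) auto
  have e: "AE om in N. (\<Sum>C\<in>S. b C*w om C) = (\<Sum>C\<in>S. b C*W om C)" using ae by eventually_elim simp
  have g: "gaussian_rv N (%om. \<Sum>C\<in>S. b C*W om C)" by (rule wn_gauss[OF wn S])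
  \<comment> \<open>Having a normal density is a property of the law, so Gaussianity transfers to an
    almost surely equal variable once that is measurable.\<close>
  have d: "distr N lborel (%om. \<Sum>C\<in>S. b C*w om C) = distr N lborel (%om. \<Sum>C\<in>S. b C*W om C)"
  using g m e by (intro distr_cong_AE) (auto simp: gaussian_rv_def)
  have "(EX muv. AE om in N. (\<Sum>C\<in>S. b C*w om C) = muv)" if "AE om in N. (\<Sum>C\<in>S. b C*W om C) = muv" for muv
  by (intro exI[of _ muv]) (use e that in eventually_elim, simp)
  then show ?thesis using g m d unfolding gaussian_rv_def distributed_def by auto
 qed
 have wn': "white_noise La N w"
 proof -
  have "(LINT om|N. w om C) = (LINT om|N. W om C)" if "C : fin_sets La" for C
  by (rule integral_cong_AE) (use Wm wm that ae in auto)
  moreover have "(LINT om|N. w om C*w om C') = (LINT om|N. W om C*W om C')" if "C : fin_sets La" "C' : fin_sets La" for C C'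
  by (rule integral_cong_AE) (use Wm wm that ae in auto)
  ultimately show ?thesis using wn gauss unfolding white_noise_def by auto
 qed
 have cont: "continuous_on UNIV (%s. w om (C_set p (clampT s)))" "continuous_on UNIV (%v. w om (A_set (clampI v)))"
  "continuous_on UNIV (%x. w om (strip1 x))" "continuous_on UNIV (%x. w om (strip2 x))" if "om : space N" for om
 proof -
  have g: "good om" if "om ~: Z" using that Z \<open>om : space N\<close> by auto
  have r: "range clampT <= {0..pi/2}" "range clampI <= {0..1} \<times> {0..1}"
  using clampT_id(2) clampI_id(2) by blast+
  show "continuous_on UNIV (%s. w om (C_set p (clampT s)))"
  using g continuous_on_compose2[OF _ clamp_continuous(1), of "{0..pi/2}" "%s. W om (C_set p s)", OF _ r(1)]
  unfolding w_def good_def by (cases "om : Z") auto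
  show "continuous_on UNIV (%v. w om (A_set (clampI v)))"
  using g continuous_on_compose2[OF _ clamp_continuous(2), of "{0..1} \<times> {0..1}" "%v. W om (A_set v)", OF _ r(2)]
  unfolding w_def good_def by (cases "om : Z") auto
  \<comment> \<open>Continuity on bounded intervals extends to the half-line through an open cover,
    and to negative arguments because a strip with a negative bound is empty, hence equal to the one
    at 0.\<close>
  have strip: "continuous_on UNIV (%x. h (max 0 x))" if "ALL n. continuous_on {0..real (Suc n)} h" for h :: "real => real"
  proof -
  have U: "(\<Union>n. {..<real (Suc n)}) = UNIV"
  proof -
  have "EX n. x < real (Suc n)" for x :: real using reals_Archimedean2[of x] by (metis less_trans lessI of_nat_less_iff)
  then show ?thesis by auto
  qed
  have "continuous_on {..<real (Suc n)} (%x. h (max 0 x))" for n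
  by (rule continuous_on_compose2[OF that[rule_format, of n]]) (auto intro!: continuous_intros)
  then have "continuous_on (\<Union>n\<in>UNIV. {..<real (Suc n)}) (%x. h (max 0 x))" by (intro continuous_on_open_UN) auto
  then show ?thesis unfolding U .
  qed
  have s: "strip1 x = strip1 (max 0 x)" "strip2 x = strip2 (max 0 x)" for x
  by (cases "0 <= x"; simp add: strip1_def strip2_def ennreal_neg)+
  show "continuous_on UNIV (%x. w om (strip1 x))" using g strip[of "%x. W om (strip1 x)"]
  unfolding w_def good_def by (cases "om : Z") (auto simp: s(1)[symmetric])
  show "continuous_on UNIV (%x. w om (strip2 x))" using g strip[of "%x. W om (strip2 x)"]
  unfolding w_def good_def by (cases "om : Z") (auto simp: s(2)[symmetric])
 qed
 have "meas_paths p N w" unfolding meas_paths_def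
  by (intro conjI caratheodory_measurable wm cont fin_sets_strips[OF C_set_sets[OF p] C_set_strips[OF p]]
  fin_sets_strips[OF A_set_sets A_set_strips[OF clampI_id(2)]] fin_sets_strips[OF strip_sets(1) strip_strips(1)]
  fin_sets_strips[OF strip_sets(2) strip_strips(2)])
 then have "noise La l p N w" unfolding noise_def noise_axioms_def using p wn' smooth_tail_axioms by blast
 moreover have "AE om in N. w om = W om & w om {} = 0" using ae c5 by eventually_elim simp
 ultimately show thesis by (rule that)
qed

end

section \<open>The function f and its derivative\<close>

text \<open>A Borel function that agrees on the open interval with the derivative of
  \<open>f_fun p\<close> off pi/4, where the maximum norm has its kink; for infinite p,
  \<open>f_fun\<close> is tan - 1 below that point and 1 - cot above it.\<close>

definition f_deriv :: "ennreal => real => real" where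
 "f_deriv p th = (if p = top then (if th < pi/4 then 1+(tan th)^2 else 1+(cot th)^2) else
  let P = enn2real p; S = sin th powr P + cos th powr P; n = S powr (1/P) in
  ((cos th + sin th)*n-(sin th - cos th)*(S powr (1/P-1)*(sin th powr (P-1) * cos th - cos th powr (P-1) * sin th)))/n^2)"

lemma f_deriv_measurable[measurable]: "f_deriv p : meas borel"
 unfolding f_deriv_def[abs_def] tan_def cot_def Let_def by measurable

lemma f_fun_measurable[measurable]: "f_fun p : meas borel"
 unfolding f_fun_def[abs_def] by measurable

lemma sin_cos_bounds:
 assumes "0 < th" "th < pi/2"
 shows "0 < sin th" "sin th <= 1" "0 < cos th" "cos th <= 1" "1/2 <= max (sin th) (cos th)"
proof -
 show "0 < sin th" "0 < cos th" using assms by (auto intro: sin_gt_zero cos_gt_zero)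
 have "1/2 <= sin th | 1/2 <= cos th"
 proof (rule ccontr)
  assume "~ (1/2 <= sin th | 1/2 <= cos th)"
  then have "(sin th)^2 <= (1/2)^2" "(cos th)^2 <= (1/2)^2" using \<open>0 < sin th\<close> \<open>0 < cos th\<close> by (auto intro!: power_mono)
  then show False using sin_cos_squared_add[of th] by (simp add: power2_eq_square)
 qed
 then show "1/2 <= max (sin th) (cos th)" by auto
qed auto

lemma f_fun_bounded:
 assumes "1 <= p" "0 <= th" "th <= pi/2"
 shows "abs (f_fun p th) <= 1"
proof -
 have s: "0 <= sin th" "0 <= cos th" using assms by (auto intro!: sin_ge_zero cos_ge_zero)
 have "abs (sin th - cos th) <= max (sin th) (cos th)" using s by auto
 also have "... <= Lp_norm p (sin th, cos th)" by (rule Lp_norm_bounds(1)[OF assms(1) s])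
 finally have "abs (sin th - cos th) <= Lp_norm p (sin th, cos th)" .
 then show ?thesis unfolding f_fun_def by (cases "Lp_norm p (sin th, cos th) = 0") (auto simp: divide_le_eq)
qed

text \<open>The norm of (sin, cos) lies between 1/2 and 2, and its partial derivatives are at most
  1; 24 is the bound 6 of the numerator divided by (1/2)^2.\<close>

lemma f_deriv_bounded:
 assumes p: "1 <= p" and th: "0 < th" "th < pi/2"
 shows "abs (f_deriv p th) <= 24"
proof -
 note sc = sin_cos_bounds[OF th]
 show ?thesis
 proof (cases "p = top")
  case True
  have "tan th <= 1" if "th < pi/4" using tan_monotone'[of th "pi/4"] th that by (simp add: tan_45)
  moreover have "cot th <= 1" if "~ th < pi/4"
  proof -
  have "1 <= tan th" using th that tan_mono_le[of "pi/4" th] by (simp add: tan_45)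
  then show ?thesis using sc by (simp add: tan_def cot_def)
  qed
  moreover have "0 <= tan th" "0 <= cot th" using sc by (auto simp: tan_def cot_def)
  ultimately show ?thesis using True power_mono[of "tan th" 1 2] power_mono[of "cot th" 1 2] by (auto simp: f_deriv_def)
 next
  case False
  define P S n where "P = enn2real p" and "S = sin th powr P + cos th powr P" and "n = S powr (1/P)"
  have P: "1 <= P" unfolding P_def by (rule enn2real_ge_1[OF p False])
  have n: "n = Lp_norm p (sin th, cos th)" using sc False by (simp add: Lp_norm_def n_def S_def P_def)
  have nb: "1/2 <= n" "n <= 2" unfolding n
  using Lp_norm_bounds[OF p, of "sin th" "cos th"] sc sin_le_one[of th] cos_le_one[of th] by linarith+
  have S: "0 < S" unfolding S_def using sc by (simp add: add_pos_pos)
  \<comment> \<open>This bounds a partial derivative of the norm: x^(P - 1) is at most S^(1 -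
    1/P).\<close>
  have q: "S powr (1/P-1)*(x powr (P-1)) <= 1" if "0 < x" "x powr P <= S" for x
  proof -
  have "x powr (P-1) = (x powr P) powr (1-1/P)" using P by (simp add: powr_powr algebra_simps)
  also have "... <= S powr (1-1/P)" using that P by (intro powr_mono2) auto
  finally have "S powr (1/P-1)*(x powr (P-1)) <= S powr (1/P-1)*S powr (1-1/P)" by (intro mult_left_mono) auto
  also have "... = 1" using S by (simp add: powr_add[symmetric])
  finally show ?thesis .
  qed
  define a b where "a = S powr (1/P-1)*(sin th powr (P-1))" and "b = S powr (1/P-1)*(cos th powr (P-1))"
  have ab: "0 <= a" "a <= 1" "0 <= b" "b <= 1"
  using sc q[of "sin th"] q[of "cos th"] by (simp_all add: a_def b_def S_def)
  have "abs (a * cos th - b * sin th) <= 1"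
  proof -
  have "0 <= a * cos th" "0 <= b * sin th" "a * cos th <= 1*1" "b * sin th <= 1*1"
  using ab sc mult_le_one[of a "cos th"] mult_le_one[of b "sin th"] by simp_all
  then show ?thesis by linarith
  qed
  moreover have "abs (sin th - cos th) <= 1" using sc(1-4) by linarith
  ultimately have 1: "abs ((sin th - cos th)*(a * cos th - b * sin th)) <= 1*1" unfolding abs_mult by (intro mult_mono) auto
  have "abs (cos th + sin th) <= 2" using sc(1-4) by linarith
  then have 2: "abs ((cos th + sin th)*n) <= 2*2" unfolding abs_mult using nb by (intro mult_mono) auto
  have "f_deriv p th = ((cos th + sin th)*n-(sin th - cos th)*(a * cos th - b * sin th))/n^2"
  unfolding f_deriv_def Let_def a_def b_def n_def S_def P_def if_not_P[OF False] by (simp only: right_diff_distrib mult.assoc)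
  moreover have "abs ((cos th + sin th)*n-(sin th - cos th)*(a * cos th - b * sin th)) <= 6" using 1 2 by linarith
  moreover have "1/4 <= n^2" using power_mono[OF nb(1), of 2] by (simp add: power2_eq_square)
  ultimately show ?thesis using nb by (simp add: abs_divide divide_le_eq)
 qed
qed

lemma f_fun_deriv:
 assumes p: "1 <= p" and th: "0 < th" "th < pi/2" "th ~= pi/4"
 shows "deriv (f_fun p) th = f_deriv p th"
proof (rule DERIV_imp_deriv)
 note sc = sin_cos_bounds[OF th(1,2)]
 have near: "\<forall>\<^sub>F x in nhds th. 0 < x & x < pi/2"
  using eventually_nhds_in_open[of "{0<..<pi/2}" th] th by simp
 show "(f_fun p has_field_derivative f_deriv p th) (at th)"
 proof (cases "p = top")
  case True
  consider "th < pi/4" | "pi/4 < th" using th by linarith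
  then show ?thesis
  proof cases
  case 1
  have "\<forall>\<^sub>F x in nhds th. x < pi/4" using eventually_nhds_in_open[of "{..<pi/4}" th] 1 by simp
  with near have ev: "\<forall>\<^sub>F x in nhds th. f_fun p x = tan x-1"
  proof eventually_elim
  case (elim x)
  note s = sin_cos_bounds[of x]
  have "tan x < 1" using elim tan_monotone[of x "pi/4"] by (simp add: tan_45)
  then have "sin x <= cos x" using elim s by (simp add: tan_def divide_less_eq)
  then show ?case using True elim s by (simp add: f_fun_def Lp_norm_def tan_def diff_divide_distrib)
  qed
  have "((%x. tan x-1) has_field_derivative f_deriv p th) (at th)"
  by (rule DERIV_cong[OF DERIV_diff[OF DERIV_tan DERIV_const]]) (use 1 True sc in \<open>simp_all add: f_deriv_def tan_sec power_inverse\<close>)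
  then show ?thesis using DERIV_cong_ev[OF refl ev refl] by blast
  next
  case 2
  have "\<forall>\<^sub>F x in nhds th. pi/4 < x" using eventually_nhds_in_open[of "{pi/4<..}" th] 2 by simp
  with near have ev: "\<forall>\<^sub>F x in nhds th. f_fun p x = 1 - cot x"
  proof eventually_elim
  case (elim x)
  note s = sin_cos_bounds[of x]
  have "1 < tan x" using elim tan_monotone[of "pi/4" x] by (simp add: tan_45)
  then have "cos x <= sin x" using elim s by (simp add: tan_def less_divide_eq)
  then show ?case using True elim s by (simp add: f_fun_def Lp_norm_def cot_def diff_divide_distrib)
  qed
  have "1+(cot th)^2 = inverse ((sin th)^2)" using sc by (simp add: cot_def divide_simps)
  then have "((%x. 1 - cot x) has_field_derivative f_deriv p th) (at th)"
  by (intro DERIV_cong[OF DERIV_diff[OF DERIV_const DERIV_cot]]) (use 2 True sc in \<open>simp_all add: f_deriv_def\<close>)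
  then show ?thesis using DERIV_cong_ev[OF refl ev refl] by blast
  qed
 next
  case False
  define P where "P = enn2real p"
  have P: "1 <= P" unfolding P_def by (rule enn2real_ge_1[OF p False])
  have ev: "\<forall>\<^sub>F x in nhds th. f_fun p x = (sin x - cos x)/(sin x powr P + cos x powr P) powr (1/P)"
  using near
  proof eventually_elim
  case (elim x)
  then show ?case using sin_cos_bounds[of x] False by (simp add: f_fun_def Lp_norm_def P_def)
  qed
  have S: "0 < sin th powr P + cos th powr P" using sc by (simp add: add_pos_pos)
  have ne: "(sin th powr P + cos th powr P) powr (1/P) ~= 0" using S by simp
  have d1: "((%x. sin x powr P) has_field_derivative P * sin th powr (P-1) * cos th) (at th)"
  "((%x. cos x powr P) has_field_derivative P * cos th powr (P-1)*(- sin th)) (at th)"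
  using DERIV_fun_powr[OF DERIV_sin sc(1), of P] DERIV_fun_powr[OF DERIV_cos sc(3), of P] by (simp_all add: mult.assoc)
  have cancel: "1/P*x*(P*a * c+P*b*(- d)) = x*(a * c-b*d)" for x a b c d :: real using P by (simp add: field_simps)
  note d2 = DERIV_cong[OF DERIV_fun_powr[OF DERIV_add[OF d1] S, of "1/P"] cancel[of "_ powr (1/P-real 1)"]]
  note d3 = DERIV_divide[OF DERIV_diff[OF DERIV_sin DERIV_cos] d2 ne]
  have "((%x. (sin x - cos x)/(sin x powr P + cos x powr P) powr (1/P)) has_field_derivative f_deriv p th) (at th)"
  by (rule DERIV_cong[OF d3]) (use False in \<open>simp add: f_deriv_def Let_def P_def[symmetric] power2_eq_square\<close>)
  then show ?thesis using DERIV_cong_ev[OF refl ev refl] by blast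
 qed
qed

text \<open>If \<open>f\<close> is not integrable, its integral is 0 by convention and the bound
  persists; this spares a measurability argument for individual paths.\<close>

lemma integral_abs_le:
 fixes f g :: "'a => real"
 assumes "integrable M g" "!!x. abs (f x) <= g x"
 shows "abs (\<integral>x. f x \<partial>M) <= (LINT x|M. g x)"
proof (cases "integrable M f")
 case True
 have "abs (\<integral>x. f x \<partial>M) <= (LINT x|M. abs (f x))" by (rule integral_abs_bound)
 also have "... <= (LINT x|M. g x)" using True assms by (intro integral_mono) auto
 finally show ?thesis .
next
 case False
 have "0 <= g x" for x using assms(2)[of x] by linarith
 then show ?thesis using False by (simp add: not_integrable_integral_eq integral_nonneg_AE)
qed

section \<open>The limit at the angle pi/2\<close>

context smooth_tail
begin

text \<open>The marginal processes are of mean square order x, so these weighted integrals converge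
  at 0 and at infinity for almost every path; integrability in this sense controls the ray integrals
  of all slopes t >= 1 at once.\<close>

definition path_regular :: "(pt set => real) => bool" where
 "path_regular u \<longleftrightarrow> intb (%x. pos x/(x*(1+x))*W1 u x) &
  intb (%x. pos x/(x*(1+x))*W2 u x) & u {} = 0"

text \<open>For slopes t >= 1 the ray integral is at most a(t) t times a constant depending on the
  path, and a(t) t tends to 0.\<close>

lemma Z_ray_tendsto:
 assumes p: "1 <= p" and u: "path_regular u"
 shows "((%t. Z_ray p t u) ---> 0) at_top"
proof -
 define H where "H W x = pos x/(x*(1+x))*abs (W u x)" for W :: "(pt set => real) => real => real" and x
 have "intb (H W)" if "intb (%x. pos x/(x*(1+x))*W u x)" for W
 proof -
  have "H W = (%x. abs (pos x/(x*(1+x))*W u x))" by (auto simp: fun_eq_iff H_def abs_mult split: split_indicator)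
  then show ?thesis using integrable_abs[OF that] by simp
 qed
 then have Hi: "intb (H W1)" "intb (H W2)" using u unfolding path_regular_def by blast+
 define K where "K = 3*(LBINT x. H W1 x)+3*(LBINT x. H W2 x)"
 have H0: "0 <= H W x" for W x by (auto simp: H_def split: split_indicator)
 have bound: "abs (Z_ray p t u) <= apos t*t*K" if t: "1 <= t" for t
 proof -
  have X: "Xp p t <= 2"
  proof -
  have "1/t <= 1" using t by simp
  then show ?thesis using Xp_bounds(2)[OF p, of t] t by linarith
  qed
  \<comment> \<open>The second term has \<open>W2\<close> at the argument t x; substituting absorbs
    one factor \<open>t\<close>, and the remaining 1 + 2t keeps the bound of order a(t) t.\<close>
  define g where "g x = apos t*t*3*H W1 x+apos t*(1+2*t)*t*H W2 (0+t*x)" for x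
  have Hs: "intb (%x. H W2 (0+t*x))" "(LBINT x. H W2 x) = abs t *\<^sub>R (LBINT x. H W2 (0+t*x))"
  by (rule lborel_integrable_real_affine[OF Hi(2)], use t in simp, rule lborel_integral_real_affine, use t in simp)
  have gi: "integrable lborel g" unfolding g_def[abs_def] using Hi Hs by (intro lintegrable_add integrable_mult_right) auto
  have le: "abs (indicator {0<..Xp p t} x*(dens (x, x*t)*(W1 u x*t-W2 u (x*t)))) <= g x" for x
  proof (cases "0 < x & x <= Xp p t")
  case False
  then show ?thesis using H0 apos_nonneg[of t] t by (auto simp: g_def)
  next
  case True
  then have x: "0 < x" "x <= 2" using X by auto
  have d: "dens (x, x*t) = apos t/x" using x t l_ray[of x t] by (simp add: dens_def quad_def apos_def)
  have 1: "abs (W1 u x)/x <= 3*H W1 x"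
  proof -
  have "abs (W1 u x)/x = (1+x)*H W1 x" using x by (simp add: H_def)
  also have "... <= 3*H W1 x" using x H0 by (intro mult_right_mono) auto
  finally show ?thesis .
  qed
  have 2: "abs (W2 u (x*t))/x <= (1+2*t)*t*H W2 (t*x)"
  proof -
  have "0 < 1+t*x" using x t by (simp add: add_pos_pos)
  then have "abs (W2 u (x*t))/x = (1+x*t)*(t*H W2 (t*x))" using x t by (simp add: H_def mult.commute[of x t])
  also have "... <= (1+2*t)*(t*H W2 (t*x))" using x t H0 by (intro mult_right_mono) auto
  finally show ?thesis by (simp add: mult.assoc)
  qed
  have "abs (indicator {0<..Xp p t} x*(dens (x, x*t)*(W1 u x*t-W2 u (x*t)))) = apos t*abs (W1 u x*t-W2 u (x*t))/x"
  using True apos_nonneg[of t] by (simp add: d abs_mult)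
  also have "... <= apos t*(abs (W1 u x)*t+abs (W2 u (x*t)))/x"
  using x t apos_nonneg[of t] abs_triangle_ineq4[of "W1 u x*t" "W2 u (x*t)"]
  by (intro divide_right_mono mult_left_mono) (auto simp: abs_mult)
  also have "... = apos t*(t*(abs (W1 u x)/x)+abs (W2 u (x*t))/x)" by (simp add: add_divide_distrib algebra_simps)
  also have "... <= apos t*(t*(3*H W1 x)+(1+2*t)*t*H W2 (t*x))"
  using 1 2 t apos_nonneg[of t] by (intro mult_left_mono add_mono) auto
  also have "... = g x" by (simp add: g_def algebra_simps)
  finally show ?thesis .
  qed
  have "abs (Z_ray p t u) <= (LBINT x. g x)" unfolding Z_ray_def by (rule integral_abs_le[OF gi le])
  also have "... = apos t*t*3*(LBINT x. H W1 x)+apos t*(1+2*t)*(t*(LBINT x. H W2 (0+t*x)))"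
  unfolding g_def[abs_def] using Hi Hs by (subst lint_add) (auto simp: mult.assoc)
  also have "t*(LBINT x. H W2 (0+t*x)) = (LBINT x. H W2 x)" using Hs(2) t by simp
  also have "apos t*(1+2*t)*(LBINT x. H W2 x) <= apos t*(3*t)*(LBINT x. H W2 x)"
  using t apos_nonneg[of t] H0 by (intro mult_right_mono mult_left_mono integral_nonneg_AE) auto
  finally show ?thesis by (simp add: K_def algebra_simps)
 qed
 show ?thesis
 proof (rule Lim_null_comparison)
  show "\<forall>\<^sub>F t in at_top. norm (Z_ray p t u) <= apos t*t*K"
  using eventually_ge_at_top[of "1::real"] by eventually_elim (use bound in simp)
  show "((%t. apos t*t*K) ---> 0) at_top" using tendsto_mult_left_zero[OF apos_mult_tendsto] by simp
 qed
qed

lemma B_can_tendsto: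
 assumes p: "1 <= p"
  and i: "p ~= top ==> intb (%x. indicator {1<..} x*(dens (x, y_real p x)*(W1 u x*ydv p x-W2 u (y_real p x))))"
 shows "((%t. B_can p t u) ---> B_lim p u) at_top"
proof (cases "p = top")
 case True
 have 1: "((%t. (LBINT y. indicator {1..max 1 t} y*apos y)) ---> (LBINT y. indicator {1..} y*apos y)) at_top"
 proof (rule integral_dominated_convergence_at_top[OF _ _ apos_integrable(1)])
  show "AE y in lborel. ((%t. indicator {1..max 1 t} y*apos y) ---> indicator {1..} y*apos y) at_top"
  proof (rule AE_I2)
  fix y :: real
  have "\<forall>\<^sub>F t in at_top. indicator {1..max 1 t} y*apos y = indicator {1..} y*apos y"
  using eventually_ge_at_top[of y] by eventually_elim (auto simp: indicator_def)
  then show "((%t. indicator {1..max 1 t} y*apos y) ---> indicator {1..} y*apos y) at_top" by (rule tendsto_eventually)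
  qed
 qed (auto simp: indicator_def apos_nonneg)
 have 2: "((%t. (LBINT x. indicator {max 1 (1/t)..} x*(apos (1/x)/x))) ---> (LBINT x. indicator {1..} x*(apos (1/x)/x))) at_top"
 proof (rule tendsto_eventually)
  show "\<forall>\<^sub>F t in at_top. (LBINT x. indicator {max 1 (1/t)..} x*(apos (1/x)/x)) = (LBINT x. indicator {1..} x*(apos (1/x)/x))"
  using eventually_ge_at_top[of "1::real"] by eventually_elim (simp add: max_def)
 qed
 show ?thesis unfolding B_can_def B_lim_def if_P[OF True] by (intro tendsto_intros 1 2)
next
 case False
 define h where "h x = dens (x, y_real p x)*(W1 u x*ydv p x-W2 u (y_real p x))" for x
 have hi: "intb (%x. indicator {1<..} x*h x)" using i[OF False] by (simp add: h_def)
 have X: "(Xp p ---> 1) at_top"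
 proof (rule tendsto_sandwich)
  show "\<forall>\<^sub>F t in at_top. 1 <= Xp p t" "\<forall>\<^sub>F t in at_top. Xp p t <= 1+1/t"
  using eventually_gt_at_top[of "0::real"] by (eventually_elim, use Xp_bounds p in auto)+
  show "((%t::real. 1+1/t) ---> 1) at_top" by real_asymp
 qed auto
 have ge: "\<forall>\<^sub>F t in at_top. 1 <= Xp p t"
  using eventually_gt_at_top[of "0::real"] by eventually_elim (use Xp_bounds p in auto)
 have split: "indicator {Xp p t<..} x*h x = indicator {Xp p t<..} x*(indicator {1<..} x*h x)" if "1 <= Xp p t" for t x
  using that by (auto simp: indicator_def)
 have "((%t. (LBINT x. indicator {Xp p t<..} x*(indicator {1<..} x*h x))) ---> (LBINT x. indicator {1<..} x*h x)) at_top"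
 proof (rule integral_dominated_convergence_at_top[OF _ _ integrable_abs[OF hi]])
  show "AE x in lborel. ((%t. indicator {Xp p t<..} x*(indicator {1<..} x*h x)) ---> indicator {1<..} x*h x) at_top"
  proof (rule AE_I2)
  fix x :: real
  show "((%t. indicator {Xp p t<..} x*(indicator {1<..} x*h x)) ---> indicator {1<..} x*h x) at_top"
  proof (cases "1 < x")
  case True
  have "\<forall>\<^sub>F t in at_top. indicator {Xp p t<..} x*(indicator {1<..} x*h x) = indicator {1<..} x*h x"
  using order_tendstoD(2)[OF X True] by eventually_elim simp
  then show ?thesis by (rule tendsto_eventually)
  qed simp
  qed
  show "\<forall>\<^sub>F t in at_top. AE x in lborel. norm (indicator {Xp p t<..} x*(indicator {1<..} x*h x)) <= abs (indicator {1<..} x*h x)"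
  by (auto simp: indicator_def)
  show "(%x. indicator {Xp p t<..} x*(indicator {1<..} x*h x)) : meas lborel" for t
  by (intro borel_measurable_times borel_measurable_integrable[OF hi]) measurable
 qed (use hi in auto)
 then have "((%t. (LBINT x. indicator {Xp p t<..} x*h x)) ---> (LBINT x. indicator {1<..} x*h x)) at_top"
  by (rule Lim_transform_eventually) (use ge in eventually_elim, simp only: split)
 then show ?thesis using False by (simp add: B_can_def B_lim_def B_curve_def h_def)
qed

lemma Z_interior_eq:
 assumes p: "1 <= p" and th: "0 < th" "th < pi/2"
 shows "Z_interior p l u th = Z_ray p (tan th) u+B_can p (tan th) u"
proof -
 define t where "t = tan th"
 have t: "0 < t" unfolding t_def using th by (rule tan_gt_zero)
 have 1: "(LINT x:{0<..x_p p th}|lborel. l (x, x*tan th)*(W1 u x*tan th - W2 u (x*tan th))) = Z_ray p (tan th) u"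
  unfolding Z_ray_def set_lebesgue_integral_def x_p_eq[OF th] t_def[symmetric]
  by (intro lint_cong) (use t in \<open>auto simp: indicator_def dens_def quad_def\<close>)
 have cot: "cot th = 1/t" unfolding t_def tan_def cot_def by simp
 have 2: "B_term p l u th = B_can p (tan th) u"
 proof (cases "p = top")
  case True
  have "(LINT y:{1..max 1 t}|lborel. l (1, y)) = (LBINT y. indicator {1..max 1 t} y*apos y)"
  unfolding set_lebesgue_integral_def by (intro lint_cong) (auto simp: indicator_def apos_def a_def)
  moreover have "(LINT x:{max 1 (1/t)..}|lborel. l (x, 1)) = (LBINT x. indicator {max 1 (1/t)..} x*(apos (1/x)/x))"
  unfolding set_lebesgue_integral_def by (intro lint_cong) (auto simp: indicator_def l_x1)
  ultimately show ?thesis using True by (simp add: B_term_def B_can_def cot t_def[symmetric])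
 next
  case False
  have pw: "indicator {Xp p t<..} x *\<^sub>R (l (x, y_real p x)*(W1 u x*deriv (y_real p) x-W2 u (y_real p x))) =
  indicator {Xp p t<..} x*(dens (x, y_real p x)*(W1 u x*ydv p x-W2 u (y_real p x)))" for x
  proof (cases "Xp p t < x")
  case True
  then have x: "1 < x" using Xp_bounds(1)[OF p t] by linarith
  show ?thesis using x y_real_ge_1[OF p False x] y_real_deriv[OF p False x] by (simp add: dens_def quad_def ydv_def)
  qed simp
  show ?thesis unfolding B_term_def B_can_def if_not_P[OF False] B_curve_def set_lebesgue_integral_def x_p_eq[OF th] t_def[symmetric] pw ..
 qed
 show ?thesis unfolding Z_interior_def 1 2 ..
qed

text \<open>The value at pi/2 is defined as a limit of path integrals and so has to be found path by
  path rather than in mean square. It enters \<open>beta_proc\<close> at every angle.\<close>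

lemma alpha_proc_eq:
 assumes p: "1 <= p"
 shows "0 < th ==> th < pi/2 ==> alpha_proc p l u th = alpha_can p th u"
  "path_regular u ==> (p ~= top ==> intb (%x. indicator {1<..} x*(dens (x, y_real p x)*(W1 u x*ydv p x-W2 u (y_real p x))))) ==>
  alpha_proc p l u (pi/2) = alpha_lim p u"
proof -
 show "alpha_proc p l u th = alpha_can p th u" if "0 < th" "th < pi/2"
  using that by (simp add: alpha_proc_def alpha_can_def clampT_id Z_term_def Z_interior_eq[OF p])
 assume u: "path_regular u" "p ~= top ==> intb (%x. indicator {1<..} x*(dens (x, y_real p x)*(W1 u x*ydv p x-W2 u (y_real p x))))"
 have "((%t. Z_ray p t u+B_can p t u) ---> 0+B_lim p u) at_top"
  by (intro tendsto_add Z_ray_tendsto[OF p u(1)] B_can_tendsto[OF p u(2)])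
 from filterlim_compose[OF this filterlim_tan_at_left]
 have "((%th. Z_ray p (tan th) u+B_can p (tan th) u) ---> B_lim p u) (at_left (pi/2))" by simp
 moreover have "\<forall>\<^sub>F th in at_left (pi/2). Z_ray p (tan th) u+B_can p (tan th) u = Z_interior p l u th"
  using eventually_at_left_real[of 0 "pi/2"] by (auto elim!: eventually_mono simp: Z_interior_eq[OF p])
 ultimately have "(Z_interior p l u ---> B_lim p u) (at_left (pi/2))" by (rule Lim_transform_eventually)
 then have "Lim (at_left (pi/2)) (Z_interior p l u) = B_lim p u" by (intro tendsto_Lim) auto
 then show "alpha_proc p l u (pi/2) = alpha_lim p u" by (simp add: alpha_proc_def alpha_lim_def clampT_id Z_term_def)
qed

end

lemma integrable_weight: "intb (%x. pos x/(x*(1+x)) * sqrt (2*abs x))"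
proof -
 have F: "intb (%x. pos x*(indicator {0<..1} (1/x) * sqrt (1/x)/x))"
 proof (rule integrable_inverse_subst(1)[where F = "%t. indicator {0<..1} t * sqrt t"])
  have "(%t. pos t*(indicator {0<..1} t * sqrt t/t)) = (%t. indicator {0<..1} t/sqrt t :: real)"
  by (auto simp: fun_eq_iff indicator_def real_div_sqrt sqrt_divide_self_eq inverse_eq_divide)
  then show "intb (%t. pos t*(indicator {0<..1} t * sqrt t/t))"
  using integral_inverse_sqrt(1)[of 1] by simp
 qed measurable
 show ?thesis
 proof (rule lint_bound)
  show "intb (%x. sqrt 2*(indicator {0<..1} x/sqrt x)+sqrt 2*(pos x*(indicator {0<..1} (1/x) * sqrt (1/x)/x)))"
  by (intro lintegrable_add integrable_mult_right integral_inverse_sqrt(1) F) auto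
  have "abs (pos x/(x*(1+x)) * sqrt (2*abs x)) <= sqrt 2*(indicator {0<..1} x/sqrt x)+sqrt 2*(pos x*(indicator {0<..1} (1/x) * sqrt (1/x)/x))" for x :: real
  proof (cases "0 < x")
  case True
  have e: "pos x/(x*(1+x)) * sqrt (2*abs x) = sqrt 2/(sqrt x*(1+x))"
  proof -
  have "x = sqrt x * sqrt x" using True by simp
  then have "sqrt x/(x*(1+x)) = 1/(sqrt x*(1+x))" using True by (metis mult.assoc nonzero_divide_mult_cancel_left real_sqrt_eq_zero_cancel_iff less_irrefl)
  then have "sqrt 2*(sqrt x/(x*(1+x))) = sqrt 2*(1/(sqrt x*(1+x)))" by simp
  then show ?thesis using True by (simp add: real_sqrt_mult)
  qed
  have "sqrt 2/(sqrt x*(1+x)) <= sqrt 2/(sqrt x*(if x <= 1 then 1 else x))"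
  using True by (intro divide_left_mono mult_left_mono) auto
  then show ?thesis unfolding e using True by (auto simp: indicator_def real_sqrt_divide split: if_splits)
  qed simp
  then show "AE x in lborel. norm (pos x/(x*(1+x)) * sqrt (2*abs x)) <= norm (sqrt 2*(indicator {0<..1} x/sqrt x)+sqrt 2*(pos x*(indicator {0<..1} (1/x) * sqrt (1/x)/x)))"
  unfolding real_norm_def by (intro AE_I2 order_trans[OF _ abs_ge_self])
 qed measurable
qed

context noise
begin

text \<open>Comparing a tail measure with itself at distance 0 makes the size bounds
  \<open>K\<close> of the comparison available for a single process.\<close>

lemma self_pair: "noise_pair La l p N w La l N w 0"
 by unfold_locales auto

lemma jointly_W:
 assumes "c : meas borel"
 shows "jointly lborel (%x u. c x*W1 u x)" "jointly lborel (%x u. c x*W2 u x)"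
 unfolding jointly_def case_prod_beta'
 using W_path_measurable[OF mp, of fst "lborel |*| N" snd] W_path_measurable[OF mpi, of fst "lborel |*| La" snd] assms
 by (auto intro!: borel_measurable_times mcomp[OF measurable_fst] simp: measurable_fst[of lborel, simplified])

text \<open>The L2 bounds sqrt (2x) integrate against the weights, so by Minkowski the path
  integrals converge absolutely almost surely.\<close>

lemma paths_regular:
 assumes "AE om in N. w om {} = 0"
 shows "AE om in N. path_regular (w om) & (p ~= top -->
  intb (%x. indicator {1<..} x*(dens (x, y_real p x)*(W1 (w om) x*ydv p x-W2 (w om) (y_real p x)))))"
proof -
 interpret S: noise_pair La l p N w La l N w 0 by (rule self_pair)
 define c where "c x = pos x/(x*(1+x))" for x :: real
 have cm: "c : meas borel" unfolding c_def[abs_def] by measurable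
 have ci: "intb (%x. abs (c x) * sqrt (2*abs x))"
 proof -
  have "(%x. abs (c x) * sqrt (2*abs x)) = (%x. pos x/(x*(1+x)) * sqrt (2*abs x))"
  by (auto simp: c_def fun_eq_iff indicator_def)
  then show ?thesis using integrable_weight by simp
 qed
 have "AE om in N. intb (%x. c x*W1 (w om) x)"
  by (rule represents_integral(2)[OF sigma_finite_lborel jointly_W(1)[OF cm] S.close_scale_const[OF S.close_W1, unfolded S.close_def, THEN conjunct1] ci])
 moreover have "AE om in N. intb (%x. c x*W2 (w om) x)"
  by (rule represents_integral(2)[OF sigma_finite_lborel jointly_W(2)[OF cm] S.close_scale_const[OF S.close_W2, unfolded S.close_def, THEN conjunct1] ci])
 moreover have "AE om in N. p ~= top --> intb (%x. indicator {1<..} x*(dens (x, y_real p x)*(W1 (w om) x*ydv p x-W2 (w om) (y_real p x))))"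
  using S.close_B_curve(2)[of 1] by (cases "p = top") auto
 ultimately show ?thesis using assms by eventually_elim (simp add: path_regular_def c_def)
qed

definition mcoef :: "real => real" where
 "mcoef th = (LINT ps:{0..th}|Q_measure p La. f_fun p ps)/variance_of (Q_measure p La) (f_fun p)"

text \<open>On one regular path at a time, everything defined through \<open>deriv\<close>,
  \<open>vector_derivative\<close> or \<open>Lim\<close> is replaced by a closed form; what remains
  inside the absolute value is linear in the path.\<close>

lemma L_var_eq:
 fixes g :: "real \<times> real => real ^ 'm::finite"
 assumes q: "set_integrable lborel {0<..<pi/2} q" "!!th. th : {0<..<pi/2} ==> 0 <= q th"
  and si: "sets si = sets (restrict_space borel ({0..1} \<times> {0..1}))"
  and u: "path_regular u" "p ~= top ==> intb (%x. indicator {1<..} x*(dens (x, y_real p x)*(W1 u x*ydv p x-W2 u (y_real p x))))"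
  and I: "!!j. integrable si (%v. g v $ j*I_kernel v u)"
 shows "L_var p q La l d g si u = (LINT th:{0<..<pi/2}|lborel. q th * abs (G_can (f_deriv p) si g mcoef (%th. LINT x:{0..th}|lborel. d x) th u))"
proof -
 have T: "1 <= PhiT p" by (rule PhiT_bounds(1)[OF p])
 have beta: "beta_proc p La l u th = beta_can th u" if "0 < th" "th < pi/2" for th
 proof -
  have "beta_proc p La l u th = (alpha_can p th u*PhiT p-Phi p La th * alpha_lim p u)/(PhiT p)^2"
  using that u by (simp add: beta_proc_def Phi_total[OF p] alpha_proc_eq(1)[OF p] alpha_proc_eq(2)[OF p u])
  also have "... = beta_can th u" unfolding beta_can_def using T by (simp add: field_simps power2_eq_square)
  finally show ?thesis .
 qed
 \<comment> \<open>The three exceptional points are the end points of the interval and the kink of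
   the maximum norm.\<close>
 have M: "(LINT ps:{0..pi/2}|lborel. beta_proc p La l u ps * deriv (f_fun p) ps) = M_can (f_deriv p) u"
  unfolding set_lebesgue_integral_def M_can_def
  by (rule integral_discrete_difference[where X = "{0, pi/2, pi/4}"])
  (auto simp: indicator_def beta f_fun_deriv[OF p])
 have sp: "space si = {0..1} \<times> {0..1}" using sets_eq_imp_space_eq[OF si] by (simp add: space_restrict_space)
 have kernel: "u (A_set v)-(ell_dot1 La v * W1 u (fst v)+ell_dot2 La v * W2 u (snd v)) = I_kernel v u" if "v : space si" for v
 proof -
  have v: "0 <= fst v" "0 <= snd v" "clampI v = v" using that clampI_id(1)[of v] by (auto simp: sp)
  \<comment> \<open>Where a coordinate of \<open>v\<close> is 0, the partial derivative in that
    coordinate is multiplied by a marginal process at 0, which vanishes; elsewhere the closed forms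
    apply.\<close>
  have e: "W1 u 0 = 0" "W2 u 0 = 0" using u(1) by (simp_all add: path_regular_def W1_def W2_def strip1_def strip2_def)
  have 1: "ell_dot1 La v * W1 u (fst v) = e1 v * W1 u (fst v)"
  using ell_dot1_eq[of v] v e by (cases "fst v = 0") (auto simp: e1_def)
  have 2: "ell_dot2 La v * W2 u (snd v) = e2 v * W2 u (snd v)"
  using ell_dot2_eq[of v] v e by (cases "snd v = 0") (auto simp: e2_def)
  show ?thesis unfolding I_kernel_def 1 2 v(3) by simp
 qed
 have Iv: "integrable si (%v. I_kernel v u *\<^sub>R g v)"
 proof -
  have "(%v. I_kernel v u *\<^sub>R g v) = (%v. \<Sum>j\<in>UNIV. (g v $ j*I_kernel v u) *\<^sub>R axis j 1)"
  by (auto simp: fun_eq_iff vec_eq_iff axis_def if_distrib[of "%x. _*x"] cong: if_cong)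
  then show ?thesis using I by (auto intro!: Bochner_Integration.integrable_sum integrable_scaleR_left)
 qed
 have It: "I_term La g si u $ j = I_can si (%v. g v $ j) u" for j
 proof -
  have "I_term La g si u = (LINT v|si. I_kernel v u *\<^sub>R g v)"
  unfolding I_term_def by (intro lint_cong refl) (simp add: kernel)
  then show ?thesis using integral_bounded_linear[OF bounded_linear_vec_nth Iv, of j] by (simp add: I_can_def mult.commute)
 qed
 have G: "gamma_proc p La l u th - (LINT x:{0..th}|lborel. d x) \<bullet> I_term La g si u = G_can (f_deriv p) si g mcoef (%th. LINT x:{0..th}|lborel. d x) th u"
  if "0 < th" "th < pi/2" for th
  unfolding gamma_proc_def beta[OF that] M G_can_def mcoef_def by (simp add: inner_vec_def It)
 show ?thesis unfolding L_var_def by (rule set_lebesgue_integral_cong) (auto simp: G mult.commute)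
qed

end

section \<open>The variance of f under the angular law\<close>

lemma Lp_norm_mono1:
 assumes "1 <= p" "0 <= x" "x <= y"
 shows "Lp_norm p (x, 1) <= Lp_norm p (y, 1)" "Lp_norm p (1, x) <= Lp_norm p (1, y)"
proof -
 have "0 <= enn2real p" by simp
 then have "x powr enn2real p <= y powr enn2real p" using assms by (intro powr_mono2) auto
 then have "(x powr enn2real p+1) powr (1/enn2real p) <= (y powr enn2real p+1) powr (1/enn2real p)"
  by (intro powr_mono2) auto
 then show "Lp_norm p (x, 1) <= Lp_norm p (y, 1)" "Lp_norm p (1, x) <= Lp_norm p (1, y)"
  using assms by (auto simp: Lp_norm_def add.commute)
qed

lemma f_arctan_eq:
 assumes p: "1 <= p" and t: "0 < t"
 shows "f_fun p (arctan t) = (t-1)/Lp_norm p (t, 1)"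
proof -
 define c where "c = cos (arctan t)"
 have c: "0 < c" unfolding c_def using arctan_bounded[of t] by (intro cos_gt_zero_pi) auto
 have s: "sin (arctan t) = c*t" using tan_arctan[of t] c unfolding tan_def c_def by (simp add: field_simps)
 have "f_fun p (arctan t) = (c*t - c*1)/(c*Lp_norm p (t, 1))"
  unfolding f_fun_def s c_def[symmetric] using Lp_norm_scale[OF p c, of t 1] t by simp
 also have "... = (t-1)/Lp_norm p (t, 1)" using c unfolding right_diff_distrib[symmetric] by simp
 finally show ?thesis .
qed

text \<open>Strict monotonicity means that \<open>f_fun p\<close> takes each value at one slope at
  most, which later keeps its variance positive. The three cases choose the form of the quotient in
  which numerator and denominator move in favourable directions.\<close>

lemma f_arctan_less:
 assumes p: "1 <= p" and t: "0 < t" "t < s"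
 shows "f_fun p (arctan t) < f_fun p (arctan s)"
proof -
 have pos: "0 < Lp_norm p (x, 1)" "0 < Lp_norm p (1, x)" if "0 < x" for x
  using Lp_norm_bounds(1)[OF p, of x 1] Lp_norm_bounds(1)[OF p, of 1 x] that by auto
 consider "s <= 1" | "t <= 1" "1 < s" | "1 < t" by linarith
 then show ?thesis
 proof cases
  case 1
  have "(1-s)/Lp_norm p (s, 1) <= (1-s)/Lp_norm p (t, 1)"
  using 1 t pos[of t] Lp_norm_mono1(1)[OF p, of t s] by (intro divide_left_mono mult_pos_pos) auto
  also have "... < (1-t)/Lp_norm p (t, 1)" using t pos[of t] by (intro divide_strict_right_mono) auto
  finally show ?thesis using t by (simp add: f_arctan_eq[OF p] minus_divide_left[symmetric] diff_divide_distrib)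
 next
  case 2
  have "(t-1)/Lp_norm p (t, 1) <= 0" "0 < (s-1)/Lp_norm p (s, 1)" using 2 t pos[of t] pos[of s] by (auto simp: divide_le_0_iff)
  then show ?thesis using t by (simp add: f_arctan_eq[OF p])
 next
  case 3
  have r: "(x-1)/Lp_norm p (x, 1) = (1-1/x)/Lp_norm p (1, 1/x)" if "1 < x" for x
  proof -
  have "Lp_norm p (x, 1) = x*Lp_norm p (1, 1/x)" using Lp_norm_scale[OF p, of x 1 "1/x"] that by simp
  then show ?thesis using that by (simp add: divide_simps)
  qed
  have "(1-1/t)/Lp_norm p (1, 1/t) < (1-1/s)/Lp_norm p (1, 1/t)"
  using 3 t pos(2)[of "1/t"] by (intro divide_strict_right_mono) (auto simp: frac_less2)
  also have "... <= (1-1/s)/Lp_norm p (1, 1/s)"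
  using 3 t pos(2)[of "1/s"] pos(2)[of "1/t"] Lp_norm_mono1(2)[OF p, of "1/s" "1/t"]
  by (intro divide_left_mono mult_pos_pos) (auto simp: frac_le)
  finally show ?thesis using 3 t by (simp add: f_arctan_eq[OF p] r)
 qed
qed

context noise
begin

definition angle_dens :: "real => real" where
 "angle_dens th = indicator {0<..<pi/2} th * (adens p (tan th)*(1+(tan th)^2))"

lemma angle_dens_integral:
 assumes "0 <= th"
 shows "intb (%ps. angle_dens ps * of_bool (ps <= th))" "(LBINT ps. angle_dens ps * of_bool (ps <= th)) = Phi p La th"
proof -
 define g where "g t = adens p t * of_bool (arctan t <= th)" for t
 have gm: "g : meas borel" unfolding g_def[abs_def] by measurable
 have bij: "bij_betw tan {0<..<pi/2} {0<..}"
  by (rule bij_betw_byWitness[where f' = arctan]) (use arctan_ubound in \<open>auto simp: arctan_tan tan_arctan tan_gt_zero\<close>)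
 have a0: "adens p t = 0" if "t <= 0" for t using that by (simp add: adens_def apos_def)
 have gi: "intb (%t. pos t*g t)" "(LBINT t. pos t*g t) = Phi p La th"
 proof -
  have "(%t. pos t*g t) = g" using a0 by (auto simp: fun_eq_iff g_def indicator_def)
  moreover have "integrable lborel g"
  by (rule lint_bound[OF adens_integrable[OF p]]) (use gm in \<open>auto simp: g_def\<close>)
  ultimately show "intb (%t. pos t*g t)" "(LBINT t. pos t*g t) = Phi p La th"
  unfolding Phi_eq[OF p] g_def[symmetric] by simp_all
 qed
 have der: "(tan has_field_derivative 1+(tan x)^2) (at x)" if "x : {0<..<pi/2}" for x
 proof -
  have "cos x ~= 0" using cos_gt_zero[of x] that by auto
  then show ?thesis using DERIV_tan[of x] tan_sec[of x] by (simp add: power_inverse)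
 qed
 have m: "(%x. indicator {0<..<pi/2} x*(abs (1+(tan x)^2)*g (tan x))) : meas borel"
  using gm unfolding tan_def by measurable
 have eq: "indicator {0<..<pi/2} x*(abs (1+(tan x)^2)*g (tan x)) = angle_dens x * of_bool (x <= th)" for x
  using arctan_tan[of x] by (auto simp: angle_dens_def g_def indicator_def abs_of_nonneg)
 show "intb (%ps. angle_dens ps * of_bool (ps <= th))" "(LBINT ps. angle_dens ps * of_bool (ps <= th)) = Phi p La th"
  using integrable_subst_pos[OF _ bij der m gm gi(1), unfolded eq] gi(2) by simp_all
qed

definition f_int :: "real => real" where
 "f_int th = (LBINT t. apos t*(Xp p t*(of_bool (arctan t <= th)*f_fun p (arctan t))))"

lemma f_arctan_bound: "0 < t ==> abs (f_fun p (arctan t)) <= 1"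
 using arctan_ubound[of t] by (intro f_fun_bounded p) auto

lemma weights:
 fixes th :: real
 assumes "0 < t"
 shows "0 <= Xp p t*(of_bool (arctan t <= th)*((f_fun p (arctan t)+1)/2)) & Xp p t*(of_bool (arctan t <= th)*((f_fun p (arctan t)+1)/2)) <= 1+1/t"
  "0 <= Xp p t * of_bool (arctan t <= th) & Xp p t * of_bool (arctan t <= th) <= 1+1/t"
  "0 <= Xp p t*(f_fun p (arctan t))^2 & Xp p t*(f_fun p (arctan t))^2 <= 1+1/t"
proof -
 have X: "0 <= Xp p t" "Xp p t <= 1+1/t" using Xp_bounds[OF p assms] by auto
 have *: "0 <= Xp p t * c & Xp p t * c <= 1+1/t" if "0 <= c" "c <= 1" for c
  using X that mult_left_mono[of c 1 "Xp p t"] by auto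
 note f = f_arctan_bound[OF assms]
 show "0 <= Xp p t*(of_bool (arctan t <= th)*((f_fun p (arctan t)+1)/2)) & Xp p t*(of_bool (arctan t <= th)*((f_fun p (arctan t)+1)/2)) <= 1+1/t"
  "0 <= Xp p t * of_bool (arctan t <= th) & Xp p t * of_bool (arctan t <= th) <= 1+1/t"
  "0 <= Xp p t*(f_fun p (arctan t))^2 & Xp p t*(f_fun p (arctan t))^2 <= 1+1/t"
  by (intro *; use f in \<open>simp add: abs_square_le_1 abs_le_iff[of _ "1::real"]\<close>)+
qed

text \<open>Writing f = 2 (f + 1)/2 - 1 expresses a signed integrand through factors in [0, 1], the
  class to which \<open>coef_diff\<close> applies.\<close>

lemma f_int_split:
 "f_int th = 2*(LBINT t. apos t*(Xp p t*(of_bool (arctan t <= th)*((f_fun p (arctan t)+1)/2))))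
  - (LBINT t. apos t*(Xp p t * of_bool (arctan t <= th)))"
proof -
 define A B where "A t = apos t*(Xp p t*(of_bool (arctan t <= th)*((f_fun p (arctan t)+1)/2)))"
  and "B t = apos t*(Xp p t * of_bool (arctan t <= th))" for t
 have i: "integrable lborel A" "integrable lborel B" unfolding A_def[abs_def] B_def[abs_def]
  by (rule coef_bounds(1)[OF _ weights(1)], measurable, rule coef_bounds(1)[OF _ weights(2)], measurable)
 have "f_int th = (LBINT t. 2*A t-B t)"
  unfolding f_int_def by (intro lint_cong) (auto simp: A_def B_def field_simps)
 also have "... = 2*(LBINT t. A t)-(LBINT t. B t)" using i by simp
 finally show ?thesis unfolding A_def B_def .
qed

lemma f_int_bound: "abs (f_int th) <= PhiT p"
proof -
 have "abs (f_int th) <= (LBINT t. adens p t)" unfolding f_int_def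
 proof (rule integral_abs_le[OF adens_integrable[OF p]])
  fix t
  show "abs (apos t*(Xp p t*(of_bool (arctan t <= th)*f_fun p (arctan t)))) <= adens p t"
  proof (cases "0 < t")
  case True
  have "apos t*Xp p t*abs (of_bool (arctan t <= th)*f_fun p (arctan t)) <= apos t*Xp p t*1"
  using f_arctan_bound[OF True] apos_nonneg[of t] Xp_bounds(1)[OF p True] by (intro mult_left_mono mult_nonneg_nonneg) auto
  then show ?thesis using apos_nonneg[of t] Xp_bounds(1)[OF p True] by (simp add: adens_def abs_mult mult.assoc)
  qed (simp add: apos_def adens_def)
 qed
 then show ?thesis by (simp add: PhiT_def)
qed

definition sq_int :: real where
 "sq_int = (LBINT t. apos t*(Xp p t*(f_fun p (arctan t))^2))"

definition var_f :: real where
 "var_f = sq_int/PhiT p-(f_int (pi/2)/PhiT p)^2"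

lemma Q_f_int:
 assumes "0 <= th"
 shows "(LINT ps:{0..th}|Q_measure p La. f_fun p ps) = f_int th / PhiT p"
 unfolding integral_Q[OF p f_fun_measurable assms] f_int_def integral_divide_zero[symmetric] adens_def
 by (intro lint_cong) (auto simp: mult.assoc)

lemma variance_eq: "variance_of (Q_measure p La) (f_fun p) = (LBINT t. adens p t/PhiT p*(f_fun p (arctan t)-f_int (pi/2)/PhiT p)^2)"
 "variance_of (Q_measure p La) (f_fun p) = var_f"
proof -
 define muv where "muv = f_int (pi/2)/PhiT p"
 have T: "1 <= PhiT p" by (rule PhiT_bounds(1)[OF p])
 have mean: "mean_of (Q_measure p La) (f_fun p) = muv" unfolding mean_of_def muv_def by (rule Q_f_int) simp
 have le: "arctan t <= pi/2" for t using arctan_ubound[of t] by simp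
 have "variance_of (Q_measure p La) (f_fun p) = (LBINT t. adens p t/PhiT p*(of_bool (arctan t <= pi/2)*(f_fun p (arctan t) - muv)^2))"
  unfolding variance_of_def mean by (rule integral_Q[OF p]) auto
 then show 1: "variance_of (Q_measure p La) (f_fun p) = (LBINT t. adens p t/PhiT p*(f_fun p (arctan t)-f_int (pi/2)/PhiT p)^2)"
  by (simp only: le of_bool_eq mult_1 muv_def)
 have i1: "intb (%t. apos t*(Xp p t*(f_fun p (arctan t))^2))" by (rule coef_bounds(1)[OF _ weights(3)]) auto
 have i2: "intb (%t. apos t*(Xp p t*f_fun p (arctan t)))"
 proof (rule lint_bound[OF adens_integrable[OF p]])
  show "AE t in lborel. norm (apos t*(Xp p t*f_fun p (arctan t))) <= norm (adens p t)"
  proof (rule AE_I2)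
  fix t
  show "norm (apos t*(Xp p t*f_fun p (arctan t))) <= norm (adens p t)"
  using f_arctan_bound[of t] mult_left_mono[of "abs (f_fun p (arctan t))" 1 "abs (apos t)*abs (Xp p t)"]
  by (cases "0 < t") (auto simp: adens_def abs_mult apos_def mult.assoc)
  qed
 qed measurable
 have f2: "(LBINT t. apos t*(Xp p t*f_fun p (arctan t))) = f_int (pi/2)" unfolding f_int_def by (simp only: le of_bool_eq mult_1)
 have "(LBINT t. adens p t/PhiT p*(f_fun p (arctan t) - muv)^2) = (LBINT t. (apos t*(Xp p t*(f_fun p (arctan t))^2)-2 * muv * (apos t*(Xp p t*f_fun p (arctan t))) + muv\<^sup>2*adens p t)/PhiT p)"
  by (intro lint_cong) (auto simp: adens_def power2_eq_square algebra_simps add_divide_distrib diff_divide_distrib)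
 also have "... = (sq_int-2 * muv * f_int (pi/2) + muv\<^sup>2*PhiT p)/PhiT p"
  using i1 i2 adens_integrable[OF p] by (simp add: sq_int_def f2 PhiT_def)
 also have "... = var_f" unfolding var_f_def muv_def using T by (simp add: field_simps power2_eq_square)
 finally show "variance_of (Q_measure p La) (f_fun p) = var_f" unfolding 1 muv_def .
qed

text \<open>\<open>f_fun p\<close> equals its mean at one slope at most and the angular law has a
  density in the slope; zero variance would leave no mass at all.\<close>

lemma variance_pos: "0 < var_f"
proof -
 define muv where "muv = f_int (pi/2)/PhiT p"
 define h where "h t = adens p t/PhiT p*(f_fun p (arctan t) - muv)^2" for t
 have T: "1 <= PhiT p" by (rule PhiT_bounds(1)[OF p])
 have muv: "abs muv <= 1" using f_int_bound[of "pi/2"] T by (simp add: muv_def abs_divide divide_le_eq)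
 have h0: "0 <= h t" for t using adens_bounds(1)[OF p, of t] T by (simp add: h_def)
 have hi: "integrable lborel h"
 proof (rule lint_bound)
  show "intb (%t. 4*adens p t)" using adens_integrable[OF p] by simp
  show "h : meas lborel" unfolding h_def[abs_def] by measurable
  show "AE t in lborel. norm (h t) <= norm (4*adens p t)"
  proof (rule AE_I2)
  fix t
  show "norm (h t) <= norm (4*adens p t)"
  proof (cases "0 < t")
  case True
  have "abs (f_fun p (arctan t) - muv) <= 2" using f_arctan_bound[OF True] muv by linarith
  then have "(f_fun p (arctan t) - muv)^2 <= 2^2" using abs_le_square_iff[of "f_fun p (arctan t) - muv" 2] by simp
  moreover have "adens p t/PhiT p <= adens p t" using adens_bounds(1)[OF p, of t] T by (simp add: divide_le_eq mult_left_mono[of 1 "PhiT p" "adens p t", simplified])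
  ultimately have "h t <= adens p t*2^2" unfolding h_def using adens_bounds(1)[OF p, of t] by (intro mult_mono) auto
  then show ?thesis using h0[of t] adens_bounds(1)[OF p, of t] by simp
  qed (simp add: h_def adens_def apos_def)
  qed
 qed
 have "0 <= var_f" unfolding variance_eq(2)[symmetric] variance_eq(1) muv_def[symmetric] h_def[symmetric] using h0 by (intro integral_nonneg_AE) auto
 moreover have "var_f ~= 0"
 proof
  assume "var_f = 0"
  then have "integral\<^sup>L lborel h = 0" using variance_eq unfolding muv_def[symmetric] h_def[abs_def] by simp
  then have ae: "AE t in lborel. h t = 0" using integral_nonneg_eq_0_iff_AE[OF hi] h0 by simp
  have ne: "AE t in lborel. 0 < t --> f_fun p (arctan t) ~= muv"
  proof (cases "EX t>0. f_fun p (arctan t) = muv")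
  case True
  then obtain s where s: "0 < s" "f_fun p (arctan s) = muv" by blast
  have "t = s" if "0 < t" "f_fun p (arctan t) = muv" for t
  using f_arctan_less[OF p, of t s] f_arctan_less[OF p, of s t] that s by (cases t s rule: linorder_cases) auto
  then show ?thesis using AE_ne_point[of s] by (auto elim!: AE_mp)
  qed auto
  have "AE t in lborel. adens p t = 0"
  using ae ne by eventually_elim (use T in \<open>auto simp: h_def adens_def apos_def split: if_splits\<close>)
  then have "PhiT p = 0" unfolding PhiT_def using integral_eq_zero_AE by blast
  then show False using T by simp
 qed
 ultimately show ?thesis by simp
qed

end

context noise_pair
begin

lemma f_int_close: "abs (S1.f_int th - S0.f_int th) <= 3*e"
proof -
 have 1: "abs ((LBINT t. S1.apos t*(Xp p t*(of_bool (arctan t <= th)*((f_fun p (arctan t)+1)/2)))) -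
  (LBINT t. S0.apos t*(Xp p t*(of_bool (arctan t <= th)*((f_fun p (arctan t)+1)/2))))) <= e"
  by (rule coef_diff[OF _ S1.weights(1)]) measurable
 have 2: "abs ((LBINT t. S1.apos t*(Xp p t * of_bool (arctan t <= th))) -
  (LBINT t. S0.apos t*(Xp p t * of_bool (arctan t <= th)))) <= e"
  by (rule coef_diff[OF _ S1.weights(2)]) measurable
 show ?thesis using 1 2 unfolding S1.f_int_split S0.f_int_split by linarith
qed

lemma quotient_close:
 assumes "abs (A1-A0) <= de" "abs A0 <= 2"
 shows "abs (A1/S1.PhiT p-A0/S0.PhiT p) <= de + 2*e"
proof -
 have "A1/S1.PhiT p-A0/S0.PhiT p = (A1-A0)*(1/S1.PhiT p)+A0*(1/S1.PhiT p-1/S0.PhiT p)" by (simp add: algebra_simps diff_divide_distrib)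
 also have "abs ... <= abs (A1-A0)*abs (1/S1.PhiT p)+abs A0*abs (1/S1.PhiT p-1/S0.PhiT p)"
  by (rule order_trans[OF abs_triangle_ineq]) (simp only: abs_mult order_refl)
 also have "... <= de * 1+2*e" using assms ratio_close(1,3) e by (intro add_mono mult_mono) auto
 finally show ?thesis by simp
qed

lemma mean_close:
 "abs (S1.f_int th / S1.PhiT p) <= 1" "abs (S0.f_int th / S0.PhiT p) <= 1" "abs (S1.f_int th / S1.PhiT p-S0.f_int th / S0.PhiT p) <= 5*e"
proof -
 show "abs (S1.f_int th / S1.PhiT p) <= 1" "abs (S0.f_int th / S0.PhiT p) <= 1"
  using S1.f_int_bound[of th] S0.f_int_bound[of th] S1.PhiT_bounds[OF S1.p] S0.PhiT_bounds[OF S1.p] by (auto simp: abs_divide divide_le_eq)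
 have "abs (S0.f_int th) <= 2" using S0.f_int_bound[of th] S0.PhiT_bounds[OF S1.p] by simp
 from quotient_close[OF f_int_close this] show "abs (S1.f_int th / S1.PhiT p-S0.f_int th / S0.PhiT p) <= 5*e" by simp
qed

lemma var_close: "abs (S1.var_f-S0.var_f) <= 13*e"
proof -
 have "abs (S1.sq_int-S0.sq_int) <= e" unfolding S1.sq_int_def S0.sq_int_def
  by (rule coef_diff[OF _ S1.weights(3)]) measurable
 moreover have "abs S0.sq_int <= 2" unfolding S0.sq_int_def using S0.coef_bounds(2,3)[OF _ S0.weights(3)] by (simp add: abs_le_iff)
 ultimately have 1: "abs (S1.sq_int/S1.PhiT p-S0.sq_int/S0.PhiT p) <= 3*e" using quotient_close[of S1.sq_int S0.sq_int e] by simp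
 define m1 m0 where "m1 = S1.f_int (pi/2)/S1.PhiT p" and "m0 = S0.f_int (pi/2)/S0.PhiT p"
 have m: "abs m1 <= 1" "abs m0 <= 1" "abs (m1 - m0) <= 5*e" unfolding m1_def m0_def by (rule mean_close)+
 have "abs (m1^2 - m0^2) = abs (m1 - m0)*abs (m1 + m0)" by (simp add: abs_mult[symmetric] power2_eq_square algebra_simps)
 also have "... <= (5*e)*2" using m by (intro mult_mono) auto
 finally show ?thesis using 1 unfolding S1.var_f_def S0.var_f_def m1_def[symmetric] m0_def[symmetric] by linarith
qed

text \<open>Variances differ by at most 13e, so the condition \<open>26*e <= v\<close> keeps the
  perturbed one above v/2; the rest is the Lipschitz estimate for a quotient.\<close>

lemma mcoef_close:
 assumes v: "v = S0.var_f" "26*e <= v" and th: "0 <= th"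
 shows "abs (S1.mcoef th) <= 2/v" "abs (S0.mcoef th) <= 2/v" "abs (S1.mcoef th - S0.mcoef th) <= (10/v+26/v^2)*e"
proof -
 have v0: "0 < v" "0 < S1.var_f" using S0.variance_pos S1.variance_pos v by auto
 have v1: "v/2 <= S1.var_f" using var_close v by (auto simp: abs_le_iff)
 define M1 M0 where "M1 = S1.f_int th / S1.PhiT p" and "M0 = S0.f_int th / S0.PhiT p"
 have M: "abs M1 <= 1" "abs M0 <= 1" "abs (M1-M0) <= 5*e" unfolding M1_def M0_def by (rule mean_close)+
 have m: "S1.mcoef th = M1/S1.var_f" "S0.mcoef th = M0/v"
  using th v by (simp_all add: S1.mcoef_def S0.mcoef_def M1_def M0_def S1.Q_f_int S0.Q_f_int S1.variance_eq(2) S0.variance_eq(2))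
 have inv: "1/S1.var_f <= 2/v" using v0 v1 by (simp add: field_simps)
 have "abs (S1.mcoef th) = abs M1*(1/S1.var_f)" unfolding m using v0 by (simp add: abs_divide)
 also have "... <= 1*(2/v)" using M inv v0 by (intro mult_mono) auto
 finally show "abs (S1.mcoef th) <= 2/v" by simp
 have "abs (S0.mcoef th) = abs M0/v" unfolding m using v0 by (simp add: abs_divide)
 also have "... <= 2/v" using M v0 by (intro divide_right_mono) auto
 finally show "abs (S0.mcoef th) <= 2/v" .
 have "S1.mcoef th - S0.mcoef th = (M1-M0)*(1/S1.var_f)+M0*((v - S1.var_f)*(1/S1.var_f)/v)"
  unfolding m using v0 by (simp add: field_simps)
 also have "abs ... <= abs (M1-M0)*abs (1/S1.var_f)+abs M0*(abs (v - S1.var_f)*abs (1/S1.var_f)/v)"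
  using v0 by (intro order_trans[OF abs_triangle_ineq]) (simp add: abs_mult abs_divide)
 also have "... <= (5*e)*(2/v)+1*((13*e)*(2/v)/v)"
  using M v0 inv var_close v e by (intro add_mono mult_mono divide_right_mono) (auto simp: abs_minus_commute)
 also have "... = (10/v+26/v^2)*e" by (simp add: power2_eq_square field_simps)
 finally show "abs (S1.mcoef th - S0.mcoef th) <= (10/v+26/v^2)*e" .
qed

text \<open>Factor k1^2 - k0^2 = (k1 - k0)(k1 + k0) and apply Cauchy-Schwarz in the common L2
  space.\<close>

lemma close_variance:
 assumes c: "close Fa Fb K c"
 shows "abs ((LINT z|La1. (Fa (%C. indicator C z))^2)-(LINT z|La0. (Fb (%C. indicator C z))^2)) <= c*(2*K)"
proof -
 define k1 k0 where "k1 = S1.sym_kern Fa" and "k0 = S0.sym_kern Fb"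
 note c' = c[unfolded close_def S1.represents_def S0.represents_def]
 have l: "l2_le lborel k1 K" "l2_le lborel k0 K" unfolding k1_def k0_def S1.sym_kern_def S0.sym_kern_def
  using c' by (auto intro: S1.l2_le_kern S0.l2_le_kern)
 have d: "l2_le lborel (%z. k1 z-k0 z) c" using c' by (simp add: k1_def k0_def)
 have eq: "(LINT z|La1. (Fa (%C. indicator C z))^2) = (LBINT z. (k1 z)^2)" "(LINT z|La0. (Fb (%C. indicator C z))^2) = (LBINT z. (k0 z)^2)"
  unfolding k1_def k0_def S1.sym_kern_def S0.sym_kern_def using c' by (auto intro!: S1.integral_kern S0.integral_kern dest: l2_leD(1))
 have "(LBINT z. (k1 z)^2)-(LBINT z. (k0 z)^2) = (LBINT z. (k1 z)^2-(k0 z)^2)"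
  using l2_leD(3)[OF l(1)] l2_leD(3)[OF l(2)] by simp
 also have "... = (LBINT z. (k1 z-k0 z)*(k1 z+k0 z))"
  by (intro lint_cong) (auto simp: power2_eq_square algebra_simps)
 finally show ?thesis using l2_le_inner(2)[OF d l2_le_add[OF l]] unfolding eq by simp
qed

end

section \<open>Parametric models\<close>

lemma integrable_powr_0:
 assumes "-1 < (b::real)" "0 <= (c::real)"
 shows "intb (%x. indicator {0<..c} x*x powr b)"
proof -
 have "((%x. if x : {0..c} then x powr b else 0) has_integral (c powr (b+1)/(b+1))) UNIV"
  by (rule has_integral_restrict_UNIV[THEN iffD2, OF has_integral_powr_from_0[OF assms]])
 then have "(nn_integral lborel (%x. ennreal (if x : {0..c} then x powr b else 0))) = ennreal (c powr (b+1)/(b+1))"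
  by (intro nn_integral_has_integral_lborel) auto
 moreover have "(if x : {0..c} then x powr b else 0) = indicator {0<..c} x*x powr b" for x
  by (auto simp: indicator_def less_le)
 ultimately have "(nn_integral lborel (%x. ennreal (indicator {0<..c} x*x powr b))) < top" by (simp only: ennreal_less_top)
 then show ?thesis by (intro integrableI_nonneg) (auto simp: indicator_def)
qed

text \<open>An upper bound for eta^(-nuv) divided by Xp(t) (1 + t^2), the factor between the density
  along rays and the angular density: for t <= 1 by eta = t and Xp >= 1/t, for t > 1 by eta = 1/t
  and Xp >= 1.\<close>

definition ray_weight :: "real => real => real" where
 "ray_weight nuv t = (if t <= 1 then t powr (1 - nuv) else t powr (nuv - 2))"

lemma ray_weight_le:
 assumes nuv: "0 < nuv" "nuv < 1" and t: "0 < t"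
 shows "0 <= ray_weight nuv t" "ray_weight nuv t*(1+t) <= 2"
proof -
 show "0 <= ray_weight nuv t" by (simp add: ray_weight_def)
 show "ray_weight nuv t*(1+t) <= 2"
 proof (cases "t <= 1")
  case True
  have "t powr (1 - nuv) <= 1" using True t nuv powr_mono2[of "1 - nuv" t 1] by simp
  then have "t powr (1 - nuv)*(1+t) <= 1*2" using True t by (intro mult_mono) auto
  then show ?thesis using True by (simp add: ray_weight_def)
 next
  case False
  have "t powr (nuv - 2)*(1+t) <= t powr (- 1)*(2*t)" using False nuv by (intro mult_mono powr_mono) auto
  also have "... = 2" using t by (simp add: powr_minus)
  finally show ?thesis using False by (simp add: ray_weight_def)
 qed
qed

text \<open>Near 0 the integrand is of order t^(-nuv), at infinity of order t^(nuv - 2); both are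
  integrable because nuv < 1.\<close>

lemma ray_weight_integrable:
 assumes nuv: "0 < nuv" "nuv < 1"
 shows "intb (%t. pos t*(ray_weight nuv t*(1+1/t)))"
proof -
 have i0: "intb (%x. indicator {0<..1} x*x powr (- nuv))" using nuv by (intro integrable_powr_0) auto
 have i1: "intb (%x. pos x*(indicator {0<..1} (1/x)*(1/x) powr (1 - nuv)/x))"
 proof (rule integrable_inverse_subst(1)[where F = "%t. indicator {0<..1} t*t powr (1 - nuv)"])
  have "(%t. pos t*(indicator {0<..1} t*t powr (1 - nuv)/t)) = (%x. indicator {0<..1} x*x powr (- nuv) :: real)"
  by (auto simp: fun_eq_iff indicator_def powr_diff powr_minus divide_inverse)
  then show "intb (%t. pos t*(indicator {0<..1} t*t powr (1 - nuv)/t))" using i0 by simp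
 qed measurable
 have le: "abs (pos t*(ray_weight nuv t*(1+1/t))) <=
  2*(indicator {0<..1} t*t powr (- nuv))+2*(pos t*(indicator {0<..1} (1/t)*(1/t) powr (1 - nuv)/t))" for t :: real
 proof (cases "0 < t")
  case True
  show ?thesis
  proof (cases "t <= 1")
  case le: True
  have "t powr (1 - nuv) = t powr (- nuv)*t" using True by (simp add: powr_diff powr_minus divide_inverse)
  then have "ray_weight nuv t*(1+1/t) = t powr (- nuv)*(t+1)" using le True by (simp add: ray_weight_def field_simps)
  also have "... <= t powr (- nuv)*2" using le by (intro mult_left_mono) auto
  finally show ?thesis using True le ray_weight_le(1)[OF nuv True] by (auto simp: indicator_def)
  next
  case False
  have "(1/t) powr (1 - nuv)/t = t powr (nuv - 1)/t" using True by (simp add: powr_divide powr_minus[symmetric] divide_powr_uminus)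
  also have "... = t powr (nuv - 2)" using True powr_diff[of t "nuv - 1" 1] by (simp add: algebra_simps)
  finally have e: "(1/t) powr (1 - nuv)/t = ray_weight nuv t" using False by (simp add: ray_weight_def)
  have "ray_weight nuv t*(1+1/t) <= ray_weight nuv t*2" using False ray_weight_le(1)[OF nuv True] by (intro mult_left_mono) auto
  moreover have "pos t*(indicator {0<..1} (1/t)*(1/t) powr (1 - nuv)/t) = ray_weight nuv t"
  using e True False by (simp add: indicator_def)
  ultimately show ?thesis using True False ray_weight_le(1)[OF nuv True] by (simp add: indicator_def abs_mult)
  qed
 qed simp
 show ?thesis
 proof (rule lint_bound)
  show "intb (%t. 2*(indicator {0<..1} t*t powr (- nuv))+2*(pos t*(indicator {0<..1} (1/t)*(1/t) powr (1 - nuv)/t)))"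
  using i0 i1 by (intro lintegrable_add integrable_mult_right) auto
  show "(%t. pos t*(ray_weight nuv t*(1+1/t))) : meas lborel" unfolding ray_weight_def[abs_def] by measurable
 qed (use le in \<open>auto intro!: AE_I2 order_trans[OF _ abs_ge_self] simp del: abs_mult\<close>)
qed

lemma eta_arctan: "0 < t ==> eta (arctan t) = min t (1/t)"
 unfolding eta_def tan_cot tan_arctan by (simp add: inverse_eq_divide)

lemma eta_lower: "0 < th ==> th < pi/2 ==> min th (pi/2 - th) <= eta th"
 unfolding eta_def using arctan_le_self[of "tan th"] arctan_le_self[of "tan (pi/2 - th)"] arctan_tan[of th] arctan_tan[of "pi/2 - th"]
  tan_gt_zero[of th] tan_gt_zero[of "pi/2 - th"] by (intro min.mono) auto

lemma eta_integrable:
 assumes nuv: "0 < nuv" "nuv < 1"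
 shows "intb (%th. indicator {0<..<pi/2} th * eta th powr (- nuv))"
proof -
 define h where "h th = indicator {0<..pi/2} th * th powr (- nuv)" for th :: real
 have hi: "integrable lborel h" unfolding h_def[abs_def] using nuv by (intro integrable_powr_0) auto
 have hr: "intb (%th. h (pi/2+(- 1) * th))" by (rule lborel_integrable_real_affine[OF hi]) simp
 show ?thesis
 proof (rule lint_bound[OF lintegrable_add[OF hi hr]])
  show "(%th. indicator {0<..<pi/2} th * eta th powr (- nuv)) : meas lborel"
  unfolding eta_def[abs_def] tan_def by measurable
  show "AE th in lborel. norm (indicator {0<..<pi/2} th * eta th powr (- nuv)) <= norm (h th + h (pi/2+(- 1) * th))"
  proof (rule AE_I2)
  fix th :: real
  show "norm (indicator {0<..<pi/2} th * eta th powr (- nuv)) <= norm (h th + h (pi/2+(- 1) * th))"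
  proof (cases "0 < th & th < pi/2")
  case True
  have "eta th powr (- nuv) <= min th (pi/2 - th) powr (- nuv)"
  using True nuv eta_lower[of th] by (intro powr_mono2') auto
  also have "... <= th powr (- nuv)+(pi/2 - th) powr (- nuv)" by (simp add: min_def)
  finally show ?thesis using True by (simp add: h_def indicator_def)
  next
  case False
  then have "th ~: {0<..<pi/2}" by auto
  then show ?thesis by simp
  qed
  qed
 qed
qed

text \<open>Condition (5) on the angular densities, rewritten for the densities along rays.\<close>

lemma ray_density_close:
 assumes "smooth_tail La1 l1" "smooth_tail La0 l0" and p: "1 <= p" and nuv: "0 < nuv" "nuv < 1"
  and close: "!!th. 0 < th ==> th < pi/2 ==> eta th powr nuv * abs (noise.angle_dens l1 p th - noise.angle_dens l0 p th) <= ep"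
  and n: "noise La1 l1 p N1 w1" "noise La0 l0 p N0 w0" and t: "0 < t"
 shows "abs (smooth_tail.apos l1 t-smooth_tail.apos l0 t) <= ep * ray_weight nuv t"
proof -
 interpret S1: noise La1 l1 p N1 w1 by (rule n)
 interpret S0: noise La0 l0 p N0 w0 by (rule n)
 define d where "d = abs (S1.apos t-S0.apos t)"
 have at: "0 < arctan t" "arctan t < pi/2" using t arctan_ubound by auto
 have "S1.angle_dens (arctan t)-S0.angle_dens (arctan t) = (S1.apos t-S0.apos t)*(Xp p t*(1+t^2))"
  using at unfolding S1.angle_dens_def S0.angle_dens_def S1.adens_def S0.adens_def tan_arctan by (simp add: algebra_simps)
 then have le: "min t (1/t) powr nuv * (d*(Xp p t*(1+t^2))) <= ep"
  using close[OF at] Xp_bounds(1)[OF p t] by (simp add: eta_arctan[OF t] d_def abs_mult)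
 show ?thesis
 proof (cases "t <= 1")
  case True
  have "1/t*1 <= Xp p t*(1+t^2)" using t Xp_bounds(1,3)[OF p t] by (intro mult_mono) auto
  then have "t powr nuv * (d*(1/t)) <= t powr nuv * (d*(Xp p t*(1+t^2)))" by (intro mult_left_mono) (auto simp: d_def)
  moreover have "min t (1/t) = t" using True t mult_le_one[of t t] by (simp add: min_def le_divide_eq)
  ultimately have "t powr nuv * (d*(1/t)) <= ep" using le by simp
  then have "t powr (1 - nuv)*(t powr nuv * (d*(1/t))) <= t powr (1 - nuv) * ep" by (intro mult_left_mono) auto
  moreover have "t powr (1 - nuv)*(t powr nuv * (d*(1/t))) = d"
  proof -
  have "t powr (1 - nuv)*t powr nuv = t" using t by (simp add: powr_add[symmetric])
  then have "t powr (1 - nuv)*(t powr nuv * (d*(1/t))) = t*(d*(1/t))" by (metis mult.assoc)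
  then show ?thesis using t by simp
  qed
  ultimately show ?thesis using True by (simp add: d_def ray_weight_def mult.commute)
 next
  case False
  have "1*t^2 <= Xp p t*(1+t^2)" using t Xp_bounds(1)[OF p t] by (intro mult_mono) auto
  then have "(1/t) powr nuv * (d*t^2) <= (1/t) powr nuv * (d*(Xp p t*(1+t^2)))" by (intro mult_left_mono) (auto simp: d_def)
  moreover have "1/t <= 1" using False by simp
  then have "min t (1/t) = 1/t" using False by (intro min_absorb2) linarith
  ultimately have "(1/t) powr nuv * (d*t^2) <= ep" using le by simp
  then have "t powr (nuv - 2)*((1/t) powr nuv * (d*t^2)) <= t powr (nuv - 2) * ep" by (intro mult_left_mono) auto
  moreover have "t powr (nuv - 2)*((1/t) powr nuv * (d*t^2)) = d"
  proof -
  have "(1/t) powr nuv = t powr (- nuv)" using t by (simp add: powr_divide powr_minus_divide)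
  moreover have "t^2 = t powr 2" using t by simp
  moreover have "t powr (nuv - 2)*(t powr (- nuv)*t powr 2) = 1" using t by (simp add: powr_add[symmetric] del: powr_numeral)
  ultimately show ?thesis by (metis mult.assoc mult.commute mult_1)
  qed
  ultimately have "d <= t powr (nuv - 2) * ep" by simp
  then show ?thesis using False by (simp add: d_def ray_weight_def mult.commute)
 qed
qed

section \<open>Gradients in the parameter\<close>

locale angular_model =
 fixes p :: ennreal and R :: "(real ^ 'm::finite) set" and Lar :: "real ^ 'm => pt measure" and lamr :: "real ^ 'm => real \<times> real => real"
  and ph rh :: "real ^ 'm => real => real" and gradph gradrh :: "real ^ 'm => real => real ^ 'm"
  and N :: "real ^ 'm => 'b measure" and W :: "real ^ 'm => 'b => pt set => real"
 assumes p: "1 <= p"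
  and model: "!!r. r : R ==> tail_measure (Lar r) & smooth_with_density (Lar r) (lamr r)"
  and ph: "!!r th. r : R ==> th : {0<..<pi/2} ==> (Phi p (Lar r) has_real_derivative ph r th) (at th)"
  and rh: "!!r th. r : R ==> th : {0..pi/2} ==> rh r th = ph r th / Phi p (Lar r) (pi/2)"
  and gradrh: "!!r th. r : R ==> th : {0..pi/2} ==> ((%s. rh s th) has_derivative (%h. gradrh r th \<bullet> h)) (at r within R)"
  and exchange: "!!r th. r : R ==> th : {0..pi/2} ==> set_integrable lborel {0..th} (gradrh r) &
  ((%s. LINT x:{0..th}|lborel. rh s x) has_derivative (%h. (LINT x:{0..th}|lborel. gradrh r x) \<bullet> h)) (at r within R)"
  and gradph: "!!r th. r : R ==> th : {0..pi/2} ==> ((%s. ph s th) has_derivative (%h. gradph r th \<bullet> h)) (at r within R)"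
  and wiener: "!!r. r : R ==> wiener_process p (Lar r) (N r) (W r)"
begin

lemma tail: "r : R ==> smooth_tail (Lar r) (lamr r)"
 using model by unfold_locales blast+

definition w :: "real ^ 'm => 'b => pt set => real" where
 "w r = (SOME w. noise (Lar r) (lamr r) p (N r) w & (AE om in N r. w om = W r om & w om {} = 0))"

lemma w: "r : R ==> noise (Lar r) (lamr r) p (N r) (w r)" "r : R ==> AE om in N r. w r om = W r om & w r om {} = 0"
proof -
 assume r: "r : R"
 have "EX w. noise (Lar r) (lamr r) p (N r) w & (AE om in N r. w om = W r om & w om {} = 0)"
  by (rule smooth_tail.regular_version[OF tail[OF r] p wiener[OF r]]) blast
 from someI_ex[OF this] show "noise (Lar r) (lamr r) p (N r) (w r)" "AE om in N r. w r om = W r om & w r om {} = 0"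
  unfolding w_def by blast+
qed

lemma phi_eq: "r : R ==> 0 < th ==> th < pi/2 ==> ph r th = noise.angle_dens (lamr r) p th"
 using DERIV_unique[OF ph smooth_tail.Phi_deriv[OF tail p]] noise.angle_dens_def[OF w(1)] by simp

lemma phi_integral:
 assumes r: "r : R" and th: "0 <= th" "th <= pi/2"
 shows "set_integrable lborel {0..th} (ph r)" "(LINT x:{0..th}|lborel. ph r x) = Phi p (Lar r) th"
proof -
 interpret S: noise "Lar r" "lamr r" p "N r" "w r" by (rule w(1)[OF r])
 have eq: "indicator {0..th} x *\<^sub>R ph r x = S.angle_dens x * of_bool (x <= th)" if "x ~: {0, pi/2}" for x
  using that th phi_eq[OF r, of x] by (auto simp: indicator_def S.angle_dens_def)
 show "set_integrable lborel {0..th} (ph r)" unfolding set_integrable_def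
  by (rule integrable_discrete_difference[where X = "{0, pi/2}", THEN iffD2, OF _ _ _ _ S.angle_dens_integral(1)[OF th(1)]]) (use eq in auto)
 have "(LINT x:{0..th}|lborel. ph r x) = (LBINT x. S.angle_dens x * of_bool (x <= th))"
  unfolding set_lebesgue_integral_def by (rule integral_discrete_difference[where X = "{0, pi/2}"]) (use eq in auto)
 then show "(LINT x:{0..th}|lborel. ph r x) = Phi p (Lar r) th" using S.angle_dens_integral(2)[OF th(1)] by simp
qed

lemma total: "r : R ==> Phi p (Lar r) (pi/2) = smooth_tail.PhiT (lamr r) p" "r : R ==> 1 <= Phi p (Lar r) (pi/2)"
 using smooth_tail.Phi_total[OF tail p] smooth_tail.PhiT_bounds(1)[OF tail p] by simp_all

definition grad_int :: "real ^ 'm => real => real ^ 'm" where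
 "grad_int r th = (LINT x:{0..th}|lborel. gradph r x)"

text \<open>The total angular mass is a quotient of values of the two densities, hence differentiable in \<open>r\<close>. Its
 gradient is found by integrating the gradient of the normalized density, whose integral is zero.\<close>

lemma gradient_identity:
 assumes r: "r : interior R"
 shows "set_integrable lborel {0..pi/2} (gradph r)"
  "0 <= th ==> th <= pi/2 ==> (LINT x:{0..th}|lborel. gradrh r x) =
  (1/Phi p (Lar r) (pi/2)) *\<^sub>R grad_int r th + (- (Phi p (Lar r) th / (Phi p (Lar r) (pi/2))^2)) *\<^sub>R grad_int r (pi/2)"
proof -
 have rR: "r : R" using r interior_subset by blast
 interpret S: noise "Lar r" "lamr r" p "N r" "w r" by (rule w(1)[OF rR])
 have at: "at r within R = at r" by (rule at_within_interior[OF r])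
 have nR: "\<forall>\<^sub>F s in at r. s : R" using eventually_nhds_in_nhd[OF r] by (auto simp: eventually_at_filter elim: eventually_mono)
 define T where "T s = Phi p (Lar s) (pi/2)" for s
 have T: "1 <= T r" unfolding T_def by (rule total(2)[OF rR])
 note dph = gradph[OF rR, unfolded at] and drh = gradrh[OF rR, unfolded at]
 \<comment> \<open>A pivot angle at which the normalized density does not vanish; if there were
   none, the total mass would be 0.\<close>
 obtain th' where th': "th' : {0..pi/2}" "rh r th' ~= 0"
 proof (rule ccontr)
  assume neg: "~ thesis"
  have z: "rh r th = 0" if "th : {0..pi/2}" for th using neg that \<open>!!th'. th' : {0..pi / 2} ==> rh r th' ~= 0 ==> thesis\<close> by blast
  have z2: "indicator {0..pi/2} th *\<^sub>R ph r th = 0" for th using z[of th] rh[OF rR, of th] T by (auto simp: indicator_def T_def)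
  have "Phi p (Lar r) (pi/2) = 0" using phi_integral(2)[OF rR, of "pi/2"] unfolding set_lebesgue_integral_def z2 by simp
  then show False using T by (simp add: T_def)
 qed
 \<comment> \<open>The quotient rule for the total mass, written as \<open>ph / rh\<close> at the
   pivot.\<close>
 define v where "v = (1 / rh r th') *\<^sub>R gradph r th'-(ph r th'/(rh r th' * rh r th')) *\<^sub>R gradrh r th'"
 have dT: "(T has_derivative (%h. v \<bullet> h)) (at r)"
 proof (rule has_derivative_transform_eventually)
  have "((%s. ph s th' / rh s th') has_derivative (%h. (gradph r th' \<bullet> h * rh r th' - ph r th'*(gradrh r th' \<bullet> h))/(rh r th' * rh r th'))) (at r)"
  by (rule has_derivative_divide'[OF dph[OF th'(1)] drh[OF th'(1)] th'(2)])
  also have "(%h. (gradph r th' \<bullet> h * rh r th' - ph r th'*(gradrh r th' \<bullet> h))/(rh r th' * rh r th')) = (%h. v \<bullet> h)"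
  using th'(2) by (auto simp: fun_eq_iff v_def inner_diff_left diff_divide_distrib)
  finally show "((%s. ph s th' / rh s th') has_derivative (%h. v \<bullet> h)) (at r)" .
  have q: "ph s th' / rh s th' = T s" if "s : R" "rh s th' ~= 0" for s
  using rh[OF that(1) th'(1)] that total(2)[OF that(1)] by (auto simp: T_def field_simps)
  have "((%s. rh s th') ---> rh r th') (at r)" using has_derivative_continuous[OF drh[OF th'(1)]] by (simp add: isCont_def)
  from tendsto_imp_eventually_ne[OF this th'(2)] nR
  show "\<forall>\<^sub>F s in at r. ph s th' / rh s th' = T s" by eventually_elim (rule q)
  show "ph r th' / rh r th' = T r" by (rule q[OF rR th'(2)])
 qed simp
 \<comment> \<open>The quotient rule for \<open>rh = ph / T\<close> and uniqueness of derivatives in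
   the interior, solved for the gradient of \<open>ph\<close>; the gradient \<open>v\<close> of the
   mass enters linearly.\<close>
 have id: "gradph r th = T r *\<^sub>R gradrh r th + (ph r th / T r) *\<^sub>R v" if th: "th : {0..pi/2}" for th
 proof -
  have "((%s. ph s th / T s) has_derivative (%h. (gradph r th \<bullet> h*T r - ph r th * (v \<bullet> h))/(T r*T r))) (at r)"
  by (rule has_derivative_divide'[OF dph[OF th] dT]) (use T in simp)
  moreover have "\<forall>\<^sub>F s in at r. ph s th / T s = rh s th" using nR by eventually_elim (simp add: rh[OF _ th] T_def)
  ultimately have "((%s. rh s th) has_derivative (%h. (gradph r th \<bullet> h*T r - ph r th * (v \<bullet> h))/(T r*T r))) (at r)"
  by (rule has_derivative_transform_eventually) (simp_all add: rh[OF rR th] T_def)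
  from has_derivative_unique[OF this drh[OF th]]
  have e: "(gradph r th \<bullet> h*T r - ph r th * (v \<bullet> h))/(T r*T r) = gradrh r th \<bullet> h" for h by (rule fun_cong)
  have "(T r *\<^sub>R gradrh r th + (ph r th / T r) *\<^sub>R v) \<bullet> h = gradph r th \<bullet> h" for h
  unfolding inner_add_left inner_scaleR_left e[symmetric] using T by (simp add: field_simps)
  then show ?thesis by (metis vector_eq_rdot)
 qed
 have sub: "set_integrable lborel {0..th} (gradph r) & grad_int r th = T r *\<^sub>R (LINT x:{0..th}|lborel. gradrh r x)+(Phi p (Lar r) th / T r) *\<^sub>R v"
  if th: "0 <= th" "th <= pi/2" for th
 proof -
  have eq: "indicator {0..th} x *\<^sub>R gradph r x = T r *\<^sub>R (indicator {0..th} x *\<^sub>R gradrh r x)+(indicator {0..th} x *\<^sub>R ph r x) *\<^sub>R ((1/T r) *\<^sub>R v)" for x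
  using id[of x] th by (auto simp: indicator_def)
  have i1: "intb (%x. indicator {0..th} x *\<^sub>R gradrh r x)" using exchange[OF rR, of th] th by (simp add: set_integrable_def)
  have i2: "intb (%x. indicator {0..th} x *\<^sub>R ph r x)" using phi_integral(1)[OF rR th] by (simp add: set_integrable_def)
  have i3: "intb (%x. (indicator {0..th} x *\<^sub>R ph r x) *\<^sub>R ((1/T r) *\<^sub>R v))" by (intro integrable_scaleR_left i2)
  have i4: "intb (%x. T r *\<^sub>R (indicator {0..th} x *\<^sub>R gradrh r x))" by (intro integrable_scaleR_right i1)
  have "grad_int r th = T r *\<^sub>R (LBINT x. indicator {0..th} x *\<^sub>R gradrh r x)+(LBINT x. indicator {0..th} x *\<^sub>R ph r x) *\<^sub>R ((1/T r) *\<^sub>R v)"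
  unfolding grad_int_def set_lebesgue_integral_def eq lint_add[OF i4 i3]
  by (simp only: integral_scaleR_right integral_scaleR_left[OF i2])
  then show ?thesis using phi_integral(2)[OF rR th] lintegrable_add[OF i4 i3]
  by (simp add: set_integrable_def set_lebesgue_integral_def eq)
 qed
 show "set_integrable lborel {0..pi/2} (gradph r)" using sub[of "pi/2"] by simp
 \<comment> \<open>The normalized density integrates to 1 for every parameter, so the gradient of
   this constant vanishes.\<close>
 have zero: "(LINT x:{0..pi/2}|lborel. gradrh r x) = 0"
 proof -
  have one: "(LINT x:{0..pi/2}|lborel. rh s x) = 1" if s: "s : R" for s
  proof -
  have "(LINT x:{0..pi/2}|lborel. rh s x) = (LINT x:{0..pi/2}|lborel. ph s x/T s)"
  by (rule set_lebesgue_integral_cong) (auto simp: rh[OF s] T_def)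
  also have "... = (LINT x:{0..pi/2}|lborel. ph s x)/T s" by simp
  also have "... = 1" using phi_integral(2)[OF s, of "pi/2"] total(2)[OF s] by (simp add: T_def)
  finally show ?thesis .
  qed
  have "((%s. LINT x:{0..pi/2}|lborel. rh s x) has_derivative (%h. (LINT x:{0..pi/2}|lborel. gradrh r x) \<bullet> h)) (at r)"
  using exchange[OF rR, of "pi/2"] unfolding at by simp
  moreover have "\<forall>\<^sub>F s in at r. (LINT x:{0..pi/2}|lborel. rh s x) = 1" using nR by eventually_elim (rule one)
  ultimately have "((%s. 1 :: real) has_derivative (%h. (LINT x:{0..pi/2}|lborel. gradrh r x) \<bullet> h)) (at r)"
  by (rule has_derivative_transform_eventually) (simp_all add: one[OF rR])
  from has_derivative_unique[OF this has_derivative_const] have "(LINT x:{0..pi/2}|lborel. gradrh r x) \<bullet> h = 0" for h by (rule fun_cong)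
  then show ?thesis using inner_eq_zero_iff by blast
 qed
 \<comment> \<open>On the full interval the first term of \<open>sub\<close> is 0 and the quotient
   Phi/T is 1, which identifies \<open>v\<close>.\<close>
 have v: "v = grad_int r (pi/2)" using sub[of "pi/2"] T by (simp add: zero T_def[symmetric])
 show "(LINT x:{0..th}|lborel. gradrh r x) = (1/Phi p (Lar r) (pi/2)) *\<^sub>R grad_int r th + (- (Phi p (Lar r) th / (Phi p (Lar r) (pi/2))^2)) *\<^sub>R grad_int r (pi/2)"
  if "0 <= th" "th <= pi/2"
  using sub[OF that] T unfolding v[symmetric] T_def[symmetric]
  by (simp add: scaleR_add_right power2_eq_square)
qed

end

lemma norm_scale_diff:
 fixes u1 u0 :: "'a::real_normed_vector"
 assumes "abs (x1-x0) <= d" "abs x0 <= 1" "norm u1 <= B" "norm (u1-u0) <= h"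
 shows "norm (x1 *\<^sub>R u1-x0 *\<^sub>R u0) <= d*B+h"
proof -
 have "x1 *\<^sub>R u1-x0 *\<^sub>R u0 = (x1-x0) *\<^sub>R u1+x0 *\<^sub>R (u1-u0)" by (simp add: algebra_simps)
 also have "norm ... <= abs (x1-x0)*norm u1+abs x0*norm (u1-u0)" by (metis norm_scaleR norm_triangle_ineq)
 also have "... <= d*B+1*h" using assms by (intro add_mono mult_mono) (auto intro: order_trans[OF norm_ge_zero] order_trans[OF abs_ge_zero])
 finally show ?thesis by simp
qed

section \<open>Uniform closeness near the true parameter\<close>

locale angular_test = angular_model p R Lar lamr ph rh gradph gradrh N W
 for p and R :: "(real ^ 'm::finite) set" and Lar lamr ph rh gradph gradrh and N :: "real ^ 'm => 'b measure" and W +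
 fixes r0 :: "real ^ 'm" and q :: "real => real" and si :: "(real \<times> real) measure" and g :: "real \<times> real => real ^ 'm" and nuv :: real
 assumes r0: "r0 : interior R"
  and q: "ALL th:{0<..<pi/2}. 0 < q th" "set_integrable lborel {0<..<pi/2} q"
  and si: "sets si = sets (restrict_space borel ({0..1} \<times> {0..1}))" "finite_measure si"
  and g: "g : meas si" "integrable si (%v. (norm (g v))^2)"
  and nuv: "0 < nuv" "nuv < 1"
  and lim: "!!s. (ALL n. s n : R) & s ----> r0 ==>
  uniform_limit {0..pi/2} (%n th. eta th powr nuv * abs (ph (s n) th - ph r0 th)) (%_. 0) sequentially &
  uniform_limit {0..pi/2} (%n th. eta th powr nuv * norm (gradph (s n) th - gradph r0 th)) (%_. 0) sequentially"
begin

lemma r0R: "r0 : R" using r0 interior_subset by blast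

definition G :: "real ^ 'm => real => (pt set => real) => real" where
 "G r = noise.G_can (Lar r) (lamr r) p (f_deriv p) si g (noise.mcoef (Lar r) p) (%th. LINT x:{0..th}|lborel. gradrh r x)"

definition V :: "real ^ 'm => nat => (nat => real) => (nat => real) => real" where
 "V r k b th = (\<integral>z. (\<Sum>i<k. b i*G r (th i) (%C. indicator C z))^2 \<partial>Lar r)"

text \<open>A neighbourhood of \<open>r0\<close> measured by the two weighted suprema of the
  hypothesis on densities and gradients; the interior is included because derivatives are unique
  there.\<close>

definition near :: "real ^ 'm => real => bool" where
 "near r ep \<longleftrightarrow> r : interior R & (ALL th:{0<..<pi/2}. eta th powr nuv * abs (ph r th - ph r0 th) <= ep &
  eta th powr nuv * norm (gradph r th - gradph r0 th) <= ep)"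

lemma g_integrable: "integrable si g" "integrable si (%v. g v $ j)" "(LINT v|si. abs (g v $ j)) <= (LINT v|si. norm (g v))"
proof -
 interpret finite_measure si by (rule si)
 have le: "norm x <= norm (1+(norm x)^2)" for x :: "real ^ 'm"
 proof -
  have "2*norm x <= 1+(norm x)^2" using sum_squares_bound[of 1 "norm x"] by simp
  then have "norm x <= 1+(norm x)^2" using norm_ge_zero[of x] by linarith
  then show ?thesis by simp
 qed
 show i: "integrable si g"
  by (rule lint_bound[of _ "%v. 1+(norm (g v))^2"]) (use g le in auto)
 then show j: "integrable si (%v. g v $ j)" using integrable_bounded_linear[OF bounded_linear_vec_nth i] by simp
 show "(LINT v|si. abs (g v $ j)) <= (LINT v|si. norm (g v))"
  using i j by (intro integral_mono) (auto intro: Finite_Cartesian_Product.norm_nth_le[of "g _" j, simplified])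
qed

definition eta_int :: real where
 "eta_int = (LBINT th. indicator {0<..<pi/2} th * eta th powr (- nuv))"

text \<open>The weight eta^(-nuv) is integrable, so the weighted supremum controls the integrals of
  gradients up to every angle by the same constant.\<close>

lemma grad_int_close:
 assumes n: "near r ep" and th: "0 <= th" "th <= pi/2" and ep: "0 <= ep"
 shows "norm (grad_int r th - grad_int r0 th) <= ep * eta_int"
  "norm (grad_int r0 th) <= (LBINT x. norm (indicator {0..pi/2} x *\<^sub>R gradph r0 x))"
proof -
 have i: "set_integrable lborel {0..th} (gradph r)" "set_integrable lborel {0..th} (gradph r0)"
  using gradient_identity(1)[of r] gradient_identity(1)[OF r0] n th unfolding near_def by (auto intro: set_integrable_subset)
 have "grad_int r th - grad_int r0 th = (LBINT x. indicator {0..th} x *\<^sub>R (gradph r x-gradph r0 x))"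
  unfolding grad_int_def set_integral_diff(2)[OF i, symmetric] by (simp add: set_lebesgue_integral_def)
 also have "norm ... <= (LBINT x. norm (indicator {0..th} x *\<^sub>R (gradph r x-gradph r0 x)))" by (rule integral_norm_bound)
 also have "... <= (LBINT x. ep * (indicator {0<..<pi/2} x*eta x powr (- nuv)))"
 proof (rule integral_mono_AE)
  show "intb (%x. norm (indicator {0..th} x *\<^sub>R (gradph r x-gradph r0 x)))"
  using set_integral_diff(1)[OF i] by (intro integrable_norm) (simp add: set_integrable_def)
  show "intb (%x. ep * (indicator {0<..<pi/2} x*eta x powr (- nuv)))"
  by (intro integrable_mult_right eta_integrable nuv)
  show "AE x in lborel. norm (indicator {0..th} x *\<^sub>R (gradph r x-gradph r0 x)) <= ep * (indicator {0<..<pi/2} x*eta x powr (- nuv))"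
  using smooth_tail.AE_ne_point[OF tail[OF r0R], of 0] smooth_tail.AE_ne_point[OF tail[OF r0R], of "pi/2"]
  proof eventually_elim
  case (elim x)
  show ?case
  proof (cases "0 < x & x < pi/2")
  case True
  have e: "0 < eta x" using eta_lower[of x] True by linarith
  have "eta x powr nuv * norm (gradph r x-gradph r0 x) <= ep" using n True unfolding near_def by simp
  then have "eta x powr (- nuv)*(eta x powr nuv * norm (gradph r x-gradph r0 x)) <= eta x powr (- nuv) * ep" by (intro mult_left_mono) auto
  moreover have "eta x powr (- nuv)*eta x powr nuv = 1" using e by (simp add: powr_add[symmetric])
  ultimately have "norm (gradph r x-gradph r0 x) <= eta x powr (- nuv) * ep" by (metis mult.assoc mult_1)
  then show ?thesis using True ep by (auto simp: indicator_def mult.commute)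
  next
  case False
  then have "x ~: {0..th}" using elim th by auto
  then show ?thesis using ep by (auto simp: indicator_def)
  qed
  qed
 qed
 also have "... = ep * eta_int" by (simp add: eta_int_def)
 finally show "norm (grad_int r th - grad_int r0 th) <= ep * eta_int" .
 have "norm (grad_int r0 th) <= (LBINT x. norm (indicator {0..th} x *\<^sub>R gradph r0 x))"
  unfolding grad_int_def set_lebesgue_integral_def by (rule integral_norm_bound)
 also have "... <= (LBINT x. norm (indicator {0..pi/2} x *\<^sub>R gradph r0 x))"
  using i(2) gradient_identity(1)[OF r0] th unfolding set_integrable_def
  by (intro integral_mono integrable_norm) (auto simp: indicator_def)
 finally show "norm (grad_int r0 th) <= (LBINT x. norm (indicator {0..pi/2} x *\<^sub>R gradph r0 x))" .
qed

text \<open>In the factor defining \<open>e\<close>, the integral of the ray weight serves the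
  weighted L1 distance, and the 2 serves the pointwise bound from
  \<open>ray_weight_le\<close>.\<close>

lemma near_pair:
 assumes n: "near r ep" and ep: "0 <= ep" and C0: "!!t. smooth_tail.apos (lamr r0) t <= C0/(1+abs t)"
 defines "e \<equiv> (2+(LBINT t. pos t*(ray_weight nuv t*(1+1/t)))) * ep"
 shows "noise_pair (Lar r) (lamr r) p (N r) (w r) (Lar r0) (lamr r0) (N r0) (w r0) e"
  "0 < t ==> abs (smooth_tail.apos (lamr r) t-smooth_tail.apos (lamr r0) t) <= e/(1+t)"
  "0 < t ==> smooth_tail.apos (lamr r) t <= (C0+2 * ep)/(1+t)"
proof -
 have rR: "r : R" using n interior_subset unfolding near_def by blast
 interpret S1: noise "Lar r" "lamr r" p "N r" "w r" by (rule w(1)[OF rR])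
 interpret S0: noise "Lar r0" "lamr r0" p "N r0" "w r0" by (rule w(1)[OF r0R])
 define J where "J = (LBINT t. pos t*(ray_weight nuv t*(1+1/t)))"
 have J: "0 <= J" unfolding J_def using ray_weight_le(1)[OF nuv] by (intro integral_nonneg_AE) (auto simp: indicator_def)
 have e: "e = 2 * ep + J * ep" "0 <= J * ep" using J ep by (simp_all add: e_def J_def algebra_simps)
 have d: "abs (S1.apos t-S0.apos t) <= ep * ray_weight nuv t" if "0 < t" for t
  by (rule ray_density_close[OF tail[OF rR] tail[OF r0R] p nuv _ w(1)[OF rR] w(1)[OF r0R] that])
  (use n phi_eq[OF rR] phi_eq[OF r0R] in \<open>auto simp: near_def\<close>)
 have d2: "abs (S1.apos t-S0.apos t) <= 2 * ep / (1+t)" if "0 < t" for t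
 proof -
  have "ep * (ray_weight nuv t*(1+t)) <= ep * 2" using ray_weight_le(2)[OF nuv that] ep by (intro mult_left_mono) auto
  then have "ep * ray_weight nuv t <= 2 * ep / (1+t)" using that by (simp add: le_divide_eq mult.assoc)
  then show ?thesis using d[OF that] by linarith
 qed
 show "abs (S1.apos t-S0.apos t) <= e/(1+t)" if "0 < t" for t
  using d2[OF that] divide_right_mono[of "2 * ep" e "1+t"] e that by linarith
 show "S1.apos t <= (C0+2 * ep)/(1+t)" if "0 < t" for t
  using d2[OF that] C0[of t] that by (simp add: add_divide_distrib abs_le_iff)
 have le: "pos t*(abs (S1.apos t-S0.apos t)*(1+1/t)) <= ep * (pos t*(ray_weight nuv t*(1+1/t)))" for t
 proof (cases "0 < t")
  case True
  have "abs (S1.apos t-S0.apos t)*(1+1/t) <= ep * ray_weight nuv t*(1+1/t)" using d[OF True] True by (intro mult_right_mono) auto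
  then show ?thesis using True by (simp add: mult.assoc)
 qed simp
 have i: "intb (%t. ep * (pos t*(ray_weight nuv t*(1+1/t))))"
  by (intro integrable_mult_right ray_weight_integrable nuv)
 have i2: "intb (%t. pos t*(abs (S1.apos t-S0.apos t)*(1+1/t)))"
 proof (rule lint_bound[OF i])
  show "AE t in lborel. norm (pos t*(abs (S1.apos t-S0.apos t)*(1+1/t))) <= norm (ep * (pos t*(ray_weight nuv t*(1+1/t))))"
  proof (rule AE_I2)
  fix t :: real
  have "0 <= pos t*(abs (S1.apos t-S0.apos t)*(1+1/t))" by (auto simp: indicator_def)
  then show "norm (pos t*(abs (S1.apos t-S0.apos t)*(1+1/t))) <= norm (ep * (pos t*(ray_weight nuv t*(1+1/t))))"
  using le[of t] unfolding real_norm_def by linarith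
  qed
 qed measurable
 have "(LBINT t. pos t*(abs (S1.apos t-S0.apos t)*(1+1/t))) <= ep * J"
  using integral_mono[OF i2 i le] by (simp add: J_def)
 also have "... <= e" using e ep by (simp add: mult.commute)
 finally show "noise_pair (Lar r) (lamr r) p (N r) (w r) (Lar r0) (lamr r0) (N r0) (w r0) e"
  using i2 e ep by unfold_locales auto
qed

text \<open>The constants are built from \<open>r0\<close> and the fixed data and depend neither on
  the angle nor on \<open>r\<close>; the modulus \<open>c\<close> is an explicit function continuous
  at 0 with value 0 there.\<close>

lemma uniform_close:
 obtains K ep0 c where "0 < ep0" "isCont c 0" "c 0 = 0"
  "!!r ep. 0 < ep ==> ep <= ep0 ==> near r ep ==> (ALL th. 0 < th & th < pi/2 -->
  noise.represents (Lar r) (N r) (w r) (G r th) K & noise.represents (Lar r0) (N r0) (w r0) (G r0 th) K) &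
  (ALL k b th. (ALL i<k. 0 < th i & th i < pi/2) --> abs (V r k b th - V r0 k b th) <= (\<Sum>i<k. abs (b i))^2 * c ep)"
proof -
 interpret S0: noise "Lar r0" "lamr r0" p "N r0" "w r0" by (rule w(1)[OF r0R])
 obtain C0 where C0: "0 <= C0" "!!t. S0.apos t <= C0/(1+abs t)" using S0.apos_bound by blast
 define ka where "ka = 2+(LBINT t. pos t*(ray_weight nuv t*(1+1/t)))"
 have ka: "2 <= ka" unfolding ka_def using ray_weight_le(1)[OF nuv] by (auto simp: indicator_def intro!: integral_nonneg_AE)
 define v where "v = S0.var_f"
 have v: "0 < v" unfolding v_def by (rule S0.variance_pos)
 define Hn where "Hn = eta_int"
 have Hn: "0 <= Hn" unfolding Hn_def eta_int_def by (intro integral_nonneg_AE) (auto simp: indicator_def)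
 define Bg where "Bg = (LBINT x. norm (indicator {0..pi/2} x *\<^sub>R gradph r0 x))"
 have Bg: "0 <= Bg" unfolding Bg_def by (intro integral_nonneg_AE) auto
 define Jg where "Jg = (LINT v|si. norm (g v))"
 have Jg: "0 <= Jg" unfolding Jg_def by (intro integral_nonneg_AE) auto
 define Ka where "Ka = 18+4*(C0+2)"
 \<comment> \<open>One bound for \<open>mcoef\<close>, through 2/v, and for the integrated gradient,
   through 2(Bg + Hn).\<close>
 define B where "B = 2/v+2*(Bg+Hn)"
 \<comment> \<open>24 bounds \<open>f_deriv\<close>, 2 Ka is the size of \<open>beta_can\<close>,
   and pi/2 is the length of the interval.\<close>
 define KM where "KM = 24*(2*Ka)*(pi/2)"
 define E where "E ep = ka * ep + sqrt (ka * ep)" for ep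
 \<comment> \<open>The sum of the moduli of \<open>mcoef\<close> and of the integrated gradient, so
   that one number serves both.\<close>
 define de where "de ep = (10/v+26/v^2)*(ka * ep)+(4*(ka * ep)*(Bg+Hn)+2*(ep * Hn))" for ep
 define K where "K = 2*Ka+(B*KM+real CARD('m)*(B*(Jg*8)))"
 define cG where "cG ep = 6*Ka*E ep + ((de ep * KM+B*(24*(6*Ka*E ep)*(pi/2)))+real CARD('m)*(de ep * (Jg*8)+B*(Jg*(8*E ep))))" for ep
 define c where "c ep = cG ep * (2*K)" for ep
 \<comment> \<open>The bound 1 turns perturbed quantities into constants; the other one is the
   condition of \<open>mcoef_close\<close> with \<open>ka * ep\<close> in place of
   \<open>e\<close>.\<close>
 define ep0 where "ep0 = min 1 (v / (26 * ka))"
 have ep0: "0 < ep0" unfolding ep0_def using v ka by simp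
 have cc: "isCont c 0" unfolding c_def[abs_def] cG_def E_def de_def by (intro continuous_intros)
 have c0: "c 0 = 0" by (simp add: c_def cG_def E_def de_def)
 have main: "(ALL th. 0 < th & th < pi/2 -->
  noise.represents (Lar r) (N r) (w r) (G r th) K & noise.represents (Lar r0) (N r0) (w r0) (G r0 th) K) &
  (ALL k b th. (ALL i<k. 0 < th i & th i < pi/2) --> abs (V r k b th - V r0 k b th) <= (\<Sum>i<k. abs (b i))^2 * c ep)"
  if ep: "0 < ep" "ep <= ep0" and n: "near r ep" for r ep
 proof -
  have rI: "r : interior R" using n by (simp add: near_def)
  have rR: "r : R" using rI interior_subset by blast
  have ep1: "ep <= 1" "26*(ka * ep) <= v" "0 <= ep" using ep ka v by (auto simp: ep0_def field_simps)
  note np = near_pair[OF n ep1(3) C0(2), folded ka_def]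
  interpret P: noise_pair "Lar r" "lamr r" p "N r" "w r" "Lar r0" "lamr r0" "N r0" "w r0" "ka * ep" by (rule np(1))
  have E: "ka * ep + sqrt (ka * ep) = E ep" by (simp add: E_def)
  have C1: "P.S1.apos t <= (C0+2)/(1+t)" if "0 < t" for t
  using np(3)[OF that] divide_right_mono[of "C0+2 * ep" "C0+2" "1+t"] ep1 that by linarith
  have C2: "S0.apos t <= (C0+2)/(1+t)" if "0 < t" for t
  using C0(2)[of t] divide_right_mono[of C0 "C0+2" "1+t"] that by simp
  note ca = P.close_alpha[OF _ C1 C2 np(2), folded Ka_def]
  have cb: "P.close (P.S1.beta_can th) (S0.beta_can th) (2*Ka) (6*Ka*E ep)" if "0 < th" "th < pi/2" for th
  using P.close_beta[OF ca(1)[OF _ _ _ _ that] ca(2)] C0(1) unfolding E by simp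
  have cM: "P.close (P.S1.M_can (f_deriv p)) (S0.M_can (f_deriv p)) KM (24*(6*Ka*E ep)*(pi/2))"
  unfolding KM_def by (rule P.close_M[OF cb f_deriv_measurable f_deriv_bounded[OF p]])
  have cI: "P.close (P.S1.I_can si (%v. g v $ j)) (S0.I_can si (%v. g v $ j)) (Jg*8) (Jg*(8*E ep))" for j
  proof (rule P.close_mono[OF P.close_I[OF si g_integrable(2)]])
  show "(LINT v|si. abs (g v $ j))*8 <= Jg*8" unfolding Jg_def using g_integrable(3) by simp
  show "(LINT v|si. abs (g v $ j))*(8*(ka * ep + sqrt (ka * ep))) <= Jg*(8*E ep)"
  unfolding Jg_def E using g_integrable(3) ep ka by (intro mult_right_mono) (auto simp: E_def)
  qed
  define D where "D s th = (LINT x:{0..th}|lborel. gradrh s x)" for s th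
  have D: "norm (D r th) <= B" "norm (D r0 th) <= B" "norm (D r th - D r0 th) <= 4*(ka * ep)*(Bg+Hn)+2*(ep * Hn)" if th: "0 <= th" "th <= pi/2" for th
  proof -
  define x1 x0 y1 y0 where "x1 = 1/P.S1.PhiT p" and "x0 = 1/S0.PhiT p" and "y1 = - (Phi p (Lar r) th / (P.S1.PhiT p)^2)" and "y0 = - (Phi p (Lar r0) th / (S0.PhiT p)^2)"
  have xy: "abs x1 <= 1" "abs x0 <= 1" "abs (x1-x0) <= ka * ep" "abs y1 <= 1" "abs y0 <= 1" "abs (y1-y0) <= 3*(ka * ep)"
  unfolding x1_def x0_def y1_def y0_def by (rule P.ratio_close)+
  have eq: "D r th = x1 *\<^sub>R grad_int r th + y1 *\<^sub>R grad_int r (pi/2)" "D r0 th = x0 *\<^sub>R grad_int r0 th + y0 *\<^sub>R grad_int r0 (pi/2)"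
  using gradient_identity(2)[OF rI th] gradient_identity(2)[OF r0 th] total(1)[OF rR] total(1)[OF r0R]
  by (simp_all add: D_def x1_def x0_def y1_def y0_def)
  have pi2: "0 <= pi/2" "pi/2 <= pi/2" by simp_all
  have d: "norm (grad_int r th - grad_int r0 th) <= ep * Hn" "norm (grad_int r (pi/2)-grad_int r0 (pi/2)) <= ep * Hn"
  unfolding Hn_def using grad_int_close(1)[OF n th ep1(3)] grad_int_close(1)[OF n pi2 ep1(3)] .
  have b0: "norm (grad_int r0 th) <= Bg" "norm (grad_int r0 (pi/2)) <= Bg"
  unfolding Bg_def using grad_int_close(2)[OF n th ep1(3)] grad_int_close(2)[OF n pi2 ep1(3)] .
  have "ep * Hn <= 1*Hn" using ep1 Hn by (intro mult_right_mono) auto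
  then have b1: "norm (grad_int r th) <= Bg+Hn" "norm (grad_int r (pi/2)) <= Bg+Hn"
  using d b0 norm_triangle_sub[of "grad_int r th" "grad_int r0 th"] norm_triangle_sub[of "grad_int r (pi/2)" "grad_int r0 (pi/2)"] by linarith+
  have nb: "norm (x *\<^sub>R u+y *\<^sub>R z) <= B" if "abs x <= 1" "abs y <= 1" "norm u <= Bg+Hn" "norm z <= Bg+Hn" for x y and u z :: "real ^ 'm"
  proof -
  have "norm (x *\<^sub>R u+y *\<^sub>R z) <= abs x*norm u+abs y*norm z" by (metis norm_scaleR norm_triangle_ineq)
  also have "... <= 1*(Bg+Hn)+1*(Bg+Hn)" using that by (intro add_mono mult_mono) auto
  also have "... <= B" unfolding B_def using v by simp
  finally show ?thesis .
  qed
  show "norm (D r th) <= B" "norm (D r0 th) <= B" unfolding eq using xy b1 b0 Hn by (auto intro!: nb)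
  have "D r th - D r0 th = (x1 *\<^sub>R grad_int r th - x0 *\<^sub>R grad_int r0 th)+(y1 *\<^sub>R grad_int r (pi/2)-y0 *\<^sub>R grad_int r0 (pi/2))" by (simp add: eq)
  also have "norm ... <= (ka * ep * (Bg+Hn) + ep * Hn)+(3*(ka * ep)*(Bg+Hn) + ep * Hn)"
  by (intro norm_triangle_mono norm_scale_diff xy b1 d)
  finally show "norm (D r th - D r0 th) <= 4*(ka * ep)*(Bg+Hn)+2*(ep * Hn)" by (simp add: algebra_simps)
  qed
  have nn: "0 <= 4*(ka * ep)*(Bg+Hn)" "0 <= ep * Hn" "0 <= (10/v+26/v^2)*(ka * ep)"
  using ka ep1(3) Bg Hn v by auto
  have m: "abs (P.S1.mcoef th) <= B" "abs (S0.mcoef th) <= B" "abs (P.S1.mcoef th - S0.mcoef th) <= de ep" if "0 <= th" for th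
  proof -
  have "2/v <= B" using Bg Hn by (simp add: B_def)
  moreover have "a <= a+(b+2 * c)" if "0 <= b" "0 <= c" for a b c :: real using that by simp
  then have "(10/v+26/v^2)*(ka * ep) <= de ep" unfolding de_def using nn(1,2) by blast
  ultimately show "abs (P.S1.mcoef th) <= B" "abs (S0.mcoef th) <= B" "abs (P.S1.mcoef th - S0.mcoef th) <= de ep"
  using P.mcoef_close[OF v_def ep1(2) that] by (meson order_trans)+
  qed
  have Dde: "norm (D r th - D r0 th) <= de ep" if "0 <= th" "th <= pi/2" for th
  using D(3)[OF that] nn(3) unfolding de_def by (rule order_trans[OF _ add_increasing[OF _ order_refl]])
  have Gd: "G s = noise.G_can (Lar s) (lamr s) p (f_deriv p) si g (noise.mcoef (Lar s) p) (D s)" for s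
  unfolding G_def D_def[abs_def] ..
  have cG: "P.close (G r th) (G r0 th) K (cG ep)" if "0 < th" "th < pi/2" for th
  unfolding Gd K_def cG_def
  using that by (intro P.close_G cb cM cI m D Dde) auto
  have Vc: "abs (V r k b th - V r0 k b th) <= (\<Sum>i<k. abs (b i))^2 * c ep" if "ALL i<k. 0 < th i & th i < pi/2" for k b th
  proof -
  have "P.close (%u. \<Sum>i<k. b i*G r (th i) u) (%u. \<Sum>i<k. b i*G r0 (th i) u) (\<Sum>i<k. abs (b i)*K) (\<Sum>i<k. abs (b i) * cG ep)"
  using that by (intro P.close_sum P.close_scale_const cG) auto
  from P.close_variance[OF this] show ?thesis
  unfolding V_def sum_distrib_right[symmetric] c_def by (simp add: power2_eq_square algebra_simps)
  qed
  show ?thesis using cG[unfolded P.close_def] Vc by blast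
 qed
 show thesis by (rule that[OF ep0 cc c0 main])
qed

end

section \<open>Quantiles and convergence in outer probability\<close>

text \<open>\<open>Y\<close> is only almost surely equal to a measurable variable; in the completion
  its sublevel sets are measurable and have the probabilities of those of \<open>Z\<close>.\<close>

lemma quantile_distr:
 assumes Z: "Z : meas N" and ae: "AE om in N. Y om = Z om"
 shows "quantile N Y b = Inf {x. b <= cdf (distr N borel Z) x}"
proof -
 have "measure (completion N) {om : space N. Y om <= x} = cdf (distr N borel Z) x" for x
 proof -
  have Zs: "{om : space N. Z om <= x} : sets N" using Z by measurable
  have e: "AE om in completion N. om : {om : space N. Z om <= x} \<longleftrightarrow> om : {om : space N. Y om <= x}"
  using AE_completion[OF ae] by eventually_elim auto
  have Ys: "{om : space N. Y om <= x} : sets (completion N)" by (rule completion.in_sets_AE[OF e]) (use Zs in auto)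
  have "measure (completion N) {om : space N. Y om <= x} = measure (completion N) {om : space N. Z om <= x}"
  by (rule measure_eq_AE) (use e Ys Zs in \<open>auto elim: AE_mp\<close>)
  also have "... = measure N {om : space N. Z om <= x}" using Zs by simp
  also have "... = cdf (distr N borel Z) x" unfolding cdf_def using Z by (subst measure_distr) (auto intro!: arg_cong[where f = "measure N"])
  finally show ?thesis .
 qed
 then show ?thesis by (simp add: quantile_def)
qed

context noise
begin

lemma jointly_integral_measurable:
 assumes muv: "sigma_finite_measure muv" and J: "jointly muv F"
 shows "(%om. (LINT s|muv. F s (w om))) : meas N"
proof -
 have "(%(om, s). F s (w om)) : meas (N |*| muv)"
  using mcomp[OF measurable_pair_swap' J[unfolded jointly_def, THEN conjunct1]] by (simp add: case_prod_beta')
 from sigma_finite_measure.borel_measurable_lebesgue_integral[OF muv this] show ?thesis .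
qed

lemma I_integrable:
 fixes g :: "real \<times> real => real"
 assumes si: "sets si = sets (restrict_space borel ({0..1} \<times> {0..1}))" "finite_measure si" and g: "integrable si g"
 shows "AE om in N. integrable si (%v. g v * I_kernel v (w om))"
proof -
 interpret S: noise_pair La l p N w La l N w 0 by (rule self_pair)
 have sp: "space si = {0..1} \<times> {0..1}" using sets_eq_imp_space_eq[OF si(1)] by (simp add: space_restrict_space)
 have b: "represents (%u. g v * I_kernel v u) (abs (g v)*8)" if "v : space si" for v
  using S.close_scale_const[OF S.close_I_kernel, of v "g v"] that unfolding S.close_def sp by blast
 show ?thesis
  by (rule represents_integral(2)[OF finite_measure.axioms(1)[OF si(2)] jointly_I[OF si(1) borel_measurable_integrable[OF g]] b]) (use g in auto)
qed

lemma mcoef_measurable: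
 "(%th. f_int th / PhiT p/variance_of (Q_measure p La) (f_fun p)) : meas borel"
proof -
 have "(%(th::real, t). apos t*(Xp p t*(of_bool (arctan t <= th)*f_fun p (arctan t)))) : meas (borel |*| lborel)" by measurable
 from lborel.borel_measurable_lebesgue_integral[OF this] have [measurable]: "f_int : meas borel" unfolding f_int_def[abs_def] .
 show ?thesis by measurable
qed

end

lemma outer_prob_mono:
 assumes "A <= A'" "A' <= space M"
 shows "0 <= outer_prob M A" "outer_prob M A <= outer_prob M A'"
proof -
 have ne: "{measure M B |B. B : sets M & C <= B} ~= {}" if "C <= space M" for C using that by auto
 have bdd: "bdd_below {measure M B |B. B : sets M & A <= B}" by (rule bdd_belowI[of _ 0]) auto
 show "0 <= outer_prob M A" unfolding outer_prob_def using ne[of A] assms by (intro cInf_greatest) auto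
 show "outer_prob M A <= outer_prob M A'" unfolding outer_prob_def
  by (rule cInf_superset_mono[OF ne[OF assms(2)] bdd]) (use assms in auto)
qed

text \<open>An inclusion of events suffices, since outer probability is monotone on arbitrary
  subsets of the space; the transformed estimators may fail to be measurable.\<close>

lemma conv_in_prob_subset:
 assumes Z: "conv_in_prob M Z z"
  and sub: "!!ep. 0 < ep ==> EX de>0. ALL n. ALL om:space M. dist (Z n om) z <= de --> dist (Y n om) y <= ep"
 shows "conv_in_prob M Y y"
 unfolding conv_in_prob_def
proof (intro allI impI)
 fix ep :: real assume "0 < ep"
 from sub[OF this] obtain de where de: "0 < de" "!!n om. om : space M ==> dist (Z n om) z <= de ==> dist (Y n om) y <= ep" by blast
 have s: "{om : space M. dist (Y n om) y > ep} <= {om : space M. dist (Z n om) z > de}" for n using de(2)[of _ n] by force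
 show "(%n. outer_prob M {om : space M. dist (Y n om) y > ep}) ----> 0"
 proof (rule tendsto_sandwich[OF _ _ tendsto_const])
  show "(%n. outer_prob M {om : space M. dist (Z n om) z > de}) ----> 0" using Z de(1) unfolding conv_in_prob_def by blast
 qed (use outer_prob_mono[OF s] in auto)
qed

section \<open>Convergence of the quantiles of the limit variable\<close>

context angular_test
begin

lemma near_eventually:
 assumes s: "!!n. s n : R" "s ----> r0" and ep: "0 < ep"
 shows "\<forall>\<^sub>F n in sequentially. near (s n) ep"
proof -
 have l: "uniform_limit {0..pi/2} (%n th. eta th powr nuv * abs (ph (s n) th - ph r0 th)) (%_. 0) sequentially"
  "uniform_limit {0..pi/2} (%n th. eta th powr nuv * norm (gradph (s n) th - gradph r0 th)) (%_. 0) sequentially"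
  using lim[of s] s by blast+
 have i: "\<forall>\<^sub>F n in sequentially. s n : interior R" by (rule topological_tendstoD[OF s(2) open_interior r0])
 show ?thesis using i uniform_limitD[OF l(1) ep] uniform_limitD[OF l(2) ep]
 proof eventually_elim
  case (elim n)
  have le: "x <= ep" if "dist x (0::real) < ep" for x using that by (simp add: dist_real_def abs_less_iff less_imp_le)
  show ?case unfolding near_def using elim by (intro conjI ballI le) auto
 qed
qed

text \<open>Absorbing \<open>q\<close> into a finite measure on the open interval makes the weighted
  integral a plain L1 norm and leaves out the end points.\<close>

definition ka :: "real measure" where
 "ka = density (restrict_space lborel {0<..<pi/2}) (%th. ennreal (q th))"

lemma q_measurable: "q : meas (restrict_space lborel {0<..<pi/2})"
 using q(2) unfolding set_integrable_def by (subst borel_measurable_restrict_space_iff) (auto simp: mult.commute)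

lemma kappa: "space ka = {0<..<pi/2}" "finite_measure ka" "(%th. th) : measurable ka borel" "sets ka = sets (restrict_space lborel {0<..<pi/2})"
 "f : meas ka ==> (LINT th|ka. f th) = (LINT th:{0<..<pi/2}|lborel. q th * f th)"
proof -
 show sp: "space ka = {0<..<pi/2}" and st: "sets ka = sets (restrict_space lborel {0<..<pi/2})"
  by (simp_all add: ka_def space_restrict_space)
 show "(%th. th) : measurable ka borel" unfolding measurable_cong_sets[OF st refl] by (rule measurable_restrict_space1) simp
 show "finite_measure ka"
 proof
  have "emeasure ka (space ka) = (\<integral>\<^sup>+th. ennreal (q th) \<partial>restrict_space lborel {0<..<pi/2})"
  unfolding ka_def space_density emeasure_density[OF mcomp[OF q_measurable measurable_ennreal] sets.top]
  by (intro nn_integral_cong) simp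
  also have "... = (nn_integral lborel (%th. ennreal (indicator {0<..<pi/2} th *\<^sub>R q th)))"
  by (subst nn_integral_restrict_space) (auto intro!: nn_integral_cong simp: indicator_def)
  also have "... < top"
  using integrableD(2)[OF q(2)[unfolded set_integrable_def]] q(1) by (auto simp: top.not_eq_extremum intro!: le_less_trans[OF nn_integral_mono] elim!: ennreal_leI)
  finally show "emeasure ka (space ka) ~= \<infinity>" by simp
 qed
 assume f: "f : meas ka"
 then have f': "f : meas (restrict_space lborel {0<..<pi/2})" by (simp add: measurable_cong_sets[OF st refl])
 have "(LINT th|ka. f th) = (\<integral>th. q th *\<^sub>R f th \<partial>restrict_space lborel {0<..<pi/2})"
  unfolding ka_def using q(1) by (intro integral_density[OF f' q_measurable] AE_I2) (auto simp: space_restrict_space less_imp_le)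
 also have "... = (LINT th:{0<..<pi/2}|lborel. q th * f th)" by (subst integral_restrict_space) (auto simp: set_lebesgue_integral_def)
 finally show "(LINT th|ka. f th) = (LINT th:{0<..<pi/2}|lborel. q th * f th)" .
qed

lemma G_measurable:
 assumes r: "r : R"
 shows "(%(th, om). G r th (w r om)) : meas (ka |*| N r)"
proof -
 interpret S: noise "Lar r" "lamr r" p "N r" "w r" by (rule w(1)[OF r])
 have b: "(%z. S.beta_can (fst z) (w r (snd z))) : meas (ka |*| N r)"
  using mcomp[OF measurable_Pair[OF mcomp[OF measurable_fst kappa(3)] measurable_snd] S.beta_can_measurable[OF S.mp]] by simp
 have "S.mcoef : meas ka \<longleftrightarrow> (%th. S.f_int th / S.PhiT p/variance_of (Q_measure p (Lar r)) (f_fun p)) : meas ka"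
  by (rule measurable_cong) (simp add: kappa(1) S.mcoef_def S.Q_f_int)
 then have m: "S.mcoef : meas ka" using mcomp[OF kappa(3) S.mcoef_measurable] by simp
 define D where "D th = (LINT x:{0..th}|lborel. gradrh r x)" for th
 have D: "D : meas ka"
 proof -
  have "set_integrable lborel {0..pi/2} (gradrh r)" using exchange[OF r, of "pi/2"] by simp
  then have [measurable]: "(%x. indicator {0..pi/2} x *\<^sub>R gradrh r x) : meas borel"
  using borel_measurable_integrable unfolding set_integrable_def by auto
  have "(%(th::real, x). of_bool (x <= th) *\<^sub>R (indicator {0..pi/2} x *\<^sub>R gradrh r x)) : meas (borel |*| lborel)" by measurable
  from mcomp[OF kappa(3) lborel.borel_measurable_lebesgue_integral[OF this]]
  have 1: "(%th. (LBINT x. of_bool (x <= th) *\<^sub>R (indicator {0..pi/2} x *\<^sub>R gradrh r x))) : meas ka" .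
  have "D : meas ka \<longleftrightarrow> (%th. (LBINT x. of_bool (x <= th) *\<^sub>R (indicator {0..pi/2} x *\<^sub>R gradrh r x))) : meas ka"
  by (rule measurable_cong) (auto simp: kappa(1) D_def set_lebesgue_integral_def indicator_def intro!: lint_cong)
  with 1 show ?thesis by simp
 qed
 have Dj: "(%th. D th $ j) : meas ka" for j
  using mcomp[OF D borel_measurable_continuous_onI[OF linear_continuous_on[OF bounded_linear_vec_nth]]] .
 have M: "(%om. S.M_can (f_deriv p) (w r om)) : meas (N r)"
  unfolding S.M_can_def by (rule S.jointly_integral_measurable[OF sigma_finite_lborel S.jointly_beta]) measurable
 have I: "(%om. S.I_can si (%v. g v $ j) (w r om)) : meas (N r)" for j
  unfolding S.I_can_def
  by (rule S.jointly_integral_measurable[OF finite_measure.axioms(1)[OF si(2)] S.jointly_I[OF si(1) borel_measurable_integrable[OF g_integrable(2)]]])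
 show ?thesis unfolding G_def S.G_can_def case_prod_beta' D_def[symmetric]
  by (intro borel_measurable_add borel_measurable_times borel_measurable_sum borel_measurable_const b
  mcomp[OF measurable_fst m] mcomp[OF measurable_snd M] mcomp[OF measurable_fst Dj] mcomp[OF measurable_snd I])
qed

text \<open>Null sets of two kinds are discarded: where the regular version differs from the given
  process, and where one of the path integrals fails to converge.\<close>

lemma L_var_AE:
 assumes r: "r : R"
 shows "AE om in N r. L_var p q (Lar r) (lamr r) (gradrh r) g si (W r om) = L1_path ka (%th om. G r th (w r om)) om"
proof -
 interpret S: noise "Lar r" "lamr r" p "N r" "w r" by (rule w(1)[OF r])
 have "AE om in N r. w r om {} = 0" using w(2)[OF r] by eventually_elim (rule conjunct2)
 from S.paths_regular[OF this] have reg: "AE om in N r. S.path_regular (w r om) & (p ~= top -->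
  intb (%x. indicator {1<..} x*(S.dens (x, y_real p x)*(W1 (w r om) x*ydv p x-W2 (w r om) (y_real p x)))))" .
 have "AE om in N r. ALL j:UNIV. integrable si (%v. g v $ j*S.I_kernel v (w r om))"
  by (rule AE_finite_allI) (auto intro!: S.I_integrable si g_integrable)
 with reg w(2)[OF r] AE_space show ?thesis
 proof eventually_elim
  case (elim om)
  have m: "(%th. abs (G r th (w r om))) : meas ka"
  using measurable_Pair1[OF G_measurable[OF r] elim(3)] by simp
  have "L_var p q (Lar r) (lamr r) (gradrh r) g si (w r om) = (LINT th:{0<..<pi/2}|lborel. q th * abs (G r th (w r om)))"
  unfolding G_def by (rule S.L_var_eq[OF q(2) _ si(1)]) (use q(1) elim(1,4) in \<open>auto intro: less_imp_le\<close>)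
  then show ?case using elim(2) unfolding L1_path_def kappa(5)[OF m] by simp
 qed
qed

definition law :: "real ^ 'm => real measure" where
 "law r = distr (N r) borel (L1_path ka (%th om. G r th (w r om)))"

definition quant :: "real ^ 'm => real => real" where
 "quant r b = quantile (N r) (%om. L_var p q (Lar r) (lamr r) (gradrh r) g si (W r om)) b"

lemma G_gproc:
 assumes r: "r : R" and rep: "!!th. 0 < th & th < pi/2 ==> noise.represents (Lar r) (N r) (w r) (G r th) K"
 shows "gproc ka (N r) (%th om. G r th (w r om)) (K^2)" "gauss_char ka (N r) (%th om. G r th (w r om)) (V r)"
  "real_distribution (law r)" "quant r b = Inf {x. b <= cdf (law r) x}"
proof -
 interpret S: noise "Lar r" "lamr r" p "N r" "w r" by (rule w(1)[OF r])
 have *: "wiener_int (Lar r) (N r) (w r) (%om. G r th (w r om)) (%z. G r th (%C. indicator C z))" "l2_le (Lar r) (%z. G r th (%C. indicator C z)) K"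
  if "th : space ka" for th using rep[of th] that unfolding S.represents_def kappa(1) by auto
 show gp: "gproc ka (N r) (%th om. G r th (w r om)) (K^2)" and "gauss_char ka (N r) (%th om. G r th (w r om)) (V r)"
  using wiener_int_gproc[OF S.wn G_measurable[OF r] *] unfolding V_def[abs_def] by auto
 have m: "L1_path ka (%th om. G r th (w r om)) : meas (N r)" by (rule L1_path_measurable[OF gp kappa(2)])
 have "prob_space (N r)" using S.wn by (simp add: white_noise_def)
 then show "real_distribution (law r)" unfolding law_def using m by (intro prob_space.real_distribution_distr)
 show "quant r b = Inf {x. b <= cdf (law r) x}" unfolding quant_def law_def by (rule quantile_distr[OF m L_var_AE[OF r]])
qed

text \<open>Variances of linear combinations converge, hence so do the Gaussian characteristic
  functions; the theorem on the L1 norm and then the one on quantiles conclude.\<close>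

lemma quant_tendsto:
 assumes s: "!!n. s n : R" "s ----> r0" and b: "b ----> b0" "0 < b0" "b0 < 1"
 shows "(%n. quant (s n) (b n)) ----> quant r0 b0"
proof (rule uniform_close)
 fix K ep0 c
 assume ep0: "0 < ep0" and c: "isCont c 0" "c 0 = 0"
  and close: "!!r ep. 0 < ep ==> ep <= ep0 ==> near r ep ==> (ALL th. 0 < th & th < pi/2 -->
  noise.represents (Lar r) (N r) (w r) (G r th) K & noise.represents (Lar r0) (N r0) (w r0) (G r0 th) K) &
  (ALL k b th. (ALL i<k. 0 < th i & th i < pi/2) --> abs (V r k b th - V r0 k b th) <= (\<Sum>i<k. abs (b i))^2 * c ep)"
 \<comment> \<open>The uniform L2 bound is known for parameters close to \<open>r0\<close>, while
   the convergence theorem asks for it at every index; a shift by \<open>m\<close> removes the first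
   terms.\<close>
 obtain m where m: "!!n. n >= m ==> near (s n) ep0" using near_eventually[OF s ep0] unfolding eventually_sequentially by blast
 define t where "t n = s (n + m)" for n
 have t: "t n : R" "near (t n) ep0" for n using s m by (auto simp: t_def)
 have tl: "t ----> r0" unfolding t_def by (rule LIMSEQ_ignore_initial_segment[OF s(2)])
 have rep: "!!th. 0 < th & th < pi/2 ==> noise.represents (Lar (t n)) (N (t n)) (w (t n)) (G (t n) th) K"
  "!!th. 0 < th & th < pi/2 ==> noise.represents (Lar r0) (N r0) (w r0) (G r0 th) K" for n
  using close[OF ep0 order_refl t(2)] by blast+
 note gn = G_gproc[OF t(1) rep(1)] and g0 = G_gproc[OF r0R rep(2)]
 have Vlim: "(%n. V (t n) k b th) ----> V r0 k b th" if th: "ALL i<k. 0 < th i & th i < pi/2" for k b th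
 proof (rule tendstoI)
  fix d :: real assume d: "0 < d"
  define B where "B = (\<Sum>i<k. abs (b i))^2+1"
  have B: "0 < B" unfolding B_def by (simp add: add_nonneg_pos)
  have "\<forall>\<^sub>F ep in at_right 0. abs (c ep) < d/B"
  proof -
  have "(c ---> 0) (at_right 0)" using c by (metis isCont_def filterlim_at_split)
  from tendstoD[OF this, of "d/B"] d B show ?thesis by (simp add: dist_real_def)
  qed
  then have "\<forall>\<^sub>F ep in at_right 0. abs (c ep) < d/B & 0 < ep & ep <= ep0"
  using eventually_at_right_less[of "0::real"] eventually_at_right_real[OF ep0] by eventually_elim auto
  then obtain ep where ep: "abs (c ep) < d/B" "0 < ep" "ep <= ep0" using eventually_happens'[of "at_right (0::real)"] by auto
  have "(\<Sum>i<k. abs (b i))^2 * c ep <= (\<Sum>i<k. abs (b i))^2*abs (c ep)" by (intro mult_left_mono) auto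
  also have "... <= B*abs (c ep)" unfolding B_def by (intro mult_right_mono) auto
  also have "... < d" using ep(1) B by (simp add: field_simps)
  finally have lt: "(\<Sum>i<k. abs (b i))^2 * c ep < d" .
  show "\<forall>\<^sub>F n in sequentially. dist (V (t n) k b th) (V r0 k b th) < d"
  using near_eventually[OF t(1) tl ep(2)]
  proof eventually_elim
  case (elim n)
  then have "abs (V (t n) k b th - V r0 k b th) <= (\<Sum>i<k. abs (b i))^2 * c ep" using close[OF ep(2,3) elim] th by blast
  then show ?case using lt by (simp add: dist_real_def)
  qed
 qed
 have "weak_conv_m (%n. law (t n)) (law r0)" unfolding law_def
 proof (rule L1_path_weak_conv[OF gn(1) g0(1) kappa(2)])
  fix k :: nat and b th :: "nat => real"
  assume th: "!!i. i < k ==> th i : space ka"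
  have ch: "(CLINT om|N r. iexp (\<Sum>i<k. b i*G r (th i) (w r om))) = complex_of_real (exp (- V r k b th / 2))"
  if "gauss_char ka (N r) (%th om. G r th (w r om)) (V r)" for r
  using that th unfolding gauss_char_def by blast
  have "(%n. V (t n) k b th) ----> V r0 k b th" by (rule Vlim) (use th kappa(1) in auto)
  then show "(%n. CLINT om|N (t n). iexp (\<Sum>i<k. b i*G (t n) (th i) (w (t n) om)))
  ----> (CLINT om|N r0. iexp (\<Sum>i<k. b i*G r0 (th i) (w r0 om)))"
  by (simp only: ch[OF gn(2)] ch[OF g0(2)]) (intro tendsto_intros; simp)
 qed
 from quantile_tendsto[OF gn(3) g0(3) this _ LIMSEQ_ignore_initial_segment[OF b(1), of m] b(2,3)]
 have "(%n. Inf {x. b (n + m) <= cdf (law (t n)) x}) ----> Inf {x. b0 <= cdf (law r0) x}"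
  using L1_path_no_gap[OF g0(1,2) kappa(2)] unfolding law_def by blast
 then have "(%n. quant (t n) (b (n + m))) ----> quant r0 b0" by (simp only: gn(4) g0(4))
 then have "(%n. quant (s (n + m)) (b (n + m))) ----> quant r0 b0" unfolding t_def .
 then show ?thesis by (rule LIMSEQ_offset)
qed

text \<open>Otherwise parameters approach \<open>r0\<close> with levels at which the quantiles stay
  apart. Along a subsequence the levels converge to some \<open>a0\<close> inside (0, 1), and
  \<open>quant_tendsto\<close> with moving levels, once for these parameters and once for the
  constant \<open>r0\<close>, gives the same limit.\<close>

lemma quant_uniform:
 assumes b: "0 < b0" "b1 < 1" and ep: "0 < ep"
 shows "EX de>0. ALL r:R. dist r r0 <= de --> (ALL a:{b0..b1}. abs (quant r a-quant r0 a) <= ep)"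
proof (rule ccontr)
 assume neg: "~ ?thesis"
 have "EX r a. r : R & dist r r0 <= 1/real (Suc n) & a : {b0..b1} & ep < abs (quant r a-quant r0 a)" for n
  using neg by (force simp: not_le dest!: spec[of _ "1/real (Suc n)"])
 then obtain s a where sa: "!!n. s n : R" "!!n. dist (s n) r0 <= 1/real (Suc n)" "!!n. a n : {b0..b1}" "!!n. ep < abs (quant (s n) (a n)-quant r0 (a n))" by metis
 obtain a0 k where k: "a0 : {b0..b1}" "strict_mono (k :: nat => nat)" "(a \<circ> k) ----> a0"
  using compact_imp_seq_compact[OF compact_Icc, of b0 b1] sa(3) unfolding seq_compact_def by metis
 have sl: "s ----> r0"
 proof (rule metric_LIMSEQ_I)
  fix e :: real assume "0 < e"
  then obtain m where m: "1/real (Suc m) < e" using reals_Archimedean[of e] by (auto simp: inverse_eq_divide)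
  have "dist (s n) r0 < e" if "n >= m" for n
  proof -
  have "1/real (Suc n) <= 1/real (Suc m)" using that by (intro divide_left_mono) auto
  then show ?thesis using sa(2)[of n] m by linarith
  qed
  then show "EX m. ALL n>=m. dist (s n) r0 < e" by blast
 qed
 have a0: "0 < a0" "a0 < 1" using k(1) b by auto
 have "(%n. quant (s (k n)) ((a \<circ> k) n)) ----> quant r0 a0"
  using sa(1) LIMSEQ_subseq_LIMSEQ[OF sl k(2)] by (intro quant_tendsto k(3) a0) (auto simp: o_def)
 moreover have "(%n. quant r0 ((a \<circ> k) n)) ----> quant r0 a0" by (intro quant_tendsto k(3) a0 r0R tendsto_const)
 ultimately have "(%n. abs (quant (s (k n)) ((a \<circ> k) n)-quant r0 ((a \<circ> k) n))) ----> abs (quant r0 a0-quant r0 a0)" by (intro tendsto_intros)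
 then have "ep <= abs (quant r0 a0-quant r0 a0)" by (rule LIMSEQ_le_const) (use sa(4) in \<open>auto intro!: less_imp_le\<close>)
 then show False using ep by simp
qed

end

theorem theorem4:
  fixes p :: ennreal
    and q :: "real \<Rightarrow> real"
    and M :: "'w measure"
    and X :: "nat \<Rightarrow> 'w \<Rightarrow> real \<times> real"
    and P :: "(real \<times> real) measure"
    and \<Lambda> :: "(ennreal \<times> ennreal) measure"
    and lam :: "real \<times> real \<Rightarrow> real"
    and c :: "real \<times> real \<Rightarrow> real"
    and k :: "nat \<Rightarrow> real"
    and R :: "(real ^ 'm::finite) set"
    and r0 :: "real ^ 'm"
    and \<Lambda>r :: "real ^ 'm \<Rightarrow> (ennreal \<times> ennreal) measure"
    and lamr :: "real ^ 'm \<Rightarrow> real \<times> real \<Rightarrow> real"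
    and \<phi> :: "real ^ 'm \<Rightarrow> real \<Rightarrow> real"
    and \<rho> :: "real ^ 'm \<Rightarrow> real \<Rightarrow> real"
    and grad\<phi> grad\<rho> :: "real ^ 'm \<Rightarrow> real \<Rightarrow> real ^ 'm"
    and \<sigma> :: "(real \<times> real) measure"
    and g :: "real \<times> real \<Rightarrow> real ^ 'm"
    and rhat rcheck :: "nat \<Rightarrow> 'w \<Rightarrow> real ^ 'm"
    and \<alpha>1 \<alpha>2 \<alpha>3 \<nu> :: real
    and N :: "real ^ 'm \<Rightarrow> 'b measure"
    and W :: "real ^ 'm \<Rightarrow> 'b \<Rightarrow> (ennreal \<times> ennreal) set \<Rightarrow> real"
    and \<Q> :: "real ^ 'm \<Rightarrow> real \<Rightarrow> real"
  assumes p: "1 \<le> p"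
    and q: "\<forall>\<theta>\<in>{0<..<pi/2}. 0 < q \<theta>" "set_integrable lborel {0<..<pi/2} q"
      \<comment> \<open>sample and regular variation\<close>
    and sample: "iid_sample M X P"
    and margins: "continuous_on UNIV (F1 P)" "continuous_on UNIV (F2 P)"
    and regvar: "radon_E \<Lambda>" "regularly_varying P \<Lambda>"
    and k: "filterlim k at_top sequentially" "(\<lambda>n. k n / real n) \<longlonglongrightarrow> 0"
      \<comment> \<open>the model; end point values of the angular densities are free\<close>
    and model: "\<forall>r\<in>R. tail_measure (\<Lambda>r r) \<and> smooth_with_density (\<Lambda>r r) (lamr r)"
    and \<phi>: "\<forall>r\<in>R. \<forall>\<theta>\<in>{0<..<pi/2}. (Phi p (\<Lambda>r r) has_real_derivative \<phi> r \<theta>) (at \<theta>)"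
    and \<rho>: "\<forall>r\<in>R. \<forall>\<theta>\<in>{0..pi/2}. \<rho> r \<theta> = \<phi> r \<theta> / Phi p (\<Lambda>r r) (pi/2)"
    and null_hyp: "r0 \<in> R" "angular_measure p \<Lambda> = angular_measure p (\<Lambda>r r0)"
      \<comment> \<open>(1)\<close>
    and a1: "smooth_with_density \<Lambda> lam"
      \<comment> \<open>(2)\<close>
    and a2_density: "\<forall>u. 0 \<le> c u" "distributed P lborel (U_vec P) (\<lambda>u. ennreal (c u))"
    and a2_pos: "0 < \<alpha>1" "0 < \<alpha>2" "0 < \<alpha>3"
    and a2_D: "(\<lambda>t. D_dist c lam (1 / t) t) \<in> O[at_right 0](\<lambda>t. t powr \<alpha>1)"
    and a2_Phi: "\<forall>s\<ge>1. (\<lambda>t. Phi s \<Lambda> t) \<in> O[at_right 0](\<lambda>t. t powr \<alpha>2) \<and>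
          (\<lambda>t. Phi s \<Lambda> (pi/2) - Phi s \<Lambda> (pi/2 - t)) \<in> O[at_right 0](\<lambda>t. t powr \<alpha>3)"
    and a2_k: "k \<in> o(\<lambda>n. real n powr
          (2 * min \<alpha>1 (min \<alpha>2 \<alpha>3) / (2 * min \<alpha>1 (min \<alpha>2 \<alpha>3) + 1)))"
      \<comment> \<open>(3)\<close>
    and a3_interior: "r0 \<in> interior R"
    and a3_grad: "\<forall>r\<in>R. \<forall>\<theta>\<in>{0..pi/2}.
          ((\<lambda>s. \<rho> s \<theta>) has_derivative (\<lambda>h. grad\<rho> r \<theta> \<bullet> h)) (at r within R)"
    and a3_integrable: "set_integrable lborel {0..pi/2} (grad\<rho> r0)"
    and a3_exchange: "\<forall>r\<in>R. \<forall>\<theta>\<in>{0..pi/2}. set_integrable lborel {0..\<theta>} (grad\<rho> r) \<and>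
          ((\<lambda>s. LINT x:{0..\<theta>}|lborel. \<rho> s x) has_derivative
             (\<lambda>h. (LINT x:{0..\<theta>}|lborel. grad\<rho> r x) \<bullet> h)) (at r within R)"
    and a3_hadamard: "hadamard_derivative (\<lambda>r \<theta>. Q_cdf p (\<Lambda>r r) \<theta>)
          (\<lambda>h \<theta>. (LINT x:{0..\<theta>}|lborel. grad\<rho> r0 x) \<bullet> h) r0 R {0..pi/2}"
      \<comment> \<open>(4)\<close>
    and a4_sigma: "sets \<sigma> = sets (restrict_space borel ({0..1} \<times> {0..1}))" "finite_measure \<sigma>"
    and a4_g: "g \<in> borel_measurable \<sigma>" "integrable \<sigma> (\<lambda>v. (norm (g v))\<^sup>2)"
    and a4_est: "\<forall>n. estimator M X n (rhat n)"
    and a4_expansion: "conv_in_prob M (\<lambda>n \<omega>. sqrt (k n) *\<^sub>R (rhat n \<omega> - r0) -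
          (\<integral>v. (sqrt (k n) * (ell_hat (k n) (\<lambda>i. X i \<omega>) n v - ell P v)) *\<^sub>R g v \<partial>\<sigma>)) 0"
      \<comment> \<open>(5)\<close>
    and a5_bound: "bdd_above ((\<lambda>\<theta>. eta \<theta> * \<phi> r0 \<theta>) ` {0..pi/2})"
    and a5_nu: "0 < \<nu>" "\<nu> < 1"
    and a5_grad: "\<forall>r\<in>R. \<forall>\<theta>\<in>{0..pi/2}.
          ((\<lambda>s. \<phi> s \<theta>) has_derivative (\<lambda>h. grad\<phi> r \<theta> \<bullet> h)) (at r within R)"
    and a5_lim: "\<forall>s. (\<forall>n. s n \<in> R) \<and> s \<longlonglongrightarrow> r0 \<longrightarrow>
          uniform_limit {0..pi/2} (\<lambda>n \<theta>. eta \<theta> powr \<nu> * \<bar>\<phi> (s n) \<theta> - \<phi> r0 \<theta>\<bar>) (\<lambda>_. 0) sequentially \<and>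
          uniform_limit {0..pi/2} (\<lambda>n \<theta>. eta \<theta> powr \<nu> * norm (grad\<phi> (s n) \<theta> - grad\<phi> r0 \<theta>)) (\<lambda>_. 0) sequentially"
      \<comment> \<open>the Wiener processes and the quantile function of the limit variable\<close>
    and wiener: "\<forall>r\<in>R. wiener_process p (\<Lambda>r r) (N r) (W r)"
    and \<Q>: "\<forall>r\<in>R. \<forall>a\<in>{0<..<1}.
          \<Q> r a = quantile (N r) (\<lambda>\<omega>. L_var p q (\<Lambda>r r) (lamr r) (grad\<rho> r) g \<sigma> (W r \<omega>)) a"
      \<comment> \<open>consistent estimator\<close>
    and check: "\<forall>n. estimator M X n (rcheck n)" "\<forall>n. \<forall>\<omega>\<in>space M. rcheck n \<omega> \<in> R"
          "conv_in_prob M rcheck r0"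
  shows "(\<forall>\<alpha>\<in>{0<..<1}. conv_in_prob M (\<lambda>n \<omega>. \<Q> (rcheck n \<omega>) (1 - \<alpha>)) (\<Q> r0 (1 - \<alpha>))) \<and>
    (\<forall>a0 a1. 0 < a0 \<and> a0 \<le> a1 \<and> a1 < 1 \<longrightarrow>
       conv_in_prob M (\<lambda>n \<omega>. SUP \<alpha>\<in>{a0..a1}. \<bar>\<Q> (rcheck n \<omega>) (1 - \<alpha>) - \<Q> r0 (1 - \<alpha>)\<bar>) 0)"
proof -
 interpret T: angular_test p R \<Lambda>r lamr \<phi> \<rho> grad\<phi> grad\<rho> N W r0 q \<sigma> g \<nu>
  by (intro angular_test.intro angular_model.intro angular_test_axioms.intro p q a3_interior a4_sigma a4_g a5_nu
   model[THEN bspec] \<phi>[THEN bspec, THEN bspec] \<rho>[THEN bspec, THEN bspec] a3_grad[THEN bspec, THEN bspec]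
   a3_exchange[THEN bspec, THEN bspec] a5_grad[THEN bspec, THEN bspec] wiener[THEN bspec] a5_lim[THEN spec, THEN mp])
 have Q: "\<Q> r b = T.quant r b" if "r \<in> R" "b \<in> {0<..<1}" for r b
  using \<Q> that unfolding T.quant_def by blast
 note cp = conv_in_prob_subset[OF check(3)]
 \<comment> \<open>The bound is deterministic in the value of the estimator, so it holds pointwise
   on the sample space; the level 1 - \<alpha> runs through [1 - a1, 1 - a0].\<close>
 have uniform: "\<exists>\<delta>>0. \<forall>n. \<forall>\<omega>\<in>space M. dist (rcheck n \<omega>) r0 \<le> \<delta> \<longrightarrow>
   (\<forall>\<alpha>\<in>{a0..a1}. \<bar>\<Q> (rcheck n \<omega>) (1 - \<alpha>) - \<Q> r0 (1 - \<alpha>)\<bar> \<le> \<epsilon>)"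
  if a: "0 < a0" "a0 \<le> a1" "a1 < 1" and \<epsilon>: "0 < \<epsilon>" for a0 a1 \<epsilon> :: real
 proof -
  obtain \<delta> where \<delta>: "0 < \<delta>" "\<And>r b. r \<in> R \<Longrightarrow> dist r r0 \<le> \<delta> \<Longrightarrow> b \<in> {1 - a1..1 - a0} \<Longrightarrow> \<bar>T.quant r b - T.quant r0 b\<bar> \<le> \<epsilon>"
   using T.quant_uniform[of "1 - a1" "1 - a0" \<epsilon>] a \<epsilon> by auto
  have "\<bar>\<Q> (rcheck n \<omega>) (1 - \<alpha>) - \<Q> r0 (1 - \<alpha>)\<bar> \<le> \<epsilon>" if "\<omega> \<in> space M" "dist (rcheck n \<omega>) r0 \<le> \<delta>" "\<alpha> \<in> {a0..a1}" for n \<omega> \<alpha>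
   using \<delta>(2)[of "rcheck n \<omega>" "1 - \<alpha>"] check(2) that a Q[of "rcheck n \<omega>" "1 - \<alpha>"] Q[OF T.r0R, of "1 - \<alpha>"] by auto
  with \<delta>(1) show ?thesis by blast
 qed
 show ?thesis
 proof (intro conjI ballI allI impI)
  fix \<alpha> :: real assume \<alpha>: "\<alpha> \<in> {0<..<1}"
  show "conv_in_prob M (\<lambda>n \<omega>. \<Q> (rcheck n \<omega>) (1 - \<alpha>)) (\<Q> r0 (1 - \<alpha>))"
  proof (rule cp)
   fix \<epsilon> :: real assume "0 < \<epsilon>"
   then show "\<exists>\<delta>>0. \<forall>n. \<forall>\<omega>\<in>space M. dist (rcheck n \<omega>) r0 \<le> \<delta> \<longrightarrow> dist (\<Q> (rcheck n \<omega>) (1 - \<alpha>)) (\<Q> r0 (1 - \<alpha>)) \<le> \<epsilon>"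
   using uniform[of \<alpha> \<alpha> \<epsilon>] \<alpha> by (simp add: dist_real_def)
  qed
 next
  fix a0 a1 :: real assume a: "0 < a0 \<and> a0 \<le> a1 \<and> a1 < 1"
  show "conv_in_prob M (\<lambda>n \<omega>. SUP \<alpha>\<in>{a0..a1}. \<bar>\<Q> (rcheck n \<omega>) (1 - \<alpha>) - \<Q> r0 (1 - \<alpha>)\<bar>) 0"
  proof (rule cp)
   fix \<epsilon> :: real assume \<epsilon>: "0 < \<epsilon>"
   \<comment> \<open>A supremum of reals is informative only for a nonempty bounded set; the uniform
     bound provides boundedness.\<close>
   have sup: "dist (SUP \<alpha>\<in>{a0..a1}. \<bar>h \<alpha>\<bar>) 0 \<le> \<epsilon>" if h: "\<And>\<alpha>. \<alpha> \<in> {a0..a1} \<Longrightarrow> \<bar>h \<alpha>\<bar> \<le> \<epsilon>" for h :: "real \<Rightarrow> real"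
   proof -
   have "(SUP \<alpha>\<in>{a0..a1}. \<bar>h \<alpha>\<bar>) \<le> \<epsilon>" using a h by (intro cSUP_least) auto
   moreover have "\<bar>h a0\<bar> \<le> (SUP \<alpha>\<in>{a0..a1}. \<bar>h \<alpha>\<bar>)" using a h by (intro cSUP_upper bdd_aboveI2[of _ _ \<epsilon>]) auto
   then have "0 \<le> (SUP \<alpha>\<in>{a0..a1}. \<bar>h \<alpha>\<bar>)" by (rule order_trans[OF abs_ge_zero])
   ultimately show ?thesis by (simp add: dist_real_def)
   qed
   obtain \<delta> where \<delta>: "0 < \<delta>" "\<And>n \<omega>. \<omega> \<in> space M \<Longrightarrow> dist (rcheck n \<omega>) r0 \<le> \<delta> \<Longrightarrow>
   \<forall>\<alpha>\<in>{a0..a1}. \<bar>\<Q> (rcheck n \<omega>) (1 - \<alpha>) - \<Q> r0 (1 - \<alpha>)\<bar> \<le> \<epsilon>"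
   using uniform[of a0 a1 \<epsilon>] a \<epsilon> by blast
   have "dist (SUP \<alpha>\<in>{a0..a1}. \<bar>\<Q> (rcheck n \<omega>) (1 - \<alpha>) - \<Q> r0 (1 - \<alpha>)\<bar>) 0 \<le> \<epsilon>"
   if "\<omega> \<in> space M" "dist (rcheck n \<omega>) r0 \<le> \<delta>" for n \<omega>
   by (rule sup) (use \<delta>(2)[OF that] in blast)
   with \<delta>(1) show "\<exists>\<delta>>0. \<forall>n. \<forall>\<omega>\<in>space M. dist (rcheck n \<omega>) r0 \<le> \<delta> \<longrightarrow>
   dist (SUP \<alpha>\<in>{a0..a1}. \<bar>\<Q> (rcheck n \<omega>) (1 - \<alpha>) - \<Q> r0 (1 - \<alpha>)\<bar>) 0 \<le> \<epsilon>"
   by blast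
  qed
 qed
qed

end
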